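(* Let $\mathsf{TJ}(\varphi)$ be the formula $(\forall f^1)(\varphi(f)=0\leftrightarrow(\exists x^0)f(x)=0)$ with $\varphi$ of type $2$, and let $\mathsf{MU}(\mu)$ be the formula $(\forall f^1)((\exists x^0)(f(x)=0)\to f(\mu(f))=0)$ with $\mu$ of type $2$. (1) The system $\mathsf B_0$ proves $(\exists^{\mathrm{st}}\varphi^2)\mathsf{TJ}(\varphi)\leftrightarrow(\exists^{\mathrm{st}}\mu^2)\mathsf{MU}(\mu)$, while the system $\mathsf B_0^-$ does not. (2) The system $\mathsf B_0^-$ does prove $(\mu^2)^{\mathrm{st}}\leftrightarrow(\exists^2)^{\mathrm{st}}$, where $(\exists^2)$ is the sentence $(\exists\varphi^2)\mathsf{TJ}(\varphi)$ and $(\mu^2)$ is the sentence $(\exists\mu^2)\mathsf{MU}(\mu)$.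
   Context: Finite types are generated from $0$ (natural numbers) by $\to$; type $n+1$ is $n\to0$; superscripts on variables denote types. $\mathsf{E\text{-}EFA}^\omega$ is the extensional finite-type arithmetic of first-order strength $\mathsf{EFA}=I\Delta_0+\mathrm{EXP}$, namely Kohlenbach's system $\mathsf{E\text{-}G}_3\mathsf A^\omega$ ("Applied Proof Theory", Ch. 3). The nonstandard language adds unary predicates $\mathrm{st}^\sigma$ and quantifiers $\forall^{\mathrm{st}}x^\sigma,\exists^{\mathrm{st}}x^\sigma$ for every finite type $\sigma$; formulas without these symbols are called internal. $\mathsf{E\text{-}EFA}^{\omega}_{\mathrm{st}}$ is $\mathsf{E\text{-}EFA}^\omega$ plus: (EQ) $\forall^{\mathrm{st}}x\,\Phi(x)\leftrightarrow\forall x(\mathrm{st}(x)\to\Phi(x))$ and $\exists^{\mathrm{st}}x\,\Phi(x)\leftrightarrow\exists x(\mathrm{st}(x)\wedge\Phi(x))$ for arbitrary $\Phi$; ($\mathcal T_{\mathrm{st}}$) $\mathrm{st}(x)\wedge x=y\to\mathrm{st}(y)$; $\mathrm{st}(t)$ for each closed term $t$; $\mathrm{st}(f)\wedge\mathrm{st}(x)\to\mathrm{st}(fx)$; $\mathrm{st}^0(x)\wedge y\le x\to\mathrm{st}^0(y)$. Finite sequences of objects of type $\sigma$ are coded as single objects of type $\sigma$, such that every object codes a finite sequence; $x\in y$ means $x$ equals a component of the sequence coded by $y$; $\cup$ is concatenation; for $Y$ of type $\sigma\to\tau$, $Y[x]:=\bigcup_{f\in Y}f(x)$. Further axioms ($\varphi$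 internal; $A$ quantifier-free internal): ($\mathsf I$) $\forall^{\mathrm{st}}y'\,\exists x\,\forall y\in y'\,\varphi(x,y)\to\exists x\,\forall^{\mathrm{st}}y\,\varphi(x,y)$; ($\mathsf{HAC}_{\mathrm{int}}$) $\forall^{\mathrm{st}}x^\sigma\,\exists^{\mathrm{st}}y^\tau\,\varphi(x,y)\to\exists^{\mathrm{st}}Y^{\sigma\to\tau}\,\forall^{\mathrm{st}}x^\sigma\,\exists y^\tau\in Y[x]\ \varphi(x,y)$ (parameters allowed in both); ($\mathsf{PF\text{-}TP}_\forall$) $\forall^{\mathrm{st}}\underline x\,\varphi(\underline x)\to\forall\underline x\,\varphi(\underline x)$, where $\varphi(\underline x)$ has no free variables besides $\underline x$; ($\mathsf{QF\text{-}AC}^{\sigma,\tau}$) $(\forall x^\sigma)(\exists y^\tau)A(x,y)\to(\exists Y^{\sigma\to\tau})(\forall x^\sigma)A(x,Y(x))$. $\mathsf B_0:=\mathsf{E\text{-}EFA}^{\omega}_{\mathrm{st}}+\mathsf I+\mathsf{HAC}_{\mathrm{int}}+\mathsf{PF\text{-}TP}_\forall+\mathsf{QF\text{-}AC}^{1,0}$, and $\mathsf B_0^-$ is $\mathsf B_0$ without $\mathsf{PF\text{-}TP}_\forall$. For internal $\varphi$, $\varphi^{\mathrm{st}}$ is obtained by relativizing all quantifiers (except bounded number quantifiers) to "st". *)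

theory Defs
  imports Main
begin

section \<open>Finite types, terms and formulas\<close>

datatype ty = N | Fun ty ty  (infixr "\<rightarrow>" 65)

abbreviation ty1 :: ty where "ty1 \<equiv> N \<rightarrow> N"
abbreviation ty2 :: ty where "ty2 \<equiv> ty1 \<rightarrow> N"

primrec arg_tys :: "ty \<Rightarrow> ty list" where
  "arg_tys N = []"
| "arg_tys (\<sigma> \<rightarrow> \<tau>) = \<sigma> # arg_tys \<tau>"

text \<open>The constants of Kohlenbach's \<open>G\<^sub>3A\<^sup>\<omega>\<close>: zero, successor, minimum, maximum, the
  branches \<open>A\<^sub>0, \<dots>, A\<^sub>3\<close> of the Ackermann function (successor of the second argument,
  addition, multiplication, exponentiation), their iterations \<open>\<Phi>\<^sub>1, \<Phi>\<^sub>2, \<Phi>\<^sub>3\<close> (maximum, sum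
  and product of \<open>f 0, \<dots>, f x\<close>), the bounded search functional \<open>\<mu>\<^sub>b\<close>, the combinators
  \<open>\<Pi>\<close> and \<open>\<Sigma>\<close>, and the functionals for bounded predicative recursion.\<close>

datatype cnst =
    CZero | CSuc | CMin | CMax | CA0 | CA1 | CA2 | CA3 | CPhi1 | CPhi2 | CPhi3 | CMub
  | CPi ty ty | CSigma ty ty ty | CRec ty

primrec cnst_ty :: "cnst \<Rightarrow> ty" where
  "cnst_ty CZero = N"
| "cnst_ty CSuc = N \<rightarrow> N"
| "cnst_ty CMin = N \<rightarrow> N \<rightarrow> N"
| "cnst_ty CMax = N \<rightarrow> N \<rightarrow> N"
| "cnst_ty CA0 = N \<rightarrow> N \<rightarrow> N"
| "cnst_ty CA1 = N \<rightarrow> N \<rightarrow> N"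
| "cnst_ty CA2 = N \<rightarrow> N \<rightarrow> N"
| "cnst_ty CA3 = N \<rightarrow> N \<rightarrow> N"
| "cnst_ty CPhi1 = ty1 \<rightarrow> N \<rightarrow> N"
| "cnst_ty CPhi2 = ty1 \<rightarrow> N \<rightarrow> N"
| "cnst_ty CPhi3 = ty1 \<rightarrow> N \<rightarrow> N"
| "cnst_ty CMub = (N \<rightarrow> N \<rightarrow> N) \<rightarrow> N \<rightarrow> N"
| "cnst_ty (CPi \<rho> \<tau>) = \<rho> \<rightarrow> \<tau> \<rightarrow> \<rho>"
| "cnst_ty (CSigma \<delta> \<rho> \<tau>) = (\<delta> \<rightarrow> \<rho> \<rightarrow> \<tau>) \<rightarrow> (\<delta> \<rightarrow> \<rho>) \<rightarrow> \<delta> \<rightarrow> \<tau>"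
| "cnst_ty (CRec \<rho>) = N \<rightarrow> \<rho> \<rightarrow> (N \<rightarrow> N \<rightarrow> \<rho>) \<rightarrow> (N \<rightarrow> \<rho>) \<rightarrow> \<rho>"

text \<open>A variable is a name together with its type; equal names at different types are
  different variables.\<close>

type_synonym var = "nat \<times> ty"

datatype tm = Var var | Con cnst | App tm tm  (infixl "\<cdot>" 90)

primrec tm_ty :: "tm \<Rightarrow> ty option" where
  "tm_ty (Var x) = Some (snd x)"
| "tm_ty (Con c) = Some (cnst_ty c)"
| "tm_ty (s \<cdot> t) = (case tm_ty s of
      Some (\<sigma> \<rightarrow> \<tau>) \<Rightarrow> if tm_ty t = Some \<sigma> then Some \<tau> else None
    | _ \<Rightarrow> None)"

primrec fv_tm :: "tm \<Rightarrow> var set" where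
  "fv_tm (Var x) = {x}"
| "fv_tm (Con c) = {}"
| "fv_tm (s \<cdot> t) = fv_tm s \<union> fv_tm t"

text \<open>\<open>fresh t\<close> is larger than every variable name occurring in \<open>t\<close>.\<close>

primrec fresh :: "tm \<Rightarrow> nat" where
  "fresh (Var x) = Suc (fst x)"
| "fresh (Con c) = 0"
| "fresh (s \<cdot> t) = max (fresh s) (fresh t)"

primrec subst_tm :: "tm \<Rightarrow> var \<Rightarrow> tm \<Rightarrow> tm" where
  "subst_tm (Var y) x t = (if y = x then t else Var y)"
| "subst_tm (Con c) x t = Con c"
| "subst_tm (s1 \<cdot> s2) x t = subst_tm s1 x t \<cdot> subst_tm s2 x t"

abbreviation apps :: "tm \<Rightarrow> tm list \<Rightarrow> tm" where
  "apps \<equiv> foldl App"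

text \<open>Equality and \<open>\<le>\<close> are primitive at type 0 only.\<close>

datatype fm =
    Bot
  | Eq tm tm  (infix "\<^bold>=" 50)
  | Le tm tm  (infix "\<^bold>\<le>" 50)
  | St ty tm
  | And fm fm  (infixr "\<^bold>\<and>" 35)
  | Or fm fm  (infixr "\<^bold>\<or>" 30)
  | Imp fm fm  (infixr "\<^bold>\<longrightarrow>" 25)
  | All var fm
  | Ex var fm
  | AllSt var fm
  | ExSt var fm

abbreviation Neg :: "fm \<Rightarrow> fm" where
  "Neg A \<equiv> A \<^bold>\<longrightarrow> Bot"

abbreviation Iff :: "fm \<Rightarrow> fm \<Rightarrow> fm"  (infix "\<^bold>\<longleftrightarrow>" 25) where
  "A \<^bold>\<longleftrightarrow> B \<equiv> (A \<^bold>\<longrightarrow> B) \<^bold>\<and> (B \<^bold>\<longrightarrow> A)"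

primrec wf :: "fm \<Rightarrow> bool" where
  "wf Bot \<longleftrightarrow> True"
| "wf (s \<^bold>= t) \<longleftrightarrow> tm_ty s = Some N \<and> tm_ty t = Some N"
| "wf (s \<^bold>\<le> t) \<longleftrightarrow> tm_ty s = Some N \<and> tm_ty t = Some N"
| "wf (St \<sigma> t) \<longleftrightarrow> tm_ty t = Some \<sigma>"
| "wf (A \<^bold>\<and> B) \<longleftrightarrow> wf A \<and> wf B"
| "wf (A \<^bold>\<or> B) \<longleftrightarrow> wf A \<and> wf B"
| "wf (A \<^bold>\<longrightarrow> B) \<longleftrightarrow> wf A \<and> wf B"
| "wf (All x A) \<longleftrightarrow> wf A"
| "wf (Ex x A) \<longleftrightarrow> wf A"
| "wf (AllSt x A) \<longleftrightarrow> wf A"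
| "wf (ExSt x A) \<longleftrightarrow> wf A"

primrec fv :: "fm \<Rightarrow> var set" where
  "fv Bot = {}"
| "fv (s \<^bold>= t) = fv_tm s \<union> fv_tm t"
| "fv (s \<^bold>\<le> t) = fv_tm s \<union> fv_tm t"
| "fv (St \<sigma> t) = fv_tm t"
| "fv (A \<^bold>\<and> B) = fv A \<union> fv B"
| "fv (A \<^bold>\<or> B) = fv A \<union> fv B"
| "fv (A \<^bold>\<longrightarrow> B) = fv A \<union> fv B"
| "fv (All x A) = fv A - {x}"
| "fv (Ex x A) = fv A - {x}"
| "fv (AllSt x A) = fv A - {x}"
| "fv (ExSt x A) = fv A - {x}"

text \<open>Substitution does not rename bound variables; it is only used under \<open>free_for\<close>.\<close>

primrec subst :: "fm \<Rightarrow> var \<Rightarrow> tm \<Rightarrow> fm" where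
  "subst Bot x t = Bot"
| "subst (r \<^bold>= s) x t = (subst_tm r x t \<^bold>= subst_tm s x t)"
| "subst (r \<^bold>\<le> s) x t = (subst_tm r x t \<^bold>\<le> subst_tm s x t)"
| "subst (St \<sigma> s) x t = St \<sigma> (subst_tm s x t)"
| "subst (A \<^bold>\<and> B) x t = (subst A x t \<^bold>\<and> subst B x t)"
| "subst (A \<^bold>\<or> B) x t = (subst A x t \<^bold>\<or> subst B x t)"
| "subst (A \<^bold>\<longrightarrow> B) x t = (subst A x t \<^bold>\<longrightarrow> subst B x t)"
| "subst (All y A) x t = All y (if y = x then A else subst A x t)"
| "subst (Ex y A) x t = Ex y (if y = x then A else subst A x t)"
| "subst (AllSt y A) x t = AllSt y (if y = x then A else subst A x t)"
| "subst (ExSt y A) x t = ExSt y (if y = x then A else subst A x t)"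

abbreviation binder_ok :: "tm \<Rightarrow> var \<Rightarrow> var \<Rightarrow> fm \<Rightarrow> bool \<Rightarrow> bool" where
  "binder_ok t x y A P \<equiv> x \<notin> fv A - {y} \<or> (y \<notin> fv_tm t \<and> P)"

primrec free_for :: "tm \<Rightarrow> var \<Rightarrow> fm \<Rightarrow> bool" where
  "free_for t x Bot \<longleftrightarrow> True"
| "free_for t x (r \<^bold>= s) \<longleftrightarrow> True"
| "free_for t x (r \<^bold>\<le> s) \<longleftrightarrow> True"
| "free_for t x (St \<sigma> s) \<longleftrightarrow> True"
| "free_for t x (A \<^bold>\<and> B) \<longleftrightarrow> free_for t x A \<and> free_for t x B"
| "free_for t x (A \<^bold>\<or> B) \<longleftrightarrow> free_for t x A \<and> free_for t x B"
| "free_for t x (A \<^bold>\<longrightarrow> B) \<longleftrightarrow> free_for t x A \<and> free_for t x B"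
| "free_for t x (All y A) \<longleftrightarrow> binder_ok t x y A (free_for t x A)"
| "free_for t x (Ex y A) \<longleftrightarrow> binder_ok t x y A (free_for t x A)"
| "free_for t x (AllSt y A) \<longleftrightarrow> binder_ok t x y A (free_for t x A)"
| "free_for t x (ExSt y A) \<longleftrightarrow> binder_ok t x y A (free_for t x A)"

primrec internal :: "fm \<Rightarrow> bool" where
  "internal Bot \<longleftrightarrow> True"
| "internal (s \<^bold>= t) \<longleftrightarrow> True"
| "internal (s \<^bold>\<le> t) \<longleftrightarrow> True"
| "internal (St \<sigma> t) \<longleftrightarrow> False"
| "internal (A \<^bold>\<and> B) \<longleftrightarrow> internal A \<and> internal B"
| "internal (A \<^bold>\<or> B) \<longleftrightarrow> internal A \<and> internal B"
| "internal (A \<^bold>\<longrightarrow> B) \<longleftrightarrow> internal A \<and> internal B"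
| "internal (All x A) \<longleftrightarrow> internal A"
| "internal (Ex x A) \<longleftrightarrow> internal A"
| "internal (AllSt x A) \<longleftrightarrow> False"
| "internal (ExSt x A) \<longleftrightarrow> False"

primrec quantifier_free :: "fm \<Rightarrow> bool" where
  "quantifier_free Bot \<longleftrightarrow> True"
| "quantifier_free (s \<^bold>= t) \<longleftrightarrow> True"
| "quantifier_free (s \<^bold>\<le> t) \<longleftrightarrow> True"
| "quantifier_free (St \<sigma> t) \<longleftrightarrow> True"
| "quantifier_free (A \<^bold>\<and> B) \<longleftrightarrow> quantifier_free A \<and> quantifier_free B"
| "quantifier_free (A \<^bold>\<or> B) \<longleftrightarrow> quantifier_free A \<and> quantifier_free B"
| "quantifier_free (A \<^bold>\<longrightarrow> B) \<longleftrightarrow> quantifier_free A \<and> quantifier_free B"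
| "quantifier_free (All x A) \<longleftrightarrow> False"
| "quantifier_free (Ex x A) \<longleftrightarrow> False"
| "quantifier_free (AllSt x A) \<longleftrightarrow> False"
| "quantifier_free (ExSt x A) \<longleftrightarrow> False"


section \<open>Abbreviations of the object language\<close>

abbreviation V :: "nat \<Rightarrow> ty \<Rightarrow> tm" where "V n \<sigma> \<equiv> Var (n, \<sigma>)"

abbreviation tzero :: tm where "tzero \<equiv> Con CZero"
abbreviation tsuc :: "tm \<Rightarrow> tm" where "tsuc t \<equiv> Con CSuc \<cdot> t"
abbreviation tmin :: "tm \<Rightarrow> tm \<Rightarrow> tm" where "tmin s t \<equiv> Con CMin \<cdot> s \<cdot> t"
abbreviation tmax :: "tm \<Rightarrow> tm \<Rightarrow> tm" where "tmax s t \<equiv> Con CMax \<cdot> s \<cdot> t"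
abbreviation tplus :: "tm \<Rightarrow> tm \<Rightarrow> tm"  (infixl "\<^bold>+" 65) where "s \<^bold>+ t \<equiv> Con CA1 \<cdot> s \<cdot> t"
abbreviation ttimes :: "tm \<Rightarrow> tm \<Rightarrow> tm"  (infixl "\<^bold>*" 70) where "s \<^bold>* t \<equiv> Con CA2 \<cdot> s \<cdot> t"

primrec eq_at :: "ty \<Rightarrow> tm \<Rightarrow> tm \<Rightarrow> fm" where
  "eq_at N s t = (s \<^bold>= t)"
| "eq_at (\<sigma> \<rightarrow> \<tau>) s t =
     (let z = (max (fresh s) (fresh t), \<sigma>) in All z (eq_at \<tau> (s \<cdot> Var z) (t \<cdot> Var z)))"

primrec zero_at :: "ty \<Rightarrow> tm" where
  "zero_at N = tzero"
| "zero_at (\<sigma> \<rightarrow> \<tau>) = Con (CPi \<tau> \<sigma>) \<cdot> zero_at \<tau>"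

text \<open>\<open>vars_from n \<sigma>\<close> lists variables of the argument types of \<open>\<sigma>\<close>, with consecutive names
  starting at \<open>n\<close>.\<close>

definition vars_from :: "nat \<Rightarrow> ty \<Rightarrow> var list" where
  "vars_from n \<sigma> = zip [n..<n + length (arg_tys \<sigma>)] (arg_tys \<sigma>)"

abbreviation All_list :: "var list \<Rightarrow> fm \<Rightarrow> fm" where "All_list xs A \<equiv> foldr All xs A"
abbreviation AllSt_list :: "var list \<Rightarrow> fm \<Rightarrow> fm" where "AllSt_list xs A \<equiv> foldr AllSt xs A"


subsection \<open>Finite sequences\<close>

text \<open>\<open>is_pair c a b\<close> says that \<open>c\<close> is the Cantor pair \<open>(a + b)(a + b + 1) / 2 + b\<close>.\<close>

definition is_pair :: "tm \<Rightarrow> tm \<Rightarrow> tm \<Rightarrow> fm" where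
  "is_pair c a b = (c \<^bold>+ c \<^bold>= (a \<^bold>+ b) \<^bold>* tsuc (a \<^bold>+ b) \<^bold>+ (b \<^bold>+ b))"

text \<open>A number \<open>c = \<langle>n, \<langle>a, b\<rangle>\<rangle>\<close> codes the sequence of length \<open>n\<close> whose \<open>i\<close>-th component is
  Goedel's \<open>\<beta>(a, b, i)\<close>, the remainder of \<open>a\<close> modulo \<open>1 + (i + 1) b\<close>. Since the pairing is
  onto, every number codes a sequence. In \<open>is_length k c n\<close> and \<open>is_comp k c i v\<close> the bound
  variables have names from \<open>k\<close> on, so \<open>k\<close> must exceed all names in the other arguments.\<close>

definition is_length :: "nat \<Rightarrow> tm \<Rightarrow> tm \<Rightarrow> fm" where
  "is_length k c n = Ex (k, N) (is_pair c n (V k N))"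

definition is_comp :: "nat \<Rightarrow> tm \<Rightarrow> tm \<Rightarrow> tm \<Rightarrow> fm" where
  "is_comp k c i v =
     (let n = (k, N); d = (k + 1, N); a = (k + 2, N); b = (k + 3, N); q = (k + 4, N) in
      Ex n (Ex d (Ex a (Ex b (Ex q (
        is_pair c (Var n) (Var d) \<^bold>\<and> is_pair (Var d) (Var a) (Var b) \<^bold>\<and>
        Var a \<^bold>= Var q \<^bold>* tsuc (tsuc i \<^bold>* Var b) \<^bold>+ v \<^bold>\<and>
        v \<^bold>\<le> tsuc i \<^bold>* Var b))))))"

text \<open>An object \<open>y\<close> of type \<open>\<sigma>\<close> with argument types \<open>\<sigma>\<^sub>1, \<dots>, \<sigma>\<^sub>k\<close> codes the sequence whose
  length is that of the number \<open>y 0 \<dots> 0\<close> and whose \<open>i\<close>-th component is the functional that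
  maps \<open>z\<^sub>1 \<dots> z\<^sub>k\<close> to the \<open>i\<close>-th component of the number \<open>y z\<^sub>1 \<dots> z\<^sub>k\<close>. \<open>mem_seq \<sigma> x y\<close> is
  \<open>x \<in> y\<close>: \<open>x\<close> equals such a component, the equality at type \<open>\<sigma>\<close> being pointwise.\<close>

definition mem_seq :: "ty \<Rightarrow> tm \<Rightarrow> tm \<Rightarrow> fm" where
  "mem_seq \<sigma> x y =
     (let m = max (fresh x) (fresh y);
          n = (m, N); i = (m + 1, N);
          zs = vars_from (m + 2) \<sigma>;
          k = m + 2 + length (arg_tys \<sigma>) in
      Ex n (Ex i (
        is_length k (apps y (map zero_at (arg_tys \<sigma>))) (Var n) \<^bold>\<and>
        tsuc (Var i) \<^bold>\<le> Var n \<^bold>\<and>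
        All_list zs (is_comp k (apps y (map Var zs)) (Var i) (apps x (map Var zs))))))"

text \<open>\<open>mem_union_app \<sigma> \<tau> y Y x\<close> is \<open>y \<in> Y[x]\<close> for \<open>Y\<close> of type \<open>\<sigma> \<rightarrow> \<tau>\<close>. Here \<open>Y[x]\<close> is the
  concatenation of the sequences \<open>f(x)\<close> for \<open>f \<in> Y\<close>, so its components are exactly the
  components of the \<open>f(x)\<close>.\<close>

definition mem_union_app :: "ty \<Rightarrow> ty \<Rightarrow> tm \<Rightarrow> tm \<Rightarrow> tm \<Rightarrow> fm" where
  "mem_union_app \<sigma> \<tau> y Y x =
     (let f = (max (fresh y) (max (fresh Y) (fresh x)), \<sigma> \<rightarrow> \<tau>) in
      Ex f (mem_seq (\<sigma> \<rightarrow> \<tau>) (Var f) Y \<^bold>\<and> mem_seq \<tau> y (Var f \<cdot> x)))"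


subsection \<open>Relativization to the standard objects\<close>

text \<open>Bounded number quantifiers are those of the form \<open>\<forall>x (x \<le> t \<longrightarrow> B)\<close> and
  \<open>\<exists>x (x \<le> t \<and> B)\<close> with \<open>x\<close> not in \<open>t\<close>, or the same with \<open>x < t\<close>, i.e. \<open>S x \<le> t\<close>.\<close>

definition bound_on :: "var \<Rightarrow> fm \<Rightarrow> bool" where
  "bound_on x C \<longleftrightarrow> snd x = N \<and>
     (\<exists>t. x \<notin> fv_tm t \<and> (C = (Var x \<^bold>\<le> t) \<or> C = (tsuc (Var x) \<^bold>\<le> t)))"

definition bounded_All :: "var \<Rightarrow> fm \<Rightarrow> bool" where
  "bounded_All x A \<longleftrightarrow> (\<exists>C B. A = (C \<^bold>\<longrightarrow> B) \<and> bound_on x C)"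

definition bounded_Ex :: "var \<Rightarrow> fm \<Rightarrow> bool" where
  "bounded_Ex x A \<longleftrightarrow> (\<exists>C B. A = (C \<^bold>\<and> B) \<and> bound_on x C)"

text \<open>The relativization \<open>\<phi>\<^sup>s\<^sup>t\<close> is meant for internal \<open>\<phi>\<close>; the clauses for the external
  constructors only make the function total.\<close>

primrec relst :: "fm \<Rightarrow> fm" where
  "relst Bot = Bot"
| "relst (s \<^bold>= t) = (s \<^bold>= t)"
| "relst (s \<^bold>\<le> t) = (s \<^bold>\<le> t)"
| "relst (St \<sigma> t) = St \<sigma> t"
| "relst (A \<^bold>\<and> B) = (relst A \<^bold>\<and> relst B)"
| "relst (A \<^bold>\<or> B) = (relst A \<^bold>\<or> relst B)"
| "relst (A \<^bold>\<longrightarrow> B) = (relst A \<^bold>\<longrightarrow> relst B)"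
| "relst (All x A) = (if bounded_All x A then All x (relst A) else AllSt x (relst A))"
| "relst (Ex x A) = (if bounded_Ex x A then Ex x (relst A) else ExSt x (relst A))"
| "relst (AllSt x A) = AllSt x (relst A)"
| "relst (ExSt x A) = ExSt x (relst A)"


section \<open>Derivability\<close>

text \<open>Hilbert-style classical many-sorted predicate logic. Free variables of axioms are
  implicitly universally quantified, by \<open>all_intro\<close>. The standard quantifiers have no rules
  of their own, since (EQ) reduces them to the ordinary ones.\<close>

inductive proves :: "fm set \<Rightarrow> fm \<Rightarrow> bool"  (infix "\<turnstile>" 20) for T :: "fm set" where
  axiom: "A \<in> T \<Longrightarrow> wf A \<Longrightarrow> T \<turnstile> A"
| mp: "T \<turnstile> A \<^bold>\<longrightarrow> B \<Longrightarrow> T \<turnstile> A \<Longrightarrow> T \<turnstile> B"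
| imp_K: "wf A \<Longrightarrow> wf B \<Longrightarrow> T \<turnstile> A \<^bold>\<longrightarrow> B \<^bold>\<longrightarrow> A"
| imp_S: "wf A \<Longrightarrow> wf B \<Longrightarrow> wf C \<Longrightarrow>
    T \<turnstile> (A \<^bold>\<longrightarrow> B \<^bold>\<longrightarrow> C) \<^bold>\<longrightarrow> (A \<^bold>\<longrightarrow> B) \<^bold>\<longrightarrow> A \<^bold>\<longrightarrow> C"
| and_left: "wf A \<Longrightarrow> wf B \<Longrightarrow> T \<turnstile> A \<^bold>\<and> B \<^bold>\<longrightarrow> A"
| and_right: "wf A \<Longrightarrow> wf B \<Longrightarrow> T \<turnstile> A \<^bold>\<and> B \<^bold>\<longrightarrow> B"
| and_intro: "wf A \<Longrightarrow> wf B \<Longrightarrow> T \<turnstile> A \<^bold>\<longrightarrow> B \<^bold>\<longrightarrow> A \<^bold>\<and> B"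
| or_left: "wf A \<Longrightarrow> wf B \<Longrightarrow> T \<turnstile> A \<^bold>\<longrightarrow> A \<^bold>\<or> B"
| or_right: "wf A \<Longrightarrow> wf B \<Longrightarrow> T \<turnstile> B \<^bold>\<longrightarrow> A \<^bold>\<or> B"
| or_elim: "wf A \<Longrightarrow> wf B \<Longrightarrow> wf C \<Longrightarrow>
    T \<turnstile> (A \<^bold>\<longrightarrow> C) \<^bold>\<longrightarrow> (B \<^bold>\<longrightarrow> C) \<^bold>\<longrightarrow> A \<^bold>\<or> B \<^bold>\<longrightarrow> C"
| bot_elim: "wf A \<Longrightarrow> T \<turnstile> Bot \<^bold>\<longrightarrow> A"
| classical: "wf A \<Longrightarrow> T \<turnstile> Neg (Neg A) \<^bold>\<longrightarrow> A"
| all_inst: "wf A \<Longrightarrow> tm_ty t = Some (snd x) \<Longrightarrow> free_for t x A \<Longrightarrow>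
    T \<turnstile> All x A \<^bold>\<longrightarrow> subst A x t"
| ex_witness: "wf A \<Longrightarrow> tm_ty t = Some (snd x) \<Longrightarrow> free_for t x A \<Longrightarrow>
    T \<turnstile> subst A x t \<^bold>\<longrightarrow> Ex x A"
| all_intro: "T \<turnstile> B \<^bold>\<longrightarrow> A \<Longrightarrow> x \<notin> fv B \<Longrightarrow> T \<turnstile> B \<^bold>\<longrightarrow> All x A"
| ex_elim: "T \<turnstile> A \<^bold>\<longrightarrow> B \<Longrightarrow> x \<notin> fv B \<Longrightarrow> T \<turnstile> Ex x A \<^bold>\<longrightarrow> B"


section \<open>Axioms\<close>

text \<open>The non-logical axioms of \<open>E-EFA\<^sup>\<omega>\<close>, i.e. of \<open>E-G\<^sub>3A\<^sup>\<omega>\<close>, with induction for quantifier-free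
  internal formulas and full extensionality, and without the true universal sentences that some
  presentations add (they would exceed the strength of EFA). The schemata are over all formulas and types;
  ill-typed instances are excluded by the premise of the rule \<open>axiom\<close>.\<close>

inductive_set EFA :: "fm set" where
  eq_refl: "(V 0 N \<^bold>= V 0 N) \<in> EFA"
| eq_trans: "(V 0 N \<^bold>= V 1 N \<^bold>\<longrightarrow> V 0 N \<^bold>= V 2 N \<^bold>\<longrightarrow> V 1 N \<^bold>= V 2 N) \<in> EFA"
| le_cong: "(V 0 N \<^bold>= V 1 N \<^bold>\<longrightarrow> V 2 N \<^bold>= V 3 N \<^bold>\<longrightarrow> V 0 N \<^bold>\<le> V 2 N \<^bold>\<longrightarrow> V 1 N \<^bold>\<le> V 3 N) \<in> EFA"
| extensionality:
    "(eq_at \<sigma> (V 0 \<sigma>) (V 1 \<sigma>) \<^bold>\<longrightarrow>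
      eq_at \<tau> (V 2 (\<sigma> \<rightarrow> \<tau>) \<cdot> V 0 \<sigma>) (V 2 (\<sigma> \<rightarrow> \<tau>) \<cdot> V 1 \<sigma>)) \<in> EFA"
| suc_inj: "(tsuc (V 0 N) \<^bold>= tsuc (V 1 N) \<^bold>\<longrightarrow> V 0 N \<^bold>= V 1 N) \<in> EFA"
| suc_not_zero: "Neg (tsuc (V 0 N) \<^bold>= tzero) \<in> EFA"
| le_zero: "(V 0 N \<^bold>\<le> tzero \<^bold>\<longleftrightarrow> V 0 N \<^bold>= tzero) \<in> EFA"
| le_suc: "(V 0 N \<^bold>\<le> tsuc (V 1 N) \<^bold>\<longleftrightarrow> V 0 N \<^bold>\<le> V 1 N \<^bold>\<or> V 0 N \<^bold>= tsuc (V 1 N)) \<in> EFA"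
| min_le1: "(tmin (V 0 N) (V 1 N) \<^bold>\<le> V 0 N) \<in> EFA"
| min_le2: "(tmin (V 0 N) (V 1 N) \<^bold>\<le> V 1 N) \<in> EFA"
| min_or: "(tmin (V 0 N) (V 1 N) \<^bold>= V 0 N \<^bold>\<or> tmin (V 0 N) (V 1 N) \<^bold>= V 1 N) \<in> EFA"
| max_ge1: "(V 0 N \<^bold>\<le> tmax (V 0 N) (V 1 N)) \<in> EFA"
| max_ge2: "(V 1 N \<^bold>\<le> tmax (V 0 N) (V 1 N)) \<in> EFA"
| max_or: "(tmax (V 0 N) (V 1 N) \<^bold>= V 0 N \<^bold>\<or> tmax (V 0 N) (V 1 N) \<^bold>= V 1 N) \<in> EFA"
| A0: "(Con CA0 \<cdot> V 0 N \<cdot> V 1 N \<^bold>= tsuc (V 1 N)) \<in> EFA"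
| A1_zero: "(Con CA1 \<cdot> V 0 N \<cdot> tzero \<^bold>= V 0 N) \<in> EFA"
| A1_suc: "(Con CA1 \<cdot> V 0 N \<cdot> tsuc (V 1 N) \<^bold>= Con CA0 \<cdot> V 0 N \<cdot> (Con CA1 \<cdot> V 0 N \<cdot> V 1 N)) \<in> EFA"
| A2_zero: "(Con CA2 \<cdot> V 0 N \<cdot> tzero \<^bold>= tzero) \<in> EFA"
| A2_suc: "(Con CA2 \<cdot> V 0 N \<cdot> tsuc (V 1 N) \<^bold>= Con CA1 \<cdot> V 0 N \<cdot> (Con CA2 \<cdot> V 0 N \<cdot> V 1 N)) \<in> EFA"
| A3_zero: "(Con CA3 \<cdot> V 0 N \<cdot> tzero \<^bold>= tsuc tzero) \<in> EFA"
| A3_suc: "(Con CA3 \<cdot> V 0 N \<cdot> tsuc (V 1 N) \<^bold>= Con CA2 \<cdot> V 0 N \<cdot> (Con CA3 \<cdot> V 0 N \<cdot> V 1 N)) \<in> EFA"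
| Phi1_zero: "(Con CPhi1 \<cdot> V 0 ty1 \<cdot> tzero \<^bold>= V 0 ty1 \<cdot> tzero) \<in> EFA"
| Phi1_suc: "(Con CPhi1 \<cdot> V 0 ty1 \<cdot> tsuc (V 1 N) \<^bold>=
    tmax (V 0 ty1 \<cdot> tsuc (V 1 N)) (Con CPhi1 \<cdot> V 0 ty1 \<cdot> V 1 N)) \<in> EFA"
| Phi2_zero: "(Con CPhi2 \<cdot> V 0 ty1 \<cdot> tzero \<^bold>= V 0 ty1 \<cdot> tzero) \<in> EFA"
| Phi2_suc: "(Con CPhi2 \<cdot> V 0 ty1 \<cdot> tsuc (V 1 N) \<^bold>=
    Con CA1 \<cdot> (V 0 ty1 \<cdot> tsuc (V 1 N)) \<cdot> (Con CPhi2 \<cdot> V 0 ty1 \<cdot> V 1 N)) \<in> EFA"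
| Phi3_zero: "(Con CPhi3 \<cdot> V 0 ty1 \<cdot> tzero \<^bold>= V 0 ty1 \<cdot> tzero) \<in> EFA"
| Phi3_suc: "(Con CPhi3 \<cdot> V 0 ty1 \<cdot> tsuc (V 1 N) \<^bold>=
    Con CA2 \<cdot> (V 0 ty1 \<cdot> tsuc (V 1 N)) \<cdot> (Con CPhi3 \<cdot> V 0 ty1 \<cdot> V 1 N)) \<in> EFA"
| mub_found:
    "(V 2 N \<^bold>\<le> V 1 N \<^bold>\<and> V 0 (N \<rightarrow> ty1) \<cdot> V 1 N \<cdot> V 2 N \<^bold>= tzero \<^bold>\<longrightarrow>
      V 0 (N \<rightarrow> ty1) \<cdot> V 1 N \<cdot> (Con CMub \<cdot> V 0 (N \<rightarrow> ty1) \<cdot> V 1 N) \<^bold>= tzero) \<in> EFA"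
| mub_least:
    "(tsuc (V 2 N) \<^bold>\<le> Con CMub \<cdot> V 0 (N \<rightarrow> ty1) \<cdot> V 1 N \<^bold>\<longrightarrow>
      Neg (V 0 (N \<rightarrow> ty1) \<cdot> V 1 N \<cdot> V 2 N \<^bold>= tzero)) \<in> EFA"
| mub_default:
    "(Con CMub \<cdot> V 0 (N \<rightarrow> ty1) \<cdot> V 1 N \<^bold>= tzero \<^bold>\<or>
      (V 0 (N \<rightarrow> ty1) \<cdot> V 1 N \<cdot> (Con CMub \<cdot> V 0 (N \<rightarrow> ty1) \<cdot> V 1 N) \<^bold>= tzero \<^bold>\<and>
       Con CMub \<cdot> V 0 (N \<rightarrow> ty1) \<cdot> V 1 N \<^bold>\<le> V 1 N)) \<in> EFA"
| Pi: "eq_at \<rho> (Con (CPi \<rho> \<tau>) \<cdot> V 0 \<rho> \<cdot> V 1 \<tau>) (V 0 \<rho>) \<in> EFA"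
| Sigma:
    "eq_at \<tau>
      (Con (CSigma \<delta> \<rho> \<tau>) \<cdot> V 0 (\<delta> \<rightarrow> \<rho> \<rightarrow> \<tau>) \<cdot> V 1 (\<delta> \<rightarrow> \<rho>) \<cdot> V 2 \<delta>)
      (V 0 (\<delta> \<rightarrow> \<rho> \<rightarrow> \<tau>) \<cdot> V 2 \<delta> \<cdot> (V 1 (\<delta> \<rightarrow> \<rho>) \<cdot> V 2 \<delta>)) \<in> EFA"
| Rec_zero:
    "y = V 1 \<rho> \<Longrightarrow> z = V 2 (N \<rightarrow> N \<rightarrow> \<rho>) \<Longrightarrow> v = V 3 (N \<rightarrow> \<rho>) \<Longrightarrow>
     ws = map Var (vars_from 4 \<rho>) \<Longrightarrow>
     (apps (Con (CRec \<rho>) \<cdot> tzero \<cdot> y \<cdot> z \<cdot> v) ws \<^bold>= apps y ws) \<in> EFA"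
| Rec_suc:
    "x = V 0 N \<Longrightarrow> y = V 1 \<rho> \<Longrightarrow> z = V 2 (N \<rightarrow> N \<rightarrow> \<rho>) \<Longrightarrow> v = V 3 (N \<rightarrow> \<rho>) \<Longrightarrow>
     ws = map Var (vars_from 4 \<rho>) \<Longrightarrow>
     (apps (Con (CRec \<rho>) \<cdot> tsuc x \<cdot> y \<cdot> z \<cdot> v) ws \<^bold>=
      tmin (apps (z \<cdot> apps (Con (CRec \<rho>) \<cdot> x \<cdot> y \<cdot> z \<cdot> v) ws \<cdot> x) ws) (apps (v \<cdot> x) ws)) \<in> EFA"
| QF_induction:
    "internal A \<Longrightarrow> quantifier_free A \<Longrightarrow>
     (subst A (n, N) tzero \<^bold>\<and> All (n, N) (A \<^bold>\<longrightarrow> subst A (n, N) (tsuc (V n N))) \<^bold>\<longrightarrow>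
      All (n, N) A) \<in> EFA"

inductive_set EFA_st :: "fm set" where
  EFA: "A \<in> EFA \<Longrightarrow> A \<in> EFA_st"
| EQ_all: "(AllSt x A \<^bold>\<longleftrightarrow> All x (St (snd x) (Var x) \<^bold>\<longrightarrow> A)) \<in> EFA_st"
| EQ_ex: "(ExSt x A \<^bold>\<longleftrightarrow> Ex x (St (snd x) (Var x) \<^bold>\<and> A)) \<in> EFA_st"
| st_eq: "(St \<sigma> (V 0 \<sigma>) \<^bold>\<and> eq_at \<sigma> (V 0 \<sigma>) (V 1 \<sigma>) \<^bold>\<longrightarrow> St \<sigma> (V 1 \<sigma>)) \<in> EFA_st"
| st_closed: "fv_tm t = {} \<Longrightarrow> St \<sigma> t \<in> EFA_st"
| st_app: "(St (\<sigma> \<rightarrow> \<tau>) (V 0 (\<sigma> \<rightarrow> \<tau>)) \<^bold>\<and> St \<sigma> (V 1 \<sigma>) \<^bold>\<longrightarrow>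
    St \<tau> (V 0 (\<sigma> \<rightarrow> \<tau>) \<cdot> V 1 \<sigma>)) \<in> EFA_st"
| st_le: "(St N (V 0 N) \<^bold>\<and> V 1 N \<^bold>\<le> V 0 N \<^bold>\<longrightarrow> St N (V 1 N)) \<in> EFA_st"

inductive_set Idealization :: "fm set" where
  "internal A \<Longrightarrow> x = (i, \<sigma>) \<Longrightarrow> y = (j, \<tau>) \<Longrightarrow> y' = (k, \<tau>) \<Longrightarrow>
   x \<noteq> y \<Longrightarrow> y' \<noteq> x \<Longrightarrow> y' \<noteq> y \<Longrightarrow> y' \<notin> fv A \<Longrightarrow>
   (AllSt y' (Ex x (All y (mem_seq \<tau> (Var y) (Var y') \<^bold>\<longrightarrow> A))) \<^bold>\<longrightarrow>
    Ex x (AllSt y A)) \<in> Idealization"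

inductive_set HAC_int :: "fm set" where
  "internal A \<Longrightarrow> x = (i, \<sigma>) \<Longrightarrow> y = (j, \<tau>) \<Longrightarrow> Y = (k, \<sigma> \<rightarrow> \<tau>) \<Longrightarrow>
   x \<noteq> y \<Longrightarrow> Y \<notin> fv A \<Longrightarrow>
   (AllSt x (ExSt y A) \<^bold>\<longrightarrow>
    ExSt Y (AllSt x (Ex y (mem_union_app \<sigma> \<tau> (Var y) (Var Y) (Var x) \<^bold>\<and> A)))) \<in> HAC_int"

inductive_set PF_TP :: "fm set" where
  "internal A \<Longrightarrow> fv A \<subseteq> set xs \<Longrightarrow> (AllSt_list xs A \<^bold>\<longrightarrow> All_list xs A) \<in> PF_TP"

inductive_set QF_AC :: "ty \<Rightarrow> ty \<Rightarrow> fm set" for \<sigma> \<tau> :: ty where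
  "internal A \<Longrightarrow> quantifier_free A \<Longrightarrow> x = (i, \<sigma>) \<Longrightarrow> y = (j, \<tau>) \<Longrightarrow> Y = (k, \<sigma> \<rightarrow> \<tau>) \<Longrightarrow>
   x \<noteq> y \<Longrightarrow> Y \<notin> fv A \<Longrightarrow>
   (All x (Ex y A) \<^bold>\<longrightarrow> Ex Y (All x (subst A y (Var Y \<cdot> Var x)))) \<in> QF_AC \<sigma> \<tau>"

definition B0_minus :: "fm set" where
  "B0_minus = EFA_st \<union> Idealization \<union> HAC_int \<union> QF_AC ty1 N"

definition B0 :: "fm set" where
  "B0 = B0_minus \<union> PF_TP"


section \<open>Turing jump functional and Feferman's search functional\<close>

text \<open>The variables \<open>\<phi>\<close> and \<open>\<mu>\<close> of type 2 are kept distinct from the bound variables by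
  their type.\<close>

definition TJ :: "var \<Rightarrow> fm" where
  "TJ \<phi> = All (0, ty1)
     (Var \<phi> \<cdot> V 0 ty1 \<^bold>= tzero \<^bold>\<longleftrightarrow> Ex (0, N) (V 0 ty1 \<cdot> V 0 N \<^bold>= tzero))"

definition MU :: "var \<Rightarrow> fm" where
  "MU \<mu> = All (0, ty1)
     (Ex (0, N) (V 0 ty1 \<cdot> V 0 N \<^bold>= tzero) \<^bold>\<longrightarrow>
      V 0 ty1 \<cdot> (Var \<mu> \<cdot> V 0 ty1) \<^bold>= tzero)"

end

theory Submission
  imports Defs "HOL-Library.Countable_Set" "HOL-Library.Nat_Bijection" "HOL-Number_Theory.Cong"
begin

text \<open>
  Unprovability in \<open>B0_minus\<close>: a theorem of \<open>B0_minus\<close> has a uniform witness under a semantic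
  Shoenfield--Diller--Nahm functional interpretation, in which an external formula becomes a game
  \<open>\<forall>x \<exists>y R\<close> with \<open>R\<close> internal, and internal formulas are evaluated in a
  fixed extensional type structure with all functionals of type 2. Witnesses are typed lambda terms
  over functionals that are bounded on bounded families of arguments. The functional \<open>\<exists>\<^sup>2\<close> takes
  two values, hence is such a functional, but \<open>\<mu>\<close> is unbounded on the characteristic
  functions of the singletons, which form a bounded family.

  For the equivalence in \<open>B0\<close>, \<open>\<mu>\<close> is obtained from \<open>\<exists>\<^sup>2\<close> internally by quantifier-free choice, and
  parameter-free Transfer turns the existence of an internal object into that of a standard one.
  For the relativized equivalence in \<open>B0_minus\<close>, \<open>HAC_int\<close> yields a standard \<open>Y\<close> with a zero of \<open>f\<close>
  among the components of \<open>Y[f]\<close>; these are all bounded by \<open>4 (Y f)\<close>, so bounded search finds one.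
\<close>

section \<open>An applicative structure: a graph model with countable approximations\<close>

text \<open>Quantifier-free choice must be true in the type structure, and once
  \<open>\<exists>\<^sup>2\<close> belongs to it, so does \<mu>. Truth in the structure therefore
  cannot separate the two functionals, and two notions are kept apart: internal quantifiers range
  over all elements of the partial equivalence relations (\<open>elt\<close>), whereas strategies
  have to be \<open>good\<close>, which adds the boundedness. So \<mu> exists, but no standard \<mu>
  can be exhibited; this is the gap that parameter-free Transfer closes. Computability or continuity
  would be the wrong restriction on strategies, because the discontinuous
  \<open>\<exists>\<^sup>2\<close> must remain among them. Types are relations on one untyped
  structure instead of a family of HOL types. Abstraction and conversion are then available once for
  all types, and closure of the strategies under typed terms becomes a logical-relations argument.
  Strategies never receive the environment: internal parameters are treated uniformly, and only what
  is declared standard reaches a strategy, as a list of candidates.\<close>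

text \<open>An element is a set of tokens; \<open>Arr s k\<close> is the step function that outputs \<open>k\<close> once the countable
  set \<open>dec s\<close> is contained in the argument. Countable instead of finite approximations make every
  functional of type 2 representable (\<open>orc\<close>).\<close>

datatype idx = NumI nat | PL idx | PR idx | Arr "nat \<Rightarrow> idx option" idx

type_synonym U = "idx set"

text \<open>Right to left this is monotonicity; left to right, every output token depends on
  countably many input tokens.\<close>

definition cont :: "(U \<Rightarrow> U) \<Rightarrow> bool" where
  "cont F \<longleftrightarrow> (\<forall>B k. k \<in> F B \<longleftrightarrow> (\<exists>C. countable C \<and> C \<subseteq> B \<and> k \<in> F C))"

text \<open>\<open>None\<close> entries are skipped; without them the empty set would have no
  enumeration.\<close>

definition dec :: "(nat \<Rightarrow> idx option) \<Rightarrow> U" where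
  "dec s = {x. Some x \<in> range s}"

definition app :: "U \<Rightarrow> U \<Rightarrow> U"  (infixl "\<bullet>" 90) where
  "A \<bullet> B = {k. \<exists>s. dec s \<subseteq> B \<and> Arr s k \<in> A}"

definition lam :: "(U \<Rightarrow> U) \<Rightarrow> U" where
  "lam F = {Arr s k | s k. k \<in> F (dec s)}"

definition num :: "nat \<Rightarrow> U" where "num n = {NumI n}"
definition pair :: "U \<Rightarrow> U \<Rightarrow> U" where "pair a b = PL ` a \<union> PR ` b"
definition pfst :: "U \<Rightarrow> U" where "pfst p = {k. PL k \<in> p}"
definition psnd :: "U \<Rightarrow> U" where "psnd p = {k. PR k \<in> p}"

text \<open>Collecting values over all selections \<open>g\<close> of numbers from \<open>h\<close>
  keeps the operation monotone on arbitrary elements. A total \<open>h\<close> admits exactly one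
  selection, so there the operation computes \<open>\<Theta>\<close>.\<close>

definition orc :: "(nat \<Rightarrow> (nat \<Rightarrow> nat) \<Rightarrow> nat) \<Rightarrow> U \<Rightarrow> U \<Rightarrow> U" where
  "orc \<Theta> p h = {NumI (\<Theta> n g) | n g. NumI n \<in> p \<and> (\<forall>k. NumI (g k) \<in> h \<bullet> num k)}"

text \<open>A guarded union instead of a case distinction on the element \<open>t\<close>, which
  would not be monotone. On numerals it selects the branch for zero or for a successor.\<close>

definition cd :: "U \<Rightarrow> U \<Rightarrow> U \<Rightarrow> U" where
  "cd t a b = {k. (NumI 0 \<in> t \<and> k \<in> a) \<or> (\<exists>n. NumI (Suc n) \<in> t \<and> k \<in> b)}"

lemma num_inject [simp]: "num m = num n \<longleftrightarrow> m = n"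
  by (simp add: num_def)

lemma pfst_pair [simp]: "pfst (pair a b) = a"
  and psnd_pair [simp]: "psnd (pair a b) = b"
  by (auto simp: pair_def pfst_def psnd_def)

lemma cd_0 [simp]: "cd (num 0) a b = a"
  and cd_Suc [simp]: "cd (num (Suc n)) a b = b"
  by (auto simp: cd_def num_def)

lemma app_cd: "cd t a b \<bullet> x = cd t (a \<bullet> x) (b \<bullet> x)"
  by (auto simp: cd_def app_def)

lemma pfst_cd: "pfst (cd t a b) = cd t (pfst a) (pfst b)"
  and psnd_cd: "psnd (cd t a b) = cd t (psnd a) (psnd b)"
  by (auto simp: cd_def pfst_def psnd_def)

lemma orc_num:
  assumes "\<And>k. h \<bullet> num k = num (g k)"
  shows "orc \<Theta> (num n) h = num (\<Theta> n g)"
proof -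
  have "g' = g" if "\<forall>k. NumI (g' k) \<in> h \<bullet> num k" for g'
  proof
    fix k from that have "NumI (g' k) \<in> num (g k)" by (simp add: assms)
    then show "g' k = g k" by (simp add: num_def)
  qed
  moreover have "NumI (g k) \<in> h \<bullet> num k" for k
    unfolding assms by (simp add: num_def)
  moreover have "NumI m \<in> num n \<longleftrightarrow> m = n" for m
    by (simp add: num_def)
  ultimately have "k \<in> orc \<Theta> (num n) h \<longleftrightarrow> k = NumI (\<Theta> n g)" for k
    unfolding orc_def mem_Collect_eq by metis
  then show ?thesis by (auto simp: num_def)
qed

lemma countable_dec: "countable (dec s)"
proof -
  have "dec s \<subseteq> (\<lambda>n. the (s n)) ` UNIV"
    by (auto simp: dec_def image_iff) (metis option.sel)
  then show ?thesis by (rule countable_subset) simp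
qed

lemma dec_surj:
  assumes "countable C"
  obtains s where "dec s = C"
proof (cases "C = {}")
  case True
  then have "dec (\<lambda>_. None) = C" by (simp add: dec_def)
  then show ?thesis by (rule that)
next
  case False
  have "dec (\<lambda>n. Some (from_nat_into C n)) = range (from_nat_into C)"
    by (auto simp: dec_def)
  then have "dec (\<lambda>n. Some (from_nat_into C n)) = C"
    using range_from_nat_into[OF False assms] by simp
  then show ?thesis by (rule that)
qed

text \<open>A continuous \<open>F\<close> is determined by its values on countable sets, and every
  countable set is \<open>dec s\<close> for some \<open>s\<close>; the tokens stored in
  \<open>lam F\<close> therefore recover \<open>F\<close> on all of \<open>U\<close>.\<close>

lemma beta:
  assumes "cont F"
  shows "lam F \<bullet> B = F B"
proof -
  have "k \<in> lam F \<bullet> B \<longleftrightarrow> k \<in> F B" for k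
  proof
    assume "k \<in> lam F \<bullet> B"
    then obtain s where "dec s \<subseteq> B" "k \<in> F (dec s)"
      by (auto simp: app_def lam_def)
    with assms countable_dec[of s] show "k \<in> F B" unfolding cont_def by blast
  next
    assume "k \<in> F B"
    with assms obtain C where C: "countable C" "C \<subseteq> B" "k \<in> F C" unfolding cont_def by blast
    from C(1) obtain s where "dec s = C" by (rule dec_surj)
    with C show "k \<in> lam F \<bullet> B" by (auto simp: app_def lam_def)
  qed
  then show ?thesis by blast
qed

lemma contI:
  assumes "\<And>B B' k. B \<subseteq> B' \<Longrightarrow> k \<in> F B \<Longrightarrow> k \<in> F B'"
    and "\<And>B k. k \<in> F B \<Longrightarrow> \<exists>C. countable C \<and> C \<subseteq> B \<and> k \<in> F C"
  shows "cont F"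
  unfolding cont_def
proof (intro allI iffI)
  fix B k assume "\<exists>C. countable C \<and> C \<subseteq> B \<and> k \<in> F C"
  then obtain C where "C \<subseteq> B" "k \<in> F C" by blast
  then show "k \<in> F B" by (rule assms(1))
qed (rule assms(2))

lemma contD: "cont F \<Longrightarrow> k \<in> F B \<Longrightarrow> \<exists>C. countable C \<and> C \<subseteq> B \<and> k \<in> F C"
  unfolding cont_def by blast

lemma cont_mono:
  assumes "cont F" "B \<subseteq> B'" "k \<in> F B"
  shows "k \<in> F B'"
proof -
  from contD[OF assms(1,3)] obtain C where "countable C" "C \<subseteq> B'" "k \<in> F C"
    using assms(2) by blast
  with assms(1) show ?thesis unfolding cont_def by blast
qed

lemma cont_countable:
  assumes "cont F" "countable D" "D \<subseteq> F B"
  shows "\<exists>C. countable C \<and> C \<subseteq> B \<and> D \<subseteq> F C"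
proof -
  have "\<forall>k\<in>D. \<exists>C. countable C \<and> C \<subseteq> B \<and> k \<in> F C"
    using assms contD by blast
  then obtain C where C: "\<forall>k\<in>D. countable (C k) \<and> C k \<subseteq> B \<and> k \<in> F (C k)"
    by metis
  have "countable (\<Union>k\<in>D. C k)" using assms(2) C by blast
  moreover have "D \<subseteq> F (\<Union>k\<in>D. C k)"
  proof
    fix k assume "k \<in> D"
    then show "k \<in> F (\<Union>k\<in>D. C k)"
      using cont_mono[OF assms(1), of "C k" "\<Union>k\<in>D. C k" k] C by blast
  qed
  ultimately show ?thesis using C by blast
qed

named_theorems cont_intros

lemma cont_const [cont_intros]: "cont (\<lambda>_. c)"
  by (rule contI) auto

lemma cont_id [cont_intros]: "cont (\<lambda>x. x)"
  by (rule contI) (auto intro: exI[of _ "{_}"])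

lemma cont_app [cont_intros]:
  assumes "cont F" "cont G"
  shows "cont (\<lambda>x. F x \<bullet> G x)"
proof (rule contI)
  fix B B' k assume "B \<subseteq> B'" "k \<in> F B \<bullet> G B"
  then show "k \<in> F B' \<bullet> G B'"
    using cont_mono[OF assms(1)] cont_mono[OF assms(2)] unfolding app_def by blast
next
  fix B k assume "k \<in> F B \<bullet> G B"
  then obtain s where s: "dec s \<subseteq> G B" "Arr s k \<in> F B" by (auto simp: app_def)
  obtain C where C: "countable C" "C \<subseteq> B" "dec s \<subseteq> G C"
    using cont_countable[OF assms(2) countable_dec s(1)] by blast
  obtain C' where C': "countable C'" "C' \<subseteq> B" "Arr s k \<in> F C'"
    using contD[OF assms(1) s(2)] by blast
  have "dec s \<subseteq> G (C \<union> C')" "Arr s k \<in> F (C \<union> C')"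
    using C C' cont_mono[OF assms(1), of C' "C \<union> C'"] cont_mono[OF assms(2), of C "C \<union> C'"] by auto
  then show "\<exists>C. countable C \<and> C \<subseteq> B \<and> k \<in> F C \<bullet> G C"
    using C C' by (intro exI[of _ "C \<union> C'"]) (auto simp: app_def)
qed

text \<open>Each token of \<open>lam (H B)\<close> concerns a single argument \<open>dec s\<close>,
  so continuity in \<open>B\<close> can be checked one argument at a time.\<close>

lemma cont_lam [cont_intros]:
  assumes "\<And>x. cont (\<lambda>B. H B x)"
  shows "cont (\<lambda>B. lam (H B))"
proof (rule contI)
  fix B B' k assume "B \<subseteq> B'" "k \<in> lam (H B)"
  then show "k \<in> lam (H B')"
    using cont_mono[OF assms] unfolding lam_def by blast
next
  fix B k assume "k \<in> lam (H B)"
  then obtain s k' where k: "k = Arr s k'" "k' \<in> H B (dec s)" by (auto simp: lam_def)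
  show "\<exists>C. countable C \<and> C \<subseteq> B \<and> k \<in> lam (H C)"
    using contD[OF assms k(2)] k(1) by (auto simp: lam_def)
qed

lemma cont_pair [cont_intros]:
  assumes "cont F" "cont G"
  shows "cont (\<lambda>x. pair (F x) (G x))"
proof (rule contI)
  fix B B' k assume "B \<subseteq> B'" "k \<in> pair (F B) (G B)"
  then show "k \<in> pair (F B') (G B')"
    using cont_mono[OF assms(1), of B B'] cont_mono[OF assms(2), of B B'] by (auto simp: pair_def)
next
  fix B k assume "k \<in> pair (F B) (G B)"
  then consider x where "k = PL x" "x \<in> F B" | x where "k = PR x" "x \<in> G B"
    by (auto simp: pair_def)
  then show "\<exists>C. countable C \<and> C \<subseteq> B \<and> k \<in> pair (F C) (G C)"
  proof cases
    case 1
    with contD[OF assms(1), of x B] show ?thesis unfolding pair_def by blast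
  next
    case 2
    with contD[OF assms(2), of x B] show ?thesis unfolding pair_def by blast
  qed
qed

lemma cont_pfst [cont_intros]: "cont F \<Longrightarrow> cont (\<lambda>x. pfst (F x))"
  by (rule contI) (auto simp: pfst_def intro: cont_mono dest: contD)

lemma cont_psnd [cont_intros]: "cont F \<Longrightarrow> cont (\<lambda>x. psnd (F x))"
  by (rule contI) (auto simp: psnd_def intro: cont_mono dest: contD)

text \<open>Here countability is essential: a selection \<open>g\<close> consults \<open>h\<close>
  at infinitely many numbers, and the union of the supports of all these values is still
  countable.\<close>

lemma cont_orc [cont_intros]:
  assumes "cont F" "cont G"
  shows "cont (\<lambda>x. orc \<Theta> (F x) (G x))"
proof (rule contI)
  have app: "cont (\<lambda>x. G x \<bullet> num k)" for k by (intro cont_intros assms)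
  {
    fix B B' k assume "B \<subseteq> B'" "k \<in> orc \<Theta> (F B) (G B)"
    then show "k \<in> orc \<Theta> (F B') (G B')"
      using cont_mono[OF assms(1) \<open>B \<subseteq> B'\<close>] cont_mono[OF app \<open>B \<subseteq> B'\<close>]
      unfolding orc_def by blast
  next
    fix B k assume "k \<in> orc \<Theta> (F B) (G B)"
    then obtain n g where ng: "k = NumI (\<Theta> n g)" "NumI n \<in> F B"
      "\<And>k. NumI (g k) \<in> G B \<bullet> num k" by (auto simp: orc_def)
    obtain C' where C': "countable C'" "C' \<subseteq> B" "NumI n \<in> F C'"
      using contD[OF assms(1) ng(2)] by blast
    have "\<forall>k. \<exists>C. countable C \<and> C \<subseteq> B \<and> NumI (g k) \<in> G C \<bullet> num k"
      using contD[OF app ng(3)] by blast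
    then obtain C where C: "\<And>k. countable (C k) \<and> C k \<subseteq> B \<and> NumI (g k) \<in> G (C k) \<bullet> num k"
      by metis
    let ?C = "C' \<union> (\<Union>k. C k)"
    have "NumI n \<in> F ?C" using C' cont_mono[OF assms(1), of C' ?C] by blast
    moreover have "NumI (g k) \<in> G ?C \<bullet> num k" for k
      using C cont_mono[OF app, of "C k" ?C] by blast
    ultimately show "\<exists>C. countable C \<and> C \<subseteq> B \<and> k \<in> orc \<Theta> (F C) (G C)"
      using C C' ng(1) by (intro exI[of _ ?C]) (auto simp: orc_def)
  }
qed

lemma cont_cd [cont_intros]:
  assumes "cont F" "cont G" "cont H"
  shows "cont (\<lambda>x. cd (F x) (G x) (H x))"
proof (rule contI)
  fix B B' k assume "B \<subseteq> B'" "k \<in> cd (F B) (G B) (H B)"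
  then show "k \<in> cd (F B') (G B') (H B')"
    using cont_mono[OF assms(1) \<open>B \<subseteq> B'\<close>] cont_mono[OF assms(2) \<open>B \<subseteq> B'\<close>]
      cont_mono[OF assms(3) \<open>B \<subseteq> B'\<close>]
    unfolding cd_def by blast
next
  fix B k assume "k \<in> cd (F B) (G B) (H B)"
  then consider "NumI 0 \<in> F B" "k \<in> G B" | n where "NumI (Suc n) \<in> F B" "k \<in> H B"
    by (auto simp: cd_def)
  then show "\<exists>C. countable C \<and> C \<subseteq> B \<and> k \<in> cd (F C) (G C) (H C)"
  proof cases
    case 1
    obtain C C' where "countable C" "C \<subseteq> B" "NumI 0 \<in> F C" "countable C'" "C' \<subseteq> B" "k \<in> G C'"
      using contD[OF assms(1) 1(1)] contD[OF assms(2) 1(2)] by blast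
    then show ?thesis
      using cont_mono[OF assms(1), of C "C \<union> C'"] cont_mono[OF assms(2), of C' "C \<union> C'"]
      by (intro exI[of _ "C \<union> C'"]) (auto simp: cd_def)
  next
    case 2
    obtain C C' where "countable C" "C \<subseteq> B" "NumI (Suc n) \<in> F C" "countable C'" "C' \<subseteq> B" "k \<in> H C'"
      using contD[OF assms(1) 2(1)] contD[OF assms(3) 2(2)] by blast
    then show ?thesis
      using cont_mono[OF assms(1), of C "C \<union> C'"] cont_mono[OF assms(3), of C' "C \<union> C'"]
      by (intro exI[of _ "C \<union> C'"]) (unfold cd_def, blast)
  qed
qed

section \<open>Extensional types and bounded families\<close>

datatype rty = RN | RF rty rty | RP rty rty

text \<open>The extensional type structure, as partial equivalence relations.\<close>

primrec per :: "rty \<Rightarrow> U \<Rightarrow> U \<Rightarrow> bool" where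
  "per RN x y \<longleftrightarrow> (\<exists>n. x = num n \<and> y = num n)"
| "per (RF r s) x y \<longleftrightarrow> (\<forall>z w. per r z w \<longrightarrow> per s (x \<bullet> z) (y \<bullet> w))"
| "per (RP r s) x y \<longleftrightarrow> per r (pfst x) (pfst y) \<and> per s (psnd x) (psnd y)"

text \<open>A logical relation on sequences: at an arrow type the \<open>i\<close>-th member is
  applied to the \<open>i\<close>-th argument of a bounded sequence. At type \<open>RF RN RN\<close>
  it amounts to total functions with a common pointwise bound.\<close>

primrec Bd :: "rty \<Rightarrow> (nat \<Rightarrow> U) \<Rightarrow> bool" where
  "Bd RN x \<longleftrightarrow> (\<exists>m. \<forall>i. \<exists>n\<le>m. x i = num n)"
| "Bd (RF r s) x \<longleftrightarrow> (\<forall>z. Bd r z \<longrightarrow> Bd s (\<lambda>i. x i \<bullet> z i))"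
| "Bd (RP r s) x \<longleftrightarrow> Bd r (\<lambda>i. pfst (x i)) \<and> Bd s (\<lambda>i. psnd (x i))"

abbreviation elt :: "rty \<Rightarrow> U \<Rightarrow> bool" where "elt r x \<equiv> per r x x"

text \<open>Both properties are proved in one induction: transitivity at an arrow type uses that an
  argument is related to itself, and this takes symmetry and transitivity at the argument
  type.\<close>

lemma per_sym_trans: "(per r x y \<longrightarrow> per r y x) \<and> (per r x y \<longrightarrow> per r y z \<longrightarrow> per r x z)"
proof (induction r arbitrary: x y z)
  case (RF r s)
  have symr: "per r x y \<Longrightarrow> per r y x" and syms: "per s x y \<Longrightarrow> per s y x" for x y
    using RF by blast+
  have sym: "per (RF r s) x y \<longrightarrow> per (RF r s) y x" for x y
    by (simp, intro impI allI) (blast intro: symr syms)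
  have "per (RF r s) x z" if "per (RF r s) x y" "per (RF r s) y z"
  proof (simp, intro allI impI)
    fix u w assume "per r u w"
    then have "per r w w" using RF(1) by blast
    with \<open>per r u w\<close> that have "per s (x \<bullet> u) (y \<bullet> w)" "per s (y \<bullet> w) (z \<bullet> w)" by auto
    then show "per s (x \<bullet> u) (z \<bullet> w)" using RF(2) by blast
  qed
  with sym show ?case by blast
next
  case (RP r s)
  then show ?case by (metis per.simps(3))
qed auto

lemma per_sym: "per r x y \<Longrightarrow> per r y x" and per_trans: "per r x y \<Longrightarrow> per r y z \<Longrightarrow> per r x z"
  using per_sym_trans by blast+

lemma per_dom1: "per r x y \<Longrightarrow> elt r x" and per_dom2: "per r x y \<Longrightarrow> elt r y"
  using per_sym per_trans by blast+

lemma per_app: "per (RF r s) x y \<Longrightarrow> per r z w \<Longrightarrow> per s (x \<bullet> z) (y \<bullet> w)"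
  by simp

text \<open>The first two members of a family are related as elements of the type structure; the others
  form a bounded family. Both relations are preserved by the same term formers, so typing
  derivations are carried out once, for \<open>typed\<close>.\<close>

definition typed :: "rty \<Rightarrow> (nat \<Rightarrow> U) \<Rightarrow> bool" where
  "typed r x \<longleftrightarrow> per r (x 0) (x 1) \<and> Bd r (\<lambda>i. x (i + 2))"

abbreviation good :: "rty \<Rightarrow> U \<Rightarrow> bool" where "good r t \<equiv> typed r (\<lambda>_. t)"

primrec dfl :: "rty \<Rightarrow> U" where
  "dfl RN = num 0"
| "dfl (RF r s) = lam (\<lambda>_. dfl s)"
| "dfl (RP r s) = pair (dfl r) (dfl s)"

named_theorems typed_intros

lemma typed_dfl [typed_intros]: "typed r (\<lambda>_. dfl r)"
  by (induction r) (auto simp: typed_def beta[OF cont_const])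

lemma typed_app [typed_intros]: "typed (RF r s) f \<Longrightarrow> typed r x \<Longrightarrow> typed s (\<lambda>i. f i \<bullet> x i)"
  by (auto simp: typed_def)

lemma typed_lam [typed_intros]:
  assumes "\<And>i. cont (F i)" and "\<And>x. typed r x \<Longrightarrow> typed s (\<lambda>i. F i (x i))"
  shows "typed (RF r s) (\<lambda>i. lam (F i))"
proof -
  have "per s (F 0 z) (F 1 w)" if "per r z w" for z w
  proof -
    \<comment> \<open>Either half of \<open>typed\<close> is extracted by completing the given half
      with default values to a full family.\<close>
    have "typed r (\<lambda>i. if i = 0 then z else if i = 1 then w else dfl r)"
      using typed_dfl[of r] that by (simp add: typed_def)
    from assms(2)[OF this] show ?thesis by (simp add: typed_def)
  qed
  moreover have "Bd s (\<lambda>i. F (i + 2) (z i))" if "Bd r z" for z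
  proof -
    have "typed r (\<lambda>i. if i < 2 then dfl r else z (i - 2))"
      using typed_dfl[of r] that by (simp add: typed_def)
    from assms(2)[OF this] show ?thesis by (simp add: typed_def)
  qed
  ultimately show ?thesis by (simp add: typed_def beta[OF assms(1)])
qed

lemma typed_num [typed_intros]: "typed RN (\<lambda>_. num n)"
  by (auto simp: typed_def)

lemma typed_pair [typed_intros]: "typed r x \<Longrightarrow> typed s y \<Longrightarrow> typed (RP r s) (\<lambda>i. pair (x i) (y i))"
  by (auto simp: typed_def)

lemma typed_pfst [typed_intros]: "typed (RP r s) x \<Longrightarrow> typed r (\<lambda>i. pfst (x i))"
  and typed_psnd [typed_intros]: "typed (RP r s) x \<Longrightarrow> typed s (\<lambda>i. psnd (x i))"
  by (auto simp: typed_def)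

lemma per_cd: "per RN t t' \<Longrightarrow> per r a a' \<Longrightarrow> per r b b' \<Longrightarrow> per r (cd t a b) (cd t' a' b')"
proof -
  assume a: "per RN t t'" "per r a a'" "per r b b'"
  then obtain n where "t = num n" "t' = num n" by auto
  with a show ?thesis by (cases n) auto
qed

text \<open>The branch taken may vary with the index. At type \<open>RN\<close> the larger of the
  two bounds serves both branches, and at higher types \<open>cd\<close> commutes with application
  and projections.\<close>

lemma B_cd: "Bd RN t \<Longrightarrow> Bd r a \<Longrightarrow> Bd r b \<Longrightarrow> Bd r (\<lambda>i. cd (t i) (a i) (b i))"
proof (induction r arbitrary: a b)
  case RN
  then obtain m1 m2 m3 where m: "\<And>i. \<exists>n\<le>m1. t i = num n" "\<And>i. \<exists>n\<le>m2. a i = num n"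
    "\<And>i. \<exists>n\<le>m3. b i = num n" unfolding Bd.simps by meson
  have "\<exists>n\<le>max m2 m3. cd (t i) (a i) (b i) = num n" for i
  proof -
    obtain n1 n2 n3 where "t i = num n1" "a i = num n2" "n2 \<le> m2" "b i = num n3" "n3 \<le> m3"
      using m by meson
    then show ?thesis by (cases n1) (auto simp: max_def)
  qed
  then show ?case unfolding Bd.simps by blast
next
  case (RF r s)
  then show ?case by (simp add: app_cd)
next
  case (RP r s)
  then show ?case by (simp add: pfst_cd psnd_cd)
qed

lemma typed_cd [typed_intros]:
  "typed RN t \<Longrightarrow> typed r a \<Longrightarrow> typed r b \<Longrightarrow> typed r (\<lambda>i. cd (t i) (a i) (b i))"
  unfolding typed_def using per_cd B_cd by blast

section \<open>Numerical oracles\<close>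

definition tot :: "U \<Rightarrow> (nat \<Rightarrow> nat) \<Rightarrow> bool" where
  "tot h g \<longleftrightarrow> (\<forall>k. h \<bullet> num k = num (g k))"

lemma per_fun: "per (RF RN RN) h h' \<longleftrightarrow> (\<exists>g. tot h g \<and> tot h' g)"
proof
  assume "per (RF RN RN) h h'"
  then have "\<forall>k. \<exists>m. h \<bullet> num k = num m \<and> h' \<bullet> num k = num m" by auto
  then show "\<exists>g. tot h g \<and> tot h' g" unfolding tot_def by metis
qed (auto simp: tot_def)

lemma orc_tot: "tot h g \<Longrightarrow> orc \<Theta> (num n) h = num (\<Theta> n g)"
  by (rule orc_num) (simp add: tot_def)

text \<open>The functions below a fixed \<open>b\<close> form a compact set, but boundedness on it
  demands no continuity of \<open>\<Theta>\<close>.\<close>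

definition bddO :: "(nat \<Rightarrow> (nat \<Rightarrow> nat) \<Rightarrow> nat) \<Rightarrow> bool" where
  "bddO \<Theta> \<longleftrightarrow> (\<forall>q b. \<exists>m. \<forall>p\<le>q. \<forall>h. (\<forall>k. h k \<le> b k) \<longrightarrow> \<Theta> p h \<le> m)"

lemma per_orc: "per RN p p' \<Longrightarrow> per (RF RN RN) h h' \<Longrightarrow> per RN (orc \<Theta> p h) (orc \<Theta> p' h')"
  unfolding per_fun by (auto simp: orc_tot)

lemma B_fun: "Bd (RF RN RN) h \<Longrightarrow> \<exists>b. \<forall>i. \<exists>g. tot (h i) g \<and> (\<forall>k. g k \<le> b k)"
proof -
  assume h: "Bd (RF RN RN) h"
  have "\<exists>m. \<forall>i. \<exists>n\<le>m. h i \<bullet> num k = num n" for k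
  proof -
    have "Bd RN (\<lambda>_. num k)" by auto
    then have "Bd RN (\<lambda>i. h i \<bullet> num k)" using h unfolding Bd.simps(2) by simp
    then show ?thesis by simp
  qed
  then obtain b where "\<And>k i. \<exists>n\<le>b k. h i \<bullet> num k = num n" by metis
  then have "\<exists>g. \<forall>k. g k \<le> b k \<and> h i \<bullet> num k = num (g k)" for i
    by (intro choice allI) blast
  then show ?thesis unfolding tot_def by blast
qed

lemma B_orc:
  assumes "bddO \<Theta>" "Bd RN p" "Bd (RF RN RN) h"
  shows "Bd RN (\<lambda>i. orc \<Theta> (p i) (h i))"
proof -
  obtain q where q: "\<And>i. \<exists>n\<le>q. p i = num n" using assms(2) by auto
  obtain b where b: "\<And>i. \<exists>g. tot (h i) g \<and> (\<forall>k. g k \<le> b k)" using B_fun[OF assms(3)] by blast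
  obtain m where m: "\<And>p h. p \<le> q \<Longrightarrow> (\<And>k. h k \<le> b k) \<Longrightarrow> \<Theta> p h \<le> m"
    using assms(1) unfolding bddO_def by metis
  have "\<exists>n\<le>m. orc \<Theta> (p i) (h i) = num n" for i
    using q[of i] b[of i] m orc_tot by metis
  then show ?thesis by auto
qed

lemma typed_orc [typed_intros]:
  "typed RN p \<Longrightarrow> typed (RF RN RN) h \<Longrightarrow> bddO \<Theta> \<Longrightarrow> typed RN (\<lambda>i. orc \<Theta> (p i) (h i))"
  unfolding typed_def using per_orc B_orc by blast

lemma good_dom: "good r t \<Longrightarrow> elt r t"
  by (simp add: typed_def)

definition un :: "(nat \<Rightarrow> nat) \<Rightarrow> U \<Rightarrow> U" where
  "un f x = orc (\<lambda>n _. f n) x (lam (\<lambda>_. num 0))"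

text \<open>The second number is passed as a constant function and read off at 0, so binary
  functions fit the format of one number and one function.\<close>

definition bin :: "(nat \<Rightarrow> nat \<Rightarrow> nat) \<Rightarrow> U \<Rightarrow> U \<Rightarrow> U" where
  "bin f x y = orc (\<lambda>n g. f n (g 0)) x (lam (\<lambda>_. y))"

lemma un_num [simp]: "un f (num n) = num (f n)"
  unfolding un_def by (rule orc_tot[of _ "\<lambda>_. 0"]) (simp add: tot_def beta[OF cont_const])

lemma bin_num [simp]: "bin f (num n) (num m) = num (f n m)"
  unfolding bin_def by (rule orc_tot[of _ "\<lambda>_. m", simplified]) (simp add: tot_def beta[OF cont_const])

lemma cont_un [cont_intros]: "cont F \<Longrightarrow> cont (\<lambda>x. un f (F x))"
  unfolding un_def by (intro cont_intros)

lemma cont_bin [cont_intros]: "cont F \<Longrightarrow> cont G \<Longrightarrow> cont (\<lambda>x. bin f (F x) (G x))"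
  unfolding bin_def by (intro cont_intros)

text \<open>If \<open>\<Theta> p h\<close> only consults the first \<open>c p\<close> values of
  \<open>h\<close>, then \<open>p \<le> q\<close> and \<open>h \<le> b\<close> leave finitely many
  inputs, hence finitely many values.\<close>

lemma bddO_finite:
  assumes "\<And>p h. \<Theta> p h = \<Theta>' p (map h [0..<c p])"
  shows "bddO \<Theta>"
  unfolding bddO_def
proof (intro allI)
  fix q and b :: "nat \<Rightarrow> nat"
  define n where "n = Max (c ` {..q})"
  \<comment> \<open>The inserted 0 covers \<open>n = 0\<close>, where there is no value of
    \<open>b\<close> to take the maximum of.\<close>
  define bm where "bm = Max (insert 0 (b ` {..<n}))"
  have c: "c p \<le> n" if "p \<le> q" for p using that by (simp add: n_def)
  have b: "b k \<le> bm" if "k < n" for k using that by (simp add: bm_def)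
  let ?A = "{..q} \<times> {xs. set xs \<subseteq> {..bm} \<and> length xs \<le> n}"
  have fin: "finite ((\<lambda>(p, xs). \<Theta>' p xs) ` ?A)" (is "finite ?S")
    by (intro finite_imageI finite_cartesian_product finite_lists_length_le) auto
  have "\<Theta> p h \<le> Max ?S" if "p \<le> q" "\<forall>k. h k \<le> b k" for p h
  proof (rule Max_ge[OF fin])
    have "h k \<le> bm" if "k < c p" for k
      using that \<open>\<forall>k. h k \<le> b k\<close> b c[OF \<open>p \<le> q\<close>] by (meson le_trans less_le_trans)
    then have "(p, map h [0..<c p]) \<in> ?A" using that c by auto
    then show "\<Theta> p h \<in> ?S" unfolding assms by force
  qed
  then show "\<exists>m. \<forall>p\<le>q. \<forall>h. (\<forall>k. h k \<le> b k) \<longrightarrow> \<Theta> p h \<le> m" by blast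
qed

lemma bddO_un: "bddO (\<lambda>n _. f n)"
  by (rule bddO_finite[of _ "\<lambda>p _. f p" "\<lambda>_. 0"]) simp

lemma bddO_bin: "bddO (\<lambda>n g. f n (g 0))"
  by (rule bddO_finite[of _ "\<lambda>p xs. f p (hd xs)" "\<lambda>_. 1"]) simp

lemma typed_un [typed_intros]: "typed RN x \<Longrightarrow> typed RN (\<lambda>i. un f (x i))"
  unfolding un_def by (intro typed_intros cont_intros bddO_un)

lemma typed_bin [typed_intros]: "typed RN x \<Longrightarrow> typed RN y \<Longrightarrow> typed RN (\<lambda>i. bin f (x i) (y i))"
  unfolding bin_def by (intro typed_intros cont_intros bddO_bin)

section \<open>Games\<close>

abbreviation RL :: "rty \<Rightarrow> rty" where "RL r \<equiv> RP RN (RF RN r)"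

text \<open>A list is a length together with a total function whose values beyond the length are
  ignored. Lists thus inherit \<open>per\<close> and \<open>Bd\<close> from products and
  functions.\<close>

definition lmem :: "U \<Rightarrow> U set" where
  "lmem l = {psnd l \<bullet> num j | j n. pfst l = num n \<and> j < n}"

definition lsing :: "U \<Rightarrow> U" where "lsing x = pair (num 1) (lam (\<lambda>_. x))"

text \<open>Position \<open>k\<close> of the concatenation of \<open>n\<close> lists with lengths \<open>g\<close> lies in list \<open>locj\<close> at
  position \<open>lock\<close>, where the argument is the code of \<open>(n, k)\<close>.\<close>

definition locj :: "nat \<Rightarrow> (nat \<Rightarrow> nat) \<Rightarrow> nat" where
  "locj p g = (case prod_decode p of (n, k) \<Rightarrow>
     if \<exists>j<n. k < (\<Sum>i\<le>j. g i) then LEAST j. j < n \<and> k < (\<Sum>i\<le>j. g i) else 0)"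

definition lock :: "nat \<Rightarrow> (nat \<Rightarrow> nat) \<Rightarrow> nat" where
  "lock p g = snd (prod_decode p) - (\<Sum>i<locj p g. g i)"

definition lensum :: "nat \<Rightarrow> (nat \<Rightarrow> nat) \<Rightarrow> nat" where
  "lensum n g = (\<Sum>i<n. g i)"

text \<open>Locating an entry of the concatenation requires the lengths of all the lists
  \<open>F x\<close>. The total length and the two coordinates of a position are numerical
  functionals of the function \<open>lens\<close>, hence oracles.\<close>

definition lbind :: "U \<Rightarrow> (U \<Rightarrow> U) \<Rightarrow> U" where
  "lbind l F = (let lens = lam (\<lambda>j. pfst (F (psnd l \<bullet> j))) in
     pair (orc lensum (pfst l) lens)
       (lam (\<lambda>k. let p = bin (\<lambda>n k. prod_encode (n, k)) (pfst l) k in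
          psnd (F (psnd l \<bullet> orc locj p lens)) \<bullet> orc lock p lens)))"

lemma lmem_lsing [simp]: "lmem (lsing x) = {x}"
  by (auto simp: lmem_def lsing_def beta[OF cont_const])

lemma cont_lsing [cont_intros]: "cont F \<Longrightarrow> cont (\<lambda>x. lsing (F x))"
  unfolding lsing_def by (intro cont_intros)

lemma typed_lsing [typed_intros]: "typed r x \<Longrightarrow> typed (RL r) (\<lambda>i. lsing (x i))"
  unfolding lsing_def by (intro typed_intros cont_intros)

lemma cont_lbind [cont_intros]:
  assumes "cont L" "\<And>y. cont (\<lambda>x. F x y)" "\<And>x. cont (F x)"
  shows "cont (\<lambda>x. lbind (L x) (F x))"
proof -
  have 1: "cont (\<lambda>x. F x (G x))" if "cont G" for G
  proof -
    have "cont (\<lambda>x. lam (F x) \<bullet> G x)" by (intro cont_intros assms that)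
    then show ?thesis by (simp add: beta[OF assms(3)])
  qed
  show ?thesis unfolding lbind_def Let_def by (intro cont_intros 1 assms)
qed

text \<open>The partial sums of the lengths increase, so the least \<open>j\<close> whose block ends
  beyond a position is the block containing it; the offset remains after subtracting the earlier
  blocks.\<close>

lemma sum_le_locj:
  fixes g :: "nat \<Rightarrow> nat"
  assumes "j < n" "k < g j"
  shows "locj (prod_encode (n, (\<Sum>i<j. g i) + k)) g = j"
    and "lock (prod_encode (n, (\<Sum>i<j. g i) + k)) g = k"
    and "(\<Sum>i<j. g i) + k < lensum n g"
proof -
  let ?k = "(\<Sum>i<j. g i) + k"
  have less: "?k < (\<Sum>i\<le>j. g i)"
    using assms(2) by (simp add: lessThan_Suc_atMost[symmetric])
  have "\<not> ?k < (\<Sum>i\<le>j'. g i)" if "j' < j" for j'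
  proof -
    have "(\<Sum>i\<le>j'. g i) \<le> (\<Sum>i<j. g i)" using that by (intro sum_mono2) auto
    then show ?thesis by simp
  qed
  then have "(LEAST j. j < n \<and> ?k < (\<Sum>i\<le>j. g i)) = j"
    using less assms(1) by (intro Least_equality) (auto simp: not_less[symmetric])
  then show 1: "locj (prod_encode (n, ?k)) g = j"
    using less assms(1) by (auto simp: locj_def)
  show "lock (prod_encode (n, ?k)) g = k" unfolding lock_def 1 by simp
  have "(\<Sum>i\<le>j. g i) \<le> lensum n g"
    unfolding lensum_def using assms(1) by (intro sum_mono2) auto
  then show "?k < lensum n g" using less by simp
qed

text \<open>The bound is uniform in the lengths: the index stays within the number \<open>n\<close>
  of blocks, a component of the pair coded by \<open>p\<close>, and so does the default 0.\<close>

lemma bddO_locj: "bddO locj"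
  unfolding bddO_def
proof (intro allI exI impI)
  fix q p :: nat and b h :: "nat \<Rightarrow> nat" assume p: "p \<le> q"
  obtain n k where nk: "prod_decode p = (n, k)" by fastforce
  have "n \<le> p" using nk le_prod_encode_1[of n k] by (metis prod_decode_inverse)
  moreover have "locj p h \<le> n"
  proof (cases "\<exists>j<n. k < (\<Sum>i\<le>j. h i)")
    case True
    then have "(LEAST j. j < n \<and> k < (\<Sum>i\<le>j. h i)) < n" by (rule LeastI2_ex) auto
    then show ?thesis by (simp add: locj_def nk)
  next
    case False
    then show ?thesis unfolding locj_def nk prod.case by (simp only: if_False)
  qed
  ultimately show "locj p h \<le> q" using p by simp
qed

lemma bddO_lock: "bddO lock"
  unfolding bddO_def
proof (intro allI exI impI)
  fix q p :: nat and b h :: "nat \<Rightarrow> nat" assume p: "p \<le> q"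
  obtain n k where nk: "prod_decode p = (n, k)" by fastforce
  have "k \<le> p" using nk le_prod_encode_2[of k n] by (metis prod_decode_inverse)
  then show "lock p h \<le> q" using p by (simp add: lock_def nk)
qed

lemma bddO_lensum: "bddO lensum"
  by (rule bddO_finite[of _ "\<lambda>_. sum_list" "\<lambda>n. n"])
     (simp add: lensum_def interv_sum_list_conv_sum_set_nat atLeast0LessThan)

lemma typed_lbind [typed_intros]:
  assumes "typed (RL r) l" "\<And>i. cont (F i)" "\<And>x. typed r x \<Longrightarrow> typed (RL s) (\<lambda>i. F i (x i))"
  shows "typed (RL s) (\<lambda>i. lbind (l i) (F i))"
proof -
  have 1: "cont (\<lambda>x. F i (G x))" if "cont G" for G i
  proof -
    have "cont (\<lambda>x. lam (F i) \<bullet> G x)" by (intro cont_intros assms that)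
    then show ?thesis by (simp add: beta[OF assms(2)])
  qed
  have l: "typed RN (\<lambda>i. pfst (l i))" "typed (RF RN r) (\<lambda>i. psnd (l i))"
    using assms(1) by (rule typed_intros)+
  have fst: "typed RN (\<lambda>i. pfst (F i (x i)))" and snd: "typed (RF RN s) (\<lambda>i. psnd (F i (x i)))"
    if "typed r x" for x using assms(3)[OF that] by (rule typed_intros)+
  have lens: "typed (RF RN RN) (\<lambda>i. lam (\<lambda>j. pfst (F i (psnd (l i) \<bullet> j))))"
    by (rule typed_lam) (intro cont_intros 1, rule fst, rule typed_app[OF l(2)])
  show ?thesis unfolding lbind_def Let_def
    apply (rule typed_pair, rule typed_orc[OF l(1) lens bddO_lensum], rule typed_lam, intro cont_intros 1)
    apply (rule typed_app, rule snd, rule typed_app[OF l(2)])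
     apply (rule typed_orc[OF typed_bin[OF l(1)] lens bddO_locj], assumption)
    apply (rule typed_orc[OF typed_bin[OF l(1)] lens bddO_lock], assumption)
    done
qed

lemma lmem_lbind:
  assumes l: "elt (RL r) l" and F: "cont F" "\<And>x. elt r x \<Longrightarrow> elt (RL s) (F x)"
    and x: "x \<in> lmem l" and z: "z \<in> lmem (F x)"
  shows "z \<in> lmem (lbind l F)"
proof -
  have cF: "cont (\<lambda>x. F (G x))" if "cont G" for G
  proof -
    have "cont (\<lambda>x. lam F \<bullet> G x)" by (intro cont_intros assms that)
    then show ?thesis by (simp add: beta[OF F(1)])
  qed
  obtain n j where n: "pfst l = num n" "j < n" "x = psnd l \<bullet> num j"
    using x by (auto simp: lmem_def)
  obtain m k where m: "pfst (F x) = num m" "k < m" "z = psnd (F x) \<bullet> num k"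
    using z by (auto simp: lmem_def)
  have "\<forall>j. \<exists>m. pfst (F (psnd l \<bullet> num j)) = num m"
  proof
    fix j
    have "elt r (psnd l \<bullet> num j)" using l by simp
    from F(2)[OF this] show "\<exists>m. pfst (F (psnd l \<bullet> num j)) = num m" by simp
  qed
  then obtain g where g: "\<And>j. pfst (F (psnd l \<bullet> num j)) = num (g j)" by metis
  have t: "tot (lam (\<lambda>j. pfst (F (psnd l \<bullet> j)))) g"
    unfolding tot_def by (subst beta) (intro cont_intros cF, simp add: g)
  have kg: "k < g j" using g[of j] m n by simp
  let ?k = "(\<Sum>i<j. g i) + k"
  note locs = sum_le_locj[of j n k g, OF n(2) kg]
  have 1: "pfst (lbind l F) = num (lensum n g)"
    unfolding lbind_def Let_def by (simp add: n orc_tot[OF t])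
  have 2: "psnd (lbind l F) \<bullet> num ?k = z"
    unfolding lbind_def Let_def psnd_pair
    by (subst beta) (intro cont_intros cF,
      simp add: n m orc_tot[OF t] locs)
  show ?thesis unfolding lmem_def using 1 2 locs(3) by force
qed

lemma lmem_elt: "per (RL r) l l' \<Longrightarrow> x \<in> lmem l \<Longrightarrow> \<exists>x'\<in>lmem l'. per r x x'"
proof -
  assume l: "per (RL r) l l'" and "x \<in> lmem l"
  then obtain j n where x: "x = psnd l \<bullet> num j" "pfst l = num n" "j < n"
    unfolding lmem_def by blast
  have "per r x (psnd l' \<bullet> num j)" "pfst l' = num n" using l x by auto
  with x(3) show ?thesis unfolding lmem_def by blast
qed

section \<open>Environments, games and the operations on them\<close>

type_synonym env = "var \<Rightarrow> U"

primrec emb :: "ty \<Rightarrow> rty" where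
  "emb N = RN"
| "emb (\<sigma> \<rightarrow> \<tau>) = RF (emb \<sigma>) (emb \<tau>)"

definition envP :: "env \<Rightarrow> env \<Rightarrow> bool" where
  "envP a a' \<longleftrightarrow> (\<forall>v. per (emb (snd v)) (a v) (a' v))"

abbreviation envok :: "env \<Rightarrow> bool" where "envok a \<equiv> envP a a"

lemma envP_upd: "envP a a' \<Longrightarrow> per (emb (snd v)) d d' \<Longrightarrow> envP (a(v := d)) (a'(v := d'))"
  unfolding envP_def by (metis fun_upd_apply)

text \<open>A game is a formula \<open>\<forall>x \<exists>y R\<close> with \<open>R\<close> internal. Responses can be merged (\<open>joins\<close>), as in the
  Diller--Nahm variant, because \<open>R\<close> cannot be decided uniformly in the environment.\<close>

datatype game = Game (gX: rty) (gY: rty) (gR: "env \<Rightarrow> U \<Rightarrow> U \<Rightarrow> bool")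

definition ext :: "game \<Rightarrow> bool" where
  "ext G \<longleftrightarrow> (\<forall>a a' x x' y y'. envP a a' \<longrightarrow> per (gX G) x x' \<longrightarrow> per (gY G) y y' \<longrightarrow>
     gR G a x y \<longrightarrow> gR G a' x' y')"

definition joins :: "game \<Rightarrow> U \<Rightarrow> bool" where
  "joins G J \<longleftrightarrow> good (RF (RL (gY G)) (gY G)) J \<and>
     (\<forall>a x l y. envok a \<longrightarrow> elt (gX G) x \<longrightarrow> elt (RL (gY G)) l \<longrightarrow> y \<in> lmem l \<longrightarrow>
       gR G a x y \<longrightarrow> gR G a x (J \<bullet> l))"

definition game_ok :: "game \<Rightarrow> bool" where "game_ok G \<longleftrightarrow> ext G \<and> (\<exists>J. joins G J)"

text \<open>The strategy \<open>t\<close> sees the challenge but not the environment. Whatever a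
  response depends on has to reach it through the challenge.\<close>

definition valid :: "game \<Rightarrow> bool" where
  "valid G \<longleftrightarrow> (\<exists>t. good (RF (gX G) (gY G)) t \<and>
     (\<forall>a x. envok a \<longrightarrow> elt (gX G) x \<longrightarrow> gR G a x (t \<bullet> x)))"

text \<open>The negation of \<open>\<forall>x \<exists>y R\<close> is
  \<open>\<exists>x \<forall>y \<not> R\<close>. A challenge to it is a function \<open>f\<close>
  claiming to answer every \<open>x\<close>; the response lists finitely many \<open>x\<close>, one
  of which refutes \<open>f\<close>.\<close>

definition gneg :: "game \<Rightarrow> game" where
  "gneg G = Game (RF (gX G) (gY G)) (RL (gX G)) (\<lambda>a f l. \<exists>x\<in>lmem l. \<not> gR G a x (f \<bullet> x))"

definition gor :: "game \<Rightarrow> game \<Rightarrow> game" where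
  "gor G H = Game (RP (gX G) (gX H)) (RP (gY G) (gY H))
     (\<lambda>a x y. gR G a (pfst x) (pfst y) \<or> gR H a (psnd x) (psnd y))"

text \<open>One response has to serve all \<open>d\<close> at once: internal quantifiers carry no
  computational content. They range over all elements, good or not.\<close>

definition gall :: "var \<Rightarrow> game \<Rightarrow> game" where
  "gall v G = Game (gX G) (gY G) (\<lambda>a x y. \<forall>d. elt (emb (snd v)) d \<longrightarrow> gR G (a(v := d)) x y)"

definition gatom :: "(env \<Rightarrow> bool) \<Rightarrow> game" where
  "gatom Q = Game RN RN (\<lambda>a _ _. Q a)"

text \<open>To vouch that an object is standard, a finite list of candidates is offered among which
  it occurs. The challenge is a dummy.\<close>

definition gst :: "ty \<Rightarrow> (env \<Rightarrow> U) \<Rightarrow> game" where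
  "gst \<sigma> v = Game RN (RL (emb \<sigma>)) (\<lambda>a _ l. \<exists>x\<in>lmem l. per (emb \<sigma>) x (v a))"

lemma game_sel [simp]:
  "gX (gneg G) = RF (gX G) (gY G)" "gY (gneg G) = RL (gX G)"
  "gR (gneg G) a f l \<longleftrightarrow> (\<exists>x\<in>lmem l. \<not> gR G a x (f \<bullet> x))"
  "gX (gor G H) = RP (gX G) (gX H)" "gY (gor G H) = RP (gY G) (gY H)"
  "gR (gor G H) a x y \<longleftrightarrow> gR G a (pfst x) (pfst y) \<or> gR H a (psnd x) (psnd y)"
  "gX (gall v G) = gX G" "gY (gall v G) = gY G"
  "gR (gall v G) a x y \<longleftrightarrow> (\<forall>d. elt (emb (snd v)) d \<longrightarrow> gR G (a(v := d)) x y)"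
  "gX (gatom Q) = RN" "gY (gatom Q) = RN" "gR (gatom Q) a x y \<longleftrightarrow> Q a"
  "gX (gst \<sigma> t) = RN" "gY (gst \<sigma> t) = RL (emb \<sigma>)"
  "gR (gst \<sigma> t) a x l \<longleftrightarrow> (\<exists>x\<in>lmem l. per (emb \<sigma>) x (t a))"
  by (simp_all add: gneg_def gor_def gall_def gatom_def gst_def)

lemma extD: "ext G \<Longrightarrow> envP a a' \<Longrightarrow> per (gX G) x x' \<Longrightarrow> per (gY G) y y' \<Longrightarrow>
     gR G a x y \<Longrightarrow> gR G a' x' y'"
  unfolding ext_def by blast

lemma envP_sym: "envP a a' \<Longrightarrow> envP a' a"
  unfolding envP_def using per_sym by blast

lemma game_ok_extD: "game_ok G \<Longrightarrow> envP a a' \<Longrightarrow> per (gX G) x x' \<Longrightarrow> per (gY G) y y' \<Longrightarrow>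
     gR G a x y \<Longrightarrow> gR G a' x' y'"
  unfolding game_ok_def using extD by blast

text \<open>Where longer lists can only help, concatenation merges responses. Negations and
  standardness are of this kind.\<close>

lemma lmem_mono_joins:
  assumes ext: "ext G" and Y: "gY G = RL r"
    and mono: "\<And>a x l l'. lmem l \<subseteq> lmem l' \<Longrightarrow> gR G a x l \<Longrightarrow> gR G a x l'"
  shows "game_ok G"
proof -
  have "joins G (lam (\<lambda>ll. lbind ll (\<lambda>l. l)))"
    unfolding joins_def Y
  proof (intro conjI allI impI)
    show "good (RF (RL (RL r)) (RL r)) (lam (\<lambda>ll. lbind ll (\<lambda>l. l)))"
      by (intro typed_intros cont_intros) assumption+
    fix a x l y assume "elt (RL (RL r)) l" "y \<in> lmem l" "gR G a x y"
    then have "lmem y \<subseteq> lmem (lbind l (\<lambda>l. l))"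
      using lmem_lbind[of "RL r" l "\<lambda>l. l" r y] cont_id by blast
    then have "gR G a x (lbind l (\<lambda>l. l))" using \<open>gR G a x y\<close> by (rule mono)
    moreover have "lam (\<lambda>ll. lbind ll (\<lambda>l. l)) \<bullet> l = lbind l (\<lambda>l. l)"
      by (subst beta) (intro cont_intros, simp)
    ultimately show "gR G a x (lam (\<lambda>ll. lbind ll (\<lambda>l. l)) \<bullet> l)" by simp
  qed
  with ext show ?thesis unfolding game_ok_def by blast
qed

lemma game_ok_gst:
  assumes "\<And>a a'. envP a a' \<Longrightarrow> per (emb \<sigma>) (v a) (v a')"
  shows "game_ok (gst \<sigma> v)"
proof (rule lmem_mono_joins)
  show "ext (gst \<sigma> v)" unfolding ext_def
  proof (intro allI impI, simp only: game_sel)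
    fix a a' y y' assume e: "envP a a'" and y: "per (RL (emb \<sigma>)) y y'"
      and "\<exists>x\<in>lmem y. per (emb \<sigma>) x (v a)"
    then obtain x where x: "x \<in> lmem y" "per (emb \<sigma>) x (v a)" by blast
    obtain x' where x': "x' \<in> lmem y'" "per (emb \<sigma>) x x'" using lmem_elt[OF y x(1)] by blast
    have "per (emb \<sigma>) x' (v a')"
      using per_trans[OF per_sym[OF x'(2)] per_trans[OF x(2) assms[OF e]]] .
    with x' show "\<exists>x\<in>lmem y'. per (emb \<sigma>) x (v a')" by blast
  qed
qed auto

lemma game_ok_gneg:
  assumes "game_ok G"
  shows "game_ok (gneg G)"
proof (rule lmem_mono_joins)
  show "ext (gneg G)" unfolding ext_def
  proof (intro allI impI, simp only: game_sel)
    fix a a' f f' y y' assume e: "envP a a'" and f: "per (RF (gX G) (gY G)) f f'"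
      and y: "per (RL (gX G)) y y'" and "\<exists>x\<in>lmem y. \<not> gR G a x (f \<bullet> x)"
    then obtain x where x: "x \<in> lmem y" "\<not> gR G a x (f \<bullet> x)" by blast
    obtain x' where x': "x' \<in> lmem y'" "per (gX G) x x'" using lmem_elt[OF y x(1)] by blast
    have "\<not> gR G a' x' (f' \<bullet> x')"
      using game_ok_extD[OF assms envP_sym[OF e] per_sym[OF x'(2)] per_sym[OF per_app[OF f x'(2)]]] x(2)
      by blast
    with x' show "\<exists>x\<in>lmem y'. \<not> gR G a' x (f' \<bullet> x)" by blast
  qed
qed auto

lemma joins_atom: "joins (gatom Q) (lam (\<lambda>_. num 0))"
  unfolding joins_def by (auto intro!: typed_intros cont_intros)

lemma game_ok_gatom: "(\<And>a a'. envP a a' \<Longrightarrow> Q a \<Longrightarrow> Q a') \<Longrightarrow> game_ok (gatom Q)"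
  unfolding game_ok_def ext_def using joins_atom by auto

lemma game_ok_gall:
  assumes "game_ok G"
  shows "game_ok (gall v G)"
proof -
  from assms obtain J where J: "ext G" "joins G J" unfolding game_ok_def by blast
  have "ext (gall v G)" unfolding ext_def
  proof (intro allI impI, simp only: game_sel, intro allI impI)
    fix a a' x x' y y' d
    assume "envP a a'" "per (gX G) x x'" "per (gY G) y y'" "elt (emb (snd v)) d"
      and "\<forall>d. elt (emb (snd v)) d \<longrightarrow> gR G (a(v := d)) x y"
    then show "gR G (a'(v := d)) x' y'"
      using extD[OF J(1) envP_upd] by blast
  qed
  moreover have "joins (gall v G) J"
    using J(2) envP_upd unfolding joins_def game_sel by blast
  ultimately show ?thesis unfolding game_ok_def by blast
qed

definition lmap :: "(U \<Rightarrow> U) \<Rightarrow> U \<Rightarrow> U" where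
  "lmap f l = pair (pfst l) (lam (\<lambda>j. f (psnd l \<bullet> j)))"

lemma cont_comp: "cont f \<Longrightarrow> cont g \<Longrightarrow> cont (\<lambda>x. f (g x))"
  using cont_app[OF cont_const, of g "lam f"] by (simp add: beta)

lemma cont_comp2:
  assumes "\<And>y. cont (\<lambda>x. f x y)" "\<And>x. cont (f x)" "cont g"
  shows "cont (\<lambda>x. f x (g x))"
  using cont_app[OF cont_lam[of f, OF assms(1)] assms(3)] by (simp add: beta[OF assms(2)])

lemma cont_lmap [cont_intros]:
  assumes "\<And>y. cont (\<lambda>x. f x y)" "\<And>x. cont (f x)" "cont L"
  shows "cont (\<lambda>x. lmap (f x) (L x))"
  unfolding lmap_def by (intro cont_intros cont_comp2[OF assms(1,2)] assms(3))

lemma typed_lmap [typed_intros]: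
  assumes "\<And>i. cont (f i)" "\<And>x. typed r x \<Longrightarrow> typed s (\<lambda>i. f i (x i))" "typed (RL r) l"
  shows "typed (RL s) (\<lambda>i. lmap (f i) (l i))"
  unfolding lmap_def
  by (rule typed_pair, rule typed_pfst[OF assms(3)], rule typed_lam, rule cont_comp[OF assms(1)], intro cont_intros,
      rule assms(2), rule typed_app[OF typed_psnd[OF assms(3)]])

lemma lmem_lmap: "cont f \<Longrightarrow> lmem (lmap f l) = f ` lmem l"
proof -
  assume f: "cont f"
  have "lam (\<lambda>j. f (psnd l \<bullet> j)) \<bullet> x = f (psnd l \<bullet> x)" for x
    by (subst beta) (rule cont_comp[OF f], intro cont_intros, simp)
  then show ?thesis by (auto simp: lmap_def lmem_def)
qed

lemma elt_lmap:
  assumes "cont f" "\<And>x y. per r x y \<Longrightarrow> per s (f x) (f y)" "elt (RL r) l"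
  shows "elt (RL s) (lmap f l)"
proof -
  have "lam (\<lambda>j. f (psnd l \<bullet> j)) \<bullet> x = f (psnd l \<bullet> x)" for x
    by (subst beta) (rule cont_comp[OF assms(1)], intro cont_intros, simp)
  then show ?thesis using assms(2,3) by (simp add: lmap_def)
qed

text \<open>Responses are merged in each component separately. The disjunct won by some response in
  the list is then also won by the merged response.\<close>

lemma game_ok_gor:
  assumes "game_ok G" "game_ok H"
  shows "game_ok (gor G H)"
proof -
  from assms obtain J K where G: "ext G" "joins G J" and H: "ext H" "joins H K"
    unfolding game_ok_def by blast
  have "ext (gor G H)" unfolding ext_def
    using extD[OF G(1)] extD[OF H(1)] by (simp; blast)
  moreover have "joins (gor G H) (lam (\<lambda>l. pair (J \<bullet> lmap pfst l) (K \<bullet> lmap psnd l)))"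
    unfolding joins_def game_sel
  proof (intro conjI allI impI)
    have J: "good (RF (RL (gY G)) (gY G)) J" "good (RF (RL (gY H)) (gY H)) K"
      using G(2) H(2) by (auto simp: joins_def)
    show "good (RF (RL (RP (gY G) (gY H))) (RP (gY G) (gY H)))
       (lam (\<lambda>l. pair (J \<bullet> lmap pfst l) (K \<bullet> lmap psnd l)))"
    proof (rule typed_lam, intro cont_intros, rule typed_pair)
      fix x assume x: "typed (RL (RP (gY G) (gY H))) x"
      show "typed (gY G) (\<lambda>i. J \<bullet> lmap pfst (x i))" "typed (gY H) (\<lambda>i. K \<bullet> lmap psnd (x i))"
        by (rule typed_app[OF J(1)], rule typed_lmap[OF _ _ x], intro cont_intros, erule typed_pfst)
           (rule typed_app[OF J(2)], rule typed_lmap[OF _ _ x], intro cont_intros, erule typed_psnd)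
    qed
    fix a x l y
    assume a: "envok a" and x: "elt (RP (gX G) (gX H)) x" and l: "elt (RL (RP (gY G) (gY H))) l"
      and y: "y \<in> lmem l" and R: "gR G a (pfst x) (pfst y) \<or> gR H a (psnd x) (psnd y)"
    have 1: "lam (\<lambda>l. pair (J \<bullet> lmap pfst l) (K \<bullet> lmap psnd l)) \<bullet> l =
        pair (J \<bullet> lmap pfst l) (K \<bullet> lmap psnd l)"
      by (subst beta) (intro cont_intros, simp)
    have m: "pfst y \<in> lmem (lmap pfst l)" "psnd y \<in> lmem (lmap psnd l)"
      using y by (simp_all add: lmem_lmap cont_pfst cont_psnd cont_id)
    have e: "elt (RL (gY G)) (lmap pfst l)" "elt (RL (gY H)) (lmap psnd l)"
      by (rule elt_lmap[OF _ _ l]; (intro cont_intros)?; simp)+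
    have xx: "elt (gX G) (pfst x)" "elt (gX H) (psnd x)" using x by simp_all
    have "gR G a (pfst x) (pfst y) \<Longrightarrow> gR G a (pfst x) (J \<bullet> lmap pfst l)"
      using G(2) a xx(1) e(1) m(1) unfolding joins_def by blast
    moreover have "gR H a (psnd x) (psnd y) \<Longrightarrow> gR H a (psnd x) (K \<bullet> lmap psnd l)"
      using H(2) a xx(2) e(2) m(2) unfolding joins_def by blast
    ultimately
    show "gR G a (pfst x) (pfst (lam (\<lambda>l. pair (J \<bullet> lmap pfst l) (K \<bullet> lmap psnd l)) \<bullet> l)) \<or>
          gR H a (psnd x) (psnd (lam (\<lambda>l. pair (J \<bullet> lmap pfst l) (K \<bullet> lmap psnd l)) \<bullet> l))"
      using R unfolding 1 pfst_pair psnd_pair by blast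
  qed
  ultimately show ?thesis unfolding game_ok_def by blast
qed

section \<open>Classical logic for games\<close>

text \<open>A translation of strategies: \<open>\<alpha>\<close> carries challenges backwards and
  \<open>\<beta>\<close> carries responses forwards. Since \<open>\<beta>\<close> does not see the
  challenge this is narrower than implication, but it covers the structural rules.\<close>

definition maps :: "game \<Rightarrow> game \<Rightarrow> bool" where
  "maps G H \<longleftrightarrow> (\<exists>\<alpha> \<beta>. cont \<alpha> \<and> cont \<beta> \<and>
     (\<forall>x. typed (gX H) x \<longrightarrow> typed (gX G) (\<lambda>i. \<alpha> (x i))) \<and>
     (\<forall>y. typed (gY G) y \<longrightarrow> typed (gY H) (\<lambda>i. \<beta> (y i))) \<and>
     (\<forall>a x y. envok a \<longrightarrow> elt (gX H) x \<longrightarrow> elt (gY G) y \<longrightarrow>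
        gR G a (\<alpha> x) y \<longrightarrow> gR H a x (\<beta> y)))"

lemma mapsI:
  assumes "cont \<alpha>" "cont \<beta>" "\<And>x. typed (gX H) x \<Longrightarrow> typed (gX G) (\<lambda>i. \<alpha> (x i))"
    "\<And>y. typed (gY G) y \<Longrightarrow> typed (gY H) (\<lambda>i. \<beta> (y i))"
    "\<And>a x y. envok a \<Longrightarrow> elt (gX H) x \<Longrightarrow> elt (gY G) y \<Longrightarrow> gR G a (\<alpha> x) y \<Longrightarrow> gR H a x (\<beta> y)"
  shows "maps G H"
  unfolding maps_def using assms by blast

lemma typed_per:
  assumes "\<And>x. typed r x \<Longrightarrow> typed s (\<lambda>i. F (x i))" "per r x y"
  shows "per s (F x) (F y)"
proof -
  have "typed r (\<lambda>i. if i = 0 then x else if i = 1 then y else dfl r)"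
    using typed_dfl[of r] assms(2) by (simp add: typed_def)
  from assms(1)[OF this] show ?thesis by (simp add: typed_def)
qed

lemma validI:
  assumes "cont t" "\<And>x. typed (gX G) x \<Longrightarrow> typed (gY G) (\<lambda>i. t (x i))"
    "\<And>a x. envok a \<Longrightarrow> elt (gX G) x \<Longrightarrow> gR G a x (t x)"
  shows "valid G"
  unfolding valid_def
proof (intro exI conjI allI impI)
  show "good (RF (gX G) (gY G)) (lam t)" by (rule typed_lam) (use assms in auto)
qed (use assms in \<open>simp add: beta\<close>)

lemma validE:
  assumes "valid G"
  obtains t where "good (RF (gX G) (gY G)) t"
    "\<And>x y. per (gX G) x y \<Longrightarrow> per (gY G) (t \<bullet> x) (t \<bullet> y)"
    "\<And>a x. envok a \<Longrightarrow> elt (gX G) x \<Longrightarrow> gR G a x (t \<bullet> x)"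
  using assms good_dom unfolding valid_def by (metis per_app)

lemma valid_maps:
  assumes "maps G H" "valid G"
  shows "valid H"
proof -
  from assms(1) obtain \<alpha> \<beta> where m: "cont \<alpha>" "cont \<beta>"
    "\<And>x. typed (gX H) x \<Longrightarrow> typed (gX G) (\<lambda>i. \<alpha> (x i))"
    "\<And>y. typed (gY G) y \<Longrightarrow> typed (gY H) (\<lambda>i. \<beta> (y i))"
    "\<And>a x y. envok a \<Longrightarrow> elt (gX H) x \<Longrightarrow> elt (gY G) y \<Longrightarrow> gR G a (\<alpha> x) y \<Longrightarrow> gR H a x (\<beta> y)"
    unfolding maps_def by blast
  from assms(2) obtain t where t: "good (RF (gX G) (gY G)) t"
    "\<And>x y. per (gX G) x y \<Longrightarrow> per (gY G) (t \<bullet> x) (t \<bullet> y)"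
    "\<And>a x. envok a \<Longrightarrow> elt (gX G) x \<Longrightarrow> gR G a x (t \<bullet> x)" by (rule validE) blast
  show ?thesis
  proof (rule validI[of "\<lambda>x. \<beta> (t \<bullet> \<alpha> x)"])
    show "cont (\<lambda>x. \<beta> (t \<bullet> \<alpha> x))" by (rule cont_comp[OF m(2)], rule cont_app[OF cont_const m(1)])
    show "typed (gY H) (\<lambda>i. \<beta> (t \<bullet> \<alpha> (x i)))" if "typed (gX H) x" for x
      by (rule m(4)[OF typed_app[OF t(1) m(3)[OF that]]])
    fix a x assume a: "envok a" and x: "elt (gX H) x"
    have "elt (gX G) (\<alpha> x)" using typed_per[OF m(3) x] .
    then show "gR H a x (\<beta> (t \<bullet> \<alpha> x))" using m(5) t(2,3) a x by blast
  qed
qed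

lemma maps_refl: "maps G G"
  by (rule mapsI[of "\<lambda>x. x" "\<lambda>x. x"]) (auto intro: cont_id)

lemma maps_trans:
  assumes "maps G H" "maps H K"
  shows "maps G K"
proof -
  from assms(1) obtain \<alpha> \<beta> where m: "cont \<alpha>" "cont \<beta>"
    "\<And>x. typed (gX H) x \<Longrightarrow> typed (gX G) (\<lambda>i. \<alpha> (x i))"
    "\<And>y. typed (gY G) y \<Longrightarrow> typed (gY H) (\<lambda>i. \<beta> (y i))"
    "\<And>a x y. envok a \<Longrightarrow> elt (gX H) x \<Longrightarrow> elt (gY G) y \<Longrightarrow> gR G a (\<alpha> x) y \<Longrightarrow> gR H a x (\<beta> y)"
    unfolding maps_def by blast
  from assms(2) obtain \<alpha>' \<beta>' where m': "cont \<alpha>'" "cont \<beta>'"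
    "\<And>x. typed (gX K) x \<Longrightarrow> typed (gX H) (\<lambda>i. \<alpha>' (x i))"
    "\<And>y. typed (gY H) y \<Longrightarrow> typed (gY K) (\<lambda>i. \<beta>' (y i))"
    "\<And>a x y. envok a \<Longrightarrow> elt (gX K) x \<Longrightarrow> elt (gY H) y \<Longrightarrow> gR H a (\<alpha>' x) y \<Longrightarrow> gR K a x (\<beta>' y)"
    unfolding maps_def by blast
  show ?thesis
  proof (rule mapsI[of "\<lambda>x. \<alpha> (\<alpha>' x)" "\<lambda>x. \<beta>' (\<beta> x)"])
    fix a x y assume a: "envok a" "elt (gX K) x" "elt (gY G) y" "gR G a (\<alpha> (\<alpha>' x)) y"
    have "elt (gX H) (\<alpha>' x)" using typed_per[OF m'(3) a(2)] .
    moreover have "elt (gY H) (\<beta> y)" using typed_per[OF m(4) a(3)] .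
    ultimately show "gR K a x (\<beta>' (\<beta> y))" using m(5) m'(5) a by blast
  qed (use m m' cont_comp in blast)+
qed

lemma maps_cong:
  assumes "maps G H"
  shows "maps (gor A G) (gor A H)"
proof -
  from assms(1) obtain \<alpha> \<beta> where m: "cont \<alpha>" "cont \<beta>"
    "\<And>x. typed (gX H) x \<Longrightarrow> typed (gX G) (\<lambda>i. \<alpha> (x i))"
    "\<And>y. typed (gY G) y \<Longrightarrow> typed (gY H) (\<lambda>i. \<beta> (y i))"
    "\<And>a x y. envok a \<Longrightarrow> elt (gX H) x \<Longrightarrow> elt (gY G) y \<Longrightarrow> gR G a (\<alpha> x) y \<Longrightarrow> gR H a x (\<beta> y)"
    unfolding maps_def by blast
  show ?thesis
  proof (rule mapsI[of "\<lambda>x. pair (pfst x) (\<alpha> (psnd x))" "\<lambda>x. pair (pfst x) (\<beta> (psnd x))"],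
      simp_all only: game_sel pfst_pair psnd_pair)
    show "cont (\<lambda>x. pair (pfst x) (\<alpha> (psnd x)))" "cont (\<lambda>x. pair (pfst x) (\<beta> (psnd x)))"
      by (intro cont_pair cont_intros cont_comp[OF m(1)], intro cont_pair cont_intros cont_comp[OF m(2)])
    show "typed (RP (gX A) (gX G)) (\<lambda>i. pair (pfst (x i)) (\<alpha> (psnd (x i))))"
      if "typed (RP (gX A) (gX H)) x" for x
      by (rule typed_pair[OF typed_pfst[OF that] m(3)[OF typed_psnd[OF that]]])
    show "typed (RP (gY A) (gY H)) (\<lambda>i. pair (pfst (x i)) (\<beta> (psnd (x i))))"
      if "typed (RP (gY A) (gY G)) x" for x
      by (rule typed_pair[OF typed_pfst[OF that] m(4)[OF typed_psnd[OF that]]])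
  qed (use m(5) in auto)
qed

lemma maps_exch: "maps (gor A (gor B C)) (gor B (gor A C))"
  by (rule mapsI[of "\<lambda>x. pair (pfst (psnd x)) (pair (pfst x) (psnd (psnd x)))"
        "\<lambda>x. pair (pfst (psnd x)) (pair (pfst x) (psnd (psnd x)))"], simp_all only: game_sel pfst_pair psnd_pair)
     ((rule cont_intros)+, (assumption | rule typed_pair typed_pfst typed_psnd)+, auto)

lemma maps_assoc: "maps (gor A (gor B C)) (gor (gor A B) C)"
  by (rule mapsI[of "\<lambda>x. pair (pfst (pfst x)) (pair (psnd (pfst x)) (psnd x))"
        "\<lambda>x. pair (pair (pfst x) (pfst (psnd x))) (psnd (psnd x))"], simp_all only: game_sel pfst_pair psnd_pair)
     ((rule cont_intros)+, (assumption | rule typed_pair typed_pfst typed_psnd)+, auto)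

lemma maps_assoc': "maps (gor (gor A B) C) (gor A (gor B C))"
  by (rule mapsI[of "\<lambda>x. pair (pair (pfst x) (pfst (psnd x))) (psnd (psnd x))"
        "\<lambda>x. pair (pfst (pfst x)) (pair (psnd (pfst x)) (psnd x))"], simp_all only: game_sel pfst_pair psnd_pair)
     ((rule cont_intros)+, (assumption | rule typed_pair typed_pfst typed_psnd)+, auto)

lemma maps_comm: "maps (gor A B) (gor B A)"
  by (rule mapsI[of "\<lambda>x. pair (psnd x) (pfst x)" "\<lambda>x. pair (psnd x) (pfst x)"], simp_all only: game_sel pfst_pair psnd_pair)
     ((rule cont_intros)+, (assumption | rule typed_pair typed_pfst typed_psnd)+, auto)

lemma maps_weak: "maps A (gor B A)"
  by (rule mapsI[of "\<lambda>x. psnd x" "\<lambda>x. pair (dfl (gY B)) x"], simp_all only: game_sel pfst_pair psnd_pair)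
     ((rule cont_intros)+, (assumption | rule typed_pair typed_pfst typed_psnd typed_dfl)+, auto)

text \<open>Contraction is the structural rule that calls for merging: two responses to the same
  challenge are put into a list of length 2 and joined, as it cannot be decided which of them is
  right.\<close>

lemma maps_contr:
  assumes "game_ok A"
  shows "maps (gor A A) A"
proof -
  obtain J where J: "joins A J" using assms unfolding game_ok_def by blast
  define two where "two y = pair (num 2) (lam (\<lambda>j. cd j (pfst y) (psnd y)))" for y
  have lam_two: "lam (\<lambda>j. cd j (pfst y) (psnd y)) \<bullet> num j = cd (num j) (pfst y) (psnd y)" for y j
    by (rule beta, intro cont_intros)
  have mem: "pfst y \<in> lmem (two y)" "psnd y \<in> lmem (two y)" for y
    unfolding lmem_def two_def pfst_pair psnd_pair
    by (rule CollectI, rule exI[of _ 0], rule exI[of _ 2], simp add: lam_two)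
       (rule CollectI, rule exI[of _ 1], rule exI[of _ 2], simp add: lam_two cd_Suc[of 0, simplified])
  have cont: "cont two" unfolding two_def by (intro cont_intros)
  have typed: "typed (RL r) (\<lambda>i. two (y i))" if "typed (RP r r) y" for y r
    unfolding two_def
    by (rule typed_pair[OF typed_num], rule typed_lam, (rule cont_intros)+,
        rule typed_cd[OF _ typed_pfst[OF that] typed_psnd[OF that]])
  show ?thesis
  proof (rule mapsI[of "\<lambda>x. pair x x" "\<lambda>y. J \<bullet> two y"], simp_all only: game_sel pfst_pair psnd_pair)
    show "cont (\<lambda>y. J \<bullet> two y)" by (rule cont_app[OF cont_const cont])
    show "typed (gY A) (\<lambda>i. J \<bullet> two (y i))" if "typed (RP (gY A) (gY A)) y" for y
      using J typed[OF that] typed_app unfolding joins_def by blast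
    fix a x y assume a: "envok a" "elt (gX A) x" "elt (RP (gY A) (gY A)) y"
      and R: "gR A a x (pfst y) \<or> gR A a x (psnd y)"
    have "elt (RL (gY A)) (two y)" using typed_per[OF typed a(3)] .
    then show "gR A a x (J \<bullet> two y)" using R J a(1,2) mem unfolding joins_def by blast
  qed (intro cont_intros typed_pair; assumption)+
qed

section \<open>One-sided sequents of games\<close>

primrec dsj :: "game list \<Rightarrow> game" where
  "dsj [] = gatom (\<lambda>_. False)"
| "dsj (A # \<Gamma>) = gor A (dsj \<Gamma>)"

lemma game_ok_dsj: "(\<And>A. A \<in> set \<Gamma> \<Longrightarrow> game_ok A) \<Longrightarrow> game_ok (dsj \<Gamma>)"
  by (induction \<Gamma>) (auto intro: game_ok_gor game_ok_gatom)

lemma maps_absorb: "game_ok A \<Longrightarrow> A \<in> set \<Gamma> \<Longrightarrow> maps (gor A (dsj \<Gamma>)) (dsj \<Gamma>)"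
proof (induction \<Gamma>)
  case (Cons C \<Gamma>)
  show ?case
  proof (cases "A \<in> set \<Gamma>")
    case True
    then show ?thesis using Cons maps_trans[OF maps_exch maps_cong] by simp
  next
    case False
    then have "C = A" using Cons by auto
    moreover have "maps (gor (gor A A) (dsj \<Gamma>)) (gor A (dsj \<Gamma>))"
      using maps_trans[OF maps_comm maps_trans[OF maps_cong[OF maps_contr[OF Cons.prems(1)]] maps_comm]] .
    ultimately show ?thesis using maps_trans[OF maps_assoc] by simp
  qed
qed simp

text \<open>Weakening, exchange and contraction in one statement.\<close>

lemma maps_subset:
  "(\<And>A. A \<in> set \<Delta> \<Longrightarrow> game_ok A) \<Longrightarrow> set \<Gamma> \<subseteq> set \<Delta> \<Longrightarrow> maps (dsj \<Gamma>) (dsj \<Delta>)"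
proof (induction \<Gamma>)
  case Nil
  then show ?case
  proof (induction \<Delta>)
    case (Cons A \<Delta>)
    then have "maps (dsj []) (dsj \<Delta>)" by simp
    then show ?case using maps_trans[OF _ maps_weak] by simp
  qed (auto intro: maps_refl)
next
  case (Cons A \<Gamma>)
  then have "maps (dsj \<Gamma>) (dsj \<Delta>)" by simp
  from maps_trans[OF maps_cong[OF this] maps_absorb] Cons.prems show ?case by simp
qed

definition sequent :: "game list \<Rightarrow> bool" where "sequent \<Gamma> \<longleftrightarrow> valid (dsj \<Gamma>)"

lemma sequent_subset:
  "sequent \<Gamma> \<Longrightarrow> set \<Gamma> \<subseteq> set \<Delta> \<Longrightarrow> (\<And>A. A \<in> set \<Delta> \<Longrightarrow> game_ok A) \<Longrightarrow> sequent \<Delta>"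
  unfolding sequent_def using maps_subset valid_maps by blast

lemma sequent_single: "sequent [A] \<longleftrightarrow> valid A"
proof
  assume "sequent [A]"
  moreover have "maps (gor A (dsj [])) A"
    by (rule mapsI[of "\<lambda>x. pair x (num 0)" pfst], simp_all only: game_sel dsj.simps pfst_pair psnd_pair)
       ((rule cont_intros)+, (assumption | rule typed_pair typed_pfst typed_num)+, auto)
  ultimately show "valid A" unfolding sequent_def using valid_maps by simp
next
  assume "valid A"
  then show "sequent [A]" unfolding sequent_def
    using valid_maps[OF maps_trans[OF maps_weak maps_comm]] by simp
qed

lemma sequent_two: "sequent [A, B] \<longleftrightarrow> valid (gor A B)"
proof -
  have "valid (gor A (gor B (dsj []))) \<longleftrightarrow> sequent [gor A B]"
    unfolding sequent_def using valid_maps[OF maps_assoc] valid_maps[OF maps_assoc'] by auto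
  then show ?thesis unfolding sequent_single by (simp add: sequent_def)
qed

lemma sequent_or: "sequent (A # B # \<Gamma>) \<Longrightarrow> sequent (gor A B # \<Gamma>)"
  unfolding sequent_def using valid_maps[OF maps_assoc] by simp

lemma sequent_or': "sequent (gor A B # \<Gamma>) \<Longrightarrow> sequent (A # B # \<Gamma>)"
  unfolding sequent_def using valid_maps[OF maps_assoc'] by simp

text \<open>Given a supposed strategy \<open>f\<close> for \<open>A\<close> and a challenge
  \<open>x\<close> for \<open>A'\<close>, reply with the value of \<open>f\<close> at
  \<open>x\<close> and offer \<open>x\<close> as the only refutation of \<open>f\<close>. Letting
  \<open>A'\<close> differ from \<open>A\<close> in its relation makes the lemma cover the
  instantiation of quantifiers as well.\<close>

lemma v_em:
  assumes "gX A = gX A'" "gY A = gY A'"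
    "\<And>a x y. envok a \<Longrightarrow> elt (gX A) x \<Longrightarrow> elt (gY A) y \<Longrightarrow> gR A a x y \<Longrightarrow> gR A' a x y"
  shows "valid (gor (gneg A) A')"
proof (rule validI[of "\<lambda>p. pair (lsing (psnd p)) (pfst p \<bullet> psnd p)"],
    simp_all only: game_sel pfst_pair psnd_pair lmem_lsing)
  show "typed (RP (RL (gX A)) (gY A')) (\<lambda>i. pair (lsing (psnd (x i))) (pfst (x i) \<bullet> psnd (x i)))"
    if "typed (RP (RF (gX A) (gY A)) (gX A')) x" for x
    using typed_pfst[OF that] typed_psnd[OF that] unfolding assms
    by (intro typed_pair typed_lsing typed_app)
qed (use assms in \<open>auto intro!: cont_intros\<close>)

text \<open>For a fixed challenge \<open>b\<close> to \<open>G\<close> the first strategy yields a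
  function \<open>F b\<close> that plays \<open>A\<close>. Against it the second strategy either
  wins \<open>C\<close> or refutes \<open>F b\<close> at one of finitely many \<open>z\<close>. At a
  refuting \<open>z\<close> the first strategy must have won \<open>G\<close> by
  \<open>H b z\<close>; as it is not known which \<open>z\<close> refutes, all these responses are
  merged.\<close>

lemma v_cut:
  assumes "game_ok A" "game_ok G" and "valid (gor A G)" and "valid (gor (gneg A) C)"
  shows "valid (gor G C)"
proof -
  obtain J where J: "joins G J" using assms(2) unfolding game_ok_def by blast
  then have gJ: "good (RF (RL (gY G)) (gY G)) J" unfolding joins_def by blast
  obtain t where t: "good (RF (RP (gX A) (gX G)) (RP (gY A) (gY G))) t"
    "\<And>x y. per (RP (gX A) (gX G)) x y \<Longrightarrow> per (RP (gY A) (gY G)) (t \<bullet> x) (t \<bullet> y)"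
    "\<And>a x. envok a \<Longrightarrow> elt (RP (gX A) (gX G)) x \<Longrightarrow>
       gR A a (pfst x) (pfst (t \<bullet> x)) \<or> gR G a (psnd x) (psnd (t \<bullet> x))"
    by (rule validE[OF assms(3), unfolded game_sel]) (rule that)
  obtain s where s: "good (RF (RP (RF (gX A) (gY A)) (gX C)) (RP (RL (gX A)) (gY C))) s"
    "\<And>x y. per (RP (RF (gX A) (gY A)) (gX C)) x y \<Longrightarrow> per (RP (RL (gX A)) (gY C)) (s \<bullet> x) (s \<bullet> y)"
    "\<And>a x. envok a \<Longrightarrow> elt (RP (RF (gX A) (gY A)) (gX C)) x \<Longrightarrow>
       (\<exists>z\<in>lmem (pfst (s \<bullet> x)). \<not> gR A a z (pfst x \<bullet> z)) \<or> gR C a (psnd x) (psnd (s \<bullet> x))"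
    by (rule validE[OF assms(4), unfolded game_sel]) (rule that)
  define F where "F b x = pfst (t \<bullet> pair x b)" for b x
  define H where "H b x = psnd (t \<bullet> pair x b)" for b x
  define q where "q p = s \<bullet> pair (lam (F (pfst p))) (psnd p)" for p
  have cF: "cont (F b)" "cont (\<lambda>b. F b x)" "cont (H b)" "cont (\<lambda>b. H b x)" for b x
    unfolding F_def H_def by (intro cont_intros)+
  have cq: "cont q" unfolding q_def
    by (intro cont_intros, rule cont_comp[OF cF(2)], intro cont_intros)
  have TF: "typed (gY A) (\<lambda>i. F (b i) (x i))" and TH: "typed (gY G) (\<lambda>i. H (b i) (x i))"
    if "typed (gX A) x" "typed (gX G) b" for x b
    using typed_app[OF t(1) typed_pair[OF that]] typed_pfst typed_psnd unfolding F_def H_def by blast+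
  have Tq: "typed (RP (RL (gX A)) (gY C)) (\<lambda>i. q (p i))" if p: "typed (RP (gX G) (gX C)) p" for p
    unfolding q_def
    by (rule typed_app[OF s(1)], rule typed_pair[OF _ typed_psnd[OF p]], rule typed_lam[OF cF(1)],
        erule TF[OF _ typed_pfst[OF p]])
  have TL: "typed (RL (gY G)) (\<lambda>i. lmap (H (pfst (p i))) (pfst (q (p i))))"
    if p: "typed (RP (gX G) (gX C)) p" for p
    by (rule typed_lmap[OF cF(3) _ typed_pfst[OF Tq[OF p]]], erule TH[OF _ typed_pfst[OF p]])
  show ?thesis
  proof (rule validI[of "\<lambda>p. pair (J \<bullet> lmap (H (pfst p)) (pfst (q p))) (psnd (q p))"],
      simp_all only: game_sel pfst_pair psnd_pair)
    show "cont (\<lambda>p. pair (J \<bullet> lmap (H (pfst p)) (pfst (q p))) (psnd (q p)))"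
      by (intro cont_pair cont_app cont_const cont_lmap cont_pfst cont_psnd cq cF(3))
         (rule cont_comp[OF cF(4)], intro cont_intros)
    show "typed (RP (gY G) (gY C)) (\<lambda>i. pair (J \<bullet> lmap (H (pfst (p i))) (pfst (q (p i)))) (psnd (q (p i))))"
      if "typed (RP (gX G) (gX C)) p" for p
      by (rule typed_pair[OF typed_app[OF gJ TL[OF that]] typed_psnd[OF Tq[OF that]]])
    fix a p assume a: "envok a" and p: "elt (RP (gX G) (gX C)) p"
    let ?b = "pfst p"
    have eb: "elt (gX G) ?b" "elt (gX C) (psnd p)" using p by auto
    have eL: "elt (RL (gY G)) (lmap (H ?b) (pfst (q p)))" using typed_per[OF TL p] .
    have eq: "elt (RL (gX A)) (pfst (q p))" 
    proof -
      have "elt (RP (RL (gX A)) (gY C)) (q p)"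
        by (rule typed_per[where F = q, OF _ p]) (rule Tq)
      then show ?thesis by (simp only: per.simps(3))
    qed
    have eF: "elt (RF (gX A) (gY A)) (lam (F ?b))"
      unfolding per.simps beta[OF cF(1)]
      using t(2)[of "pair _ _" "pair _ _"] eb(1) by (auto simp: F_def)
    from s(3)[OF a, of "pair (lam (F ?b)) (psnd p)"] eF eb(2)
    have "(\<exists>z\<in>lmem (pfst (q p)). \<not> gR A a z (F ?b z)) \<or> gR C a (psnd p) (psnd (q p))"
      by (simp add: q_def beta[OF cF(1)])
    then show "gR G a ?b (J \<bullet> lmap (H ?b) (pfst (q p))) \<or> gR C a (psnd p) (psnd (q p))"
    proof
      assume "\<exists>z\<in>lmem (pfst (q p)). \<not> gR A a z (F ?b z)"
      then obtain z where z: "z \<in> lmem (pfst (q p))" "\<not> gR A a z (F ?b z)" by blast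
      have "elt (gX A) z" using lmem_elt[OF eq z(1)] per_dom1 by blast
      then have "gR G a ?b (H ?b z)"
        using t(3)[OF a, of "pair z ?b"] eb z(2) by (simp add: F_def H_def)
      moreover have "H ?b z \<in> lmem (lmap (H ?b) (pfst (q p)))"
        using z(1) by (simp add: lmem_lmap[OF cF(3)])
      ultimately show ?thesis using J eL eb(1) a unfolding joins_def by blast
    qed simp
  qed
qed

lemma sequent_cut:
  assumes "sequent (A # \<Gamma>)" "sequent (gneg A # \<Gamma>)" "game_ok A" "\<And>G. G \<in> set \<Gamma> \<Longrightarrow> game_ok G"
  shows "sequent \<Gamma>"
proof -
  have "valid (gor (dsj \<Gamma>) (dsj \<Gamma>))"
    using v_cut[OF assms(3) game_ok_dsj[OF assms(4)]] assms(1,2) unfolding sequent_def by simp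
  then show ?thesis unfolding sequent_def using valid_maps[OF maps_contr[OF game_ok_dsj[OF assms(4)]]] by blast
qed

lemma sequent_ax:
  assumes "\<And>G. G \<in> set \<Gamma> \<Longrightarrow> game_ok G" "A \<in> set \<Gamma>" "gneg A \<in> set \<Gamma>"
  shows "sequent \<Gamma>"
proof -
  have "sequent [gneg A, A]" unfolding sequent_two by (rule v_em) auto
  then show ?thesis by (rule sequent_subset) (use assms in auto)
qed

lemma sequent_negneg:
  assumes "sequent (A # \<Gamma>)" "game_ok A" "\<And>G. G \<in> set \<Gamma> \<Longrightarrow> game_ok G"
  shows "sequent (gneg (gneg A) # \<Gamma>)"
proof (rule sequent_cut[of A])
  show "sequent (A # gneg (gneg A) # \<Gamma>)"
    by (rule sequent_subset[OF assms(1)]) (auto intro: assms game_ok_gneg)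
  show "sequent (gneg A # gneg (gneg A) # \<Gamma>)"
    by (rule sequent_ax[of _ "gneg A"]) (auto intro: assms game_ok_gneg)
qed (auto intro: assms game_ok_gneg)

lemma sequent_negor:
  assumes "sequent (gneg A # \<Gamma>)" "sequent (gneg B # \<Gamma>)" "game_ok A" "game_ok B" "\<And>G. G \<in> set \<Gamma> \<Longrightarrow> game_ok G"
  shows "sequent (gneg (gor A B) # \<Gamma>)"
proof -
  note ok = assms(3-5) game_ok_gneg game_ok_gor
  have "sequent (gor A B # gneg (gor A B) # \<Gamma>)"
    by (rule sequent_ax[of _ "gor A B"]) (auto intro: ok)
  then have "sequent (A # B # gneg (gor A B) # \<Gamma>)" by (rule sequent_or')
  moreover have "sequent (gneg A # B # gneg (gor A B) # \<Gamma>)"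
    by (rule sequent_subset[OF assms(1)]) (auto intro: ok)
  ultimately have "sequent (B # gneg (gor A B) # \<Gamma>)" by (rule sequent_cut) (auto intro: ok)
  moreover have "sequent (gneg B # gneg (gor A B) # \<Gamma>)"
    by (rule sequent_subset[OF assms(2)]) (auto intro: ok)
  ultimately show ?thesis by (rule sequent_cut) (auto intro: ok)
qed

lemma sequent_rot: "sequent (\<Gamma> @ [A]) \<Longrightarrow> (\<And>G. G \<in> set \<Gamma> \<Longrightarrow> game_ok G) \<Longrightarrow> game_ok A \<Longrightarrow> sequent (A # \<Gamma>)"
  by (erule sequent_subset) auto

text \<open>The strategy for the premise is kept. If it loses \<open>\<Gamma>\<close> at
  \<open>a\<close>, then by the second assumption it loses \<open>\<Gamma>\<close> at every
  \<open>a(v := d)\<close>, hence wins \<open>A\<close> for all \<open>d\<close> with one and the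
  same response.\<close>

lemma sequent_all:
  assumes "sequent (A # \<Gamma>)"
    and "\<And>a d x y. envok a \<Longrightarrow> elt (emb (snd v)) d \<Longrightarrow> gR (dsj \<Gamma>) (a(v := d)) x y \<Longrightarrow> gR (dsj \<Gamma>) a x y"
  shows "sequent (gall v A # \<Gamma>)"
proof -
  from assms(1) obtain t where t: "good (RF (gX (dsj (A # \<Gamma>))) (gY (dsj (A # \<Gamma>)))) t"
     "\<And>a x. envok a \<Longrightarrow> elt (gX (dsj (A # \<Gamma>))) x \<Longrightarrow> gR (dsj (A # \<Gamma>)) a x (t \<bullet> x)"
    unfolding sequent_def valid_def by blast
  have "gR (gall v A) a (pfst x) (pfst (t \<bullet> x)) \<or> gR (dsj \<Gamma>) a (psnd x) (psnd (t \<bullet> x))"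
    if a: "envok a" and x: "elt (gX (dsj (A # \<Gamma>))) x" for a x
  proof (cases "gR (dsj \<Gamma>) a (psnd x) (psnd (t \<bullet> x))")
    case False
    have "gR A (a(v := d)) (pfst x) (pfst (t \<bullet> x))" if d: "elt (emb (snd v)) d" for d
      using t(2)[OF envP_upd[OF a d] x] assms(2)[OF a d] False by auto
    then show ?thesis by simp
  qed simp
  with t(1) show ?thesis unfolding sequent_def valid_def by auto
qed

section \<open>Interpretation of formulas as games\<close>

definition gand :: "game \<Rightarrow> game \<Rightarrow> game" where
  "gand A B = gneg (gor (gneg A) (gneg B))"

definition gimp :: "game \<Rightarrow> game \<Rightarrow> game" where
  "gimp A B = gor (gneg A) B"

definition gex :: "var \<Rightarrow> game \<Rightarrow> game" where
  "gex v A = gneg (gall v (gneg A))"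

definition gbot :: game where "gbot = gatom (\<lambda>_. False)"

lemma game_ok_derived:
  "game_ok A \<Longrightarrow> game_ok B \<Longrightarrow> game_ok (gand A B)" "game_ok A \<Longrightarrow> game_ok B \<Longrightarrow> game_ok (gimp A B)"
  "game_ok A \<Longrightarrow> game_ok (gex v A)" "game_ok gbot"
  unfolding gand_def gimp_def gex_def gbot_def
  by (auto intro: game_ok_gneg game_ok_gor game_ok_gall game_ok_gatom)

lemmas game_ok_intros = game_ok_gneg game_ok_gor game_ok_gall game_ok_derived

lemma sequent_botI: "\<forall>G\<in>set \<Gamma>. game_ok G \<Longrightarrow> sequent (gneg gbot # \<Gamma>)"
proof -
  assume ok: "\<forall>G\<in>set \<Gamma>. game_ok G"
  have "valid (gneg gbot)" unfolding gbot_def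
    by (rule validI[of "\<lambda>_. lsing (num 0)"], simp_all only: game_sel)
       (auto intro: cont_const typed_lsing typed_num)
  then have "sequent [gneg gbot]" by (simp add: sequent_single)
  then show ?thesis by (rule sequent_subset) (use ok in \<open>auto intro: game_ok_intros\<close>)
qed

lemma sequent_axh:
  assumes "\<forall>G\<in>set \<Gamma>. game_ok G" "game_ok A"
  shows "gneg A \<in> set \<Gamma> \<Longrightarrow> sequent (A # \<Gamma>)" "A \<in> set \<Gamma> \<Longrightarrow> sequent (gneg A # \<Gamma>)"
  by (rule sequent_ax[of _ A]; use assms in \<open>auto intro: game_ok_gneg\<close>)+

lemmas sequent_rules = sequent_or sequent_negneg sequent_negor

text \<open>Backward proof search instead of explicit strategies: the rules decompose the first
  formula of the sequent, a formula that cannot be decomposed is rotated to the end, and the search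
  stops when a formula meets its negation or falsity is negated.\<close>

lemma taut:
  assumes ok: "game_ok A" "game_ok B" "game_ok C"
  shows "valid (gimp A (gimp B A))"
    and "valid (gimp (gimp A (gimp B C)) (gimp (gimp A B) (gimp A C)))"
    and "valid (gimp (gand A B) A)"
    and "valid (gimp (gand A B) B)"
    and "valid (gimp A (gimp B (gand A B)))"
    and "valid (gimp A (gor A B))"
    and "valid (gimp B (gor A B))"
    and "valid (gimp (gimp A C) (gimp (gimp B C) (gimp (gor A B) C)))"
    and "valid (gimp gbot A)"
    and "valid (gimp (gimp (gimp A gbot) gbot) A)"
  unfolding gimp_def gand_def sequent_single[symmetric]
  by ((rule sequent_axh sequent_botI; use ok in \<open>auto intro: game_ok_intros; fail\<close>) |
      rule sequent_rules sequent_rot | (simp only: append.simps) | (use ok in \<open>auto intro: game_ok_intros; fail\<close>))+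

lemma valid_mp:
  assumes "valid (gimp A B)" "valid A" "game_ok A" "game_ok B"
  shows "valid B"
proof -
  have "sequent [gneg A, B]" using assms(1) by (simp add: sequent_two gimp_def)
  moreover have "sequent [A, B]" by (rule sequent_subset[of "[A]"]) (use assms in \<open>auto simp: sequent_single\<close>)
  ultimately have "sequent [B]" using assms(3,4) by (intro sequent_cut[of A "[B]"]) auto
  then show ?thesis by (simp add: sequent_single)
qed

section \<open>Functionals denoted by the constants\<close>

definition phiO :: "(nat \<Rightarrow> nat \<Rightarrow> nat) \<Rightarrow> nat \<Rightarrow> (nat \<Rightarrow> nat) \<Rightarrow> nat" where
  "phiO f n g = rec_nat (g 0) (\<lambda>k r. f (g (Suc k)) r) n"

definition mubO :: "nat \<Rightarrow> (nat \<Rightarrow> nat) \<Rightarrow> nat" where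
  "mubO n g = (if \<exists>k\<le>n. g k = 0 then LEAST k. g k = 0 else 0)"

definition tri :: "nat \<Rightarrow> nat \<Rightarrow> nat \<Rightarrow> nat" where
  "tri c i j = prod_encode (c, prod_encode (i, j))"

text \<open>One function \<open>g\<close> packs the three arguments of the recursor: tag 0 holds the
  start value, tag 1 the bound at stage \<open>i\<close>, tag 2 the step at stage \<open>i\<close>
  applied to the previous value.\<close>

definition recO :: "nat \<Rightarrow> (nat \<Rightarrow> nat) \<Rightarrow> nat" where
  "recO n g = rec_nat (g (tri 0 0 0)) (\<lambda>i r. min (g (tri 2 i r)) (g (tri 1 i 0))) n"

lemma bddO_phiO: "bddO (phiO f)"
proof (rule bddO_finite[of _ "\<lambda>p xs. phiO f p (\<lambda>k. xs ! k)" Suc])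
  fix p h
  have "k \<le> p \<Longrightarrow> rec_nat (h 0) (\<lambda>k r. f (h (Suc k)) r) k =
     rec_nat (map h [0..<Suc p] ! 0) (\<lambda>k r. f (map h [0..<Suc p] ! Suc k) r) k" for k
    by (induction k) (simp_all del: upt_Suc)
  then show "phiO f p h = phiO f p (\<lambda>k. map h [0..<Suc p] ! k)" by (simp add: phiO_def)
qed

lemma mubO_le: "mubO n g \<le> n"
  unfolding mubO_def by (auto intro: Least_le order_trans)

lemma bddO_mubO: "bddO mubO"
  unfolding bddO_def
  by (intro allI exI impI) (rule order_trans[OF mubO_le])

text \<open>At a successor the minimum caps the result by the bound stored for that stage, whatever
  the step does. So the start value and the bounds up to \<open>q\<close> dominate every
  result.\<close>

lemma bddO_recO: "bddO recO"
  unfolding bddO_def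
proof (intro allI exI impI)
  fix q p :: nat and b h :: "nat \<Rightarrow> nat" assume p: "p \<le> q" and h: "\<forall>k. h k \<le> b k"
  let ?S = "insert (b (tri 0 0 0)) ((\<lambda>i. b (tri 1 i 0)) ` {..q})"
  show "recO p h \<le> Max ?S"
  proof (cases p)
    case 0
    have "b (tri 0 0 0) \<le> Max ?S" by (rule Max_ge) auto
    then show ?thesis using 0 h by (auto simp: recO_def intro: order_trans)
  next
    case (Suc i)
    have "b (tri 1 i 0) \<le> Max ?S" by (rule Max_ge) (use Suc p in auto)
    moreover have "recO p h \<le> h (tri 1 i 0)" using Suc by (simp add: recO_def)
    moreover have "h (tri 1 i 0) \<le> b (tri 1 i 0)" using h ..
    ultimately show ?thesis by linarith
  qed
qed

definition tri1 :: "nat \<Rightarrow> nat" where "tri1 k = fst (prod_decode k)"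
definition tri2 :: "nat \<Rightarrow> nat" where "tri2 k = fst (prod_decode (snd (prod_decode k)))"
definition tri3 :: "nat \<Rightarrow> nat" where "tri3 k = snd (prod_decode (snd (prod_decode k)))"

text \<open>Builds the packed function. The truncated decrement sends tag 1 to 0, so that the inner
  \<open>cd\<close> separates the bound from the step.\<close>

definition recH :: "U \<Rightarrow> U \<Rightarrow> U \<Rightarrow> U" where
  "recH y z v = lam (\<lambda>k. cd (un tri1 k) y
     (cd (un (\<lambda>k. tri1 k - 1) k) (v \<bullet> un tri2 k) (z \<bullet> un tri3 k \<bullet> un tri2 k)))"

text \<open>The recursion is predicative: its step receives only the number obtained after all
  arguments have been supplied. These arguments can therefore be pushed into \<open>y\<close>,
  \<open>z\<close> and \<open>v\<close>, which leaves a recursion on numbers.\<close>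

primrec recU :: "ty \<Rightarrow> U \<Rightarrow> U \<Rightarrow> U \<Rightarrow> U \<Rightarrow> U" where
  "recU N x y z v = orc recO x (recH y z v)"
| "recU (\<sigma> \<rightarrow> \<tau>) x y z v =
     lam (\<lambda>w. recU \<tau> x (y \<bullet> w) (lam (\<lambda>j. lam (\<lambda>i. z \<bullet> j \<bullet> i \<bullet> w))) (lam (\<lambda>i. v \<bullet> i \<bullet> w)))"

lemma tri_simps [simp]: "tri1 (tri c i j) = c" "tri2 (tri c i j) = i" "tri3 (tri c i j) = j"
  by (simp_all add: tri_def tri1_def tri2_def tri3_def)

lemma cont_recH [cont_intros]:
  "cont F \<Longrightarrow> cont G \<Longrightarrow> cont H \<Longrightarrow> cont (\<lambda>x. recH (F x) (G x) (H x))"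
  unfolding recH_def by (intro cont_intros)

lemma cont_recU [cont_intros]:
  "cont E \<Longrightarrow> cont F \<Longrightarrow> cont G \<Longrightarrow> cont H \<Longrightarrow> cont (\<lambda>x. recU \<rho> (E x) (F x) (G x) (H x))"
proof (induction \<rho> arbitrary: E F G H)
  case N
  then show ?case unfolding recU.simps by (intro cont_intros)
next
  case (Fun \<sigma> \<tau>)
  show ?case unfolding recU.simps by (intro cont_lam Fun.IH(2) cont_intros Fun.prems)
qed

lemma typed_recU:
  "typed RN x \<Longrightarrow> typed (emb \<rho>) y \<Longrightarrow> typed (RF RN (RF RN (emb \<rho>))) z \<Longrightarrow> typed (RF RN (emb \<rho>)) v \<Longrightarrow>
     typed (emb \<rho>) (\<lambda>i. recU \<rho> (x i) (y i) (z i) (v i))"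
proof (induction \<rho> arbitrary: x y z v)
  case N
  have "typed (RF RN RN) (\<lambda>i. recH (y i) (z i) (v i))" unfolding recH_def
    by (rule typed_lam, intro cont_intros)
       (assumption | rule typed_cd typed_un typed_app N[unfolded emb.simps])+
  then show ?case unfolding recU.simps emb.simps by (rule typed_orc[OF N(1) _ bddO_recO])
next
  case (Fun \<sigma> \<tau>)
  note pr = Fun.prems[unfolded emb.simps]
  show ?case unfolding recU.simps emb.simps
  proof (rule typed_lam, intro cont_intros, rule Fun.IH(2))
    fix w assume w: "typed (emb \<sigma>) w"
    show "typed RN x" by (rule pr)
    show "typed (emb \<tau>) (\<lambda>i. y i \<bullet> w i)" by (rule typed_app[OF pr(2) w])
    show "typed (RF RN (RF RN (emb \<tau>))) (\<lambda>k. lam (\<lambda>j. lam (\<lambda>i. z k \<bullet> j \<bullet> i \<bullet> w k)))"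
      by (rule typed_lam, intro cont_intros, rule typed_lam, intro cont_intros)
         (rule typed_app[OF typed_app[OF typed_app[OF pr(3)]] w]; assumption)
    show "typed (RF RN (emb \<tau>)) (\<lambda>k. lam (\<lambda>i. v k \<bullet> i \<bullet> w k))"
      by (rule typed_lam, intro cont_intros) (rule typed_app[OF typed_app[OF pr(4)] w])
  qed
qed

abbreviation lam2 :: "(U \<Rightarrow> U \<Rightarrow> U) \<Rightarrow> U" where "lam2 F \<equiv> lam (\<lambda>x. lam (F x))"

primrec cval :: "cnst \<Rightarrow> U" where
  "cval CZero = num 0"
| "cval CSuc = lam (un Suc)"
| "cval CMin = lam2 (bin min)"
| "cval CMax = lam2 (bin max)"
| "cval CA0 = lam2 (bin (\<lambda>_. Suc))"
| "cval CA1 = lam2 (bin (+))"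
| "cval CA2 = lam2 (bin (*))"
| "cval CA3 = lam2 (bin (^))"
| "cval CPhi1 = lam2 (\<lambda>f n. orc (phiO max) n f)"
| "cval CPhi2 = lam2 (\<lambda>f n. orc (phiO (+)) n f)"
| "cval CPhi3 = lam2 (\<lambda>f n. orc (phiO (*)) n f)"
| "cval CMub = lam2 (\<lambda>f n. orc mubO n (f \<bullet> n))"
| "cval (CPi \<rho> \<tau>) = lam2 (\<lambda>x y. x)"
| "cval (CSigma \<delta> \<rho> \<tau>) = lam (\<lambda>x. lam2 (\<lambda>y z. x \<bullet> z \<bullet> (y \<bullet> z)))"
| "cval (CRec \<rho>) = lam2 (\<lambda>x y. lam2 (recU \<rho> x y))"

lemma good_cval: "good (emb (cnst_ty c)) (cval c)"
  by (cases c) (simp_all only: cnst_ty.simps emb.simps cval.simps,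
    (assumption | rule typed_lam cont_intros bddO_phiO bddO_mubO typed_num typed_un typed_bin typed_orc typed_recU typed_app)+)

section \<open>Terms, truth and the game of a formula\<close>

primrec val :: "tm \<Rightarrow> env \<Rightarrow> U" where
  "val (Var x) a = a x"
| "val (Con c) a = cval c"
| "val (s \<cdot> t) a = val s a \<bullet> val t a"

lemma tm_ty_App: "tm_ty (s \<cdot> t) = Some \<tau> \<longleftrightarrow>
    (\<exists>\<sigma>. tm_ty s = Some (\<sigma> \<rightarrow> \<tau>) \<and> tm_ty t = Some \<sigma>)"
  by (auto split: option.splits ty.splits if_splits)

lemma val_per: "tm_ty t = Some \<sigma> \<Longrightarrow> envP a a' \<Longrightarrow> per (emb \<sigma>) (val t a) (val t a')"
proof (induction t arbitrary: \<sigma>)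
  case (App s t)
  then obtain \<rho> where "per (emb (\<rho> \<rightarrow> \<sigma>)) (val s a) (val s a')" "per (emb \<rho>) (val t a) (val t a')"
    unfolding tm_ty_App by blast
  then show ?case by simp
qed (auto simp: envP_def good_dom[OF good_cval])

lemma good_closed: "tm_ty t = Some \<sigma> \<Longrightarrow> fv_tm t = {} \<Longrightarrow> good (emb \<sigma>) (val t a)"
proof (induction t arbitrary: \<sigma>)
  case (App s t)
  then obtain \<rho> where "good (emb (\<rho> \<rightarrow> \<sigma>)) (val s a)" "good (emb \<rho>) (val t a)"
    unfolding tm_ty_App by auto
  then show ?case using typed_app by auto
qed (auto simp: good_cval)

lemma val_fv: "(\<And>v. v \<in> fv_tm t \<Longrightarrow> a v = a' v) \<Longrightarrow> val t a = val t a'"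
  by (induction t) auto

lemma val_subst: "val (subst_tm s x t) a = val s (a(x := val t a))"
  by (induction s) auto

definition le_U :: "U \<Rightarrow> U \<Rightarrow> bool" where
  "le_U x y \<longleftrightarrow> (\<exists>m n. x = num m \<and> y = num n \<and> m \<le> n)"

lemma le_U_num [simp]: "le_U (num m) (num n) \<longleftrightarrow> m \<le> n"
  by (auto simp: le_U_def)

text \<open>Only meant for internal formulas.\<close>

primrec sat :: "env \<Rightarrow> fm \<Rightarrow> bool" where
  "sat a Bot \<longleftrightarrow> False"
| "sat a (s \<^bold>= t) \<longleftrightarrow> val s a = val t a"
| "sat a (s \<^bold>\<le> t) \<longleftrightarrow> le_U (val s a) (val t a)"
| "sat a (St \<sigma> t) \<longleftrightarrow> True"
| "sat a (A \<^bold>\<and> C) \<longleftrightarrow> sat a A \<and> sat a C"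
| "sat a (A \<^bold>\<or> C) \<longleftrightarrow> sat a A \<or> sat a C"
| "sat a (A \<^bold>\<longrightarrow> C) \<longleftrightarrow> (sat a A \<longrightarrow> sat a C)"
| "sat a (All x A) \<longleftrightarrow> (\<forall>d. elt (emb (snd x)) d \<longrightarrow> sat (a(x := d)) A)"
| "sat a (Ex x A) \<longleftrightarrow> (\<exists>d. elt (emb (snd x)) d \<and> sat (a(x := d)) A)"
| "sat a (AllSt x A) \<longleftrightarrow> True"
| "sat a (ExSt x A) \<longleftrightarrow> True"

definition gs :: "var \<Rightarrow> game" where "gs x = gst (snd x) (\<lambda>a. a x)"

text \<open>\<open>AllSt\<close> and \<open>ExSt\<close> receive the games of the right-hand sides
  of (EQ), which turns those axioms into equivalences of a game with itself.\<close>

primrec interp :: "fm \<Rightarrow> game" where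
  "interp Bot = gbot"
| "interp (s \<^bold>= t) = gatom (\<lambda>a. val s a = val t a)"
| "interp (s \<^bold>\<le> t) = gatom (\<lambda>a. le_U (val s a) (val t a))"
| "interp (St \<sigma> t) = gst \<sigma> (val t)"
| "interp (A \<^bold>\<and> C) = gand (interp A) (interp C)"
| "interp (A \<^bold>\<or> C) = gor (interp A) (interp C)"
| "interp (A \<^bold>\<longrightarrow> C) = gimp (interp A) (interp C)"
| "interp (All x A) = gall x (interp A)"
| "interp (Ex x A) = gex x (interp A)"
| "interp (AllSt x A) = gall x (gimp (gs x) (interp A))"
| "interp (ExSt x A) = gex x (gand (gs x) (interp A))"

lemma val_N:
  assumes "tm_ty t = Some N" "envP a a'"
  obtains n where "val t a = num n" "val t a' = num n"
  using val_per[OF assms] by auto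

lemma game_ok_gs: "game_ok (gs x)"
  unfolding gs_def by (rule game_ok_gst) (simp only: envP_def)

lemma game_ok_interp: "wf A \<Longrightarrow> game_ok (interp A)"
proof (induction A)
  case (Eq s t)
  show ?case unfolding interp.simps
  proof (rule game_ok_gatom)
    fix a a' assume "envP a a'" "val s a = val t a"
    then show "val s a' = val t a'" using Eq by (metis val_N num_inject wf.simps(2))
  qed
next
  case (Le s t)
  show ?case unfolding interp.simps
  proof (rule game_ok_gatom)
    fix a a' assume "envP a a'" "le_U (val s a) (val t a)"
    then show "le_U (val s a') (val t a')" using Le by (metis val_N wf.simps(3))
  qed
next
  case (St \<sigma> t)
  then show ?case unfolding interp.simps by (intro game_ok_gst val_per) auto
qed (auto intro!: game_ok_intros game_ok_gs simp: gbot_def[symmetric])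

lemma interp_fv: "(\<And>v. v \<in> fv A \<Longrightarrow> a v = a' v) \<Longrightarrow> gR (interp A) a x y = gR (interp A) a' x y"
proof (induction A arbitrary: a a' x y)
  case (Eq s t)
  then have "val s a = val s a'" "val t a = val t a'" by (auto intro!: val_fv)
  then show ?case by simp
next
  case (Le s t)
  then have "val s a = val s a'" "val t a = val t a'" by (auto intro!: val_fv)
  then show ?case by simp
next
  case (St \<sigma> t)
  then have "val t a = val t a'" by (auto intro!: val_fv)
  then show ?case by simp
next
  case (And A C)
  have "gR (interp A) a x y = gR (interp A) a' x y" "gR (interp C) a x y = gR (interp C) a' x y" for x y
    by (rule And.IH; use And.prems in simp)+
  then show ?case by (simp add: gand_def)
next
  case (Or A C)
  have "gR (interp A) a x y = gR (interp A) a' x y" "gR (interp C) a x y = gR (interp C) a' x y" for x y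
    by (rule Or.IH; use Or.prems in simp)+
  then show ?case by simp
next
  case (Imp A C)
  have "gR (interp A) a x y = gR (interp A) a' x y" "gR (interp C) a x y = gR (interp C) a' x y" for x y
    by (rule Imp.IH; use Imp.prems in simp)+
  then show ?case by (simp add: gimp_def)
next
  case (All v A)
  have "gR (interp A) (a(v := d)) x y = gR (interp A) (a'(v := d)) x y" for x y d
    by (rule All.IH) (use All.prems in auto)
  then show ?case by simp
next
  case (Ex v A)
  have "gR (interp A) (a(v := d)) x y = gR (interp A) (a'(v := d)) x y" for x y d
    by (rule Ex.IH) (use Ex.prems in auto)
  then show ?case by (simp add: gex_def)
next
  case (AllSt v A)
  have "gR (interp A) (a(v := d)) x y = gR (interp A) (a'(v := d)) x y" for x y d
    by (rule AllSt.IH) (use AllSt.prems in auto)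
  then show ?case by (simp add: gimp_def gs_def)
next
  case (ExSt v A)
  have "gR (interp A) (a(v := d)) x y = gR (interp A) (a'(v := d)) x y" for x y d
    by (rule ExSt.IH) (use ExSt.prems in auto)
  then show ?case by (simp add: gex_def gand_def gs_def)
qed (simp add: gbot_def)

lemma subst_id: "x \<notin> fv A \<Longrightarrow> subst A x t = A"
proof -
  have tm: "x \<notin> fv_tm s \<Longrightarrow> subst_tm s x t = s" for s by (induction s) auto
  show "x \<notin> fv A \<Longrightarrow> subst A x t = A" by (induction A) (auto simp: tm)
qed

lemma interp_subst_ty: "gX (interp (subst A x t)) = gX (interp A)" "gY (interp (subst A x t)) = gY (interp A)"
  by (induction A) (auto simp: gand_def gimp_def gex_def)

lemma interp_subst:
  "free_for t x A \<Longrightarrow> gR (interp (subst A x t)) a p q = gR (interp A) (a(x := val t a)) p q"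
proof (induction A arbitrary: a p q)
  case (And A C)
  have "gR (interp (subst A x t)) a p q = gR (interp A) (a(x := val t a)) p q"
    "gR (interp (subst C x t)) a p q = gR (interp C) (a(x := val t a)) p q" for p q
    by (rule And.IH; use And.prems in simp)+
  then show ?case by (simp add: gand_def del: fun_upd_apply)
next
  case (Or A C)
  have "gR (interp (subst A x t)) a p q = gR (interp A) (a(x := val t a)) p q"
    "gR (interp (subst C x t)) a p q = gR (interp C) (a(x := val t a)) p q" for p q
    by (rule Or.IH; use Or.prems in simp)+
  then show ?case by (simp del: fun_upd_apply)
next
  case (Imp A C)
  have "gR (interp (subst A x t)) a p q = gR (interp A) (a(x := val t a)) p q"
    "gR (interp (subst C x t)) a p q = gR (interp C) (a(x := val t a)) p q" for p q
    by (rule Imp.IH; use Imp.prems in simp)+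
  then show ?case by (simp add: gimp_def del: fun_upd_apply)
next
  case (All v A)
  show ?case
  proof (cases "x \<in> fv (All v A)")
    case True
    then have v: "v \<noteq> x" "v \<notin> fv_tm t" "free_for t x A" using All.prems by auto
    have vt: "val t (a(v := d)) = val t a" for d
      using v(2) by (intro val_fv) auto
    have "gR (interp (subst A x t)) (a(v := d)) p q = gR (interp A) ((a(x := val t a))(v := d)) p q"
      for d p q
      unfolding All.IH[OF v(3)] vt by (subst fun_upd_twist[OF v(1)]) (rule refl)
    then show ?thesis using v(1) by (simp del: fun_upd_apply) (simp add: fun_upd_def)?
  next
    case False
    show ?thesis unfolding subst_id[OF False] by (rule interp_fv) (use False in auto)
  qed
next
  case (Ex v A)
  show ?case
  proof (cases "x \<in> fv (Ex v A)")
    case True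
    then have v: "v \<noteq> x" "v \<notin> fv_tm t" "free_for t x A" using Ex.prems by auto
    have vt: "val t (a(v := d)) = val t a" for d
      using v(2) by (intro val_fv) auto
    have "gR (interp (subst A x t)) (a(v := d)) p q = gR (interp A) ((a(x := val t a))(v := d)) p q"
      for d p q
      unfolding Ex.IH[OF v(3)] vt by (subst fun_upd_twist[OF v(1)]) (rule refl)
    then show ?thesis using v(1) by (simp add: gex_def del: fun_upd_apply) (simp add: fun_upd_def)?
  next
    case False
    show ?thesis unfolding subst_id[OF False] by (rule interp_fv) (use False in auto)
  qed
next
  case (AllSt v A)
  show ?case
  proof (cases "x \<in> fv (AllSt v A)")
    case True
    then have v: "v \<noteq> x" "v \<notin> fv_tm t" "free_for t x A" using AllSt.prems by auto
    have vt: "val t (a(v := d)) = val t a" for d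
      using v(2) by (intro val_fv) auto
    have "gR (interp (subst A x t)) (a(v := d)) p q = gR (interp A) ((a(x := val t a))(v := d)) p q"
      for d p q
      unfolding AllSt.IH[OF v(3)] vt by (subst fun_upd_twist[OF v(1)]) (rule refl)
    then show ?thesis using v(1) by (simp add: gimp_def gs_def del: fun_upd_apply) (simp add: fun_upd_def)?
  next
    case False
    show ?thesis unfolding subst_id[OF False] by (rule interp_fv) (use False in auto)
  qed
next
  case (ExSt v A)
  show ?case
  proof (cases "x \<in> fv (ExSt v A)")
    case True
    then have v: "v \<noteq> x" "v \<notin> fv_tm t" "free_for t x A" using ExSt.prems by auto
    have vt: "val t (a(v := d)) = val t a" for d
      using v(2) by (intro val_fv) auto
    have "gR (interp (subst A x t)) (a(v := d)) p q = gR (interp A) ((a(x := val t a))(v := d)) p q"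
      for d p q
      unfolding ExSt.IH[OF v(3)] vt by (subst fun_upd_twist[OF v(1)]) (rule refl)
    then show ?thesis using v(1) by (simp add: gex_def gand_def gs_def del: fun_upd_apply) (simp add: fun_upd_def)?
  next
    case False
    show ?thesis unfolding subst_id[OF False] by (rule interp_fv) (use False in auto)
  qed
qed (simp_all add: val_subst gbot_def)

section \<open>Adequacy: games of internal formulas against truth\<close>

definition adequate :: "game \<Rightarrow> (env \<Rightarrow> bool) \<Rightarrow> bool" where
  "adequate G Q \<longleftrightarrow> (\<exists>t. good (RF (gX G) (gY G)) t \<and>
      (\<forall>a x. envok a \<longrightarrow> elt (gX G) x \<longrightarrow> Q a \<longrightarrow> gR G a x (t \<bullet> x))) \<and>
    (\<exists>x. good (gX G) x \<and> (\<forall>a y. envok a \<longrightarrow> elt (gY G) y \<longrightarrow> gR G a x y \<longrightarrow> Q a))"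

lemma adequateI:
  assumes "cont t" "\<And>x. typed (gX G) x \<Longrightarrow> typed (gY G) (\<lambda>i. t (x i))" "good (gX G) z"
    "\<And>a x. envok a \<Longrightarrow> elt (gX G) x \<Longrightarrow> Q a \<Longrightarrow> gR G a x (t x)"
    "\<And>a y. envok a \<Longrightarrow> elt (gY G) y \<Longrightarrow> gR G a z y \<Longrightarrow> Q a"
  shows "adequate G Q"
proof -
  have "good (RF (gX G) (gY G)) (lam t)" by (rule typed_lam) (use assms in auto)
  moreover have "lam t \<bullet> x = t x" for x by (rule beta[OF assms(1)])
  ultimately show ?thesis unfolding adequate_def
    by (intro conjI exI[of _ "lam t"] exI[of _ z]) (use assms(3-5) in auto)
qed

lemma adequate_gatom: "adequate (gatom Q) Q"
  by (rule adequateI[of "\<lambda>_. num 0" _ "num 0"]) (auto intro: cont_const typed_num simp del: per.simps)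

text \<open>The two witnesses trade places: the test challenge for \<open>G\<close>, as a
  one-element list, answers the negation, and the winning strategy for \<open>G\<close> becomes the
  test challenge for the negation.\<close>

lemma adequate_gneg:
  assumes "adequate G Q"
  shows "adequate (gneg G) (\<lambda>a. \<not> Q a)"
proof -
  obtain t x where t: "good (RF (gX G) (gY G)) t"
    "\<And>a x. envok a \<Longrightarrow> elt (gX G) x \<Longrightarrow> Q a \<Longrightarrow> gR G a x (t \<bullet> x)"
    and x: "good (gX G) x" "\<And>a y. envok a \<Longrightarrow> elt (gY G) y \<Longrightarrow> gR G a x y \<Longrightarrow> Q a"
    using assms unfolding adequate_def by blast
  show ?thesis
  proof (rule adequateI[of "\<lambda>_. lsing x" _ t], simp_all only: game_sel lmem_lsing)
    fix a f assume "envok a" "elt (RF (gX G) (gY G)) f" "\<not> Q a"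
    moreover have "elt (gY G) (f \<bullet> x)"
      using per_app[OF \<open>elt (RF (gX G) (gY G)) f\<close> good_dom[OF x(1)]] .
    ultimately show "\<exists>z\<in>{x}. \<not> gR G a z (f \<bullet> z)" using x(2) by blast
  next
    fix a l assume a: "envok a" and l: "elt (RL (gX G)) l" and "\<exists>z\<in>lmem l. \<not> gR G a z (t \<bullet> z)"
    then obtain z where "z \<in> lmem l" "\<not> gR G a z (t \<bullet> z)" by blast
    moreover have "elt (gX G) z" using lmem_elt[OF l \<open>z \<in> lmem l\<close>] per_dom1 by blast
    ultimately show "\<not> Q a" using t(2) a by blast
  qed (use t x in \<open>auto intro: cont_const typed_lsing\<close>)
qed

lemma adequate_gor:
  assumes "adequate G Q" "adequate G' Q'"
  shows "adequate (gor G G') (\<lambda>a. Q a \<or> Q' a)"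
proof -
  obtain t x where t: "good (RF (gX G) (gY G)) t"
    "\<And>a x. envok a \<Longrightarrow> elt (gX G) x \<Longrightarrow> Q a \<Longrightarrow> gR G a x (t \<bullet> x)"
    and x: "good (gX G) x" "\<And>a y. envok a \<Longrightarrow> elt (gY G) y \<Longrightarrow> gR G a x y \<Longrightarrow> Q a"
    using assms(1) unfolding adequate_def by blast
  obtain t' x' where t': "good (RF (gX G') (gY G')) t'"
    "\<And>a x. envok a \<Longrightarrow> elt (gX G') x \<Longrightarrow> Q' a \<Longrightarrow> gR G' a x (t' \<bullet> x)"
    and x': "good (gX G') x'" "\<And>a y. envok a \<Longrightarrow> elt (gY G') y \<Longrightarrow> gR G' a x' y \<Longrightarrow> Q' a"
    using assms(2) unfolding adequate_def by blast
  show ?thesis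
  proof (rule adequateI[of "\<lambda>p. pair (t \<bullet> pfst p) (t' \<bullet> psnd p)" _ "pair x x'"],
      simp_all only: game_sel pfst_pair psnd_pair per.simps)
    show "cont (\<lambda>p. pair (t \<bullet> pfst p) (t' \<bullet> psnd p))" by (intro cont_intros)
    show "good (RP (gX G) (gX G')) (pair x x')" by (intro typed_pair x x')
    show "typed (RP (gY G) (gY G')) (\<lambda>i. pair (t \<bullet> pfst (p i)) (t' \<bullet> psnd (p i)))"
      if "typed (RP (gX G) (gX G')) p" for p
      by (rule typed_pair[OF typed_app[OF t(1) typed_pfst[OF that]] typed_app[OF t'(1) typed_psnd[OF that]]])
  qed (use t(2) t'(2) x(2) x'(2) in blast)+
qed

lemma adequate_gall:
  assumes "adequate G Q"
  shows "adequate (gall v G) (\<lambda>a. \<forall>d. elt (emb (snd v)) d \<longrightarrow> Q (a(v := d)))"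
  using assms envP_upd unfolding adequate_def game_sel by meson

lemma adequate_iff: "adequate G Q \<Longrightarrow> (\<And>a. Q a \<longleftrightarrow> Q' a) \<Longrightarrow> adequate G Q'"
  unfolding adequate_def by simp

text \<open>The game of an internal formula consists of dummy moves around its truth value: one good
  strategy wins whenever the formula is true, and one good challenge can be answered only if it is
  true. This allows strategies for the axioms to exchange truth and play.\<close>

lemma adequate_interp: "internal A \<Longrightarrow> adequate (interp A) (\<lambda>a. sat a A)"
proof (induction A)
  case (And A C)
  then show ?case unfolding interp.simps gand_def
    by (intro adequate_iff[OF adequate_gneg[OF adequate_gor[OF adequate_gneg adequate_gneg]]]) auto
next
  case (Or A C)
  then show ?case unfolding interp.simps sat.simps by (intro adequate_gor) auto
next
  case (Imp A C)
  then show ?case unfolding interp.simps gimp_def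
    by (intro adequate_iff[OF adequate_gor[OF adequate_gneg]]) auto
next
  case (All v A)
  then show ?case unfolding interp.simps sat.simps by (intro adequate_gall) auto
next
  case (Ex v A)
  then show ?case unfolding interp.simps gex_def
    by (intro adequate_iff[OF adequate_gneg[OF adequate_gall[OF adequate_gneg]]]) auto
qed (auto simp: gbot_def intro: adequate_gatom)

lemma adequate_true: "adequate G Q \<Longrightarrow> (\<And>a. envok a \<Longrightarrow> Q a) \<Longrightarrow> valid G"
  unfolding adequate_def valid_def by blast

lemma sat_fv: "(\<And>v. v \<in> fv A \<Longrightarrow> a v = a' v) \<Longrightarrow> sat a A = sat a' A"
proof (induction A arbitrary: a a')
  case (Eq s t)
  then have "val s a = val s a'" "val t a = val t a'" by (auto intro!: val_fv)
  then show ?case by simp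
next
  case (Le s t)
  then have "val s a = val s a'" "val t a = val t a'" by (auto intro!: val_fv)
  then show ?case by simp
next
  case (And A C)
  have "sat a A = sat a' A" "sat a C = sat a' C"
    by (rule And.IH; use And.prems in simp)+
  then show ?case by simp
next
  case (Or A C)
  have "sat a A = sat a' A" "sat a C = sat a' C"
    by (rule Or.IH; use Or.prems in simp)+
  then show ?case by simp
next
  case (Imp A C)
  have "sat a A = sat a' A" "sat a C = sat a' C"
    by (rule Imp.IH; use Imp.prems in simp)+
  then show ?case by simp
next
  case (All v A)
  have "sat (a(v := d)) A = sat (a'(v := d)) A" for d
    by (rule All.IH) (use All.prems in auto)
  then show ?case by simp
next
  case (Ex v A)
  have "sat (a(v := d)) A = sat (a'(v := d)) A" for d
    by (rule Ex.IH) (use Ex.prems in auto)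
  then show ?case by simp
qed simp_all

lemma sat_subst_qf: "quantifier_free A \<Longrightarrow> sat a (subst A x t) = sat (a(x := val t a)) A"
  by (induction A) (simp_all add: val_subst)

lemma sat_per: "internal A \<Longrightarrow> wf A \<Longrightarrow> envP a a' \<Longrightarrow> sat a A \<longleftrightarrow> sat a' A"
proof (induction A arbitrary: a a')
  case (Eq s t)
  then have "tm_ty s = Some N" "tm_ty t = Some N" by simp_all
  from this[THEN val_N, OF Eq.prems(3)] show ?case by (metis sat.simps(2))
next
  case (Le s t)
  then have "tm_ty s = Some N" "tm_ty t = Some N" by simp_all
  from this[THEN val_N, OF Le.prems(3)] show ?case by (metis sat.simps(3))
next
  case (All v A)
  have "sat (a(v := d)) A = sat (a'(v := d)) A" if "elt (emb (snd v)) d" for d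
    by (rule All.IH) (use All.prems in \<open>auto intro: envP_upd that simp del: fun_upd_apply\<close>)
  then show ?case by simp
next
  case (Ex v A)
  have "sat (a(v := d)) A = sat (a'(v := d)) A" if "elt (emb (snd v)) d" for d
    by (rule Ex.IH) (use Ex.prems in \<open>auto intro: envP_upd that simp del: fun_upd_apply\<close>)
  then show ?case by auto
qed simp_all

lemma fv_fresh: "(n, \<sigma>) \<in> fv_tm t \<Longrightarrow> n < fresh t"
  by (induction t) auto

lemma val_fresh: "fresh t \<le> n \<Longrightarrow> val t (a((n, \<sigma>) := d)) = val t a"
  by (rule val_fv) (auto dest: fv_fresh)

text \<open>The formula compares both sides at one and the same argument, the relation at two
  related ones. Since \<open>s\<close> itself respects the relation, \<open>d\<close> may first be
  replaced by \<open>e\<close>.\<close>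

lemma sat_eq_at:
  "tm_ty s = Some \<sigma> \<Longrightarrow> tm_ty t = Some \<sigma> \<Longrightarrow> envok a \<Longrightarrow>
     sat a (eq_at \<sigma> s t) \<longleftrightarrow> per (emb \<sigma>) (val s a) (val t a)"
proof (induction \<sigma> arbitrary: s t a)
  case N
  obtain m n where "val s a = num m" "val t a = num n" using val_N N by metis
  then show ?case by auto
next
  case (Fun \<sigma> \<tau>)
  let ?z = "(max (fresh s) (fresh t), \<sigma>)"
  have *: "sat (a(?z := d)) (eq_at \<tau> (s \<cdot> Var ?z) (t \<cdot> Var ?z)) \<longleftrightarrow>
     per (emb \<tau>) (val s a \<bullet> d) (val t a \<bullet> d)" if "elt (emb \<sigma>) d" for d
  proof -
    have "sat (a(?z := d)) (eq_at \<tau> (s \<cdot> Var ?z) (t \<cdot> Var ?z)) \<longleftrightarrow>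
      per (emb \<tau>) (val (s \<cdot> Var ?z) (a(?z := d))) (val (t \<cdot> Var ?z) (a(?z := d)))"
      by (rule Fun.IH(2)) (use Fun.prems that envP_upd[of a a ?z d d] in \<open>auto simp del: fun_upd_apply\<close>)
    then show ?thesis by (simp add: val_fresh)
  qed
  have s: "per (emb (\<sigma> \<rightarrow> \<tau>)) (val s a) (val s a)" using val_per Fun.prems by blast
  show ?case
  proof
    assume "sat a (eq_at (\<sigma> \<rightarrow> \<tau>) s t)"
    then have d: "per (emb \<tau>) (val s a \<bullet> d) (val t a \<bullet> d)" if "elt (emb \<sigma>) d" for d
      using * that by (simp add: Let_def)
    have "per (emb \<tau>) (val s a \<bullet> d) (val t a \<bullet> e)" if "per (emb \<sigma>) d e" for d e
      using per_trans[of "emb \<tau>" "val s a \<bullet> d" "val s a \<bullet> e"] s that d[OF per_dom2[OF that]] by simp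
    then show "per (emb (\<sigma> \<rightarrow> \<tau>)) (val s a) (val t a)" by simp
  next
    assume "per (emb (\<sigma> \<rightarrow> \<tau>)) (val s a) (val t a)"
    then show "sat a (eq_at (\<sigma> \<rightarrow> \<tau>) s t)" using * by (simp add: Let_def)
  qed
qed

section \<open>Sequence codes and truth of the arithmetical axioms\<close>

definition ispair :: "nat \<Rightarrow> nat \<Rightarrow> nat \<Rightarrow> bool" where
  "ispair c a b \<longleftrightarrow> c + c = (a + b) * Suc (a + b) + (b + b)"

text \<open>Written with an explicit quotient and a bound on the remainder, as in
  \<open>is_comp\<close>, rather than with \<open>mod\<close>.\<close>

definition codes :: "nat \<Rightarrow> nat list \<Rightarrow> bool" where
  "codes c xs \<longleftrightarrow> (\<exists>d a b. ispair c (length xs) d \<and> ispair d a b \<and>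
     (\<forall>i<length xs. \<exists>q. a = q * Suc (Suc i * b) + xs ! i \<and> xs ! i \<le> Suc i * b))"

lemma ispair_ex: "\<exists>c. ispair c a b"
proof -
  have "even ((a + b) * Suc (a + b))" "even (b + b)" by simp_all
  then have "even ((a + b) * Suc (a + b) + (b + b))" by (rule dvd_add)
  then obtain c where "(a + b) * Suc (a + b) + (b + b) = 2 * c" by (rule evenE)
  then show ?thesis unfolding ispair_def by (intro exI[of _ c]) simp
qed

text \<open>A common prime divides \<open>(j - i) * fact m\<close>, hence \<open>fact m\<close>,
  because \<open>j - i \<le> m\<close>; but then it divides 1.\<close>

lemma beta_moduli_coprime:
  assumes "i < j" "j \<le> m"
  shows "coprime (Suc (Suc i * fact m)) (Suc (Suc j * fact m :: nat))"
proof (rule ccontr)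
  assume "\<not> coprime (Suc (Suc i * fact m)) (Suc (Suc j * fact m :: nat))"
  then have "gcd (Suc (Suc i * fact m)) (Suc (Suc j * fact m :: nat)) \<noteq> 1"
    unfolding coprime_iff_gcd_eq_1 .
  then obtain p where "prime p" and d: "p dvd gcd (Suc (Suc i * fact m)) (Suc (Suc j * fact m :: nat))"
    using prime_factor_nat by blast
  have p: "prime p" "p dvd Suc (Suc i * fact m)" "p dvd Suc (Suc j * fact m :: nat)"
    using \<open>prime p\<close> dvd_trans[OF d gcd_dvd1] dvd_trans[OF d gcd_dvd2] by blast+
  have "Suc (Suc j * fact m) - Suc (Suc i * fact m) = (j - i) * fact m"
    by (simp add: diff_mult_distrib)
  then have "p dvd (j - i) * fact m" using dvd_diff_nat[OF p(3,2)] by simp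
  then consider "p dvd j - i" | "p dvd fact m" using p(1) prime_dvd_mult_iff by blast
  then have "p dvd fact m"
  proof cases
    case 1
    then have "p \<le> m" using assms by (auto dest: dvd_imp_le)
    then show ?thesis using p(1) prime_ge_1_nat dvd_fact by blast
  qed
  then have "p dvd Suc i * fact m" by simp
  then have "p dvd 1" using p(2) by (metis dvd_add_right_iff Suc_eq_plus1)
  then show False using p(1) by simp
qed

lemma codes_ex: "\<exists>c. codes c xs"
proof -
  let ?n = "length xs"
  \<comment> \<open>The summand \<open>?n\<close> keeps the indices below \<open>m\<close>, as
    coprimality requires; the maximum keeps each entry at most \<open>m \<le> fact m\<close>, so
    that it is a genuine remainder.\<close>
  define m where "m = ?n + Max (insert 0 (set xs))"
  have le: "xs ! i \<le> m" if "i < ?n" for i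
  proof -
    have "xs ! i \<le> Max (insert 0 (set xs))" using that by (intro Max_ge) auto
    then show ?thesis by (simp add: m_def)
  qed
  let ?b = "fact m :: nat"
  have "\<forall>i\<in>{..<?n}. \<forall>j\<in>{..<?n}. i \<noteq> j \<longrightarrow> coprime (Suc (Suc i * ?b)) (Suc (Suc j * ?b))"
  proof (intro ballI impI)
    fix i j assume "i \<in> {..<?n}" "j \<in> {..<?n}" "i \<noteq> j"
    then consider "i < j" "j \<le> m" | "j < i" "i \<le> m" by (fastforce simp: m_def)
    then show "coprime (Suc (Suc i * ?b)) (Suc (Suc j * ?b))"
      by cases (use beta_moduli_coprime coprime_commute in blast)+
  qed
  from chinese_remainder_nat[OF _ this, of "\<lambda>i. xs ! i"]
  obtain a where a: "\<And>i. i < ?n \<Longrightarrow> [a = xs ! i] (mod Suc (Suc i * ?b))" by auto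
  have "\<exists>q. a = q * Suc (Suc i * ?b) + xs ! i \<and> xs ! i \<le> Suc i * ?b" if i: "i < ?n" for i
  proof -
    have "m \<le> ?b" by (rule fact_ge_self)
    then have l: "xs ! i \<le> Suc i * ?b" using le[OF i] by (simp add: le_trans)
    then have "a mod Suc (Suc i * ?b) = xs ! i" using a[OF i] by (simp add: cong_def)
    then have "a = a div Suc (Suc i * ?b) * Suc (Suc i * ?b) + xs ! i"
      by (metis div_mult_mod_eq)
    with l show ?thesis by blast
  qed
  moreover obtain d where "ispair d a ?b" using ispair_ex by blast
  moreover obtain c where "ispair c ?n d" using ispair_ex by blast
  ultimately show ?thesis unfolding codes_def by blast
qed

definition enc :: "nat list \<Rightarrow> nat" where "enc xs = (SOME c. codes c xs)"

lemma codes_enc: "codes (enc xs) xs"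
  unfolding enc_def using codes_ex by (rule someI_ex)

definition codeO :: "nat \<Rightarrow> (nat \<Rightarrow> nat) \<Rightarrow> nat" where
  "codeO n h = enc (map h [0..<n])"

text \<open>Any choice of codes is admissible: consulting finitely many values already makes the
  oracle bounded.\<close>

lemma bddO_codeO: "bddO codeO"
  by (rule bddO_finite[of _ "\<lambda>_. enc" "\<lambda>n. n"]) (simp add: codeO_def)

text \<open>Turns a list of functionals into a single functional of the same type that codes it in
  the sense of \<open>mem_seq\<close>: arguments are pushed into the entries, and the resulting
  numbers are coded. As strategies apply this operation, it has to be typed.\<close>

primrec codeU :: "ty \<Rightarrow> U \<Rightarrow> U \<Rightarrow> U" where
  "codeU N n h = orc codeO n h"
| "codeU (\<sigma> \<rightarrow> \<tau>) n h = lam (\<lambda>w. codeU \<tau> n (lam (\<lambda>j. h \<bullet> j \<bullet> w)))"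

lemma cont_codeU [cont_intros]:
  "cont F \<Longrightarrow> cont G \<Longrightarrow> cont (\<lambda>x. codeU \<tau> (F x) (G x))"
proof (induction \<tau> arbitrary: F G)
  case N
  then show ?case unfolding codeU.simps by (intro cont_intros)
next
  case (Fun \<sigma> \<tau>)
  show ?case unfolding codeU.simps by (intro cont_lam Fun.IH(2) cont_intros Fun.prems)
qed

lemma typed_codeU:
  "typed RN n \<Longrightarrow> typed (RF RN (emb \<tau>)) h \<Longrightarrow> typed (emb \<tau>) (\<lambda>i. codeU \<tau> (n i) (h i))"
proof (induction \<tau> arbitrary: n h)
  case N
  then show ?case unfolding codeU.simps emb.simps by (intro typed_orc bddO_codeO)
next
  case (Fun \<sigma> \<tau>)
  note pr = Fun.prems[unfolded emb.simps]
  show ?case unfolding codeU.simps emb.simps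
  proof (rule typed_lam, intro cont_intros, rule Fun.IH(2)[OF pr(1)])
    fix w assume w: "typed (emb \<sigma>) w"
    show "typed (RF RN (emb \<tau>)) (\<lambda>i. lam (\<lambda>j. h i \<bullet> j \<bullet> w i))"
      by (rule typed_lam, intro cont_intros) (rule typed_app[OF typed_app[OF pr(2)] w])
  qed
qed

section \<open>Codes and recursors evaluated at all their arguments\<close>

abbreviation appl :: "U \<Rightarrow> U list \<Rightarrow> U" where "appl \<equiv> foldl (\<bullet>)"

abbreviation elts :: "U list \<Rightarrow> ty list \<Rightarrow> bool" where
  "elts \<equiv> list_all2 (\<lambda>w \<sigma>. elt (emb \<sigma>) w)"

lemma per_appl:
  "per (emb \<rho>) f f' \<Longrightarrow> elts ws (arg_tys \<rho>) \<Longrightarrow> \<exists>n. appl f ws = num n \<and> appl f' ws = num n"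
proof (induction \<rho> arbitrary: f f' ws)
  case (Fun \<sigma> \<tau>)
  from Fun.prems(2) obtain w ws' where ws: "ws = w # ws'" "elt (emb \<sigma>) w" "elts ws' (arg_tys \<tau>)"
    by (auto simp: list_all2_Cons2)
  have "per (emb \<tau>) (f \<bullet> w) (f' \<bullet> w)" using Fun.prems(1) ws(2) by simp
  from Fun.IH(2)[OF this ws(3)] show ?case using ws(1) by simp
qed auto

lemma appl_codeU:
  assumes "elts ws (arg_tys \<tau>)" "\<And>j. appl (h \<bullet> num j) ws = num (g j)"
  shows "appl (codeU \<tau> (num n) h) ws = num (codeO n g)"
  using assms
proof (induction \<tau> arbitrary: h ws)
  case N
  then show ?case by (simp add: orc_tot tot_def)
next
  case (Fun \<sigma> \<tau>)
  from Fun.prems(1) obtain w ws' where ws: "ws = w # ws'" "elt (emb \<sigma>) w" "elts ws' (arg_tys \<tau>)"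
    by (auto simp: list_all2_Cons2)
  have 1: "lam (\<lambda>w. codeU \<tau> (num n) (lam (\<lambda>j. h \<bullet> j \<bullet> w))) \<bullet> w =
      codeU \<tau> (num n) (lam (\<lambda>j. h \<bullet> j \<bullet> w))"
    by (subst beta) (intro cont_intros, simp)
  have 2: "lam (\<lambda>j. h \<bullet> j \<bullet> w) \<bullet> num j = h \<bullet> num j \<bullet> w" for j
    by (subst beta) (intro cont_intros, simp)
  show ?case using Fun.IH(2)[OF ws(3), of "lam (\<lambda>j. h \<bullet> j \<bullet> w)"] Fun.prems(2)
    by (simp add: ws(1) 1 2)
qed

lemma appl_recU:
  assumes "elts ws (arg_tys \<rho>)" "appl y ws = num Y" "\<And>j i. appl (z \<bullet> num j \<bullet> num i) ws = num (Z j i)"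
    "\<And>i. appl (v \<bullet> num i) ws = num (W i)"
  shows "appl (recU \<rho> (num x) y z v) ws = num (rec_nat Y (\<lambda>i r. min (Z r i) (W i)) x)"
  using assms
proof (induction \<rho> arbitrary: y z v ws)
  case N
  define g where "g k = (if tri1 k = 0 then Y else if tri1 k = 1 then W (tri2 k) else Z (tri3 k) (tri2 k))" for k
  have "recH y z v \<bullet> num k = num (g k)" for k
  proof -
    have "recH y z v \<bullet> num k = cd (un tri1 (num k)) y
       (cd (un (\<lambda>k. tri1 k - 1) (num k)) (v \<bullet> un tri2 (num k)) (z \<bullet> un tri3 (num k) \<bullet> un tri2 (num k)))"
      unfolding recH_def by (rule beta) (intro cont_intros)
    also have "\<dots> = num (g k)"
    proof -
      consider "tri1 k = 0" | "tri1 k = Suc 0" | m where "tri1 k = Suc (Suc m)"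
        by (metis nat.exhaust)
      then show ?thesis using N by cases (auto simp: g_def)
    qed
    finally show ?thesis .
  qed
  then have "recU N (num x) y z v = num (recO x g)" by (simp add: orc_tot tot_def)
  moreover have "recO x g = rec_nat Y (\<lambda>i r. min (Z r i) (W i)) x"
    by (induction x) (simp_all add: recO_def g_def)
  ultimately show ?case using N by simp
next
  case (Fun \<sigma> \<tau>)
  from Fun.prems(1) obtain w ws' where ws: "ws = w # ws'" "elt (emb \<sigma>) w" "elts ws' (arg_tys \<tau>)"
    by (auto simp: list_all2_Cons2)
  have 1: "lam (\<lambda>w. recU \<tau> (num x) (y \<bullet> w) (lam2 (\<lambda>j i. z \<bullet> j \<bullet> i \<bullet> w)) (lam (\<lambda>i. v \<bullet> i \<bullet> w))) \<bullet> w =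
    recU \<tau> (num x) (y \<bullet> w) (lam2 (\<lambda>j i. z \<bullet> j \<bullet> i \<bullet> w)) (lam (\<lambda>i. v \<bullet> i \<bullet> w))"
    by (rule beta) (intro cont_intros)
  have 2: "lam2 (\<lambda>j i. z \<bullet> j \<bullet> i \<bullet> w) \<bullet> num j \<bullet> num i = z \<bullet> num j \<bullet> num i \<bullet> w" for j i
    by (subst beta, intro cont_intros, subst beta) (intro cont_intros, simp)
  have 3: "lam (\<lambda>i. v \<bullet> i \<bullet> w) \<bullet> num i = v \<bullet> num i \<bullet> w" for i
    by (subst beta) (intro cont_intros, simp)
  show ?case
    using Fun.IH(2)[OF ws(3), of "y \<bullet> w" "lam2 (\<lambda>j i. z \<bullet> j \<bullet> i \<bullet> w)" "lam (\<lambda>i. v \<bullet> i \<bullet> w)"] Fun.prems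
    by (simp add: ws(1) 1 2 3)
qed

section \<open>Truth of the axioms of \<open>EFA\<close>\<close>

lemma val_apps: "val (apps t ts) a = appl (val t a) (map (\<lambda>t. val t a) ts)"
  by (induction ts arbitrary: t) auto

lemma elts_vars_from: "envok a \<Longrightarrow> elts (map a (vars_from n \<sigma>)) (arg_tys \<sigma>)"
  unfolding list_all2_conv_all_nth vars_from_def envP_def by (auto simp: nth_zip)

lemma lam2_bin [simp]: "lam2 (bin f) \<bullet> x \<bullet> y = bin f x y"
  by (subst beta, intro cont_intros, subst beta) (intro cont_intros, simp)

lemma lam_un [simp]: "lam (un f) \<bullet> x = un f x"
  by (rule beta) (intro cont_intros)

lemma lam2_orc [simp]: "lam2 (\<lambda>f n. orc \<Theta> n f) \<bullet> x \<bullet> y = orc \<Theta> y x"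
  by (subst beta, intro cont_intros, subst beta) (intro cont_intros, simp)

lemma lam2_mub [simp]: "lam2 (\<lambda>f n. orc \<Theta> n (f \<bullet> n)) \<bullet> x \<bullet> y = orc \<Theta> y (x \<bullet> y)"
  by (subst beta, intro cont_intros, subst beta) (intro cont_intros, simp)

lemma lam2_Pi [simp]: "lam2 (\<lambda>x y. x) \<bullet> x \<bullet> y = x"
  by (subst beta, intro cont_intros, subst beta) (intro cont_intros, simp)

lemma lam3_Sigma [simp]: "lam (\<lambda>x. lam2 (\<lambda>y z. x \<bullet> z \<bullet> (y \<bullet> z))) \<bullet> x \<bullet> y \<bullet> z = x \<bullet> z \<bullet> (y \<bullet> z)"
  by (subst beta, intro cont_intros, subst beta, intro cont_intros, subst beta)
     (intro cont_intros, simp)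

lemma lam4_rec [simp]: "lam2 (\<lambda>x y. lam2 (recU \<rho> x y)) \<bullet> x \<bullet> y \<bullet> z \<bullet> v = recU \<rho> x y z v"
  by (subst beta, intro cont_intros, subst beta, intro cont_intros, subst beta,
      intro cont_intros, subst beta) (intro cont_intros, simp)

lemma env_num: "envok a \<Longrightarrow> \<exists>n. a (k, N) = num n"
  unfolding envP_def by (metis per.simps(1) emb.simps(1) snd_conv)

lemma env_fun: "envok a \<Longrightarrow> \<exists>g. tot (a (k, ty1)) g"
  unfolding envP_def by (metis per_fun emb.simps snd_conv)

lemma mubO_found: "k \<le> n \<Longrightarrow> g k = 0 \<Longrightarrow> g (mubO n g) = 0"
  unfolding mubO_def by (auto intro: LeastI[of "\<lambda>k. g k = 0"])

lemma mubO_least: "k < mubO n g \<Longrightarrow> g k \<noteq> 0"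
  unfolding mubO_def by (auto dest: not_less_Least split: if_splits)

lemma mubO_default: "mubO n g = 0 \<or> g (mubO n g) = 0"
proof (cases "\<exists>k\<le>n. g k = 0")
  case True
  then obtain k where "k \<le> n" "g k = 0" by blast
  then have "g (mubO n g) = 0" by (rule mubO_found)
  then show ?thesis ..
qed (auto simp: mubO_def)

lemma sat_EFA:
  assumes "A \<in> EFA" "envok a"
  shows "sat a A"
proof -
  obtain x0 x1 x2 x3 where x [simp]: "a (0, N) = num x0" "a (1, N) = num x1" "a (2, N) = num x2"
    "a (3, N) = num x3"  "a (Suc 0, N) = num x1" using env_num[OF assms(2)] by (metis One_nat_def)
  obtain g where g: "tot (a (0, ty1)) g" using env_fun[OF assms(2)] by blast
  have orc_g [simp]: "orc \<Theta> (num n) (a (0, ty1)) = num (\<Theta> n g)" for \<Theta> n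
    by (rule orc_tot[OF g])
  have app_g [simp]: "a (0, ty1) \<bullet> num n = num (g n)" for n using g by (simp add: tot_def)
  have "elt (emb (N \<rightarrow> ty1)) (a (0, N \<rightarrow> ty1))"
    using assms(2) unfolding envP_def by (metis snd_conv)
  then have "elt (RF RN RN) (a (0, N \<rightarrow> ty1) \<bullet> num x1)" by simp
  then obtain g2 where g2: "tot (a (0, N \<rightarrow> ty1) \<bullet> num x1) g2" using per_fun by blast
  have orc_g2 [simp]: "orc \<Theta> (num n) (a (0, N \<rightarrow> ty1) \<bullet> num x1) = num (\<Theta> n g2)" for \<Theta> n
    by (rule orc_tot[OF g2])
  have app_g2 [simp]: "a (0, N \<rightarrow> ty1) \<bullet> num x1 \<bullet> num n = num (g2 n)" for n
    using g2 by (simp add: tot_def)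
  have env: "elt (emb \<sigma>) (a (k, \<sigma>))" for k \<sigma>
    using assms(2) unfolding envP_def by (metis snd_conv)
  from assms(1) show ?thesis
  proof cases
    case (extensionality \<sigma> \<tau>)
    have "elt (emb (\<sigma> \<rightarrow> \<tau>)) (a (2, \<sigma> \<rightarrow> \<tau>))" by (rule env)
    then show ?thesis unfolding extensionality using assms(2)
      by (simp add: sat_eq_at del: One_nat_def)
  next
    case (Pi \<rho> \<tau>)
    then show ?thesis using assms(2) env[of \<rho> 0] by (simp add: sat_eq_at)
  next
    case (Sigma \<tau> \<delta> \<rho>)
    have "elt (emb (\<delta> \<rightarrow> \<rho> \<rightarrow> \<tau>)) (a (0, \<delta> \<rightarrow> \<rho> \<rightarrow> \<tau>))" "elt (emb (\<delta> \<rightarrow> \<rho>)) (a (1, \<delta> \<rightarrow> \<rho>))"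
      "elt (emb \<delta>) (a (2, \<delta>))" by (rule env)+
    then show ?thesis unfolding Sigma using assms(2) by (simp add: sat_eq_at del: One_nat_def)
  next
    case (mub_found)
    then show ?thesis using mubO_found[of x2 x1 g2] by simp
  next
    case (mub_least)
    then show ?thesis using mubO_least[of x2 x1 g2] by (simp add: Suc_le_eq)
  next
    case (mub_default)
    then show ?thesis using mubO_default[of x1 g2] mubO_le[of x1 g2] by simp
  next
    case (Rec_zero y \<rho> z v ws)
    let ?ws = "map a (vars_from 4 \<rho>)"
    have ws: "elts ?ws (arg_tys \<rho>)" by (rule elts_vars_from[OF assms(2)])
    obtain Y where Y: "appl (a (1, \<rho>)) ?ws = num Y" using per_appl[OF env ws] by blast
    have "elt (emb (N \<rightarrow> N \<rightarrow> \<rho>)) (a (2, N \<rightarrow> N \<rightarrow> \<rho>))" "elt (emb (N \<rightarrow> \<rho>)) (a (3, N \<rightarrow> \<rho>))" by (rule env)+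
    then have zv: "elt (emb \<rho>) (a (2, N \<rightarrow> N \<rightarrow> \<rho>) \<bullet> num j \<bullet> num i)" "elt (emb \<rho>) (a (3, N \<rightarrow> \<rho>) \<bullet> num i)"
      for i j by simp_all
    have "\<forall>j i. \<exists>n. appl (a (2, N \<rightarrow> N \<rightarrow> \<rho>) \<bullet> num j \<bullet> num i) ?ws = num n"
      using per_appl[OF zv(1) ws] by blast
    then obtain Z where Z: "\<And>j i. appl (a (2, N \<rightarrow> N \<rightarrow> \<rho>) \<bullet> num j \<bullet> num i) ?ws = num (Z j i)" by metis
    have "\<forall>i. \<exists>n. appl (a (3, N \<rightarrow> \<rho>) \<bullet> num i) ?ws = num n"
      using per_appl[OF zv(2) ws] by blast
    then obtain W where W: "\<And>i. appl (a (3, N \<rightarrow> \<rho>) \<bullet> num i) ?ws = num (W i)" by metis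
    from appl_recU[OF ws Y Z W, of 0] Y show ?thesis
      unfolding Rec_zero by (simp add: val_apps comp_def del: One_nat_def)
  next
    case (Rec_suc x y \<rho> z v ws)
    let ?ws = "map a (vars_from 4 \<rho>)"
    have ws: "elts ?ws (arg_tys \<rho>)" by (rule elts_vars_from[OF assms(2)])
    obtain Y where Y: "appl (a (1, \<rho>)) ?ws = num Y" using per_appl[OF env ws] by blast
    have "elt (emb (N \<rightarrow> N \<rightarrow> \<rho>)) (a (2, N \<rightarrow> N \<rightarrow> \<rho>))" "elt (emb (N \<rightarrow> \<rho>)) (a (3, N \<rightarrow> \<rho>))" by (rule env)+
    then have zv: "elt (emb \<rho>) (a (2, N \<rightarrow> N \<rightarrow> \<rho>) \<bullet> num j \<bullet> num i)" "elt (emb \<rho>) (a (3, N \<rightarrow> \<rho>) \<bullet> num i)"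
      for i j by simp_all
    have "\<forall>j i. \<exists>n. appl (a (2, N \<rightarrow> N \<rightarrow> \<rho>) \<bullet> num j \<bullet> num i) ?ws = num n"
      using per_appl[OF zv(1) ws] by blast
    then obtain Z where Z: "\<And>j i. appl (a (2, N \<rightarrow> N \<rightarrow> \<rho>) \<bullet> num j \<bullet> num i) ?ws = num (Z j i)" by metis
    have "\<forall>i. \<exists>n. appl (a (3, N \<rightarrow> \<rho>) \<bullet> num i) ?ws = num n"
      using per_appl[OF zv(2) ws] by blast
    then obtain W where W: "\<And>i. appl (a (3, N \<rightarrow> \<rho>) \<bullet> num i) ?ws = num (W i)" by metis
    from appl_recU[OF ws Y Z W] Z W show ?thesis
      unfolding Rec_suc by (simp add: val_apps comp_def del: One_nat_def)
  next
    case (QF_induction A n)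
    show ?thesis unfolding QF_induction
    proof (simp only: sat.simps snd_conv emb.simps, intro impI allI, elim conjE)
      fix d assume 0: "sat a (subst A (n, N) tzero)"
        and S: "\<forall>d. elt RN d \<longrightarrow> sat (a((n, N) := d)) A \<longrightarrow>
           sat (a((n, N) := d)) (subst A (n, N) (tsuc (V n N)))" and d: "elt RN d"
      have "sat (a((n, N) := num k)) A" for k
      proof (induction k)
        case 0
        then show ?case using \<open>sat a (subst A (n, N) tzero)\<close>
          by (simp add: sat_subst_qf[OF QF_induction(3)] del: fun_upd_apply)
      next
        case (Suc k)
        have "elt RN (num k)" by simp
        with S Suc have "sat (a((n, N) := num k)) (subst A (n, N) (tsuc (V n N)))" by blast
        then show ?case by (simp add: sat_subst_qf[OF QF_induction(3)] fun_upd_same del: fun_upd_apply)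
      qed
      then show "sat (a((n, N) := d)) A" using d by auto
    qed
  qed (auto simp: phiO_def le_Suc_eq min_def max_def)
qed

section \<open>Soundness of the interpretation\<close>

lemma valid_imp_trans:
  "valid (gimp A B) \<Longrightarrow> valid (gimp B C) \<Longrightarrow> game_ok A \<Longrightarrow> game_ok B \<Longrightarrow> game_ok C \<Longrightarrow> valid (gimp A C)"
  using v_cut[of B "gneg A" C] valid_maps[OF maps_comm] game_ok_gneg unfolding gimp_def by blast

lemma valid_imp_refl: "valid (gimp A A)"
  unfolding gimp_def by (rule v_em) auto

lemma valid_iff_refl: "game_ok A \<Longrightarrow> valid (gand (gimp A A) (gimp A A))"
  using valid_mp[OF valid_mp[OF taut(5)]] valid_imp_refl game_ok_derived by meson

lemma valid_all_intro:
  assumes "valid (gimp B A)" "game_ok A" "game_ok B"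
    and indep: "\<And>a d x y. gR B (a(v := d)) x y = gR B a x y"
  shows "valid (gimp B (gall v A))"
proof -
  have "sequent [A, gneg B]"
    by (rule sequent_subset[of "[gneg B, A]"]) (use assms in \<open>auto simp: sequent_two gimp_def intro: game_ok_gneg\<close>)
  then have "sequent [gall v A, gneg B]" by (rule sequent_all) (simp add: indep)
  then show ?thesis unfolding gimp_def sequent_two by (rule valid_maps[OF maps_comm])
qed

lemma valid_gneg_mono:
  assumes "valid (gimp A B)" "game_ok A" "game_ok B"
  shows "valid (gimp (gneg B) (gneg A))"
proof -
  have "sequent [B, gneg A]"
    by (rule sequent_subset[of "[gneg A, B]"]) (use assms in \<open>auto simp: sequent_two gimp_def intro: game_ok_gneg\<close>)
  then have "sequent [gneg (gneg B), gneg A]" by (rule sequent_negneg) (use assms in \<open>auto intro: game_ok_gneg\<close>)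
  then show ?thesis by (simp add: sequent_two gimp_def)
qed

lemma valid_all_inst: "valid (gimp (gall v A) A)"
  unfolding gimp_def
proof (rule v_em)
  fix a x y assume "envok a" "gR (gall v A) a x y"
  then have "gR A (a(v := a v)) x y" by (simp only: game_sel envP_def)
  then show "gR A a x y" by simp
qed simp_all

lemma valid_gall_mono:
  assumes "valid (gimp A B)" "game_ok A" "game_ok B"
  shows "valid (gimp (gall v A) (gall v B))"
proof (rule valid_all_intro)
  show "valid (gimp (gall v A) B)"
    using valid_imp_trans[OF valid_all_inst assms(1)] assms game_ok_gall by blast
qed (use assms game_ok_gall in auto)

lemma valid_gimp_mono:
  assumes "valid (gimp A B)" "game_ok A" "game_ok B" "game_ok S"
  shows "valid (gimp (gimp S A) (gimp S B))"
proof -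
  have "valid (gimp S (gimp A B))"
    by (rule valid_mp[OF taut(1)[OF _ assms(4) assms(4)] assms(1)]) (intro game_ok_derived assms)+
  then show ?thesis by (rule valid_mp[OF taut(2)[OF assms(4,2,3)]]) (intro game_ok_derived assms)+
qed

lemma valid_ex_elim:
  assumes "valid (gimp A B)" "game_ok A" "game_ok B"
    and indep: "\<And>a d x y. gR B (a(v := d)) x y = gR B a x y"
  shows "valid (gimp (gex v A) B)"
proof -
  have "sequent [gneg A, B]" using assms(1) by (simp add: sequent_two gimp_def)
  then have "sequent [gall v (gneg A), B]" by (rule sequent_all) (simp add: indep)
  then have "sequent [gneg (gneg (gall v (gneg A))), B]"
    by (rule sequent_negneg) (use assms in \<open>auto intro: game_ok_intros\<close>)
  then show ?thesis by (simp add: sequent_two gimp_def gex_def)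
qed

lemma gR_indep: "x \<notin> fv A \<Longrightarrow> gR (interp A) (a(x := d)) p q = gR (interp A) a p q"
  by (rule interp_fv) auto

lemma valid_all_inst_interp:
  assumes "wf A" "tm_ty t = Some (snd x)" "free_for t x A"
  shows "valid (interp (All x A \<^bold>\<longrightarrow> subst A x t))"
  unfolding interp.simps gimp_def
proof (rule v_em)
  fix a p q assume "envok a" "gR (gall x (interp A)) a p q"
  moreover have "elt (emb (snd x)) (val t a)" using val_per[OF assms(2) \<open>envok a\<close>] .
  ultimately show "gR (interp (subst A x t)) a p q" by (simp add: interp_subst[OF assms(3)])
qed (simp_all add: interp_subst_ty)

lemma valid_ex_interp:
  assumes "wf A" "tm_ty t = Some (snd x)" "free_for t x A"
  shows "valid (interp (subst A x t \<^bold>\<longrightarrow> Ex x A))"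
proof -
  have "valid (gor (gneg (gall x (gneg (interp A)))) (gneg (interp (subst A x t))))"
  proof (rule v_em)
    fix a p q assume a: "envok a" and R: "gR (gall x (gneg (interp A))) a p q"
    moreover have "elt (emb (snd x)) (val t a)" using val_per[OF assms(2) a] .
    ultimately have "gR (gneg (interp A)) (a(x := val t a)) p q" by (simp del: fun_upd_apply)
    then show "gR (gneg (interp (subst A x t))) a p q" by (simp add: interp_subst[OF assms(3)])
  qed (simp_all add: interp_subst_ty)
  from valid_maps[OF maps_comm this] show ?thesis by (simp add: gimp_def gex_def)
qed

lemma wf_subst: "wf A \<Longrightarrow> tm_ty t = Some (snd x) \<Longrightarrow> wf (subst A x t)"
proof -
  assume t: "tm_ty t = Some (snd x)"
  have "tm_ty s = Some \<sigma> \<Longrightarrow> tm_ty (subst_tm s x t) = Some \<sigma>" for s \<sigma>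
    by (induction s arbitrary: \<sigma>) (auto simp: t tm_ty_App simp del: tm_ty.simps(3))
  then show "wf A \<Longrightarrow> wf (subst A x t)" by (induction A) auto
qed

lemma proves_wf: "T \<turnstile> A \<Longrightarrow> wf A"
  by (induction rule: proves.induct) (auto intro: wf_subst)

lemmas taut_ax = taut(1,3-7)[OF _ _ game_ok_derived(4)] taut(2,8)
  taut(9,10)[OF _ game_ok_derived(4) game_ok_derived(4)]

lemma soundness:
  assumes "T \<turnstile> A" and T: "\<And>A. A \<in> T \<Longrightarrow> wf A \<Longrightarrow> valid (interp A)"
  shows "valid (interp A)"
  using assms(1)
proof (induction rule: proves.induct)
  case (mp A B)
  then show ?case using valid_mp game_ok_interp proves_wf by (metis interp.simps(7) wf.simps(7))
next
  case (all_inst A t x)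
  then show ?case by (rule valid_all_inst_interp)
next
  case (ex_witness A t x)
  then show ?case by (rule valid_ex_interp)
next
  case (all_intro B A x)
  then have "wf A" "wf B" using proves_wf by fastforce+
  then show ?case using all_intro valid_all_intro[OF _ game_ok_interp game_ok_interp] gR_indep by simp
next
  case (ex_elim A B x)
  then have "wf A" "wf B" using proves_wf by fastforce+
  then show ?case using ex_elim valid_ex_elim[OF _ game_ok_interp game_ok_interp] gR_indep by simp
qed (use T in \<open>auto intro!: taut_ax game_ok_interp\<close>)

section \<open>Validity of the axioms: arithmetic and standardness\<close>

lemma internal_valid: "internal A \<Longrightarrow> (\<And>a. envok a \<Longrightarrow> sat a A) \<Longrightarrow> valid (interp A)"
  using adequate_true[OF adequate_interp] by blast

lemma internal_eq_at: "internal (eq_at \<sigma> s t)"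
  by (induction \<sigma> arbitrary: s t) (auto simp: Let_def)

lemma internal_subst: "internal A \<Longrightarrow> internal (subst A x t)"
  by (induction A) auto

lemma internal_EFA: "A \<in> EFA \<Longrightarrow> internal A"
  by (induction rule: EFA.induct) (auto simp: internal_eq_at internal_subst)

text \<open>The working form for implications: from a strategy \<open>f\<close> for \<open>A\<close>
  and a challenge \<open>b\<close> to \<open>C\<close>, \<open>\<xi>\<close> computes the finitely
  many challenges at which \<open>f\<close> is consulted together with the answer to
  \<open>b\<close>. The answer may be justified by the success of \<open>f\<close> at just these
  challenges.\<close>

lemma valid_imp_dial:
  assumes \<xi>: "cont \<xi>" "\<And>p. typed (RP (RF (gX A) (gY A)) (gX C)) p \<Longrightarrow> typed (RP (RL (gX A)) (gY C)) (\<lambda>i. \<xi> (p i))"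
    and R: "\<And>a f b. envok a \<Longrightarrow> elt (RF (gX A) (gY A)) f \<Longrightarrow> elt (gX C) b \<Longrightarrow>
      (\<And>x. x \<in> lmem (pfst (\<xi> (pair f b))) \<Longrightarrow> gR A a x (f \<bullet> x)) \<Longrightarrow> gR C a b (psnd (\<xi> (pair f b)))"
  shows "valid (gimp A C)"
  unfolding gimp_def
proof (rule validI[of "\<lambda>p. \<xi> (pair (pfst p) (psnd p))"], simp_all only: game_sel)
  show "cont (\<lambda>p. \<xi> (pair (pfst p) (psnd p)))"
    by (rule cont_comp[OF \<xi>(1)]) (intro cont_intros)
  show "typed (RP (RL (gX A)) (gY C)) (\<lambda>i. \<xi> (pair (pfst (p i)) (psnd (p i))))"
    if "typed (RP (RF (gX A) (gY A)) (gX C)) p" for p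
    by (rule \<xi>(2)) (rule typed_pair[OF typed_pfst[OF that] typed_psnd[OF that]])
  fix a p assume "envok a" "elt (RP (RF (gX A) (gY A)) (gX C)) p"
  then show "(\<exists>x\<in>lmem (pfst (\<xi> (pair (pfst p) (psnd p)))). \<not> gR A a x (pfst p \<bullet> x)) \<or>
       gR C a (psnd p) (psnd (\<xi> (pair (pfst p) (psnd p))))"
    using R[of a "pfst p" "psnd p"] by (metis per.simps(3))
qed

lemma valid_uncurry:
  assumes "valid (gimp A (gimp C D))" "game_ok A" "game_ok C" "game_ok D"
  shows "valid (gimp (gand A C) D)"
proof -
  have "sequent [gneg A, gneg C, D]"
    using assms(1) unfolding sequent_def gimp_def dsj.simps
    by (rule valid_maps[OF maps_cong, rotated])
       (rule maps_trans[OF maps_cong], rule maps_trans[OF maps_weak maps_comm], rule maps_refl)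
  then have "sequent [gneg (gand A C), D]"
    unfolding gand_def by (intro sequent_negneg sequent_or) (use assms in \<open>auto intro: game_ok_intros\<close>)
  then show ?thesis by (simp add: sequent_two gimp_def)
qed

text \<open>The candidates for the first object are passed on for the second. The test challenge
  \<open>x\<close> of the equation is probed so that a successful reply makes the equation
  true.\<close>

lemma valid_st_eq:
  assumes "wf (St \<sigma> (V 0 \<sigma>) \<^bold>\<and> eq_at \<sigma> (V 0 \<sigma>) (V 1 \<sigma>) \<^bold>\<longrightarrow> St \<sigma> (V 1 \<sigma>))"
  shows "valid (interp (St \<sigma> (V 0 \<sigma>) \<^bold>\<and> eq_at \<sigma> (V 0 \<sigma>) (V 1 \<sigma>) \<^bold>\<longrightarrow> St \<sigma> (V 1 \<sigma>)))"
proof -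
  let ?S = "gst \<sigma> (val (V 0 \<sigma>))" and ?S' = "gst \<sigma> (val (V 1 \<sigma>))" and ?E = "interp (eq_at \<sigma> (V 0 \<sigma>) (V 1 \<sigma>))"
  obtain t x where t: "good (RF (gX ?E) (gY ?E)) t"
    and x: "good (gX ?E) x" "\<And>a y. envok a \<Longrightarrow> elt (gY ?E) y \<Longrightarrow> gR ?E a x y \<Longrightarrow> sat a (eq_at \<sigma> (V 0 \<sigma>) (V 1 \<sigma>))"
    using adequate_interp[OF internal_eq_at] unfolding adequate_def by blast
  have ok: "game_ok ?S" "game_ok ?S'" "game_ok ?E"
    using game_ok_interp[of "St \<sigma> (V 0 \<sigma>)"] game_ok_interp[of "St \<sigma> (V 1 \<sigma>)"] game_ok_interp[of "eq_at \<sigma> (V 0 \<sigma>) (V 1 \<sigma>)"] assms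
    by simp_all
  have "valid (gimp ?S (gimp ?E ?S'))"
  proof (rule valid_imp_dial[where \<xi> = "\<lambda>p. pair (lsing (num 0)) (pair (lsing x) (pfst p \<bullet> num 0))"],
      simp_all only: gimp_def game_sel pfst_pair psnd_pair lmem_lsing)
    show "cont (\<lambda>p. pair (lsing (num 0)) (pair (lsing x) (pfst p \<bullet> num 0)))" by (intro cont_intros)
    show "typed (RP (RL RN) (RP (RL (gX ?E)) (RL (emb \<sigma>))))
       (\<lambda>i. pair (lsing (num 0)) (pair (lsing x) (pfst (p i) \<bullet> num 0)))"
      if "typed (RP (RF RN (RL (emb \<sigma>))) (RP (RF (gX ?E) (gY ?E)) RN)) p" for p
      by (intro typed_pair typed_lsing typed_num x(1), rule typed_app[OF typed_pfst[OF that] typed_num])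
    fix a f b assume a: "envok a" and b: "elt (RP (RF (gX ?E) (gY ?E)) RN) b"
      and R: "\<And>z. z \<in> {num 0} \<Longrightarrow> \<exists>z\<in>lmem (f \<bullet> z). per (emb \<sigma>) z (val (V 0 \<sigma>) a)"
    have y: "elt (gY ?E) (pfst b \<bullet> x)"
      using b per_app[OF _ good_dom[OF x(1)]] by (metis per.simps(3))
    obtain z where z: "z \<in> lmem (f \<bullet> num 0)" "per (emb \<sigma>) z (a (0, \<sigma>))" using R by auto
    have "per (emb \<sigma>) z (a (1, \<sigma>))" if "gR ?E a x (pfst b \<bullet> x)"
      using x(2)[OF a y that] z(2) a per_trans by (auto simp: sat_eq_at)
    then show "(\<exists>z\<in>{x}. \<not> gR ?E a z (pfst b \<bullet> z)) \<or> (\<exists>z\<in>lmem (f \<bullet> num 0). per (emb \<sigma>) z (val (V 1 \<sigma>) a))"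
      using z(1) by auto
  qed
  from valid_uncurry[OF this ok(1,3,2)] show ?thesis by simp
qed

text \<open>The value of a closed term is independent of the environment and good, because all
  constants are; it may be offered as the only candidate.\<close>

lemma valid_st_closed:
  assumes "fv_tm t = {}" "wf (St \<sigma> t)"
  shows "valid (interp (St \<sigma> t))"
proof (rule validI[of "\<lambda>_. lsing (val t (\<lambda>_. {}))"], simp_all only: interp.simps game_sel lmem_lsing)
  have v: "val t a = val t (\<lambda>_. {})" for a by (rule val_fv) (simp add: assms)
  show "typed (RL (emb \<sigma>)) (\<lambda>i. lsing (val t (\<lambda>_. {})))"
    by (rule typed_lsing[OF good_closed]) (use assms in auto)
  show "\<exists>x\<in>{val t (\<lambda>_. {})}. per (emb \<sigma>) x (val t a)" if "envok a" for a
    using val_per[of t \<sigma> a a] assms(2) that v[of a] by simp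
qed (rule cont_const)

text \<open>Every candidate function is applied to every candidate argument.\<close>

lemma valid_st_app:
  "valid (interp (St (\<sigma> \<rightarrow> \<tau>) (V 0 (\<sigma> \<rightarrow> \<tau>)) \<^bold>\<and> St \<sigma> (V 1 \<sigma>) \<^bold>\<longrightarrow> St \<tau> (V 0 (\<sigma> \<rightarrow> \<tau>) \<cdot> V 1 \<sigma>)))"
proof -
  let ?F = "gst (\<sigma> \<rightarrow> \<tau>) (val (V 0 (\<sigma> \<rightarrow> \<tau>)))" and ?X = "gst \<sigma> (val (V 1 \<sigma>))"
    and ?Y = "gst \<tau> (val (V 0 (\<sigma> \<rightarrow> \<tau>) \<cdot> V 1 \<sigma>))"
  have ok: "game_ok ?F" "game_ok ?X" "game_ok ?Y"
    using game_ok_interp[of "St (\<sigma> \<rightarrow> \<tau>) (V 0 (\<sigma> \<rightarrow> \<tau>))"] game_ok_interp[of "St \<sigma> (V 1 \<sigma>)"]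
      game_ok_interp[of "St \<tau> (V 0 (\<sigma> \<rightarrow> \<tau>) \<cdot> V 1 \<sigma>)"] by simp_all
  define H where "H p = lbind (pfst p \<bullet> num 0) (\<lambda>f. lmap (\<lambda>x. f \<bullet> x) (pfst (psnd p) \<bullet> num 0))" for p
  have cH: "cont H" unfolding H_def by (intro cont_intros)
  have TH: "typed (RL (emb \<tau>)) (\<lambda>i. H (p i))"
    if p: "typed (RP (RF RN (RL (emb (\<sigma> \<rightarrow> \<tau>)))) (RP (RF RN (RL (emb \<sigma>))) RN)) p" for p
    unfolding H_def
    by (rule typed_lbind[OF typed_app[OF typed_pfst[OF p] typed_num]], intro cont_intros,
        rule typed_lmap[OF _ _ typed_app[OF typed_pfst[OF typed_psnd[OF p]] typed_num]], intro cont_intros)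
       (simp only: emb.simps, erule typed_app)
  have "valid (gimp ?F (gimp ?X ?Y))"
  proof (rule valid_imp_dial[where \<xi> = "\<lambda>p. pair (lsing (num 0)) (pair (lsing (num 0)) (H p))"],
      simp_all only: gimp_def game_sel pfst_pair psnd_pair lmem_lsing)
    show "cont (\<lambda>p. pair (lsing (num 0)) (pair (lsing (num 0)) (H p)))"
      by (intro cont_pair cont_const cH)
    show "typed (RP (RL RN) (RP (RL RN) (RL (emb \<tau>)))) (\<lambda>i. pair (lsing (num 0)) (pair (lsing (num 0)) (H (p i))))"
      if "typed (RP (RF RN (RL (emb (\<sigma> \<rightarrow> \<tau>)))) (RP (RF RN (RL (emb \<sigma>))) RN)) p" for p
      by (intro typed_pair typed_lsing typed_num TH that)
    fix a f b assume a: "envok a" and f: "elt (RF RN (RL (emb (\<sigma> \<rightarrow> \<tau>)))) f"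
      and b: "elt (RP (RF RN (RL (emb \<sigma>))) RN) b"
      and R: "\<And>z. z \<in> {num 0} \<Longrightarrow> \<exists>z\<in>lmem (f \<bullet> z). per (emb (\<sigma> \<rightarrow> \<tau>)) z (val (V 0 (\<sigma> \<rightarrow> \<tau>)) a)"
    obtain g where g: "g \<in> lmem (f \<bullet> num 0)" "per (emb (\<sigma> \<rightarrow> \<tau>)) g (a (0, \<sigma> \<rightarrow> \<tau>))" using R by auto
    have f0: "elt (RL (emb (\<sigma> \<rightarrow> \<tau>))) (f \<bullet> num 0)" using per_app[OF f, of "num 0" "num 0"] by (simp only: per.simps) blast
    have "elt (RF RN (RL (emb \<sigma>))) (pfst b)" using b by (simp only: per.simps(3))
    from per_app[OF this, of "num 0" "num 0"]
    have b0: "elt (RL (emb \<sigma>)) (pfst b \<bullet> num 0)" by (simp only: per.simps) blast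
    have "\<exists>z\<in>lmem (H (pair f b)). per (emb \<tau>) z (a (0, \<sigma> \<rightarrow> \<tau>) \<bullet> a (1, \<sigma>))"
      if "x \<in> lmem (pfst b \<bullet> num 0)" "per (emb \<sigma>) x (a (1, \<sigma>))" for x
    proof (rule bexI[of _ "g \<bullet> x"])
      show "per (emb \<tau>) (g \<bullet> x) (a (0, \<sigma> \<rightarrow> \<tau>) \<bullet> a (1, \<sigma>))" using g(2) that(2) by simp
      show "g \<bullet> x \<in> lmem (H (pair f b))" unfolding H_def pfst_pair psnd_pair
      proof (rule lmem_lbind[OF f0 _ _ g(1), of _ "emb \<tau>"])
        show "cont (\<lambda>f. lmap ((\<bullet>) f) (pfst b \<bullet> num 0))" by (intro cont_intros)
        show "elt (RL (emb \<tau>)) (lmap ((\<bullet>) h) (pfst b \<bullet> num 0))" if "elt (emb (\<sigma> \<rightarrow> \<tau>)) h" for h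
          by (rule elt_lmap[OF _ _ b0], intro cont_intros) (use that in simp)
        show "g \<bullet> x \<in> lmem (lmap ((\<bullet>) g) (pfst b \<bullet> num 0))"
          using that(1) by (simp add: lmem_lmap[OF cont_app[OF cont_const cont_id]])
      qed
    qed
    then show "(\<exists>z\<in>{num 0}. \<not> (\<exists>x\<in>lmem (pfst b \<bullet> z). per (emb \<sigma>) x (val (V 1 \<sigma>) a))) \<or>
       (\<exists>x\<in>lmem (H (pair f b)). per (emb \<tau>) x (val (V 0 (\<sigma> \<rightarrow> \<tau>) \<cdot> V 1 \<sigma>) a))" by auto
  qed
  from valid_uncurry[OF this ok] show ?thesis by simp
qed

lemma sat_All_list:
  assumes "envok a" "\<And>a'. envok a' \<Longrightarrow> (\<And>v. v \<notin> set xs \<Longrightarrow> a' v = a v) \<Longrightarrow> sat a' A"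
  shows "sat a (All_list xs A)"
  using assms
proof (induction xs arbitrary: a)
  case (Cons x xs)
  have "sat (a(x := d)) (All_list xs A)" if d: "elt (emb (snd x)) d" for d
  proof (rule Cons.IH)
    show "envok (a(x := d))" using Cons.prems(1) d by (rule envP_upd)
    fix a' assume "envok a'" "\<And>v. v \<notin> set xs \<Longrightarrow> a' v = (a(x := d)) v"
    then show "sat a' A" by (intro Cons.prems(2)) auto
  qed
  then show ?case by simp
qed simp

lemma sat_is_comp:
  assumes "fresh c \<le> k" "fresh i \<le> k" "fresh v \<le> k"
    and "val c a = num C" "val i a = num I" "val v a = num W"
    and "ispair C n d" "ispair d p b" "p = q * Suc (Suc I * b) + W" "W \<le> Suc I * b"
  shows "sat a (is_comp k c i v)"
proof -
  define e where "e = a((k, N) := num n, (k + 1, N) := num d, (k + 2, N) := num p, (k + 3, N) := num b,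
    (k + 4, N) := num q)"
  have e: "e (k, N) = num n" "e (k + 1, N) = num d" "e (k + 2, N) = num p" "e (k + 3, N) = num b"
    "e (k + 4, N) = num q" by (simp_all add: e_def)
  have v: "val c e = num C" "val i e = num I" "val v e = num W"
    unfolding e_def using assms(1-6) by (simp_all add: val_fresh)
  have "sat e (is_pair c (V k N) (V (k + 1) N) \<^bold>\<and> is_pair (V (k + 1) N) (V (k + 2) N) (V (k + 3) N) \<^bold>\<and>
        V (k + 2) N \<^bold>= V (k + 4) N \<^bold>* tsuc (tsuc i \<^bold>* V (k + 3) N) \<^bold>+ v \<^bold>\<and>
        v \<^bold>\<le> tsuc i \<^bold>* V (k + 3) N)"
    using assms(7-10) unfolding ispair_def
    by (simp only: sat.simps is_pair_def val.simps cval.simps lam2_bin lam_un e v un_num bin_num num_inject le_U_num simp_thms)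
  moreover have "elt (emb N) (num m)" for m by simp
  ultimately show ?thesis
    unfolding is_comp_def Let_def sat.simps(9) snd_conv e_def by blast
qed

lemma sat_is_length:
  assumes "fresh c \<le> k" "fresh l \<le> k" "val c a = num C" "val l a = num n" "ispair C n d"
  shows "sat a (is_length k c l)"
  unfolding is_length_def sat.simps(9) snd_conv
  by (rule exI[of _ "num d"]) (use assms in \<open>simp add: is_pair_def ispair_def val_fresh\<close>)

lemma fresh_apps: "fresh t \<le> k \<Longrightarrow> (\<And>s. s \<in> set ss \<Longrightarrow> fresh s \<le> k) \<Longrightarrow> fresh (apps t ss) \<le> k"
  by (induction ss arbitrary: t) auto

lemma fresh_zero_at: "fresh (zero_at \<sigma>) = 0"
  by (induction \<sigma>) auto

lemma elts_zero: "elts (map (\<lambda>\<sigma>. val (zero_at \<sigma>) a) \<sigma>s) \<sigma>s"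
proof -
  have "tm_ty (zero_at \<sigma>) = Some \<sigma> \<and> fv_tm (zero_at \<sigma>) = {}" for \<sigma>
    by (induction \<sigma>) auto
  then have "elt (emb \<sigma>) (val (zero_at \<sigma>) a)" for \<sigma>
    using good_dom[OF good_closed] by blast
  then show ?thesis by (simp add: list_all2_conv_all_nth)
qed

lemma set_vars_from: "v \<in> set (vars_from n \<sigma>) \<Longrightarrow> n \<le> fst v \<and> fst v < n + length (arg_tys \<sigma>)"
  by (cases v) (auto simp: vars_from_def dest!: set_zip_leftD)

text \<open>\<open>codeU\<close> codes argument by argument with the same length \<open>n\<close>
  everywhere, so the length read off at zero arguments is right, and the \<open>j\<close>-th
  component is that of \<open>h\<close> at all arguments.\<close>

lemma sat_mem_seq:
  assumes a: "envok a" and y: "val y a = codeU \<sigma> (num n) h"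
    and h: "elt (RF RN (emb \<sigma>)) h" and j: "j < n" and x: "per (emb \<sigma>) (val x a) (h \<bullet> num j)"
  shows "sat a (mem_seq \<sigma> x y)"
proof -
  let ?m = "max (fresh x) (fresh y)"
  let ?k = "?m + 2 + length (arg_tys \<sigma>)" and ?zs = "vars_from (?m + 2) \<sigma>"
  let ?a = "a((?m, N) := num n, (?m + 1, N) := num j)"
  have ok: "envok ?a" using a by (intro envP_upd) auto
  have code: "\<exists>g. appl (val y a) ws = num (enc (map g [0..<n])) \<and> appl (val x a) ws = num (g j)"
    if ws: "elts ws (arg_tys \<sigma>)" for ws
  proof -
    have hj: "elt (emb \<sigma>) (h \<bullet> num i)" for i using h by simp
    have "\<forall>i. \<exists>m. appl (h \<bullet> num i) ws = num m" using per_appl[OF hj ws] by blast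
    then obtain g where g: "\<And>i. appl (h \<bullet> num i) ws = num (g i)" by metis
    have "appl (val x a) ws = num (g j)" using per_appl[OF x ws] g by force
    then show ?thesis unfolding y using appl_codeU[OF ws g] by (auto simp: codeO_def)
  qed
  have "sat ?a (is_length ?k (apps y (map zero_at (arg_tys \<sigma>))) (V ?m N))"
  proof -
    obtain g where g: "appl (val y a) (map (\<lambda>\<sigma>. val (zero_at \<sigma>) ?a) (arg_tys \<sigma>)) = num (enc (map g [0..<n]))"
      using code[OF elts_zero] by blast
    obtain d where d: "ispair (enc (map g [0..<n])) n d"
      using codes_enc[of "map g [0..<n]"] unfolding codes_def by auto
    show ?thesis
    proof (rule sat_is_length[OF _ _ _ _ d])
      show "val (apps y (map zero_at (arg_tys \<sigma>))) ?a = num (enc (map g [0..<n]))"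
        using g by (simp add: val_apps comp_def val_fresh)
    qed (auto intro!: fresh_apps simp: fresh_zero_at)
  qed
  moreover have "sat ?a (All_list ?zs (is_comp ?k (apps y (map Var ?zs)) (V (?m + 1) N) (apps x (map Var ?zs))))"
  proof (rule sat_All_list[OF ok])
    fix a' assume a': "envok a'" "\<And>v. v \<notin> set ?zs \<Longrightarrow> a' v = ?a v"
    have eq: "a' v = a v" if "fst v < ?m" for v
    proof -
      have "v \<notin> set ?zs" "v \<noteq> (?m, N)" "v \<noteq> (?m + 1, N)" using that set_vars_from[of v "?m + 2" \<sigma>] by auto
      then show ?thesis using a'(2) by simp
    qed
    have x': "val x a' = val x a" and y': "val y a' = val y a"
      by (rule val_fv, rule eq, use fv_fresh in fastforce)+
    have "(?m + 1, N) \<notin> set ?zs" using set_vars_from[of "(?m + 1, N)" "?m + 2" \<sigma>] by auto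
    then have j': "a' (?m + 1, N) = num j" using a'(2) by simp
    obtain g where g: "appl (val y a) (map a' ?zs) = num (enc (map g [0..<n]))"
      "appl (val x a) (map a' ?zs) = num (g j)" using code[OF elts_vars_from[OF a'(1)]] by blast
    obtain d p b q where e: "ispair (enc (map g [0..<n])) n d" "ispair d p b"
      "p = q * Suc (Suc j * b) + g j" "g j \<le> Suc j * b"
      using codes_enc[of "map g [0..<n]"] j unfolding codes_def by auto
    have fr: "fresh (Var z) \<le> ?k" if "z \<in> set ?zs" for z
      using set_vars_from[OF that] by simp
    show "sat a' (is_comp ?k (apps y (map Var ?zs)) (V (?m + 1) N) (apps x (map Var ?zs)))"
      by (rule sat_is_comp[OF _ _ _ _ _ _ e])
         (use fr g j' in \<open>auto intro!: fresh_apps simp: val_apps comp_def x' y'\<close>)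
  qed
  moreover have "sat ?a (tsuc (V (?m + 1) N) \<^bold>\<le> V ?m N)" using j by simp
  moreover have "elt (emb N) (num i)" for i by simp
  ultimately show ?thesis unfolding mem_seq_def Let_def sat.simps(5,9) snd_conv by blast
qed

lemma internal_mem_seq: "internal (mem_seq \<sigma> x y)"
proof -
  have "internal (All_list xs A) = internal A" for xs A by (induction xs) auto
  then show ?thesis by (simp add: mem_seq_def Let_def is_length_def is_comp_def is_pair_def)
qed

definition lupto :: "U \<Rightarrow> U" where "lupto m = pair (un Suc m) (lam (\<lambda>j. j))"

text \<open>A number below a standard one occurs among the numbers up to some candidate; the length
  \<open>Suc m\<close> in \<open>lupto\<close> includes \<open>m\<close> itself.\<close>

lemma valid_st_le: "valid (interp (St N (V 0 N) \<^bold>\<and> V 1 N \<^bold>\<le> V 0 N \<^bold>\<longrightarrow> St N (V 1 N)))"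
proof -
  let ?S = "gst N (val (V 0 N))" and ?S' = "gst N (val (V 1 N))" and ?E = "interp (V 1 N \<^bold>\<le> V 0 N)"
  have ok: "game_ok ?S" "game_ok ?S'" "game_ok ?E"
    using game_ok_interp[of "St N (V 0 N)"] game_ok_interp[of "St N (V 1 N)"] game_ok_interp[of "V 1 N \<^bold>\<le> V 0 N"] by simp_all
  have cu: "cont lupto" unfolding lupto_def by (intro cont_intros)
  have Tu: "typed (RL RN) (\<lambda>i. lupto (x i))" if "typed RN x" for x
    unfolding lupto_def by (intro typed_pair typed_un that typed_lam cont_id)
  define H where "H p = lbind (pfst p \<bullet> num 0) lupto" for p
  have cH: "cont H" unfolding H_def by (intro cont_intros cu)
  have "valid (gimp ?S (gimp ?E ?S'))"
  proof (rule valid_imp_dial[where \<xi> = "\<lambda>p. pair (lsing (num 0)) (pair (lsing (num 0)) (H p))"],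
      simp_all only: gimp_def game_sel pfst_pair psnd_pair lmem_lsing interp.simps emb.simps)
    show "cont (\<lambda>p. pair (lsing (num 0)) (pair (lsing (num 0)) (H p)))" by (intro cont_pair cont_const cH)
    show "typed (RP (RL RN) (RP (RL RN) (RL RN))) (\<lambda>i. pair (lsing (num 0)) (pair (lsing (num 0)) (H (p i))))"
      if "typed (RP (RF RN (RL RN)) (RP (RF RN RN) RN)) p" for p
      unfolding H_def
      by (intro typed_pair typed_lsing typed_num, rule typed_lbind[OF typed_app[OF typed_pfst[OF that] typed_num] cu Tu])
    fix a f b assume a: "envok a" and f: "elt (RF RN (RL RN)) f"
      and R: "\<And>z. z \<in> {num 0} \<Longrightarrow> \<exists>z\<in>lmem (f \<bullet> z). per RN z (val (V 0 N) a)"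
    obtain m where m: "num m \<in> lmem (f \<bullet> num 0)" "a (0, N) = num m" using R by auto
    have f0: "elt (RL RN) (f \<bullet> num 0)" using per_app[OF f, of "num 0" "num 0"] by (simp only: per.simps) blast
    have "num k \<in> lmem (H (pair f b))" if "k \<le> m" for k
      unfolding H_def pfst_pair
    proof (rule lmem_lbind[OF f0 cu _ m(1)])
      show "elt (RL RN) (lupto x)" if "elt RN x" for x using that by (auto simp: lupto_def beta[OF cont_id])
      show "num k \<in> lmem (lupto (num m))" using that
        by (auto simp: lupto_def lmem_def beta[OF cont_id])
    qed
    then show "(\<exists>z\<in>{num 0}. \<not> le_U (val (V 1 N) a) (val (V 0 N) a)) \<or>
       (\<exists>x\<in>lmem (H (pair f b)). per RN x (val (V 1 N) a))"
      using m(2) env_num[OF a, of 1] by (auto simp: le_U_def)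
  qed
  from valid_uncurry[OF this ok(1,3,2)] show ?thesis by simp
qed

lemma valid_EFA_st:
  assumes "A \<in> EFA_st" "wf A"
  shows "valid (interp A)"
  using assms
proof cases
  case EFA
  then show ?thesis using internal_valid internal_EFA sat_EFA by blast
next
  case (EQ_all x C)
  have "val (Var x) = (\<lambda>a. a x)" by auto
  then have "interp A = gand (gimp (interp (AllSt x C)) (interp (AllSt x C))) (gimp (interp (AllSt x C)) (interp (AllSt x C)))"
    by (simp add: EQ_all gs_def)
  then show ?thesis using valid_iff_refl[OF game_ok_interp[of "AllSt x C"]] assms(2) EQ_all by simp
next
  case (EQ_ex x C)
  have "val (Var x) = (\<lambda>a. a x)" by auto
  then have "interp A = gand (gimp (interp (ExSt x C)) (interp (ExSt x C))) (gimp (interp (ExSt x C)) (interp (ExSt x C)))"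
    by (simp add: EQ_ex gs_def)
  then show ?thesis using valid_iff_refl[OF game_ok_interp[of "ExSt x C"]] assms(2) EQ_ex by simp
qed (use valid_st_eq valid_st_closed valid_st_app valid_st_le in \<open>simp_all\<close>)

section \<open>Quantifier-free choice\<close>

lemma tot_lam_un: "tot (lam (un g)) g"
  by (simp add: tot_def)

text \<open>The axiom is internal, so only its truth is at stake, and the choice functional just has
  to be an element, not a good one. Choosing at the canonical representative
  \<open>lam (un g)\<close> of the argument makes the choice extensional.\<close>

lemma valid_QF_AC:
  assumes "A \<in> QF_AC ty1 N" "wf A"
  shows "valid (interp A)"
  using assms(1)
proof cases
  case (1 C x i y j Y k)
  show ?thesis
  proof (rule internal_valid)
    show "internal A" using 1 internal_subst by simp
    fix a assume a: "envok a"
    have wfC: "wf C" using assms(2) 1(1) by simp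
    show "sat a A" unfolding 1(1) sat.simps
    proof (intro impI)
      assume ex: "\<forall>d. elt (emb (snd x)) d \<longrightarrow>
        (\<exists>e. elt (emb (snd y)) e \<and> sat (a(x := d, y := e)) C)"
      define F where "F g = (SOME m. sat (a(x := lam (un g), y := num m)) C)" for g
      have F: "sat (a(x := lam (un g), y := num (F g))) C" for g
      proof -
        have "elt (emb (snd x)) (lam (un g))"
          using tot_lam_un[of g] per_fun[of "lam (un g)" "lam (un g)"] 1 by auto
        then obtain e where "elt (emb (snd y)) e" "sat (a(x := lam (un g), y := e)) C" using ex by blast
        then have "\<exists>m. sat (a(x := lam (un g), y := num m)) C" using 1 by auto
        then show ?thesis unfolding F_def by (rule someI_ex)
      qed
      define Z where "Z = lam (orc (\<lambda>_. F) (num 0))"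
      have Z: "Z \<bullet> d = orc (\<lambda>_. F) (num 0) d" for d
        unfolding Z_def by (rule beta) (intro cont_intros)
      have Zelt: "elt (emb (snd Y)) Z" using 1(6) per_orc[of "num 0" "num 0"] Z by auto
      have "sat (a(Y := Z, x := d)) (subst C y (Var Y \<cdot> Var x))" if d: "elt (emb (snd x)) d" for d
      proof -
        obtain g where g: "tot d g" using d per_fun[of d d] 1 by auto
        have dg: "per (emb (snd x)) d (lam (un g))"
          using g tot_lam_un[of g] per_fun[of d "lam (un g)"] 1 by auto
        have neq: "x \<noteq> Y" "y \<noteq> Y" using 1 by auto
        have v: "val (Var Y \<cdot> Var x) (a(Y := Z, x := d)) = num (F g)"
          using neq by (simp add: Z orc_tot[OF g])
        have "sat (a(Y := Z, x := d)) (subst C y (Var Y \<cdot> Var x)) \<longleftrightarrow>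
            sat (a(Y := Z, x := d, y := num (F g))) C"
          unfolding sat_subst_qf[OF 1(3)] v ..
        also have "\<dots> \<longleftrightarrow> sat (a(x := d, y := num (F g))) C"
          by (rule sat_fv) (use 1(8) in auto)
        also have "\<dots> \<longleftrightarrow> sat (a(x := lam (un g), y := num (F g))) C"
          by (rule sat_per[OF 1(2) wfC]) (intro envP_upd a dg, use 1(5) in simp)
        finally show ?thesis using F by blast
      qed
      then show "\<exists>d. elt (emb (snd Y)) d \<and> (\<forall>e. elt (emb (snd x)) e \<longrightarrow>
          sat (a(Y := d, x := e)) (subst C y (Var Y \<cdot> Var x)))" using Zelt by blast
    qed
  qed
qed

section \<open>Idealization\<close>

lemma adequateE:
  assumes "adequate G Q"
  obtains t x where "good (RF (gX G) (gY G)) t"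
    "\<And>a x. envok a \<Longrightarrow> elt (gX G) x \<Longrightarrow> Q a \<Longrightarrow> gR G a x (t \<bullet> x)"
    "good (gX G) x" "\<And>a y. envok a \<Longrightarrow> elt (gY G) y \<Longrightarrow> gR G a x y \<Longrightarrow> Q a"
  using assms unfolding adequate_def by blast

lemma game_gimp [simp]:
  "gX (gimp G H) = RP (RF (gX G) (gY G)) (gX H)" "gY (gimp G H) = RP (RL (gX G)) (gY H)"
  "gR (gimp G H) a p q \<longleftrightarrow>
     (\<exists>x\<in>lmem (pfst q). \<not> gR G a x (pfst p \<bullet> x)) \<or> gR H a (psnd p) (psnd q)"
  by (simp_all add: gimp_def)

lemma game_gs [simp]:
  "gX (gs x) = RN" "gY (gs x) = RL (emb (snd x))"
  "gR (gs x) a z l \<longleftrightarrow> (\<exists>w\<in>lmem l. per (emb (snd x)) w (a x))"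
  by (simp_all add: gs_def)

lemma lmem_list_elt: "elt (RL r) l \<Longrightarrow> x \<in> lmem l \<Longrightarrow> elt r x"
  using lmem_elt per_dom1 by blast

lemma lmem_nth: "elt (RL r) l \<Longrightarrow> x \<in> lmem l \<Longrightarrow>
    \<exists>n j. pfst l = num n \<and> j < n \<and> x = psnd l \<bullet> num j \<and> elt (RF RN r) (psnd l)"
  by (auto simp: lmem_def)

text \<open>Playing against the strategy \<open>f0\<close>, the opponent of
  \<open>\<exists>x \<forall>\<^sup>s\<^sup>ty A\<close> names only finitely many candidates for
  \<open>y\<close>. Their code is a single object \<open>y'\<close> that can be declared standard,
  and the premise at this \<open>y'\<close> yields one \<open>x\<close> for all of them.\<close>

lemma valid_Idealization:
  assumes "F \<in> Idealization" "wf F"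
  shows "valid (interp F)"
  using assms(1)
proof cases
  case (1 A x i \<sigma> y j \<tau> y' k)
  let ?mem = "mem_seq \<tau> (Var y) (Var y')"
  let ?C = "Ex x (All y (?mem \<^bold>\<longrightarrow> A))"
  have "wf A" using assms(2) 1(1) by simp
  obtain t2 z2 where t2: "good (RF (gX (interp A)) (gY (interp A))) t2"
    "\<And>a x. envok a \<Longrightarrow> elt (gX (interp A)) x \<Longrightarrow> sat a A \<Longrightarrow> gR (interp A) a x (t2 \<bullet> x)"
    using adequate_interp[OF 1(2)] by (rule adequateE) blast
  have "internal ?C" using 1(2) internal_mem_seq by simp
  from adequate_interp[OF this] obtain z1 where z1: "good (gX (interp ?C)) z1"
    "\<And>a y. envok a \<Longrightarrow> elt (gY (interp ?C)) y \<Longrightarrow> gR (interp ?C) a z1 y \<Longrightarrow> sat a ?C"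
    by (rule adequateE) blast
  let ?X1 = "gX (interp ?C)" and ?X2 = "gX (interp A)" and ?Y1 = "gY (interp ?C)" and ?Y2 = "gY (interp A)"
  let ?R = "gex x (gall y (gimp (gs y) (interp A)))"
  let ?XC = "RP (RF RN (RL (emb \<tau>))) ?X2" and ?YC = "RP (RL RN) ?Y2"
  let ?XL = "RP (RF RN (RL (emb \<tau>))) ?X1" and ?YL = "RP (RL RN) ?Y1"
  have sndy: "snd y = \<tau>" "snd y' = \<tau>" "snd x = \<sigma>" using 1 by simp_all
  \<comment> \<open>The strategy for the inner implication: ask for the candidates for
    \<open>y\<close> at the dummy challenge and win the internal matrix by its truth.\<close>
  define f0 where "f0 = lam (\<lambda>c. pair (lsing (num 0)) (t2 \<bullet> psnd c))"
  have f0_app: "f0 \<bullet> c = pair (lsing (num 0)) (t2 \<bullet> psnd c)" for c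
    unfolding f0_def by (rule beta) (intro cont_intros)
  have f0: "good (RF ?XC ?YC) f0" unfolding f0_def
    by (rule typed_lam, intro cont_intros, rule typed_pair[OF typed_lsing[OF typed_num] typed_app[OF t2(1) typed_psnd]])
  define s where "s b = lbind (b \<bullet> f0) (\<lambda>c. pfst c \<bullet> num 0)" for b
  have cs: "cont s" unfolding s_def by (intro cont_intros)
  have cp: "cont (\<lambda>c. pfst c \<bullet> num 0)" by (intro cont_intros)
  have Ts: "typed (RL (emb \<tau>)) (\<lambda>i. s (b i))" if "typed (RF (RF ?XC ?YC) (RL ?XC)) b" for b
    unfolding s_def
    by (rule typed_lbind[OF typed_app[OF that f0] cp]) (rule typed_app[OF typed_pfst typed_num])
  \<comment> \<open>All candidates named by the opponent become one coded sequence, the instance of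
    \<open>y'\<close> at which the premise is used.\<close>
  define w where "w b = codeU \<tau> (pfst (s b)) (psnd (s b))" for b
  have cw: "cont w" unfolding w_def by (intro cont_intros cs)
  have Tw: "typed (emb \<tau>) (\<lambda>i. w (b i))" if "typed (RF (RF ?XC ?YC) (RL ?XC)) b" for b
    unfolding w_def by (rule typed_codeU[OF typed_pfst[OF Ts[OF that]] typed_psnd[OF Ts[OF that]]])
  \<comment> \<open>A challenge to the premise that offers \<open>w b\<close> as the only candidate
    for \<open>y'\<close> and tests the truth of the internal conclusion by
    \<open>z1\<close>.\<close>
  define u where "u b = pair (lam (\<lambda>_. lsing (w b))) z1" for b
  have cu: "cont u" unfolding u_def by (intro cont_intros cw)
  have Tu: "typed ?XL (\<lambda>i. u (b i))" if "typed (RF (RF ?XC ?YC) (RL ?XC)) b" for b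
    unfolding u_def by (rule typed_pair[OF _ z1(1)], rule typed_lam, rule cont_const, rule typed_lsing[OF Tw[OF that]])
  have "valid (gimp (gall y' (gimp (gs y') (interp ?C))) ?R)"
  proof (rule valid_imp_dial[where \<xi> = "\<lambda>p. pair (lsing (u (psnd p))) (lsing f0)"],
      simp_all only: game_sel game_gimp game_gs sndy gex_def pfst_pair psnd_pair lmem_lsing)
    show "cont (\<lambda>p. pair (lsing (u (psnd p))) (lsing f0))"
      by (intro cont_pair cont_lsing cont_comp[OF cu] cont_intros)
    show "typed (RP (RL ?XL) (RL (RF ?XC ?YC))) (\<lambda>i. pair (lsing (u (psnd (p i)))) (lsing f0))"
      if "typed (RP (RF ?XL ?YL) (RF (RF ?XC ?YC) (RL ?XC))) p" for p
      by (intro typed_pair typed_lsing f0 Tu typed_psnd[OF that])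
    fix a f b
    assume a: "envok a" and f: "elt (RF ?XL ?YL) f" and b: "elt (RF (RF ?XC ?YC) (RL ?XC)) b"
      and R: "\<And>x. x \<in> {u b} \<Longrightarrow> \<forall>d. elt (emb \<tau>) d \<longrightarrow>
          (\<exists>z\<in>lmem (pfst (f \<bullet> x)). \<not> (\<exists>w\<in>lmem (pfst x \<bullet> z). per (emb \<tau>) w ((a(y' := d)) y'))) \<or>
          gR (interp ?C) (a(y' := d)) (psnd x) (psnd (f \<bullet> x))"
    have eu: "elt ?XL (u b)" by (rule typed_per[where F = u, OF _ b]) (rule Tu)
    have ew: "elt (emb \<tau>) (w b)" by (rule typed_per[where F = w, OF _ b]) (rule Tw)
    have es: "elt (RL (emb \<tau>)) (s b)" by (rule typed_per[where F = s, OF _ b]) (rule Ts)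
    have eY: "elt ?Y1 (psnd (f \<bullet> u b))" using per_app[OF f eu] by (simp only: per.simps(3))
    have e': "envok (a(y' := w b))" using a ew sndy by (intro envP_upd) auto
    have u: "pfst (u b) \<bullet> z = lsing (w b)" "psnd (u b) = z1" for z
      by (simp_all add: u_def beta[OF cont_const])
    have "gR (interp ?C) (a(y' := w b)) z1 (psnd (f \<bullet> u b))"
      using R[OF singletonI, rule_format, OF ew] ew by (auto simp: u simp del: interp.simps)
    then have "sat (a(y' := w b)) ?C" by (rule z1(2)[OF e' eY])
    then obtain d where d: "elt (emb \<sigma>) d"
      "\<And>e. elt (emb \<tau>) e \<Longrightarrow> sat (a(y' := w b, x := d, y := e)) ?mem \<Longrightarrow> sat (a(y' := w b, x := d, y := e)) A"
      using sndy by auto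
    have main: "sat (a(x := d, y := e)) A"
      if c: "c \<in> lmem (b \<bullet> f0)" "elt (emb \<tau>) e" "g \<in> lmem (pfst c \<bullet> num 0)" "per (emb \<tau>) g e" for c e g
    proof -
      have bf: "elt (RL ?XC) (b \<bullet> f0)" using per_app[OF b good_dom[OF f0]] .
      have "g \<in> lmem (s b)" unfolding s_def
      proof (rule lmem_lbind[OF bf cp _ c(1) c(3), of "emb \<tau>"])
        fix c assume "elt ?XC c"
        then have "elt (RF RN (RL (emb \<tau>))) (pfst c)" by (simp only: per.simps(3))
        from per_app[OF this, of "num 0" "num 0"] show "elt (RL (emb \<tau>)) (pfst c \<bullet> num 0)"
          by (simp only: per.simps) blast
      qed
      from lmem_nth[OF es this] obtain n j where n: "pfst (s b) = num n" "j < n"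
        "g = psnd (s b) \<bullet> num j" "elt (RF RN (emb \<tau>)) (psnd (s b))" by blast
      let ?e = "a(y' := w b, x := d, y := e)"
      have "sat ?e ?mem"
      proof (rule sat_mem_seq[OF _ _ n(4) n(2)])
        show "envok ?e" by (rule envP_upd[OF envP_upd[OF e']]) (use d(1) c(2) sndy in simp_all)
        show "val (Var y') ?e = codeU \<tau> (num n) (psnd (s b))" using 1 n(1) by (auto simp: w_def)
        show "per (emb \<tau>) (val (Var y) ?e) (psnd (s b) \<bullet> num j)" using per_sym[OF c(4)] n(3) by simp
      qed
      then have "sat ?e A" using d(2) c(2) by blast
      moreover have "sat ?e A = sat (a(x := d, y := e)) A" by (rule sat_fv) (use 1(9) in auto)
      ultimately show ?thesis by blast
    qed
    have "gR (interp A) (a(x := d, y := e)) (psnd c) (t2 \<bullet> psnd c)"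
      if "c \<in> lmem (b \<bullet> f0)" "elt (emb \<tau>) e" "g \<in> lmem (pfst c \<bullet> num 0)" "per (emb \<tau>) g e" for c e g
    proof (rule t2(2)[OF _ _ main[OF that]])
      show "envok (a(x := d, y := e))" using a d(1) that(2) sndy by (intro envP_upd) auto
      have "elt ?XC c" using lmem_list_elt[OF per_app[OF b good_dom[OF f0]] that(1)] .
      then show "elt ?X2 (psnd c)" by simp
    qed
    then show "\<exists>F\<in>{f0}. \<not> (\<forall>d. elt (emb \<sigma>) d \<longrightarrow> (\<exists>c\<in>lmem (b \<bullet> F).
        \<not> (\<forall>e. elt (emb \<tau>) e \<longrightarrow>
          (\<exists>z\<in>lmem (pfst (F \<bullet> c)). \<not> (\<exists>w\<in>lmem (pfst c \<bullet> z). per (emb \<tau>) w ((a(x := d, y := e)) y))) \<or>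
          gR (interp A) (a(x := d, y := e)) (psnd c) (psnd (F \<bullet> c)))))"
      using d(1) by (auto simp: f0_app)
  qed
  then show ?thesis unfolding 1(1) by (simp add: gex_def)
qed

section \<open>Choice with finitely many candidates, \<open>HAC_int\<close>\<close>

definition hacg :: "var \<Rightarrow> var \<Rightarrow> fm \<Rightarrow> game" where
  "hacg x y A = Game (emb (snd x)) (RL (emb (snd y)))
     (\<lambda>a v l. \<exists>w\<in>lmem l. sat (a(x := v, y := w)) A)"

definition exg :: "var \<Rightarrow> fm \<Rightarrow> game" where
  "exg y A = Game RN (RL (emb (snd y))) (\<lambda>a v l. \<exists>w\<in>lmem l. sat (a(y := w)) A)"

lemma game_hac [simp]:
  "gX (hacg x y A) = emb (snd x)" "gY (hacg x y A) = RL (emb (snd y))"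
  "gR (hacg x y A) a v l \<longleftrightarrow> (\<exists>w\<in>lmem l. sat (a(x := v, y := w)) A)"
  "gX (exg y A) = RN" "gY (exg y A) = RL (emb (snd y))"
  "gR (exg y A) a v l \<longleftrightarrow> (\<exists>w\<in>lmem l. sat (a(y := w)) A)"
  by (simp_all add: hacg_def exg_def)

lemma game_ok_hacg:
  assumes "internal A" "wf A"
  shows "game_ok (hacg x y A)"
proof (rule lmem_mono_joins)
  show "ext (hacg x y A)" unfolding ext_def
  proof (intro allI impI, simp only: game_hac)
    fix a a' v v' l l' assume e: "envP a a'" "per (emb (snd x)) v v'" and l: "per (RL (emb (snd y))) l l'"
      and "\<exists>w\<in>lmem l. sat (a(x := v, y := w)) A"
    then obtain w where w: "w \<in> lmem l" "sat (a(x := v, y := w)) A" by blast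
    obtain w' where w': "w' \<in> lmem l'" "per (emb (snd y)) w w'" using lmem_elt[OF l w(1)] by blast
    have "envP (a(x := v, y := w)) (a'(x := v', y := w'))" by (intro envP_upd e w')
    from sat_per[OF assms this] w(2) w'(1) show "\<exists>w\<in>lmem l'. sat (a'(x := v', y := w)) A" by blast
  qed
qed auto

lemma game_ok_exg:
  assumes "internal A" "wf A"
  shows "game_ok (exg y A)"
proof (rule lmem_mono_joins)
  show "ext (exg y A)" unfolding ext_def
  proof (intro allI impI, simp only: game_hac)
    fix a a' l l' assume e: "envP a a'" and l: "per (RL (emb (snd y))) l l'"
      and "\<exists>w\<in>lmem l. sat (a(y := w)) A"
    then obtain w where w: "w \<in> lmem l" "sat (a(y := w)) A" by blast
    obtain w' where w': "w' \<in> lmem l'" "per (emb (snd y)) w w'" using lmem_elt[OF l w(1)] by blast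
    have "envP (a(y := w)) (a'(y := w'))" by (intro envP_upd e w')
    from sat_per[OF assms this] w(2) w'(1) show "\<exists>w\<in>lmem l'. sat (a'(y := w)) A" by blast
  qed
qed auto

text \<open>The test challenge shows the internal matrix true at the standard object, hence also at
  the candidate related to it. The candidate list thus contains a true witness.\<close>

lemma valid_exg:
  assumes A: "internal A" "wf A"
  shows "valid (gimp (interp (ExSt y A)) (exg y A))"
proof -
  let ?E = "exg y A" and ?X = "gX (interp A)" and ?Y = "gY (interp A)"
  note ok = game_ok_gs[of y] game_ok_interp[OF A(2)] game_ok_exg[OF A]
  obtain z where z: "good ?X z" "\<And>a y. envok a \<Longrightarrow> elt ?Y y \<Longrightarrow> gR (interp A) a z y \<Longrightarrow> sat a A"
    using adequate_interp[OF A(1)] by (rule adequateE) blast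
  have "valid (gimp (gs y) (gimp (interp A) ?E))"
  proof (rule valid_imp_dial[where \<xi> = "\<lambda>p. pair (lsing (num 0)) (pair (lsing z) (pfst p \<bullet> num 0))"],
      simp_all only: game_sel game_gimp game_gs game_hac pfst_pair psnd_pair lmem_lsing)
    show "cont (\<lambda>p. pair (lsing (num 0)) (pair (lsing z) (pfst p \<bullet> num 0)))" by (intro cont_intros)
    show "typed (RP (RL RN) (RP (RL ?X) (RL (emb (snd y)))))
       (\<lambda>i. pair (lsing (num 0)) (pair (lsing z) (pfst (p i) \<bullet> num 0)))"
      if "typed (RP (RF RN (RL (emb (snd y)))) (RP (RF ?X ?Y) RN)) p" for p
      by (intro typed_pair typed_lsing typed_num z(1), rule typed_app[OF typed_pfst[OF that] typed_num])
    fix a f b assume a: "envok a" and b: "elt (RP (RF ?X ?Y) RN) b"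
      and R: "\<And>x. x \<in> {num 0} \<Longrightarrow> \<exists>w\<in>lmem (f \<bullet> x). per (emb (snd y)) w (a y)"
    obtain w where w: "w \<in> lmem (f \<bullet> num 0)" "per (emb (snd y)) w (a y)" using R by blast
    have "elt (RF ?X ?Y) (pfst b)" using b by (simp only: per.simps(3))
    from per_app[OF this good_dom[OF z(1)]]
    have "gR (interp A) a z (pfst b \<bullet> z) \<Longrightarrow> sat a A" by (rule z(2)[OF a])
    moreover have "sat a A \<longleftrightarrow> sat (a(y := w)) A"
      using sat_per[OF A envP_upd[OF a per_sym[OF w(2)]]] by simp
    ultimately show "(\<exists>x\<in>{z}. \<not> gR (interp A) a x (pfst b \<bullet> x)) \<or> (\<exists>w\<in>lmem (f \<bullet> num 0). sat (a(y := w)) A)"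
      using w(1) by blast
  qed
  then have "valid (gimp (gand (gs y) (interp A)) ?E)" by (rule valid_uncurry) (rule ok)+
  then have "valid (gimp (gex y (gand (gs y) (interp A))) ?E)"
    by (rule valid_ex_elim) (use ok in \<open>auto intro: game_ok_intros\<close>)
  then show ?thesis by simp
qed

text \<open>The challenge \<open>u v\<close> declares \<open>v\<close> to be the only candidate for
  \<open>x\<close>. The premise thereby becomes a plain function from \<open>x\<close> to lists of
  candidates for \<open>y\<close>.\<close>

lemma valid_hacg:
  assumes A: "internal A" "wf A"
  shows "valid (gimp (interp (AllSt x (ExSt y A))) (hacg x y A))"
proof -
  let ?E = "exg y A"
  note ok = game_ok_gs game_ok_interp[of "ExSt y A"] A game_ok_exg[OF A] game_ok_hacg[OF A]
  have 1: "valid (gimp (interp (AllSt x (ExSt y A))) (gall x (gimp (gs x) ?E)))"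
    unfolding interp.simps(10)
    by (intro valid_gall_mono valid_gimp_mono valid_exg game_ok_derived)
       (use ok in \<open>simp_all del: interp.simps\<close>)
  let ?X = "RP (RF RN (RL (emb (snd x)))) RN"
  define u where "u v = pair (lam (\<lambda>_. lsing v)) (num 0)" for v
  have cu: "cont u" unfolding u_def by (intro cont_intros)
  have Tu: "typed ?X (\<lambda>i. u (v i))" if "typed (emb (snd x)) v" for v
    unfolding u_def by (rule typed_pair[OF _ typed_num], rule typed_lam, rule cont_const, rule typed_lsing[OF that])
  have 2: "valid (gimp (gall x (gimp (gs x) ?E)) (hacg x y A))"
  proof (rule valid_imp_dial[where \<xi> = "\<lambda>p. pair (lsing (u (psnd p))) (psnd (pfst p \<bullet> u (psnd p)))"],
      simp_all only: game_sel game_gimp game_gs game_hac pfst_pair psnd_pair lmem_lsing)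
    show "cont (\<lambda>p. pair (lsing (u (psnd p))) (psnd (pfst p \<bullet> u (psnd p))))"
      by (intro cont_pair cont_lsing cont_psnd cont_app cont_comp[OF cu] cont_pfst cont_id)
    show "typed (RP (RL ?X) (RL (emb (snd y)))) (\<lambda>i. pair (lsing (u (psnd (p i)))) (psnd (pfst (p i) \<bullet> u (psnd (p i)))))"
      if "typed (RP (RF ?X (RP (RL RN) (RL (emb (snd y))))) (emb (snd x))) p" for p
      by (rule typed_pair[OF typed_lsing[OF Tu[OF typed_psnd[OF that]]]
            typed_psnd[OF typed_app[OF typed_pfst[OF that] Tu[OF typed_psnd[OF that]]]]])
    fix a f v assume "elt (emb (snd x)) v"
      and "\<And>z. z \<in> {u v} \<Longrightarrow> \<forall>d. elt (emb (snd x)) d \<longrightarrow>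
        (\<exists>k\<in>lmem (pfst (f \<bullet> z)). \<not> (\<exists>w\<in>lmem (pfst z \<bullet> k). per (emb (snd x)) w ((a(x := d)) x))) \<or>
        (\<exists>w\<in>lmem (psnd (f \<bullet> z)). sat (a(x := d, y := w)) A)"
    then show "\<exists>w\<in>lmem (psnd (f \<bullet> u v)). sat (a(x := v, y := w)) A"
      by (auto simp: u_def beta[OF cont_const])
  qed
  show ?thesis
    by (rule valid_imp_trans[OF 1 2])
       (use A in \<open>auto intro!: game_ok_intros game_ok_gs game_ok_exg game_ok_hacg game_ok_interp simp del: interp.simps\<close>)
qed

lemma taut_neg_and:
  assumes "game_ok S" "game_ok M"
  shows "valid (gimp (gneg (gand S M)) (gimp S (gneg M)))"
  unfolding gand_def gimp_def sequent_two[symmetric]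
  by ((rule sequent_axh; use assms in \<open>auto intro: game_ok_intros; fail\<close>) |
      rule sequent_rules sequent_rot | (simp only: append.simps) | (use assms in \<open>auto intro: game_ok_intros; fail\<close>))+

lemma elt_RN_ex: "(\<exists>d. elt RN d \<and> Q d) \<longleftrightarrow> (\<exists>n. Q (num n))"
  by auto

text \<open>By \<open>valid_hacg\<close> the premise supplies \<open>h\<close>, mapping
  \<open>x\<close> to a list of candidates for \<open>y\<close>. \<open>G h\<close> replaces each
  list by its code, and \<open>GG h\<close> codes the one-element sequence of \<open>G h\<close>.
  With \<open>GG h\<close> for \<open>Y\<close> the entries of the list become components of
  \<open>Y[x]\<close>, and \<open>Y\<close> is computed from \<open>h\<close> by a typed operation,
  so it may be declared standard.\<close>

lemma valid_HAC:
  assumes "F \<in> HAC_int" "wf F"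
  shows "valid (interp F)"
  using assms(1)
proof cases
  case (1 A x i \<sigma> y j \<tau> Y k)
  have A: "internal A" "wf A" using 1 assms(2) by simp_all
  let ?mu = "mem_union_app \<sigma> \<tau> (Var y) (Var Y) (Var x)"
  let ?D = "Ex y (?mu \<^bold>\<and> A)"
  have snds: "snd x = \<sigma>" "snd y = \<tau>" "snd Y = \<sigma> \<rightarrow> \<tau>" using 1 by simp_all
  have neq: "Y \<noteq> x" "Y \<noteq> y" "x \<noteq> y" using 1 by auto
  have wfD: "wf ?D" using assms(2) 1(1) by simp
  have "internal ?D" using A internal_mem_seq by (simp add: mem_union_app_def Let_def)
  from adequate_interp[OF this] obtain t3 where t3: "good (RF (gX (interp ?D)) (gY (interp ?D))) t3"
    "\<And>a x. envok a \<Longrightarrow> elt (gX (interp ?D)) x \<Longrightarrow> sat a ?D \<Longrightarrow> gR (interp ?D) a x (t3 \<bullet> x)"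
    by (rule adequateE) blast
  let ?X3 = "gX (interp ?D)" and ?Y3 = "gY (interp ?D)" and ?s = "emb \<sigma>" and ?t = "emb \<tau>"
  let ?XM = "RP (RF RN (RL ?s)) ?X3" and ?YM = "RP (RL RN) ?Y3"
  let ?XR = "RP (RF RN (RL (RF ?s ?t))) (RF ?XM ?YM)" and ?YR = "RP (RL RN) (RL ?XM)"
  let ?M = "gall x (gimp (gs x) (interp ?D))"
  let ?R = "gall Y (gimp (gs Y) (gneg ?M))"
  let ?T = "RP (RF ?s (RL ?t)) (RF ?XR ?YR)"
  define G where "G h = lam (\<lambda>v. codeU \<tau> (pfst (h \<bullet> v)) (psnd (h \<bullet> v)))" for h
  have G_app: "G h \<bullet> v = codeU \<tau> (pfst (h \<bullet> v)) (psnd (h \<bullet> v))" for h v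
    unfolding G_def by (rule beta) (intro cont_intros)
  have cG: "cont G" unfolding G_def by (intro cont_intros)
  have TG: "typed (emb (\<sigma> \<rightarrow> \<tau>)) (\<lambda>i. G (h i))" if "typed (RF ?s (RL ?t)) h" for h
    unfolding G_def emb.simps
    by (rule typed_lam, intro cont_intros, rule typed_codeU; (rule typed_pfst typed_psnd), erule typed_app[OF that])
  define GG where "GG h = codeU (\<sigma> \<rightarrow> \<tau>) (num 1) (lam (\<lambda>_. G h))" for h
  have cGG: "cont GG" unfolding GG_def by (intro cont_codeU cont_const cont_lam cG)
  have TGG: "typed (emb (\<sigma> \<rightarrow> \<tau>)) (\<lambda>i. GG (h i))" if "typed (RF ?s (RL ?t)) h" for h
    unfolding GG_def by (rule typed_codeU[OF typed_num], rule typed_lam, rule cont_const, rule TG[OF that])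
  define f0 where "f0 = lam (\<lambda>c. pair (lsing (num 0)) (t3 \<bullet> psnd c))"
  have f0_app: "f0 \<bullet> c = pair (lsing (num 0)) (t3 \<bullet> psnd c)" for c
    unfolding f0_def by (rule beta) (intro cont_intros)
  have f0: "good (RF ?XM ?YM) f0" unfolding f0_def
    by (rule typed_lam, intro cont_intros, rule typed_pair[OF typed_lsing[OF typed_num] typed_app[OF t3(1) typed_psnd]])
  define u where "u h = pair (lam (\<lambda>_. lsing (GG h))) f0" for h
  have cu: "cont u" unfolding u_def by (intro cont_pair cont_lam cont_lsing cont_const cGG)
  have Tu: "typed ?XR (\<lambda>i. u (h i))" if "typed (RF ?s (RL ?t)) h" for h
    unfolding u_def
    by (rule typed_pair[OF _ f0], rule typed_lam, rule cont_const, rule typed_lsing[OF TGG[OF that, unfolded emb.simps]])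
  define d where "d p = psnd (psnd p \<bullet> u (pfst p))" for p
  have cd: "cont d" unfolding d_def by (intro cont_psnd cont_app cont_id cont_comp[OF cu] cont_pfst)
  have Td: "typed (RL ?XM) (\<lambda>i. d (p i))" if "typed ?T p" for p
    unfolding d_def by (rule typed_psnd[OF typed_app[OF typed_psnd[OF that] Tu[OF typed_pfst[OF that]]]])
  \<comment> \<open>The opponent names finitely many candidates for \<open>x\<close>; these are the
    arguments at which the premise is consulted.\<close>
  define vs where "vs p = lbind (d p) (\<lambda>c. pfst c \<bullet> num 0)" for p
  have cp: "cont (\<lambda>c. pfst c \<bullet> num 0)" by (intro cont_intros)
  have cvs: "cont vs" unfolding vs_def by (intro cont_lbind cd cont_const cp)
  have Tvs: "typed (RL ?s) (\<lambda>i. vs (p i))" if "typed ?T p" for p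
    unfolding vs_def by (rule typed_lbind[OF Td[OF that] cp]) (rule typed_app[OF typed_pfst typed_num])
  \<comment> \<open>In \<open>gneg ?R\<close> the standardness of \<open>Y\<close> guards an
    implication instead of being a conjunct, which gives simpler moves; propositional logic restores
    the conjunction at the end.\<close>
  have "valid (gimp (hacg x y A) (gneg ?R))"
  proof (rule valid_imp_dial[where \<xi> = "\<lambda>p. pair (vs p) (lsing (u (pfst p)))"],
      simp_all only: game_sel game_gimp game_gs game_hac snds pfst_pair psnd_pair lmem_lsing emb.simps)
    show "cont (\<lambda>p. pair (vs p) (lsing (u (pfst p))))"
      by (intro cont_pair cvs cont_lsing cont_comp[OF cu] cont_pfst cont_id)
    show "typed (RP (RL ?s) (RL ?XR)) (\<lambda>i. pair (vs (p i)) (lsing (u (pfst (p i)))))" if "typed ?T p" for p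
      by (rule typed_pair[OF Tvs[OF that] typed_lsing[OF Tu[OF typed_pfst[OF that]]]])
    fix a h F
    assume a: "envok a" and h: "elt (RF ?s (RL ?t)) h" and F: "elt (RF ?XR ?YR) F"
      and R: "\<And>v. v \<in> lmem (vs (pair h F)) \<Longrightarrow> \<exists>w\<in>lmem (h \<bullet> v). sat (a(x := v, y := w)) A"
    let ?p = "pair h F"
    have p: "elt ?T ?p" using h F by simp
    have eG: "elt (emb (\<sigma> \<rightarrow> \<tau>)) (G h)" by (rule typed_per[where F = G, OF _ h]) (rule TG)
    have eGG: "elt (RF ?s ?t) (GG h)" 
      using typed_per[where F = GG, OF _ h] TGG unfolding emb.simps by blast
    have ed: "elt (RL ?XM) (d ?p)" by (rule typed_per[where F = d, OF _ p]) (rule Td)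
    have "gR ?M (a(Y := GG h)) c (f0 \<bullet> c)" if c: "c \<in> lmem (d ?p)" for c
      unfolding game_sel game_gimp game_gs snds f0_app pfst_pair psnd_pair lmem_lsing
    proof (intro allI impI)
      fix v assume v: "elt ?s v"
      show "(\<exists>z\<in>{num 0}. \<not> (\<exists>w\<in>lmem (pfst c \<bullet> z). per ?s w ((a(Y := GG h, x := v)) x))) \<or>
         gR (interp ?D) (a(Y := GG h, x := v)) (psnd c) (t3 \<bullet> psnd c)"
      proof (cases "\<exists>v'\<in>lmem (pfst c \<bullet> num 0). per ?s v' v")
        case True
        then obtain v' where v': "v' \<in> lmem (pfst c \<bullet> num 0)" "per ?s v' v" by blast
        have "v' \<in> lmem (vs ?p)" unfolding vs_def
        proof (rule lmem_lbind[OF ed cp _ c v'(1), of ?s])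
          fix c assume "elt ?XM c"
          then have "elt (RF RN (RL ?s)) (pfst c)" by (simp only: per.simps(3))
          from per_app[OF this, of "num 0" "num 0"] show "elt (RL ?s) (pfst c \<bullet> num 0)"
            by (simp only: per.simps) blast
        qed
        from R[OF this] obtain w where w: "w \<in> lmem (h \<bullet> v')" "sat (a(x := v', y := w)) A" by blast
        have hv: "per (RL ?t) (h \<bullet> v') (h \<bullet> v)" by (rule per_app[OF h v'(2)])
        from lmem_nth[OF per_dom1[OF hv] w(1)] obtain n j where n: "pfst (h \<bullet> v') = num n" "j < n"
          "w = psnd (h \<bullet> v') \<bullet> num j" by blast
        have n': "pfst (h \<bullet> v) = num n" "per ?t w (psnd (h \<bullet> v) \<bullet> num j)"
          "elt (RF RN ?t) (psnd (h \<bullet> v))"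
          using hv n per_dom2[OF hv] by simp_all
        have ew: "elt ?t w" using per_dom1[OF n'(2)] .
        let ?e = "a(Y := GG h, x := v, y := w)"
        have ee: "envok (a(Y := GG h, x := v))"
          using a v eGG snds by (intro envP_upd) simp_all
        have ok: "envok ?e" using ee ew snds by (intro envP_upd[OF ee]) simp
        have "sat ?e A"
        proof -
          have "sat (a(x := v', y := w)) A = sat (a(x := v, y := w)) A"
            by (rule sat_per[OF A]) (intro envP_upd a, use v'(2) ew snds in simp_all)
          also have "\<dots> = sat ?e A" by (rule sat_fv) (use 1(7) in auto)
          finally show ?thesis using w(2) by blast
        qed
        moreover have "sat ?e ?mu" 
        proof -
          let ?f = "(max (fresh (Var y)) (max (fresh (Var Y)) (fresh (Var x))), \<sigma> \<rightarrow> \<tau>)"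
          have f: "?f \<noteq> y" "?f \<noteq> Y" "?f \<noteq> x" by (cases y, cases Y, cases x, auto)+
          have okf: "envok (?e(?f := G h))" using eG by (intro envP_upd[OF ok]) simp
          have "sat (?e(?f := G h)) (mem_seq (\<sigma> \<rightarrow> \<tau>) (Var ?f) (Var Y))"
          proof (rule sat_mem_seq[OF okf, of _ _ 1 "lam (\<lambda>_. G h)" 0])
            show "val (Var Y) (?e(?f := G h)) = codeU (\<sigma> \<rightarrow> \<tau>) (num 1) (lam (\<lambda>_. G h))"
              using f neq by (simp add: GG_def del: codeU.simps)
            show "elt (RF RN (emb (\<sigma> \<rightarrow> \<tau>))) (lam (\<lambda>_. G h))"
              unfolding per.simps(2)[of RN] beta[OF cont_const] using eG by blast
            show "per (emb (\<sigma> \<rightarrow> \<tau>)) (val (Var ?f) (?e(?f := G h))) (lam (\<lambda>_. G h) \<bullet> num 0)"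
              unfolding beta[OF cont_const] using eG by simp
          qed simp
          moreover have "sat (?e(?f := G h)) (mem_seq \<tau> (Var y) (Var ?f \<cdot> Var x))"
          proof (rule sat_mem_seq[OF okf _ n'(3) n(2)])
            show "val (Var ?f \<cdot> Var x) (?e(?f := G h)) = codeU \<tau> (num n) (psnd (h \<bullet> v))"
              using f neq by (simp add: G_app n')
            show "per ?t (val (Var y) (?e(?f := G h))) (psnd (h \<bullet> v) \<bullet> num j)" using f n'(2) by simp
          qed
          ultimately show ?thesis unfolding mem_union_app_def Let_def sat.simps(5,9) snd_conv
            using eG by blast
        qed
        ultimately have "sat (a(Y := GG h, x := v)) ?D" using ew snds by auto
        moreover have "elt ?X3 (psnd c)" using lmem_list_elt[OF ed c] by simp
        ultimately show ?thesis using t3(2)[OF ee] by blast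
      qed auto
    qed
    then have "\<not> gR ?R a (u h) (F \<bullet> u h)"
      using eGG snds by (auto simp: u_def d_def beta[OF cont_const] simp del: interp.simps)
    then show "\<exists>z\<in>{u h}. \<not> (\<forall>e. elt (RF ?s ?t) e \<longrightarrow>
       (\<exists>k\<in>lmem (pfst (F \<bullet> z)). \<not> (\<exists>w\<in>lmem (pfst z \<bullet> k). per (RF ?s ?t) w ((a(Y := e)) Y))) \<or>
       (\<exists>c\<in>lmem (psnd (F \<bullet> z)). \<not> (\<forall>e'. elt ?s e' \<longrightarrow>
          (\<exists>k\<in>lmem (pfst (psnd z \<bullet> c)). \<not> (\<exists>w\<in>lmem (pfst c \<bullet> k). per ?s w ((a(Y := e, x := e')) x))) \<or>
          gR (interp ?D) (a(Y := e, x := e')) (psnd c) (psnd (psnd z \<bullet> c)))))"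
      using snds by (simp del: interp.simps)
  qed
  have okM: "game_ok ?M" "game_ok (gs Y)" by (intro game_ok_gall game_ok_derived(2) game_ok_gs game_ok_interp wfD)+
  have nn: "valid (gimp (gneg (gand (gs Y) ?M)) (gimp (gs Y) (gneg ?M)))"
    by (rule taut_neg_and[OF okM(2,1)])
  have "valid (gimp (gneg ?R) (gex Y (gand (gs Y) ?M)))"
    unfolding gex_def by (intro valid_gneg_mono valid_gall_mono nn game_ok_intros okM)
  with \<open>valid (gimp (hacg x y A) (gneg ?R))\<close>
  have "valid (gimp (hacg x y A) (gex Y (gand (gs Y) ?M)))"
    by (rule valid_imp_trans) (intro game_ok_intros okM game_ok_hacg A)+
  moreover have "game_ok (interp (AllSt x (ExSt y A)))" by (rule game_ok_interp) (use A in simp)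
  moreover have "game_ok (gex Y (gand (gs Y) ?M))" by (intro game_ok_derived okM)
  ultimately have "valid (gimp (interp (AllSt x (ExSt y A))) (gex Y (gand (gs Y) ?M)))"
    using valid_imp_trans[OF valid_hacg[OF A] _ _ game_ok_hacg[OF A]] by blast
  then show ?thesis unfolding 1(1) by simp
qed

section \<open>The separation: \<open>\<exists>\<^sup>2\<close> is standard, \<mu> is not\<close>

lemma B0_minus_valid: "B0_minus \<turnstile> A \<Longrightarrow> valid (interp A)"
  by (erule soundness)
     (auto simp: B0_minus_def intro: valid_EFA_st valid_Idealization valid_HAC valid_QF_AC)

definition ex2O :: "nat \<Rightarrow> (nat \<Rightarrow> nat) \<Rightarrow> nat" where
  "ex2O _ g = (if \<exists>x. g x = 0 then 0 else 1)"

lemma bddO_ex2O: "bddO ex2O"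
  unfolding bddO_def ex2O_def by (auto intro: exI[of _ 1])

text \<open>A witness is an element of the structure for which the language may have no term, so it
  enters through the environment and not by substitution.\<close>

definition gsub :: "var \<Rightarrow> U \<Rightarrow> game \<Rightarrow> game" where
  "gsub v d G = Game (gX G) (gY G) (\<lambda>a. gR G (a(v := d)))"

lemma game_gsub [simp]:
  "gX (gsub v d G) = gX G" "gY (gsub v d G) = gY G"
  "gR (gsub v d G) a = gR G (a(v := d))"
  by (simp_all add: gsub_def)

lemma game_ok_gsub:
  assumes "game_ok G" "elt (emb (snd v)) d"
  shows "game_ok (gsub v d G)"
proof -
  from assms obtain J where J: "ext G" "joins G J" unfolding game_ok_def by blast
  have "ext (gsub v d G)"
    using J(1) envP_upd[OF _ assms(2)] unfolding ext_def game_gsub by blast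
  moreover have "joins (gsub v d G) J"
    using J(2) envP_upd[OF _ assms(2)] unfolding joins_def game_gsub by blast
  ultimately show ?thesis unfolding game_ok_def by blast
qed

lemma valid_gex_gsub:
  assumes "valid (gsub v d G)" "elt (emb (snd v)) d"
  shows "valid (gex v G)"
proof -
  from assms(1) obtain s where s: "good (RF (gX G) (gY G)) s"
    "\<And>a x. envok a \<Longrightarrow> elt (gX G) x \<Longrightarrow> gR G (a(v := d)) x (s \<bullet> x)"
    unfolding valid_def game_gsub by blast
  show ?thesis unfolding gex_def
  proof (rule validI[of "\<lambda>_. lsing s"], simp_all only: game_sel lmem_lsing)
    fix a f assume a: "envok a" and f: "elt (RF (RF (gX G) (gY G)) (RL (gX G))) f"
    have "elt (gX G) x" if "x \<in> lmem (f \<bullet> s)" for x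
      using lmem_list_elt[OF per_app[OF f good_dom[OF s(1)]] that] .
    then show "\<exists>z\<in>{s}. \<not> (\<forall>d. elt (emb (snd v)) d \<longrightarrow> (\<exists>x\<in>lmem (f \<bullet> z). \<not> gR G (a(v := d)) x (z \<bullet> x)))"
      using s(2)[OF a] assms(2) by blast
  qed (intro cont_const typed_lsing s)+
qed

lemma valid_ExSt:
  assumes "internal A" "wf A" "good (emb (snd v)) d" "\<And>a. envok a \<Longrightarrow> sat (a(v := d)) A"
  shows "valid (interp (ExSt v A))"
proof -
  have d: "elt (emb (snd v)) d" by (rule good_dom[OF assms(3)])
  obtain t where t: "good (RF (gX (interp A)) (gY (interp A))) t"
    "\<And>a x. envok a \<Longrightarrow> elt (gX (interp A)) x \<Longrightarrow> sat a A \<Longrightarrow> gR (interp A) a x (t \<bullet> x)"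
    using adequate_interp[OF assms(1)] by (rule adequateE) blast
  have 1: "valid (gsub v d (interp A))" unfolding valid_def game_gsub
  proof (intro exI[of _ t] conjI allI impI t(1))
    fix a x assume "envok a" "elt (gX (interp A)) x"
    then show "gR (interp A) (a(v := d)) x (t \<bullet> x)" using t(2)[OF envP_upd[OF _ d]] assms(4) by blast
  qed
  have 2: "valid (gsub v d (gs v))"
    by (rule validI[of "\<lambda>_. lsing d"], simp_all only: game_gsub game_gs lmem_lsing)
       (use d in \<open>auto intro!: cont_const typed_lsing assms(3)\<close>)
  have ok: "game_ok (gsub v d (gs v))" "game_ok (gsub v d (interp A))"
    by (intro game_ok_gsub game_ok_gs game_ok_interp d assms)+
  have "valid (gand (gsub v d (gs v)) (gsub v d (interp A)))"
    by (rule valid_mp[OF valid_mp[OF taut(5)[OF ok ok(1)] 2] 1]) (intro ok game_ok_derived)+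
  moreover have "gand (gsub v d (gs v)) (gsub v d (interp A)) = gsub v d (gand (gs v) (interp A))"
    by (simp add: gand_def gneg_def gor_def gsub_def)
  ultimately have "valid (gsub v d (gand (gs v) (interp A)))" by simp
  from valid_gex_gsub[OF this d] show ?thesis by simp
qed

lemma TJ_standard:
  assumes "snd \<phi> = ty2"
  shows "valid (interp (ExSt \<phi> (TJ \<phi>)))"
proof (rule valid_ExSt)
  let ?d = "lam (orc ex2O (num 0))"
  have app: "?d \<bullet> f = orc ex2O (num 0) f" for f by (rule beta) (intro cont_intros)
  show "good (emb (snd \<phi>)) ?d" unfolding assms emb.simps
    by (rule typed_lam, intro cont_intros) (rule typed_orc[OF typed_num _ bddO_ex2O])
  fix a
  have neq: "\<phi> \<noteq> (0, ty1)" using assms by auto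
  have "(orc ex2O (num 0) f = num 0) \<longleftrightarrow> (\<exists>n. f \<bullet> num n = num 0)"
    if f: "elt (RF RN RN) f" for f
  proof -
    obtain g where g: "tot f g" using f per_fun by blast
    then have "f \<bullet> num n = num (g n)" for n by (simp add: tot_def)
    then show ?thesis by (simp add: orc_tot[OF g] ex2O_def)
  qed
  then show "sat (a(\<phi> := ?d)) (TJ \<phi>)"
    unfolding TJ_def sat.simps snd_conv emb.simps elt_RN_ex val.simps cval.simps
    using neq app by simp
qed (use assms in \<open>simp_all add: TJ_def\<close>)

text \<open>A standard \<open>\<mu>\<close> would be bounded on the characteristic functions of the singletons.\<close>

lemma MU_not_standard:
  assumes "snd \<mu> = ty2"
  shows "\<not> valid (interp (ExSt \<mu> (MU \<mu>)))"
proof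
  have MU: "internal (MU \<mu>)" "wf (MU \<mu>)" using assms by (simp_all add: MU_def)
  assume "valid (interp (ExSt \<mu> (MU \<mu>)))"
  then have "valid (exg \<mu> (MU \<mu>))"
    by (rule valid_mp[OF valid_exg[OF MU] _ game_ok_interp game_ok_exg[OF MU]]) (use MU in simp)
  then obtain t where t: "good (RF RN (RL (emb ty2))) t"
    "\<And>a. envok a \<Longrightarrow> \<exists>w\<in>lmem (t \<bullet> num 0). sat (a(\<mu> := w)) (MU \<mu>)"
    unfolding valid_def game_hac assms by (metis per.simps(1))
  define a :: env where "a = (\<lambda>v. dfl (emb (snd v)))"
  have "envok a" unfolding envP_def a_def using good_dom[OF typed_dfl] by blast
  from t(2)[OF this] obtain w where w: "w \<in> lmem (t \<bullet> num 0)" "sat (a(\<mu> := w)) (MU \<mu>)" by blast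
  \<comment> \<open>Boundedness passes from the strategy to its list of candidates and from there to
    each entry, in particular to the one that satisfies \<open>MU\<close>.\<close>
  have "good (RL (emb ty2)) (t \<bullet> num 0)" by (rule typed_app[OF t(1) typed_num])
  then have "good (emb ty2) w"
    using w(1) typed_app[OF typed_psnd typed_num] unfolding lmem_def by blast
  then have B: "Bd (RF (RF RN RN) RN) (\<lambda>_. w)" by (simp add: typed_def)
  define f where "f i = lam (un (\<lambda>k. if k = i then 0 else 1))" for i :: nat
  have f: "f i \<bullet> num k = num (if k = i then 0 else 1)" for i k by (simp add: f_def)
  have "Bd (RF RN RN) f" unfolding Bd.simps
  proof (intro allI impI)
    fix z :: "nat \<Rightarrow> U" assume "\<exists>m. \<forall>i. \<exists>n\<le>m. z i = num n"
    then have "\<exists>k. z i = num k" for i by blast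
    then have "\<exists>n\<le>1. f i \<bullet> z i = num n" for i using f[of i] by (metis le_numeral_extra(4) zero_le_one)
    then show "\<exists>m. \<forall>i. \<exists>n\<le>m. f i \<bullet> z i = num n" by blast
  qed
  with B have "Bd RN (\<lambda>i. w \<bullet> f i)" unfolding Bd.simps(2) by blast
  then obtain m where m: "\<And>i. \<exists>n\<le>m. w \<bullet> f i = num n" by auto
  \<comment> \<open>The only zero of this function is \<open>m + 1\<close>, just beyond the bound
    \<open>m\<close> on all the values of \<open>w\<close> at the family.\<close>
  let ?f = "f (Suc m)"
  obtain n where n: "n \<le> m" "w \<bullet> ?f = num n" using m by blast
  have "elt (RF RN RN) ?f" using f by auto
  moreover have "\<mu> \<noteq> (0, ty1)" using assms by auto
  ultimately have "?f \<bullet> num (Suc m) = num 0 \<longrightarrow> ?f \<bullet> (w \<bullet> ?f) = num 0"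
    using w(2) by (auto simp: MU_def simp del: per.simps(2))
  then show False using n by (simp add: f)
qed

lemma not_B0_minus:
  assumes "snd \<phi> = ty2" "snd \<mu> = ty2"
  shows "\<not> (B0_minus \<turnstile> ExSt \<phi> (TJ \<phi>) \<^bold>\<longleftrightarrow> ExSt \<mu> (MU \<mu>))"
proof
  assume pr: "B0_minus \<turnstile> ExSt \<phi> (TJ \<phi>) \<^bold>\<longleftrightarrow> ExSt \<mu> (MU \<mu>)"
  let ?T = "interp (ExSt \<phi> (TJ \<phi>))" and ?M = "interp (ExSt \<mu> (MU \<mu>))"
  have ok: "game_ok ?T" "game_ok ?M" using assms by (intro game_ok_interp, simp add: TJ_def MU_def)+
  have "valid (gand (gimp ?T ?M) (gimp ?M ?T))" using B0_minus_valid[OF pr] by simp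
  then have "valid (gimp ?T ?M)"
    by (rule valid_mp[OF taut(3)[OF game_ok_derived(2)[OF ok] game_ok_derived(2)[OF ok(2,1)] ok(1)]])
       (intro game_ok_derived ok)+
  then have "valid ?M" using TJ_standard[OF assms(1)] ok by (rule valid_mp)
  with MU_not_standard[OF assms(2)] show False ..
qed

section \<open>Derivations in the calculus\<close>

definition Tru :: fm where "Tru = (Bot \<^bold>\<longrightarrow> Bot)"

primrec Conj :: "fm list \<Rightarrow> fm" where
  "Conj [] = Tru"
| "Conj (A # \<Gamma>) = (A \<^bold>\<and> Conj \<Gamma>)"

abbreviation wfs :: "fm list \<Rightarrow> bool" where "wfs \<Gamma> \<equiv> \<forall>A\<in>set \<Gamma>. wf A"

lemma wf_Conj: "wf (Conj \<Gamma>) \<longleftrightarrow> wfs \<Gamma>"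
  by (induction \<Gamma>) (auto simp: Tru_def)

lemma fv_Conj: "fv (Conj \<Gamma>) = (\<Union>A\<in>set \<Gamma>. fv A)"
  by (induction \<Gamma>) (auto simp: Tru_def)

lemma imp_trans: "T \<turnstile> A \<^bold>\<longrightarrow> C \<Longrightarrow> T \<turnstile> C \<^bold>\<longrightarrow> D \<Longrightarrow> T \<turnstile> A \<^bold>\<longrightarrow> D"
  using imp_S imp_K proves.mp proves_wf by (metis wf.simps(7))

lemma imp_refl: "wf A \<Longrightarrow> T \<turnstile> A \<^bold>\<longrightarrow> A"
  using imp_S[of A "A \<^bold>\<longrightarrow> A" A T] imp_K[of A "A \<^bold>\<longrightarrow> A" T] imp_K[of A A T] proves.mp
  by (metis wf.simps(7))

lemma imp_flip: "T \<turnstile> A \<^bold>\<longrightarrow> C \<^bold>\<longrightarrow> D \<Longrightarrow> T \<turnstile> C \<^bold>\<longrightarrow> A \<^bold>\<longrightarrow> D"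
proof -
  assume a: "T \<turnstile> A \<^bold>\<longrightarrow> C \<^bold>\<longrightarrow> D"
  then have w: "wf A" "wf C" "wf D" using proves_wf by force+
  have "T \<turnstile> (A \<^bold>\<longrightarrow> C) \<^bold>\<longrightarrow> A \<^bold>\<longrightarrow> D" using proves.mp[OF imp_S a] w by blast
  then show ?thesis using imp_trans[OF imp_K] w by blast
qed

text \<open>The hypotheses form one conjunction on the left of an implication, the shape in which
  the quantifier rules of the calculus are stated.\<close>

definition pr :: "fm set \<Rightarrow> fm list \<Rightarrow> fm \<Rightarrow> bool" where
  "pr T \<Gamma> A \<longleftrightarrow> (T \<turnstile> Conj \<Gamma> \<^bold>\<longrightarrow> A)"

lemma pr_wfs: "pr T \<Gamma> A \<Longrightarrow> wfs \<Gamma>" and pr_wf: "pr T \<Gamma> A \<Longrightarrow> wf A"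
  unfolding pr_def using proves_wf wf_Conj by (metis wf.simps(7))+

lemma pr_thm: "T \<turnstile> A \<Longrightarrow> wfs \<Gamma> \<Longrightarrow> pr T \<Gamma> A"
  unfolding pr_def using proves.mp[OF imp_K] proves_wf wf_Conj by blast

lemma pr_Nil: "pr T [] A \<Longrightarrow> T \<turnstile> A"
  unfolding pr_def Conj.simps Tru_def using proves.mp imp_refl[of Bot T] by auto

lemma pr_mp: "pr T \<Gamma> (A \<^bold>\<longrightarrow> C) \<Longrightarrow> pr T \<Gamma> A \<Longrightarrow> pr T \<Gamma> C"
  unfolding pr_def
proof -
  assume a: "T \<turnstile> Conj \<Gamma> \<^bold>\<longrightarrow> A \<^bold>\<longrightarrow> C" "T \<turnstile> Conj \<Gamma> \<^bold>\<longrightarrow> A"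
  then have "wf (Conj \<Gamma>)" "wf A" "wf C" using proves_wf by force+
  then show "T \<turnstile> Conj \<Gamma> \<^bold>\<longrightarrow> C" using proves.mp[OF proves.mp[OF imp_S a(1)] a(2)] by blast
qed

lemma pr_thm_mp: "T \<turnstile> A \<^bold>\<longrightarrow> C \<Longrightarrow> pr T \<Gamma> A \<Longrightarrow> pr T \<Gamma> C"
  unfolding pr_def using imp_trans by blast

lemma pr_hyp: "A \<in> set \<Gamma> \<Longrightarrow> wfs \<Gamma> \<Longrightarrow> pr T \<Gamma> A"
proof (induction \<Gamma>)
  case (Cons D \<Gamma>)
  have w: "wf D" "wf (Conj \<Gamma>)" using Cons.prems(2) wf_Conj by auto
  show ?case
  proof (cases "A = D")
    case True
    then show ?thesis unfolding pr_def using and_left w by simp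
  next
    case False
    then have "T \<turnstile> Conj \<Gamma> \<^bold>\<longrightarrow> A" using Cons unfolding pr_def by simp
    then show ?thesis unfolding pr_def using imp_trans[OF and_right] w by simp
  qed
qed simp

lemma pr_impI: "pr T (A # \<Gamma>) C \<Longrightarrow> pr T \<Gamma> (A \<^bold>\<longrightarrow> C)"
proof -
  assume a: "pr T (A # \<Gamma>) C"
  then have w: "wf A" "wf (Conj \<Gamma>)" "wf C" using pr_wf pr_wfs wf_Conj by fastforce+
  let ?G = "Conj \<Gamma>"
  have 1: "T \<turnstile> A \<^bold>\<and> ?G \<^bold>\<longrightarrow> C" using a by (simp add: pr_def)
  have "T \<turnstile> ?G \<^bold>\<longrightarrow> A \<^bold>\<and> ?G \<^bold>\<longrightarrow> C" using proves.mp[OF imp_K 1] w by simp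
  then have 2: "T \<turnstile> (?G \<^bold>\<longrightarrow> A \<^bold>\<and> ?G) \<^bold>\<longrightarrow> ?G \<^bold>\<longrightarrow> C" using proves.mp[OF imp_S] w by simp
  have "T \<turnstile> A \<^bold>\<longrightarrow> ?G \<^bold>\<longrightarrow> C" using imp_trans[OF and_intro 2] w by simp
  then show ?thesis unfolding pr_def by (rule imp_flip)
qed

lemma pr_impE: "pr T \<Gamma> (A \<^bold>\<longrightarrow> C) \<Longrightarrow> pr T (A # \<Gamma>) C"
proof -
  assume a: "pr T \<Gamma> (A \<^bold>\<longrightarrow> C)"
  then have w: "wf A" "wf (Conj \<Gamma>)" using pr_wf pr_wfs wf_Conj by fastforce+
  then have "T \<turnstile> A \<^bold>\<and> Conj \<Gamma> \<^bold>\<longrightarrow> A \<^bold>\<longrightarrow> C" using imp_trans[OF and_right] a unfolding pr_def by blast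
  moreover have "T \<turnstile> A \<^bold>\<and> Conj \<Gamma> \<^bold>\<longrightarrow> A" using and_left w by blast
  ultimately have "pr T (A # \<Gamma>) (A \<^bold>\<longrightarrow> C)" "pr T (A # \<Gamma>) A" by (simp_all add: pr_def)
  then show ?thesis by (rule pr_mp)
qed

lemma pr_mono:
  assumes "pr T \<Gamma> A" "set \<Gamma> \<subseteq> set \<Delta>" "wfs \<Delta>"
  shows "pr T \<Delta> A"
  using assms
proof (induction \<Gamma> arbitrary: A)
  case Nil
  then show ?case using pr_thm[OF pr_Nil] by blast
next
  case (Cons D \<Gamma>)
  then have "pr T \<Delta> (D \<^bold>\<longrightarrow> A)" using pr_impI by auto
  moreover have "pr T \<Delta> D" using Cons.prems by (intro pr_hyp) auto
  ultimately show ?case by (rule pr_mp)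
qed

lemma pr_andI: "pr T \<Gamma> A \<Longrightarrow> pr T \<Gamma> C \<Longrightarrow> pr T \<Gamma> (A \<^bold>\<and> C)"
  using pr_mp pr_thm_mp[OF and_intro] pr_wf by blast

lemma pr_and1: "pr T \<Gamma> (A \<^bold>\<and> C) \<Longrightarrow> pr T \<Gamma> A" and pr_and2: "pr T \<Gamma> (A \<^bold>\<and> C) \<Longrightarrow> pr T \<Gamma> C"
  using pr_thm_mp[OF and_left] pr_thm_mp[OF and_right] pr_wf by (metis wf.simps(5))+

lemma pr_or1: "pr T \<Gamma> A \<Longrightarrow> wf C \<Longrightarrow> pr T \<Gamma> (A \<^bold>\<or> C)"
  and pr_or2: "pr T \<Gamma> C \<Longrightarrow> wf A \<Longrightarrow> pr T \<Gamma> (A \<^bold>\<or> C)"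
  using pr_thm_mp[OF or_left] pr_thm_mp[OF or_right] pr_wf by blast+

lemma pr_orE: "pr T \<Gamma> (A \<^bold>\<or> C) \<Longrightarrow> pr T (A # \<Gamma>) D \<Longrightarrow> pr T (C # \<Gamma>) D \<Longrightarrow> pr T \<Gamma> D"
proof -
  assume a: "pr T \<Gamma> (A \<^bold>\<or> C)" "pr T (A # \<Gamma>) D" "pr T (C # \<Gamma>) D"
  then have w: "wf A" "wf C" "wf D" using pr_wf by fastforce+
  have "pr T \<Gamma> (A \<^bold>\<or> C \<^bold>\<longrightarrow> D)"
    using pr_mp[OF pr_thm_mp[OF or_elim[OF w] pr_impI[OF a(2)]] pr_impI[OF a(3)]] .
  then show ?thesis using a(1) by (rule pr_mp)
qed

lemma pr_botE: "pr T \<Gamma> Bot \<Longrightarrow> wf A \<Longrightarrow> pr T \<Gamma> A"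
  by (rule pr_thm_mp[OF bot_elim])

lemma pr_ccontr: "pr T (Neg A # \<Gamma>) Bot \<Longrightarrow> wf A \<Longrightarrow> pr T \<Gamma> A"
  using pr_thm_mp[OF proves.classical] pr_impI by blast

lemma pr_allI: "pr T \<Gamma> A \<Longrightarrow> (\<And>G. G \<in> set \<Gamma> \<Longrightarrow> x \<notin> fv G) \<Longrightarrow> pr T \<Gamma> (All x A)"
  unfolding pr_def by (rule all_intro) (auto simp: fv_Conj)

lemma pr_allE: "pr T \<Gamma> (All x A) \<Longrightarrow> tm_ty t = Some (snd x) \<Longrightarrow> free_for t x A \<Longrightarrow> pr T \<Gamma> (subst A x t)"
  using pr_thm_mp[OF all_inst] pr_wf by (metis wf.simps(8))

lemma pr_exI: "pr T \<Gamma> (subst A x t) \<Longrightarrow> wf A \<Longrightarrow> tm_ty t = Some (snd x) \<Longrightarrow> free_for t x A \<Longrightarrow> pr T \<Gamma> (Ex x A)"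
  using pr_thm_mp[OF ex_witness] by blast

lemma pr_exE:
  assumes "pr T \<Gamma> (Ex x A)" "pr T (A # \<Gamma>) C" "\<And>G. G \<in> set \<Gamma> \<Longrightarrow> x \<notin> fv G" "x \<notin> fv C"
  shows "pr T \<Gamma> C"
proof -
  have "T \<turnstile> A \<^bold>\<longrightarrow> Conj \<Gamma> \<^bold>\<longrightarrow> C" using pr_impI[OF assms(2)] unfolding pr_def by (rule imp_flip)
  then have "T \<turnstile> Ex x A \<^bold>\<longrightarrow> Conj \<Gamma> \<^bold>\<longrightarrow> C"
    by (rule ex_elim) (use assms(3,4) in \<open>auto simp: fv_Conj\<close>)
  then show ?thesis using pr_mp[OF pr_thm_mp[OF _ assms(1)]] pr_hyp unfolding pr_def
    by (metis assms(1) imp_refl pr_def pr_mp pr_wfs wf_Conj)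
qed

lemma gen: "T \<turnstile> A \<Longrightarrow> T \<turnstile> All x A"
proof -
  assume "T \<turnstile> A"
  then have "pr T [] A" by (intro pr_thm) auto
  then have "pr T [] (All x A)" by (rule pr_allI) simp
  then show ?thesis by (rule pr_Nil)
qed

lemma inst1: "T \<turnstile> A \<Longrightarrow> tm_ty t = Some (snd x) \<Longrightarrow> free_for t x A \<Longrightarrow> T \<turnstile> subst A x t"
  using gen[of T A x] all_inst[of A t x T] proves.mp proves_wf by blast

section \<open>Simultaneous instantiation of quantifier-free theorems\<close>

primrec msub_tm :: "(var \<Rightarrow> tm) \<Rightarrow> tm \<Rightarrow> tm" where
  "msub_tm \<theta> (Var x) = \<theta> x"
| "msub_tm \<theta> (Con c) = Con c"
| "msub_tm \<theta> (s \<cdot> t) = msub_tm \<theta> s \<cdot> msub_tm \<theta> t"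

primrec msub :: "(var \<Rightarrow> tm) \<Rightarrow> fm \<Rightarrow> fm" where
  "msub \<theta> Bot = Bot"
| "msub \<theta> (s \<^bold>= t) = (msub_tm \<theta> s \<^bold>= msub_tm \<theta> t)"
| "msub \<theta> (s \<^bold>\<le> t) = (msub_tm \<theta> s \<^bold>\<le> msub_tm \<theta> t)"
| "msub \<theta> (St \<sigma> t) = St \<sigma> (msub_tm \<theta> t)"
| "msub \<theta> (A \<^bold>\<and> C) = (msub \<theta> A \<^bold>\<and> msub \<theta> C)"
| "msub \<theta> (A \<^bold>\<or> C) = (msub \<theta> A \<^bold>\<or> msub \<theta> C)"
| "msub \<theta> (A \<^bold>\<longrightarrow> C) = (msub \<theta> A \<^bold>\<longrightarrow> msub \<theta> C)"
| "msub \<theta> (All x A) = All x A"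
| "msub \<theta> (Ex x A) = Ex x A"
| "msub \<theta> (AllSt x A) = AllSt x A"
| "msub \<theta> (ExSt x A) = ExSt x A"

lemma msub_Var: "quantifier_free A \<Longrightarrow> msub Var A = A"
proof -
  have "msub_tm Var t = t" for t by (induction t) auto
  then show "quantifier_free A \<Longrightarrow> msub Var A = A" by (induction A) auto
qed

lemma subst_msub: "quantifier_free A \<Longrightarrow> subst (msub \<theta> A) x t = msub (\<lambda>v. subst_tm (\<theta> v) x t) A"
proof -
  have "subst_tm (msub_tm \<theta> s) x t = msub_tm (\<lambda>v. subst_tm (\<theta> v) x t) s" for s by (induction s) auto
  then show "quantifier_free A \<Longrightarrow> ?thesis" by (induction A) auto
qed

lemma msub_cong: "quantifier_free A \<Longrightarrow> (\<And>v. v \<in> fv A \<Longrightarrow> \<theta> v = \<theta>' v) \<Longrightarrow> msub \<theta> A = msub \<theta>' A"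
proof -
  have "(\<And>v. v \<in> fv_tm t \<Longrightarrow> \<theta> v = \<theta>' v) \<Longrightarrow> msub_tm \<theta> t = msub_tm \<theta>' t" for t by (induction t) auto
  then show "quantifier_free A \<Longrightarrow> (\<And>v. v \<in> fv A \<Longrightarrow> \<theta> v = \<theta>' v) \<Longrightarrow> ?thesis" by (induction A) auto
qed

lemma qf_msub: "quantifier_free (msub \<theta> A) = quantifier_free A"
  by (induction A) auto

lemma qf_free_for: "quantifier_free A \<Longrightarrow> free_for t x A"
  by (induction A) auto

lemma finite_fv: "finite (fv A)"
proof -
  have "finite (fv_tm t)" for t by (induction t) auto
  then show ?thesis by (induction A) auto
qed

lemma subst_tm_id: "x \<notin> fv_tm s \<Longrightarrow> subst_tm s x t = s"
  by (induction s) auto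

text \<open>Replacing the variables one after another agrees with replacing them simultaneously,
  because the inserted terms contain none of the listed variables.\<close>

lemma inst_list:
  assumes "T \<turnstile> msub \<theta> A" "quantifier_free A" "\<And>x. x \<in> set xs \<Longrightarrow> tm_ty (\<eta> x) = Some (snd x)"
    "\<And>x y. x \<in> set xs \<Longrightarrow> y \<in> set xs \<Longrightarrow> y \<notin> fv_tm (\<eta> x)"
  shows "T \<turnstile> msub (\<lambda>v. msub_tm (\<lambda>x. if x \<in> set xs then \<eta> x else Var x) (\<theta> v)) A"
  using assms(3,4)
proof (induction xs)
  case Nil
  have "msub_tm (\<lambda>x. Var x) t = t" for t by (induction t) auto
  then show ?case using assms(1) by simp
next
  case (Cons y ys)
  show ?case
  proof (cases "y \<in> set ys")
    case True
    then have "set (y # ys) = set ys" by auto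
    then show ?thesis using Cons by simp
  next
    case False
    have "T \<turnstile> subst (msub (\<lambda>v. msub_tm (\<lambda>x. if x \<in> set ys then \<eta> x else Var x) (\<theta> v)) A) y (\<eta> y)"
      using Cons assms(2) by (intro inst1 qf_free_for) (auto simp: qf_msub)
    moreover have "subst_tm (msub_tm (\<lambda>x. if x \<in> set ys then \<eta> x else Var x) t) y (\<eta> y) =
        msub_tm (\<lambda>x. if x \<in> set (y # ys) then \<eta> x else Var x) t" for t
    proof (induction t)
      case (Var x)
      have "x \<in> set ys \<Longrightarrow> subst_tm (\<eta> x) y (\<eta> y) = \<eta> x" using Cons.prems(2) by (intro subst_tm_id) auto
      then show ?case using False by auto
    qed auto
    ultimately show ?thesis by (simp add: subst_msub[OF assms(2)])
  qed
qed

text \<open>Arbitrary terms may contain the variables being replaced. All variables are first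
  renamed to names from \<open>K\<close> on, above every name in \<open>A\<close> and in the
  inserted terms, so that both rounds of replacement are free of interference.\<close>

lemma inst_qf:
  assumes "T \<turnstile> A" "quantifier_free A" "\<And>v. tm_ty (\<theta> v) = Some (snd v)"
  shows "T \<turnstile> msub \<theta> A"
proof -
  obtain xs where xs: "set xs = fv A" using finite_fv finite_list by blast
  have "finite (fst ` (fv A \<union> (\<Union>v\<in>fv A. fv_tm (\<theta> v))))"
  proof -
    have "finite (fv_tm t)" for t by (induction t) auto
    then show ?thesis using finite_fv by blast
  qed
  then obtain K where K: "\<And>v. v \<in> fv A \<union> (\<Union>v\<in>fv A. fv_tm (\<theta> v)) \<Longrightarrow> fst v < K"
    using finite_nat_set_iff_bounded by (metis image_eqI)
  define \<rho> where "\<rho> v = (fst v + K, snd v)" for v :: var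
  have "T \<turnstile> msub (\<lambda>v. msub_tm (\<lambda>x. if x \<in> set xs then Var (\<rho> x) else Var x) (Var v)) A"
  proof (rule inst_list)
    fix x y assume "x \<in> set xs" "y \<in> set xs"
    then have "fst y < K" using K xs by blast
    then show "y \<notin> fv_tm (Var (\<rho> x))" by (auto simp: \<rho>_def)
  qed (use assms in \<open>auto simp: msub_Var \<rho>_def\<close>)
  moreover have "msub (\<lambda>v. msub_tm (\<lambda>x. if x \<in> set xs then Var (\<rho> x) else Var x) (Var v)) A = msub (\<lambda>v. Var (\<rho> v)) A"
    by (rule msub_cong[OF assms(2)]) (use xs in auto)
  ultimately have 1: "T \<turnstile> msub (\<lambda>v. Var (\<rho> v)) A" by simp
  define \<eta> where "\<eta> v = \<theta> (fst v - K, snd v)" for v :: var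
  have \<eta>: "\<eta> (\<rho> v) = \<theta> v" for v by (simp add: \<eta>_def \<rho>_def)
  let ?ys = "map \<rho> xs"
  have "T \<turnstile> msub (\<lambda>v. msub_tm (\<lambda>x. if x \<in> set ?ys then \<eta> x else Var x) (Var (\<rho> v))) A"
  proof (rule inst_list[OF 1 assms(2)])
    fix x y assume "x \<in> set ?ys" "y \<in> set ?ys"
    then obtain v w where v: "v \<in> fv A" "x = \<rho> v" "w \<in> fv A" "y = \<rho> w" using xs by auto
    have "\<not> fst y < K" using v by (simp add: \<rho>_def)
    then show "y \<notin> fv_tm (\<eta> x)" using K[of y] v \<eta> by auto
  qed (auto simp: \<eta>_def assms(3))
  moreover have "msub (\<lambda>v. msub_tm (\<lambda>x. if x \<in> set ?ys then \<eta> x else Var x) (Var (\<rho> v))) A = msub \<theta> A"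
    by (rule msub_cong[OF assms(2)]) (use xs \<eta> in auto)
  ultimately show ?thesis by simp
qed

definition th :: "(var \<times> tm) list \<Rightarrow> var \<Rightarrow> tm" where
  "th xs v = (case map_of xs v of Some t \<Rightarrow> t | None \<Rightarrow> Var v)"

lemma th_simps [simp]: "th [] v = Var v" "th ((x, t) # xs) v = (if v = x then t else th xs v)"
  by (auto simp: th_def)

lemma inst_th:
  assumes "T \<turnstile> A" "quantifier_free A" "\<forall>(x, t)\<in>set xs. tm_ty t = Some (snd x)"
  shows "T \<turnstile> msub (th xs) A"
proof (rule inst_qf[OF assms(1,2)])
  fix v show "tm_ty (th xs v) = Some (snd v)"
    using assms(3) by (induction xs) auto
qed

section \<open>Arithmetic in EFA\<close>

locale efa =
  fixes T :: "fm set"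
  assumes EFA: "EFA \<subseteq> T"
begin

lemma ax: "A \<in> EFA \<Longrightarrow> wf A \<Longrightarrow> T \<turnstile> A"
  using EFA by (intro proves.axiom) auto

abbreviation isN :: "tm \<Rightarrow> bool" where "isN t \<equiv> tm_ty t = Some N"

lemma eq_ty: "pr T \<Gamma> (s \<^bold>= t) \<Longrightarrow> isN s \<and> isN t"
  and le_ty: "pr T \<Gamma> (s \<^bold>\<le> t) \<Longrightarrow> isN s \<and> isN t"
  by (drule pr_wf, simp)+

lemma EQ_refl: "isN t \<Longrightarrow> wfs \<Gamma> \<Longrightarrow> pr T \<Gamma> (t \<^bold>= t)"
  using pr_thm[OF inst_th[OF ax[OF eq_refl], of "[((0, N), t)]"]] by simp

lemma EQ_euclid: "pr T \<Gamma> (s \<^bold>= t) \<Longrightarrow> pr T \<Gamma> (s \<^bold>= u) \<Longrightarrow> pr T \<Gamma> (t \<^bold>= u)"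
proof -
  assume a: "pr T \<Gamma> (s \<^bold>= t)" "pr T \<Gamma> (s \<^bold>= u)"
  have "T \<turnstile> s \<^bold>= t \<^bold>\<longrightarrow> s \<^bold>= u \<^bold>\<longrightarrow> t \<^bold>= u"
    using inst_th[OF ax[OF eq_trans], of "[((0, N), s), ((1, N), t), ((2, N), u)]"] eq_ty[OF a(1)] eq_ty[OF a(2)]
    by simp
  then show ?thesis using pr_mp[OF pr_thm_mp[OF _ a(1)] a(2)] by blast
qed

lemma EQ_sym: "pr T \<Gamma> (s \<^bold>= t) \<Longrightarrow> pr T \<Gamma> (t \<^bold>= s)"
  using EQ_euclid EQ_refl eq_ty pr_wfs by blast

lemma EQ_trans: "pr T \<Gamma> (s \<^bold>= t) \<Longrightarrow> pr T \<Gamma> (t \<^bold>= u) \<Longrightarrow> pr T \<Gamma> (s \<^bold>= u)"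
  using EQ_euclid EQ_sym by blast

lemma LE_cong: "pr T \<Gamma> (s \<^bold>\<le> t) \<Longrightarrow> pr T \<Gamma> (s \<^bold>= s') \<Longrightarrow> pr T \<Gamma> (t \<^bold>= t') \<Longrightarrow> pr T \<Gamma> (s' \<^bold>\<le> t')"
proof -
  assume a: "pr T \<Gamma> (s \<^bold>\<le> t)" "pr T \<Gamma> (s \<^bold>= s')" "pr T \<Gamma> (t \<^bold>= t')"
  have "T \<turnstile> s \<^bold>= s' \<^bold>\<longrightarrow> t \<^bold>= t' \<^bold>\<longrightarrow> s \<^bold>\<le> t \<^bold>\<longrightarrow> s' \<^bold>\<le> t'"
    using inst_th[OF ax[OF le_cong], of "[((0, N), s), ((1, N), s'), ((2, N), t), ((3, N), t')]"]
      eq_ty[OF a(2)] eq_ty[OF a(3)] by simp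
  then show ?thesis using pr_mp[OF pr_mp[OF pr_thm_mp[OF _ a(2)] a(3)] a(1)] by blast
qed

lemma LE_congR: "pr T \<Gamma> (t \<^bold>= t') \<Longrightarrow> pr T \<Gamma> (s \<^bold>\<le> t) \<Longrightarrow> pr T \<Gamma> (s \<^bold>\<le> t')"
  using LE_cong EQ_refl le_ty pr_wfs by blast

lemma EQ_arg: "pr T \<Gamma> (s \<^bold>= t) \<Longrightarrow> tm_ty f = Some ty1 \<Longrightarrow> pr T \<Gamma> (f \<cdot> s \<^bold>= f \<cdot> t)"
proof -
  assume a: "pr T \<Gamma> (s \<^bold>= t)" "tm_ty f = Some ty1"
  have "T \<turnstile> s \<^bold>= t \<^bold>\<longrightarrow> f \<cdot> s \<^bold>= f \<cdot> t"
    using inst_th[OF ax[OF extensionality[of N N]], of "[((0, N), s), ((1, N), t), ((2, ty1), f)]"]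
      eq_ty[OF a(1)] a(2) by simp
  then show ?thesis using a(1) by (rule pr_thm_mp)
qed

lemma induct:
  assumes "internal A" "quantifier_free A" "wf A"
    and 0: "pr T [] (subst A (n, N) tzero)" and S: "pr T [A] (subst A (n, N) (tsuc (V n N)))"
  shows "T \<turnstile> A"
proof -
  have w: "wf (subst A (n, N) tzero)" "wf (subst A (n, N) (tsuc (V n N)))"
    using assms(3) by (auto intro: wf_subst)
  have "pr T [] (subst A (n, N) tzero \<^bold>\<and> All (n, N) (A \<^bold>\<longrightarrow> subst A (n, N) (tsuc (V n N))))"
    by (intro pr_andI 0 pr_allI pr_impI S) simp
  from pr_thm_mp[OF ax[OF QF_induction[OF assms(1,2)]] this]
  have "pr T [] (All (n, N) A)" using w assms(3) by simp
  from pr_allE[OF this, of "V n N"] have "T \<turnstile> subst A (n, N) (V n N)"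
    using pr_Nil qf_free_for[OF assms(2)] by simp
  moreover have "subst_tm t x (Var x) = t" for t x by (induction t) auto
  then have "subst A (n, N) (V n N) = A" using assms(2) by (induction A) auto
  ultimately show ?thesis by simp
qed

lemma le_zero_iff: "isN t \<Longrightarrow> wfs \<Gamma> \<Longrightarrow> pr T \<Gamma> (t \<^bold>\<le> tzero \<^bold>\<longleftrightarrow> t \<^bold>= tzero)"
  using pr_thm[OF inst_th[OF ax[OF le_zero], of "[((0, N), t)]"]] by simp

lemma le_zero_I: assumes "pr T \<Gamma> (t \<^bold>= tzero)" shows "pr T \<Gamma> (t \<^bold>\<le> tzero)"
  by (rule pr_mp[OF pr_and2[OF le_zero_iff] assms]) (use eq_ty[OF assms] pr_wfs[OF assms] in auto)

lemma le_zero_E: assumes "pr T \<Gamma> (t \<^bold>\<le> tzero)" shows "pr T \<Gamma> (t \<^bold>= tzero)"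
  by (rule pr_mp[OF pr_and1[OF le_zero_iff] assms]) (use le_ty[OF assms] pr_wfs[OF assms] in auto)

lemma le_suc_iff: "isN s \<Longrightarrow> isN t \<Longrightarrow> wfs \<Gamma> \<Longrightarrow> pr T \<Gamma> (s \<^bold>\<le> tsuc t \<^bold>\<longleftrightarrow> s \<^bold>\<le> t \<^bold>\<or> s \<^bold>= tsuc t)"
  using pr_thm[OF inst_th[OF ax[OF le_suc], of "[((0, N), s), ((1, N), t)]"]] by simp

lemma le_suc_I1: assumes "pr T \<Gamma> (s \<^bold>\<le> t)" shows "pr T \<Gamma> (s \<^bold>\<le> tsuc t)"
  by (rule pr_mp[OF pr_and2[OF le_suc_iff] pr_or1[OF assms]])
     (use le_ty[OF assms] pr_wfs[OF assms] in auto)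

lemma le_suc_I2: assumes "pr T \<Gamma> (s \<^bold>= tsuc t)" "isN t" shows "pr T \<Gamma> (s \<^bold>\<le> tsuc t)"
  by (rule pr_mp[OF pr_and2[OF le_suc_iff] pr_or2[OF assms(1)]])
     (use eq_ty[OF assms(1)] assms(2) pr_wfs[OF assms(1)] in auto)

lemma le_suc_E: "pr T \<Gamma> (s \<^bold>\<le> tsuc t) \<Longrightarrow> isN t \<Longrightarrow> pr T ((s \<^bold>\<le> t) # \<Gamma>) C \<Longrightarrow>
    pr T ((s \<^bold>= tsuc t) # \<Gamma>) C \<Longrightarrow> pr T \<Gamma> C"
  using pr_orE[OF pr_mp[OF pr_and1[OF le_suc_iff]]] le_ty pr_wfs by blast

text \<open>Facts proved by induction are stated for variables, to which the quantifier-free scheme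
  applies, and are then carried over to arbitrary terms by \<open>inst_th\<close>. The same pattern
  recurs below.\<close>

lemma le_refl_V: "T \<turnstile> V 10 N \<^bold>\<le> V 10 N"
  by (rule induct[of _ 10])
     (auto intro!: le_zero_I EQ_refl le_suc_I2)

lemma LE_refl: "isN t \<Longrightarrow> wfs \<Gamma> \<Longrightarrow> pr T \<Gamma> (t \<^bold>\<le> t)"
  using pr_thm[OF inst_th[OF le_refl_V, of "[((10, N), t)]"]] by simp

lemma LE_eq: "pr T \<Gamma> (s \<^bold>= t) \<Longrightarrow> pr T \<Gamma> (s \<^bold>\<le> t)"
  using LE_congR LE_refl eq_ty pr_wfs by blast

lemma le_trans_V: "T \<turnstile> V 10 N \<^bold>\<le> V 11 N \<^bold>\<longrightarrow> V 11 N \<^bold>\<le> V 12 N \<^bold>\<longrightarrow> V 10 N \<^bold>\<le> V 12 N"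
proof (rule induct[of _ 12]; simp?)
  let ?x = "V 10 N" and ?y = "V 11 N" and ?z = "V 12 N"
  let ?G = "[?y \<^bold>\<le> tzero, ?x \<^bold>\<le> ?y]"
  have "pr T ?G (?x \<^bold>\<le> tzero)"
    by (rule LE_congR[OF le_zero_E]) (auto intro!: pr_hyp)
  then show "pr T [] (?x \<^bold>\<le> ?y \<^bold>\<longrightarrow> ?y \<^bold>\<le> tzero \<^bold>\<longrightarrow> ?x \<^bold>\<le> tzero)" by (intro pr_impI)
  let ?A = "?x \<^bold>\<le> ?y \<^bold>\<longrightarrow> ?y \<^bold>\<le> ?z \<^bold>\<longrightarrow> ?x \<^bold>\<le> ?z"
  let ?H = "[?y \<^bold>\<le> tsuc ?z, ?x \<^bold>\<le> ?y, ?A]"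
  have "pr T ?H (?x \<^bold>\<le> tsuc ?z)"
  proof (rule le_suc_E)
    show "pr T ?H (?y \<^bold>\<le> tsuc ?z)" by (rule pr_hyp) auto
    show "pr T ((?y \<^bold>\<le> ?z) # ?H) (?x \<^bold>\<le> tsuc ?z)"
      by (rule le_suc_I1, rule pr_mp[OF pr_mp[of _ _ "?x \<^bold>\<le> ?y"]]) (rule pr_hyp; auto)+
    show "pr T ((?y \<^bold>= tsuc ?z) # ?H) (?x \<^bold>\<le> tsuc ?z)"
      by (rule LE_congR[of _ ?y]) (rule pr_hyp; auto)+
  qed simp
  then show "pr T [?A] (?x \<^bold>\<le> ?y \<^bold>\<longrightarrow> ?y \<^bold>\<le> tsuc ?z \<^bold>\<longrightarrow> ?x \<^bold>\<le> tsuc ?z)" by (intro pr_impI)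
qed

lemma LE_trans: "pr T \<Gamma> (s \<^bold>\<le> t) \<Longrightarrow> pr T \<Gamma> (t \<^bold>\<le> u) \<Longrightarrow> pr T \<Gamma> (s \<^bold>\<le> u)"
proof -
  assume a: "pr T \<Gamma> (s \<^bold>\<le> t)" "pr T \<Gamma> (t \<^bold>\<le> u)"
  have "T \<turnstile> s \<^bold>\<le> t \<^bold>\<longrightarrow> t \<^bold>\<le> u \<^bold>\<longrightarrow> s \<^bold>\<le> u"
    using inst_th[OF le_trans_V, of "[((10, N), s), ((11, N), t), ((12, N), u)]"] le_ty[OF a(1)] le_ty[OF a(2)]
    by simp
  then show ?thesis using pr_mp[OF pr_thm_mp[OF _ a(1)] a(2)] by blast
qed

lemma zero_le_V: "T \<turnstile> tzero \<^bold>\<le> V 10 N"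
proof (rule induct[of _ 10]; simp?)
  show "pr T [] (tzero \<^bold>\<le> tzero)" by (rule LE_refl) auto
  show "pr T [tzero \<^bold>\<le> V 10 N] (tzero \<^bold>\<le> tsuc (V 10 N))"
    by (rule le_suc_I1, rule pr_hyp) auto
qed

lemma zero_le: "isN t \<Longrightarrow> wfs \<Gamma> \<Longrightarrow> pr T \<Gamma> (tzero \<^bold>\<le> t)"
  using pr_thm[OF inst_th[OF zero_le_V, of "[((10, N), t)]"]] by simp

lemma suc_mono_V: "T \<turnstile> V 10 N \<^bold>\<le> V 11 N \<^bold>\<longrightarrow> tsuc (V 10 N) \<^bold>\<le> tsuc (V 11 N)"
proof (rule induct[of _ 11]; simp?)
  let ?x = "V 10 N" and ?y = "V 11 N"
  have "pr T [?x \<^bold>\<le> tzero] (tsuc ?x \<^bold>\<le> tsuc tzero)"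
    by (rule LE_eq, rule EQ_arg, rule le_zero_E) (auto intro!: pr_hyp)
  then show "pr T [] (?x \<^bold>\<le> tzero \<^bold>\<longrightarrow> tsuc ?x \<^bold>\<le> tsuc tzero)" by (rule pr_impI)
  let ?A = "?x \<^bold>\<le> ?y \<^bold>\<longrightarrow> tsuc ?x \<^bold>\<le> tsuc ?y"
  let ?H = "[?x \<^bold>\<le> tsuc ?y, ?A]"
  have "pr T ?H (tsuc ?x \<^bold>\<le> tsuc (tsuc ?y))"
  proof (rule le_suc_E)
    show "pr T ?H (?x \<^bold>\<le> tsuc ?y)" by (rule pr_hyp) auto
    show "pr T ((?x \<^bold>\<le> ?y) # ?H) (tsuc ?x \<^bold>\<le> tsuc (tsuc ?y))"
      by (rule le_suc_I1, rule pr_mp[of _ _ "?x \<^bold>\<le> ?y"]) (rule pr_hyp; auto)+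
    show "pr T ((?x \<^bold>= tsuc ?y) # ?H) (tsuc ?x \<^bold>\<le> tsuc (tsuc ?y))"
      by (rule LE_eq, rule EQ_arg, rule pr_hyp) auto
  qed simp
  then show "pr T [?A] (?x \<^bold>\<le> tsuc ?y \<^bold>\<longrightarrow> tsuc ?x \<^bold>\<le> tsuc (tsuc ?y))" by (rule pr_impI)
qed

lemma suc_mono: "pr T \<Gamma> (s \<^bold>\<le> t) \<Longrightarrow> pr T \<Gamma> (tsuc s \<^bold>\<le> tsuc t)"
proof -
  assume a: "pr T \<Gamma> (s \<^bold>\<le> t)"
  have "T \<turnstile> s \<^bold>\<le> t \<^bold>\<longrightarrow> tsuc s \<^bold>\<le> tsuc t"
    using inst_th[OF suc_mono_V, of "[((10, N), s), ((11, N), t)]"] le_ty[OF a(1)] by simp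
  then show ?thesis using a by (rule pr_thm_mp)
qed

lemma plus_zero: "isN s \<Longrightarrow> wfs \<Gamma> \<Longrightarrow> pr T \<Gamma> (s \<^bold>+ tzero \<^bold>= s)"
  using pr_thm[OF inst_th[OF ax[OF A1_zero], of "[((0, N), s)]"]] by simp

lemma plus_suc: "isN s \<Longrightarrow> isN t \<Longrightarrow> wfs \<Gamma> \<Longrightarrow> pr T \<Gamma> (s \<^bold>+ tsuc t \<^bold>= tsuc (s \<^bold>+ t))"
proof -
  assume a: "isN s" "isN t" "wfs \<Gamma>"
  have "pr T \<Gamma> (s \<^bold>+ tsuc t \<^bold>= Con CA0 \<cdot> s \<cdot> (s \<^bold>+ t))"
    using pr_thm[OF inst_th[OF ax[OF A1_suc], of "[((0, N), s), ((1, N), t)]"]] a by simp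
  moreover have "pr T \<Gamma> (Con CA0 \<cdot> s \<cdot> (s \<^bold>+ t) \<^bold>= tsuc (s \<^bold>+ t))"
    using pr_thm[OF inst_th[OF ax[OF A0], of "[((0, N), s), ((1, N), s \<^bold>+ t)]"]] a by simp
  ultimately show ?thesis by (rule EQ_trans)
qed

lemma times_suc: "isN s \<Longrightarrow> isN t \<Longrightarrow> wfs \<Gamma> \<Longrightarrow> pr T \<Gamma> (s \<^bold>* tsuc t \<^bold>= s \<^bold>+ s \<^bold>* t)"
  using pr_thm[OF inst_th[OF ax[OF A2_suc], of "[((0, N), s), ((1, N), t)]"]] by simp

lemma le_plus1_V: "T \<turnstile> V 10 N \<^bold>\<le> V 10 N \<^bold>+ V 11 N"
proof (rule induct[of _ 11]; simp?)
  let ?x = "V 10 N" and ?y = "V 11 N"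
  show "pr T [] (?x \<^bold>\<le> ?x \<^bold>+ tzero)" by (rule LE_eq, rule EQ_sym, rule plus_zero) auto
  have "pr T [?x \<^bold>\<le> ?x \<^bold>+ ?y] (?x \<^bold>\<le> tsuc (?x \<^bold>+ ?y))" by (rule le_suc_I1, rule pr_hyp) auto
  then show "pr T [?x \<^bold>\<le> ?x \<^bold>+ ?y] (?x \<^bold>\<le> ?x \<^bold>+ tsuc ?y)"
    by (rule LE_congR[OF EQ_sym[OF plus_suc], rotated 3]) auto
qed

lemma le_plus1: "isN s \<Longrightarrow> isN t \<Longrightarrow> wfs \<Gamma> \<Longrightarrow> pr T \<Gamma> (s \<^bold>\<le> s \<^bold>+ t)"
  using pr_thm[OF inst_th[OF le_plus1_V, of "[((10, N), s), ((11, N), t)]"]] by simp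

lemma le_plus2_V: "T \<turnstile> V 11 N \<^bold>\<le> V 10 N \<^bold>+ V 11 N"
proof (rule induct[of _ 11]; simp?)
  let ?x = "V 10 N" and ?y = "V 11 N"
  show "pr T [] (tzero \<^bold>\<le> ?x \<^bold>+ tzero)" by (rule zero_le) auto
  have "pr T [?y \<^bold>\<le> ?x \<^bold>+ ?y] (tsuc ?y \<^bold>\<le> tsuc (?x \<^bold>+ ?y))" by (rule suc_mono, rule pr_hyp) auto
  then show "pr T [?y \<^bold>\<le> ?x \<^bold>+ ?y] (tsuc ?y \<^bold>\<le> ?x \<^bold>+ tsuc ?y)"
    by (rule LE_congR[OF EQ_sym[OF plus_suc], rotated 3]) auto
qed

lemma le_plus2: "isN s \<Longrightarrow> isN t \<Longrightarrow> wfs \<Gamma> \<Longrightarrow> pr T \<Gamma> (t \<^bold>\<le> s \<^bold>+ t)"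
  using pr_thm[OF inst_th[OF le_plus2_V, of "[((10, N), s), ((11, N), t)]"]] by simp

lemma plus_mono1_V: "T \<turnstile> V 10 N \<^bold>\<le> V 11 N \<^bold>\<longrightarrow> V 10 N \<^bold>+ V 12 N \<^bold>\<le> V 11 N \<^bold>+ V 12 N"
proof (rule induct[of _ 12]; simp?)
  let ?x = "V 10 N" and ?y = "V 11 N" and ?z = "V 12 N"
  have "pr T [?x \<^bold>\<le> ?y] (?x \<^bold>+ tzero \<^bold>\<le> ?y \<^bold>+ tzero)"
    by (rule LE_cong[OF _ EQ_sym[OF plus_zero] EQ_sym[OF plus_zero]]) (auto intro!: pr_hyp)
  then show "pr T [] (?x \<^bold>\<le> ?y \<^bold>\<longrightarrow> ?x \<^bold>+ tzero \<^bold>\<le> ?y \<^bold>+ tzero)" by (rule pr_impI)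
  let ?A = "?x \<^bold>\<le> ?y \<^bold>\<longrightarrow> ?x \<^bold>+ ?z \<^bold>\<le> ?y \<^bold>+ ?z"
  have "pr T [?x \<^bold>\<le> ?y, ?A] (?x \<^bold>+ ?z \<^bold>\<le> ?y \<^bold>+ ?z)" by (rule pr_mp[of _ _ "?x \<^bold>\<le> ?y"]) (rule pr_hyp; auto)+
  then have "pr T [?x \<^bold>\<le> ?y, ?A] (?x \<^bold>+ tsuc ?z \<^bold>\<le> ?y \<^bold>+ tsuc ?z)"
    by (intro LE_cong[OF suc_mono EQ_sym[OF plus_suc] EQ_sym[OF plus_suc]]) auto
  then show "pr T [?A] (?x \<^bold>\<le> ?y \<^bold>\<longrightarrow> ?x \<^bold>+ tsuc ?z \<^bold>\<le> ?y \<^bold>+ tsuc ?z)" by (rule pr_impI)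
qed

lemma plus_mono1: "pr T \<Gamma> (s \<^bold>\<le> t) \<Longrightarrow> isN u \<Longrightarrow> pr T \<Gamma> (s \<^bold>+ u \<^bold>\<le> t \<^bold>+ u)"
proof -
  assume a: "pr T \<Gamma> (s \<^bold>\<le> t)" "isN u"
  have "T \<turnstile> s \<^bold>\<le> t \<^bold>\<longrightarrow> s \<^bold>+ u \<^bold>\<le> t \<^bold>+ u"
    using inst_th[OF plus_mono1_V, of "[((10, N), s), ((11, N), t), ((12, N), u)]"] le_ty[OF a(1)] a(2) by simp
  then show ?thesis using a(1) by (rule pr_thm_mp)
qed

lemma plus_mono2_V: "T \<turnstile> V 10 N \<^bold>\<le> V 11 N \<^bold>\<longrightarrow> V 12 N \<^bold>+ V 10 N \<^bold>\<le> V 12 N \<^bold>+ V 11 N"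
proof (rule induct[of _ 11]; simp?)
  let ?x = "V 10 N" and ?y = "V 11 N" and ?z = "V 12 N"
  have "pr T [?x \<^bold>\<le> tzero] (?z \<^bold>+ ?x \<^bold>\<le> ?z \<^bold>+ tzero)"
    by (rule LE_eq, rule EQ_arg, rule le_zero_E) (auto intro!: pr_hyp)
  then show "pr T [] (?x \<^bold>\<le> tzero \<^bold>\<longrightarrow> ?z \<^bold>+ ?x \<^bold>\<le> ?z \<^bold>+ tzero)" by (rule pr_impI)
  let ?A = "?x \<^bold>\<le> ?y \<^bold>\<longrightarrow> ?z \<^bold>+ ?x \<^bold>\<le> ?z \<^bold>+ ?y"
  let ?H = "[?x \<^bold>\<le> tsuc ?y, ?A]"
  have "pr T ?H (?z \<^bold>+ ?x \<^bold>\<le> ?z \<^bold>+ tsuc ?y)"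
  proof (rule le_suc_E)
    show "pr T ?H (?x \<^bold>\<le> tsuc ?y)" by (rule pr_hyp) auto
    have "pr T ((?x \<^bold>\<le> ?y) # ?H) (?z \<^bold>+ ?x \<^bold>\<le> tsuc (?z \<^bold>+ ?y))"
      by (rule le_suc_I1, rule pr_mp[of _ _ "?x \<^bold>\<le> ?y"]) (rule pr_hyp; auto)+
    then show "pr T ((?x \<^bold>\<le> ?y) # ?H) (?z \<^bold>+ ?x \<^bold>\<le> ?z \<^bold>+ tsuc ?y)"
      by (rule LE_congR[OF EQ_sym[OF plus_suc], rotated 3]) auto
    show "pr T ((?x \<^bold>= tsuc ?y) # ?H) (?z \<^bold>+ ?x \<^bold>\<le> ?z \<^bold>+ tsuc ?y)"
      by (rule LE_eq, rule EQ_arg, rule pr_hyp) auto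
  qed simp
  then show "pr T [?A] (?x \<^bold>\<le> tsuc ?y \<^bold>\<longrightarrow> ?z \<^bold>+ ?x \<^bold>\<le> ?z \<^bold>+ tsuc ?y)" by (rule pr_impI)
qed

lemma plus_mono2: "pr T \<Gamma> (s \<^bold>\<le> t) \<Longrightarrow> isN u \<Longrightarrow> pr T \<Gamma> (u \<^bold>+ s \<^bold>\<le> u \<^bold>+ t)"
proof -
  assume a: "pr T \<Gamma> (s \<^bold>\<le> t)" "isN u"
  have "T \<turnstile> s \<^bold>\<le> t \<^bold>\<longrightarrow> u \<^bold>+ s \<^bold>\<le> u \<^bold>+ t"
    using inst_th[OF plus_mono2_V, of "[((10, N), s), ((11, N), t), ((12, N), u)]"] le_ty[OF a(1)] a(2) by simp
  then show ?thesis using a(1) by (rule pr_thm_mp)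
qed

lemma double_mono: "pr T \<Gamma> (s \<^bold>\<le> t) \<Longrightarrow> pr T \<Gamma> (s \<^bold>+ s \<^bold>\<le> t \<^bold>+ t)"
  using LE_trans[OF plus_mono1 plus_mono2] le_ty by blast

text \<open>The pairing equation determines \<open>c + c\<close> only, so the bounds are stated
  without halving. Keeping \<open>b + b\<close> on the left lets bounds for nested pairs be chained
  at the cost of a single factor 2.\<close>

lemma fst_le_pair:
  assumes "pr T \<Gamma> (is_pair c a b)" "isN a" "isN b"
  shows "pr T \<Gamma> (a \<^bold>\<le> c \<^bold>+ c)" and "pr T \<Gamma> (b \<^bold>+ b \<^bold>\<le> c \<^bold>+ c)"
proof -
  let ?s = "a \<^bold>+ b"
  have eq: "pr T \<Gamma> (?s \<^bold>* tsuc ?s \<^bold>+ (b \<^bold>+ b) \<^bold>= c \<^bold>+ c)"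
    using assms(1) unfolding is_pair_def by (rule EQ_sym)
  have ty: "isN (?s \<^bold>* tsuc ?s)" "isN (b \<^bold>+ b)" "isN ?s" "wfs \<Gamma>" using assms pr_wfs by auto
  have "pr T \<Gamma> (?s \<^bold>\<le> ?s \<^bold>* tsuc ?s)"
    by (rule LE_congR[OF EQ_sym[OF times_suc[OF ty(3,3,4)]]], rule le_plus1) (use ty in auto)
  from LE_trans[OF LE_trans[OF le_plus1[OF assms(2,3) ty(4)] this] le_plus1[OF ty(1,2,4)]]
  show "pr T \<Gamma> (a \<^bold>\<le> c \<^bold>+ c)" by (rule LE_congR[OF eq])
  show "pr T \<Gamma> (b \<^bold>+ b \<^bold>\<le> c \<^bold>+ c)" by (rule LE_congR[OF eq le_plus2[OF ty(1,2,4)]])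
qed

text \<open>The remainder \<open>v\<close> is at most the number \<open>a\<close> that is divided;
  \<open>a\<close> is the first component of \<open>d\<close> and \<open>d\<close> the second
  component of \<open>c\<close>, whence \<open>v \<le> a \<le> 2d \<le> 2c\<close>.\<close>

lemma comp_le:
  assumes "fresh c \<le> k" "fresh i \<le> k" "fresh v \<le> k" "isN c" "isN i" "isN v"
  shows "T \<turnstile> is_comp k c i v \<^bold>\<longrightarrow> v \<^bold>\<le> c \<^bold>+ c"
proof -
  let ?n = "V k N" and ?d = "V (k + 1) N" and ?a = "V (k + 2) N" and ?b = "V (k + 3) N" and ?q = "V (k + 4) N"
  let ?C = "?a \<^bold>= ?q \<^bold>* tsuc (tsuc i \<^bold>* ?b) \<^bold>+ v" and ?D = "v \<^bold>\<le> tsuc i \<^bold>* ?b"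
  let ?B = "is_pair c ?n ?d \<^bold>\<and> is_pair ?d ?a ?b \<^bold>\<and> ?C \<^bold>\<and> ?D"
  have w: "wfs [?B]" using assms by (auto simp: is_pair_def)
  have h: "pr T [?B] ?B" by (rule pr_hyp) (use w in auto)
  note h1 = pr_and1[OF h] and h2 = pr_and1[OF pr_and2[OF h]] and h3 = pr_and1[OF pr_and2[OF pr_and2[OF h]]]
  have "pr T [?B] (v \<^bold>\<le> ?q \<^bold>* tsuc (tsuc i \<^bold>* ?b) \<^bold>+ v)"
    by (rule le_plus2) (use assms w in auto)
  from LE_congR[OF EQ_sym[OF h3] this] have 1: "pr T [?B] (v \<^bold>\<le> ?a)" .
  have 2: "pr T [?B] (?a \<^bold>\<le> ?d \<^bold>+ ?d)" by (rule fst_le_pair[OF h2]) auto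
  have 3: "pr T [?B] (?d \<^bold>+ ?d \<^bold>\<le> c \<^bold>+ c)" by (rule fst_le_pair[OF h1]) auto
  have "T \<turnstile> ?B \<^bold>\<longrightarrow> v \<^bold>\<le> c \<^bold>+ c"
    using pr_Nil[OF pr_impI[OF LE_trans[OF LE_trans[OF 1 2] 3]]] .
  moreover have nf: "(k + j, N) \<notin> fv (v \<^bold>\<le> c \<^bold>+ c)" for j
    using fv_fresh[of "k + j" N c] fv_fresh[of "k + j" N v] assms by auto
  moreover note nf[of 0, unfolded add_0_right]
  ultimately show ?thesis unfolding is_comp_def Let_def by (intro ex_elim)
qed

end

section \<open>Explicit functionals\<close>

lemma pr_cases: "pr T (A # \<Gamma>) C \<Longrightarrow> pr T (Neg A # \<Gamma>) C \<Longrightarrow> pr T \<Gamma> C"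
proof -
  assume a: "pr T (A # \<Gamma>) C" "pr T (Neg A # \<Gamma>) C"
  have w: "wf C" "wfs \<Gamma>" "wf A" using pr_wf[OF a(1)] pr_wfs[OF a(1)] by auto
  have h: "pr T (Neg C # \<Gamma>) (Neg C)" by (rule pr_hyp) (use w in auto)
  have "pr T (A # Neg C # \<Gamma>) Bot"
    by (rule pr_mp[OF pr_mono[OF h] pr_mono[OF a(1)]]) (use w in auto)
  then have "pr T (Neg C # \<Gamma>) (Neg A)" by (rule pr_impI)
  moreover have "pr T (Neg C # \<Gamma>) (Neg A \<^bold>\<longrightarrow> C)"
    by (rule pr_mono[OF pr_impI[OF a(2)]]) (use w in auto)
  ultimately have "pr T (Neg C # \<Gamma>) C" by (rule pr_mp[rotated])
  from pr_mp[OF h this] show ?thesis using w(1) by (rule pr_ccontr)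
qed

lemma pr_iffI: "pr T (A # \<Gamma>) C \<Longrightarrow> pr T (C # \<Gamma>) A \<Longrightarrow> pr T \<Gamma> (A \<^bold>\<longleftrightarrow> C)"
  by (intro pr_andI pr_impI)

lemma pr_iff1: "pr T \<Gamma> (A \<^bold>\<longleftrightarrow> C) \<Longrightarrow> pr T \<Gamma> A \<Longrightarrow> pr T \<Gamma> C"
  and pr_iff2: "pr T \<Gamma> (A \<^bold>\<longleftrightarrow> C) \<Longrightarrow> pr T \<Gamma> C \<Longrightarrow> pr T \<Gamma> A"
  using pr_mp[OF pr_and1] pr_mp[OF pr_and2] by blast+

lemma subst_tm_Var_id: "subst_tm t x (Var x) = t"
  by (induction t) auto

lemma subst_Var_id: "subst A x (Var x) = A"
  by (induction A) (auto simp: subst_tm_Var_id)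

section \<open>Rules for the standard quantifiers\<close>

locale efa_st = efa +
  assumes EFA_st: "EFA_st \<subseteq> T"
begin

lemma ax_st: "A \<in> EFA_st \<Longrightarrow> wf A \<Longrightarrow> T \<turnstile> A"
  using EFA_st by (intro proves.axiom) auto

lemma EQ_all: "wf A \<Longrightarrow> T \<turnstile> AllSt x A \<^bold>\<longleftrightarrow> All x (St (snd x) (Var x) \<^bold>\<longrightarrow> A)"
  by (rule ax_st[OF EFA_st.EQ_all]) simp

lemma EQ_ex: "wf A \<Longrightarrow> T \<turnstile> ExSt x A \<^bold>\<longleftrightarrow> Ex x (St (snd x) (Var x) \<^bold>\<and> A)"
  by (rule ax_st[OF EFA_st.EQ_ex]) simp

lemma pr_allstI:
  assumes "pr T (St (snd x) (Var x) # \<Gamma>) A" "\<And>G. G \<in> set \<Gamma> \<Longrightarrow> x \<notin> fv G"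
  shows "pr T \<Gamma> (AllSt x A)"
  using pr_iff2[OF pr_thm[OF EQ_all]] pr_allI[OF pr_impI[OF assms(1)] assms(2)]
    pr_wf[OF assms(1)] pr_wfs[OF assms(1)] by simp

lemma pr_allstE:
  assumes "pr T \<Gamma> (AllSt x A)" "pr T \<Gamma> (St (snd x) t)" "free_for t x A"
  shows "pr T \<Gamma> (subst A x t)"
proof -
  have w: "wf A" "tm_ty t = Some (snd x)" using pr_wf[OF assms(1)] pr_wf[OF assms(2)] by auto
  have "pr T \<Gamma> (All x (St (snd x) (Var x) \<^bold>\<longrightarrow> A))"
    using pr_iff1[OF pr_thm[OF EQ_all[OF w(1)]] assms(1)] pr_wfs[OF assms(1)] by blast
  from pr_allE[OF this w(2)] assms(3) have "pr T \<Gamma> (St (snd x) t \<^bold>\<longrightarrow> subst A x t)" by simp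
  then show ?thesis using assms(2) by (rule pr_mp)
qed

lemma pr_exstI:
  assumes "pr T \<Gamma> (subst A x t)" "pr T \<Gamma> (St (snd x) t)" "free_for t x A" "wf A"
  shows "pr T \<Gamma> (ExSt x A)"
proof -
  have "tm_ty t = Some (snd x)" using pr_wf[OF assms(2)] by simp
  then have "pr T \<Gamma> (Ex x (St (snd x) (Var x) \<^bold>\<and> A))"
    using assms by (intro pr_exI[of _ _ _ _ t]) (auto intro: pr_andI)
  then show ?thesis using pr_iff2[OF pr_thm[OF EQ_ex[OF assms(4)]]] pr_wfs[OF assms(1)] by blast
qed

lemma pr_exst_ex:
  assumes "pr T \<Gamma> (ExSt x A)"
  shows "pr T \<Gamma> (Ex x (St (snd x) (Var x) \<^bold>\<and> A))"
  using pr_iff1[OF pr_thm[OF EQ_ex] assms] pr_wf[OF assms] pr_wfs[OF assms] by simp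

lemma pr_exstE:
  assumes "pr T \<Gamma> (ExSt x A)" "pr T (A # St (snd x) (Var x) # \<Gamma>) C"
    "\<And>G. G \<in> set \<Gamma> \<Longrightarrow> x \<notin> fv G" "x \<notin> fv C"
  shows "pr T \<Gamma> C"
proof (rule pr_exE[OF pr_exst_ex[OF assms(1)] _ assms(3,4)])
  let ?B = "St (snd x) (Var x) \<^bold>\<and> A"
  have w: "wfs \<Gamma>" "wf A" using pr_wfs[OF assms(2)] by auto
  have h: "pr T (?B # \<Gamma>) ?B" by (rule pr_hyp) (use w in auto)
  have "pr T (?B # \<Gamma>) (St (snd x) (Var x) \<^bold>\<longrightarrow> A \<^bold>\<longrightarrow> C)"
    by (rule pr_mono[OF pr_impI[OF pr_impI[OF assms(2)]]]) (use w in auto)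
  then show "pr T (?B # \<Gamma>) C" using pr_mp pr_and1[OF h] pr_and2[OF h] by blast
qed

lemma pr_St:
  assumes "wfs \<Gamma>" "tm_ty t = Some \<sigma>" "\<And>v. v \<in> fv_tm t \<Longrightarrow> pr T \<Gamma> (St (snd v) (Var v))"
  shows "pr T \<Gamma> (St \<sigma> t)"
  using assms(2,3)
proof (induction t arbitrary: \<sigma>)
  case (Con c)
  have "T \<turnstile> St \<sigma> (Con c)" by (rule ax_st[OF st_closed]) (use Con in auto)
  then show ?case using assms(1) by (rule pr_thm)
next
  case (App s t)
  then obtain \<rho> where ty: "tm_ty s = Some (\<rho> \<rightarrow> \<sigma>)" "tm_ty t = Some \<rho>" unfolding tm_ty_App by blast
  have "pr T \<Gamma> (St (\<rho> \<rightarrow> \<sigma>) s)" "pr T \<Gamma> (St \<rho> t)" using App ty by simp_all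
  moreover have "T \<turnstile> St (\<rho> \<rightarrow> \<sigma>) s \<^bold>\<and> St \<rho> t \<^bold>\<longrightarrow> St \<sigma> (s \<cdot> t)"
    using inst_th[OF ax_st[OF st_app[of \<rho> \<sigma>]], of "[((0, \<rho> \<rightarrow> \<sigma>), s), ((1, \<rho>), t)]"] ty by simp
  ultimately show ?case using pr_thm_mp pr_andI by blast
qed auto

section \<open>Combinators at numerical arguments\<close>

lemma sigma0: 
  assumes "tm_ty x = Some (\<delta> \<rightarrow> \<rho> \<rightarrow> N)" "tm_ty y = Some (\<delta> \<rightarrow> \<rho>)" "tm_ty z = Some \<delta>" "wfs \<Gamma>"
  shows "pr T \<Gamma> (Con (CSigma \<delta> \<rho> N) \<cdot> x \<cdot> y \<cdot> z \<^bold>= x \<cdot> z \<cdot> (y \<cdot> z))"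
  using pr_thm[OF inst_th[OF ax[OF Sigma[of N \<delta> \<rho>]],
    of "[((0, \<delta> \<rightarrow> \<rho> \<rightarrow> N), x), ((1, \<delta> \<rightarrow> \<rho>), y), ((2, \<delta>), z)]"]] assms by simp

text \<open>At a higher result type the axiom is a pointwise equality. Its bound variable has name
  3, the first above the names 0, 1, 2 of both sides; \<open>pi1\<close> and \<open>pi2\<close>
  count likewise.\<close>

lemma sigma1:
  assumes "tm_ty x = Some (\<delta> \<rightarrow> \<rho> \<rightarrow> ty1)" "tm_ty y = Some (\<delta> \<rightarrow> \<rho>)" "tm_ty z = Some \<delta>" "isN n" "wfs \<Gamma>"
  shows "pr T \<Gamma> (Con (CSigma \<delta> \<rho> ty1) \<cdot> x \<cdot> y \<cdot> z \<cdot> n \<^bold>= x \<cdot> z \<cdot> (y \<cdot> z) \<cdot> n)"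
proof -
  let ?l = "Con (CSigma \<delta> \<rho> ty1) \<cdot> V 0 (\<delta> \<rightarrow> \<rho> \<rightarrow> ty1) \<cdot> V 1 (\<delta> \<rightarrow> \<rho>) \<cdot> V 2 \<delta>"
  let ?r = "V 0 (\<delta> \<rightarrow> \<rho> \<rightarrow> ty1) \<cdot> V 2 \<delta> \<cdot> (V 1 (\<delta> \<rightarrow> \<rho>) \<cdot> V 2 \<delta>)"
  let ?A = "?l \<cdot> V 3 N \<^bold>= ?r \<cdot> V 3 N"
  have "T \<turnstile> All (3, N) ?A" using ax[OF Sigma[of ty1 \<delta> \<rho>]] by (simp add: Let_def numeral_3_eq_3)
  then have "T \<turnstile> ?A" using proves.mp[OF all_inst[of ?A "V 3 N" "(3, N)" T]] by (simp add: subst_Var_id)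
  from pr_thm[OF inst_th[OF this, of "[((0, \<delta> \<rightarrow> \<rho> \<rightarrow> ty1), x), ((1, \<delta> \<rightarrow> \<rho>), y), ((2, \<delta>), z), ((3, N), n)]"]]
  show ?thesis using assms by simp
qed

lemma pi1:
  assumes "tm_ty x = Some ty1" "tm_ty y = Some \<tau>" "isN n" "wfs \<Gamma>"
  shows "pr T \<Gamma> (Con (CPi ty1 \<tau>) \<cdot> x \<cdot> y \<cdot> n \<^bold>= x \<cdot> n)"
proof -
  let ?A = "Con (CPi ty1 \<tau>) \<cdot> V 0 ty1 \<cdot> V 1 \<tau> \<cdot> V 2 N \<^bold>= V 0 ty1 \<cdot> V 2 N"
  have "T \<turnstile> All (2, N) ?A" using ax[OF Pi[of ty1 \<tau>]] by (simp add: Let_def numeral_2_eq_2)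
  then have "T \<turnstile> ?A" using proves.mp[OF all_inst[of ?A "V 2 N" "(2, N)" T]] by (simp add: subst_Var_id)
  from pr_thm[OF inst_th[OF this, of "[((0, ty1), x), ((1, \<tau>), y), ((2, N), n)]"]]
  show ?thesis using assms by simp
qed

lemma pi2:
  assumes "tm_ty x = Some (\<sigma> \<rightarrow> ty1)" "tm_ty y = Some \<tau>" "tm_ty z = Some \<sigma>" "isN n" "wfs \<Gamma>"
  shows "pr T \<Gamma> (Con (CPi (\<sigma> \<rightarrow> ty1) \<tau>) \<cdot> x \<cdot> y \<cdot> z \<cdot> n \<^bold>= x \<cdot> z \<cdot> n)"
proof -
  let ?A = "Con (CPi (\<sigma> \<rightarrow> ty1) \<tau>) \<cdot> V 0 (\<sigma> \<rightarrow> ty1) \<cdot> V 1 \<tau> \<cdot> V 2 \<sigma> \<cdot> V 3 N \<^bold>= V 0 (\<sigma> \<rightarrow> ty1) \<cdot> V 2 \<sigma> \<cdot> V 3 N"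
  have "T \<turnstile> All (2, \<sigma>) (All (3, N) ?A)"
    using ax[OF Pi[of "\<sigma> \<rightarrow> ty1" \<tau>]] by (simp add: Let_def numeral_2_eq_2 numeral_3_eq_3)
  then have "T \<turnstile> All (3, N) ?A"
    using proves.mp[OF all_inst[of "All (3, N) ?A" "V 2 \<sigma>" "(2, \<sigma>)" T]] by (simp add: subst_Var_id)
  then have "T \<turnstile> ?A" using proves.mp[OF all_inst[of ?A "V 3 N" "(3, N)" T]] by (simp add: subst_Var_id)
  from pr_thm[OF inst_th[OF this, of "[((0, \<sigma> \<rightarrow> ty1), x), ((1, \<tau>), y), ((2, \<sigma>), z), ((3, N), n)]"]]
  show ?thesis using assms by simp
qed

text \<open>The identity as S K K, typed so that the second argument of the outer K is a function
  from numbers.\<close>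

definition tI :: "ty \<Rightarrow> tm" where
  "tI \<sigma> = Con (CSigma \<sigma> (N \<rightarrow> \<sigma>) \<sigma>) \<cdot> Con (CPi \<sigma> (N \<rightarrow> \<sigma>)) \<cdot> Con (CPi \<sigma> N)"

lemma tI_ty [simp]: "tm_ty (tI \<sigma>) = Some (\<sigma> \<rightarrow> \<sigma>)" "fv_tm (tI \<sigma>) = {}"
  by (simp_all add: tI_def)

lemma tI_ty1: "tm_ty f = Some ty1 \<Longrightarrow> isN n \<Longrightarrow> wfs \<Gamma> \<Longrightarrow> pr T \<Gamma> (tI ty1 \<cdot> f \<cdot> n \<^bold>= f \<cdot> n)"
  unfolding tI_def by (rule EQ_trans[OF sigma1 pi1]) auto

lemma tI_N: "isN n \<Longrightarrow> wfs \<Gamma> \<Longrightarrow> pr T \<Gamma> (tI N \<cdot> n \<^bold>= n)"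
proof -
  assume n: "isN n" "wfs \<Gamma>"
  have "pr T \<Gamma> (Con (CPi N (N \<rightarrow> N)) \<cdot> n \<cdot> (Con (CPi N N) \<cdot> n) \<^bold>= n)"
    using pr_thm[OF inst_th[OF ax[OF Pi[of N ty1]], of "[((0, N), n), ((1, ty1), Con (CPi N N) \<cdot> n)]"]] n by simp
  then show ?thesis unfolding tI_def by (intro EQ_trans[OF sigma0]) (use n in auto)
qed

text \<open>\<open>\<lambda>n. n + n\<close> and \<open>\<lambda>f. g (h f)\<close>.\<close>

definition tD :: tm where "tD = Con (CSigma N N N) \<cdot> Con CA1 \<cdot> tI N"

definition tcomp :: "tm \<Rightarrow> tm \<Rightarrow> tm" where
  "tcomp g h = Con (CSigma ty1 N N) \<cdot> (Con (CPi ty1 ty1) \<cdot> g) \<cdot> h"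

lemma tD_ty [simp]: "tm_ty tD = Some ty1" "fv_tm tD = {}"
  by (simp_all add: tD_def)

lemma tD_eq: "isN n \<Longrightarrow> wfs \<Gamma> \<Longrightarrow> pr T \<Gamma> (tD \<cdot> n \<^bold>= n \<^bold>+ n)"
  unfolding tD_def by (rule EQ_trans[OF sigma0 EQ_arg[OF tI_N]]) auto

lemma tcomp_ty [simp]: "tm_ty g = Some ty1 \<Longrightarrow> tm_ty h = Some ty2 \<Longrightarrow> tm_ty (tcomp g h) = Some ty2"
  "fv_tm (tcomp g h) = fv_tm g \<union> fv_tm h"
  by (simp_all add: tcomp_def)

lemma tcomp_eq: "tm_ty g = Some ty1 \<Longrightarrow> tm_ty h = Some ty2 \<Longrightarrow> tm_ty f = Some ty1 \<Longrightarrow> wfs \<Gamma> \<Longrightarrow>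
    pr T \<Gamma> (tcomp g h \<cdot> f \<^bold>= g \<cdot> (h \<cdot> f))"
  unfolding tcomp_def by (rule EQ_trans[OF sigma0 pi1]) auto

text \<open>\<open>\<lambda>f. f (\<mu> f)\<close>.\<close>

definition tJ :: "tm \<Rightarrow> tm" where "tJ \<mu> = Con (CSigma ty1 N N) \<cdot> tI ty1 \<cdot> \<mu>"

lemma tJ_ty [simp]: "tm_ty \<mu> = Some ty2 \<Longrightarrow> tm_ty (tJ \<mu>) = Some ty2" "fv_tm (tJ \<mu>) = fv_tm \<mu>"
  by (simp_all add: tJ_def)

lemma tJ_eq: "tm_ty \<mu> = Some ty2 \<Longrightarrow> tm_ty f = Some ty1 \<Longrightarrow> wfs \<Gamma> \<Longrightarrow> pr T \<Gamma> (tJ \<mu> \<cdot> f \<^bold>= f \<cdot> (\<mu> \<cdot> f))"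
  unfolding tJ_def by (rule EQ_trans[OF sigma0 tI_ty1]) auto

text \<open>\<open>\<lambda>f. \<mu>n \<le> b f. f n = 0\<close>; the bounded search functional takes a binary function, here \<open>\<Pi> f\<close>.\<close>

definition tM :: "tm \<Rightarrow> tm" where
  "tM b = Con (CSigma ty1 N N) \<cdot> (Con (CSigma ty1 (N \<rightarrow> ty1) ty1) \<cdot>
     (Con (CPi ((N \<rightarrow> ty1) \<rightarrow> ty1) ty1) \<cdot> Con CMub) \<cdot> Con (CPi ty1 N)) \<cdot> b"

lemma tM_ty [simp]: "tm_ty b = Some ty2 \<Longrightarrow> tm_ty (tM b) = Some ty2" "fv_tm (tM b) = fv_tm b"
  by (simp_all add: tM_def)

lemma tM_eq:
  "tm_ty b = Some ty2 \<Longrightarrow> tm_ty f = Some ty1 \<Longrightarrow> wfs \<Gamma> \<Longrightarrow>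
     pr T \<Gamma> (tM b \<cdot> f \<^bold>= Con CMub \<cdot> (Con (CPi ty1 N) \<cdot> f) \<cdot> (b \<cdot> f))"
  unfolding tM_def by (rule EQ_trans[OF sigma0 EQ_trans[OF sigma1 pi2]]) auto

lemma tM_found:
  assumes "tm_ty b = Some ty2" "tm_ty f = Some ty1" "pr T \<Gamma> (x \<^bold>\<le> b \<cdot> f)" "pr T \<Gamma> (f \<cdot> x \<^bold>= tzero)"
  shows "pr T \<Gamma> (f \<cdot> (tM b \<cdot> f) \<^bold>= tzero)"
proof -
  let ?F = "Con (CPi ty1 N) \<cdot> f" and ?n = "b \<cdot> f"
  let ?m = "Con CMub \<cdot> ?F \<cdot> ?n"
  have x: "isN x" "wfs \<Gamma>" using le_ty[OF assms(3)] pr_wfs[OF assms(3)] by auto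
  have ty: "tm_ty ?F = Some (N \<rightarrow> ty1)" "isN ?n" "isN ?m" using assms by simp_all
  have "pr T \<Gamma> (?F \<cdot> ?n \<cdot> x \<^bold>= f \<cdot> x)" by (rule pi1) (use assms x in auto)
  then have "pr T \<Gamma> (?F \<cdot> ?n \<cdot> x \<^bold>= tzero)" using assms(4) by (rule EQ_trans)
  moreover have "T \<turnstile> x \<^bold>\<le> ?n \<^bold>\<and> ?F \<cdot> ?n \<cdot> x \<^bold>= tzero \<^bold>\<longrightarrow> ?F \<cdot> ?n \<cdot> ?m \<^bold>= tzero"
    using inst_th[OF ax[OF mub_found], of "[((0, N \<rightarrow> ty1), ?F), ((1, N), ?n), ((2, N), x)]"] ty x by simp
  ultimately have "pr T \<Gamma> (?F \<cdot> ?n \<cdot> ?m \<^bold>= tzero)" using pr_thm_mp pr_andI assms(3) by blast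
  moreover have "pr T \<Gamma> (?F \<cdot> ?n \<cdot> ?m \<^bold>= f \<cdot> ?m)" by (rule pi1) (use assms x in auto)
  ultimately have "pr T \<Gamma> (f \<cdot> ?m \<^bold>= tzero)" using EQ_euclid by blast
  moreover have "pr T \<Gamma> (f \<cdot> (tM b \<cdot> f) \<^bold>= f \<cdot> ?m)" by (rule EQ_arg[OF tM_eq]) (use assms x in auto)
  ultimately show ?thesis using EQ_trans by blast
qed

section \<open>Bounds for the components of a coded sequence\<close>

lemma mem_seq_N_le:
  assumes "isN y" "isN c"
  shows "T \<turnstile> mem_seq N y c \<^bold>\<longrightarrow> y \<^bold>\<le> c \<^bold>+ c"
proof -
  let ?m = "max (fresh y) (fresh c)"
  let ?L = "is_length (?m + 2) c (V ?m N)" and ?S = "tsuc (V (?m + 1) N) \<^bold>\<le> V ?m N"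
    and ?K = "is_comp (?m + 2) c (V (?m + 1) N) y"
  have "T \<turnstile> ?K \<^bold>\<longrightarrow> y \<^bold>\<le> c \<^bold>+ c" by (rule comp_le) (use assms in auto)
  moreover have "wf ?L" "wf ?S" "wf ?K"
    using assms by (auto simp: is_length_def is_comp_def is_pair_def Let_def)
  ultimately have "T \<turnstile> ?L \<^bold>\<and> ?S \<^bold>\<and> ?K \<^bold>\<longrightarrow> y \<^bold>\<le> c \<^bold>+ c"
    using imp_trans[OF imp_trans[OF and_right and_right]] by simp
  moreover have "(?m + j, N) \<notin> fv (y \<^bold>\<le> c \<^bold>+ c)" for j
    using fv_fresh[of "?m + j" N y] fv_fresh[of "?m + j" N c] by auto
  note this[of 1] this[of 0, unfolded add_0_right]
  ultimately have "T \<turnstile> Ex (?m, N) (Ex (?m + 1, N) (?L \<^bold>\<and> ?S \<^bold>\<and> ?K)) \<^bold>\<longrightarrow> y \<^bold>\<le> c \<^bold>+ c"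
    by (intro ex_elim)
  then show ?thesis by (simp add: mem_seq_def Let_def vars_from_def)
qed

text \<open>Membership at type 2 is a statement about all arguments. At the argument
  \<open>f\<close> it says that the number \<open>g f\<close> is a component of the number
  \<open>Y f\<close>, and \<open>comp_le\<close> applies.\<close>

lemma mem_seq_ty2_le:
  assumes "tm_ty g = Some ty2" "tm_ty Y = Some ty2"
  shows "T \<turnstile> mem_seq ty2 g Y \<^bold>\<longrightarrow> g \<cdot> V 0 ty1 \<^bold>\<le> Y \<cdot> V 0 ty1 \<^bold>+ Y \<cdot> V 0 ty1"
proof -
  let ?m = "max (fresh g) (fresh Y)" and ?f = "V 0 ty1"
  let ?z = "(?m + 2, ty1)" and ?C = "g \<cdot> ?f \<^bold>\<le> Y \<cdot> ?f \<^bold>+ Y \<cdot> ?f"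
  let ?L = "is_length (?m + 3) (Y \<cdot> zero_at ty1) (V ?m N)" and ?S = "tsuc (V (?m + 1) N) \<^bold>\<le> V ?m N"
    and ?K = "\<lambda>z. is_comp (?m + 3) (Y \<cdot> z) (V (?m + 1) N) (g \<cdot> z)"
  have w: "wf ?L" "wf ?S" "wf (?K (Var ?z))"
    using assms by (auto simp: is_length_def is_comp_def is_pair_def Let_def)
  have "?z \<notin> fv_tm g" "?z \<notin> fv_tm Y" using fv_fresh[of "?m + 2" ty1 g] fv_fresh[of "?m + 2" ty1 Y] by auto
  then have "subst (?K (Var ?z)) ?z ?f = ?K ?f" "free_for ?f ?z (?K (Var ?z))"
    by (simp_all add: is_comp_def is_pair_def Let_def subst_tm_id)
  then have "T \<turnstile> All ?z (?K (Var ?z)) \<^bold>\<longrightarrow> ?K ?f" using all_inst[OF w(3), of ?f ?z T] by simp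
  moreover have "T \<turnstile> ?K ?f \<^bold>\<longrightarrow> ?C" by (rule comp_le) (use assms in auto)
  ultimately have "T \<turnstile> All ?z (?K (Var ?z)) \<^bold>\<longrightarrow> ?C" by (rule imp_trans)
  then have "T \<turnstile> ?L \<^bold>\<and> ?S \<^bold>\<and> All ?z (?K (Var ?z)) \<^bold>\<longrightarrow> ?C"
    using imp_trans[OF imp_trans[OF and_right and_right]] w by simp
  moreover have "(?m + j, N) \<notin> fv ?C" for j
    using fv_fresh[of "?m + j" N g] fv_fresh[of "?m + j" N Y] by auto
  note this[of 1] this[of 0, unfolded add_0_right]
  ultimately have "T \<turnstile> Ex (?m, N) (Ex (?m + 1, N) (?L \<^bold>\<and> ?S \<^bold>\<and> All ?z (?K (Var ?z)))) \<^bold>\<longrightarrow> ?C"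
    by (intro ex_elim)
  then show ?thesis by (simp add: mem_seq_def Let_def vars_from_def numeral_3_eq_3)
qed

end

section \<open>The two equivalences\<close>

lemma free_for_self: "free_for (Var x) x A"
  by (induction A) auto

context efa_st begin

text \<open>Each of the two memberships costs a factor 2: \<open>y\<close> is at most twice
  \<open>g f\<close>, and \<open>g f\<close> at most twice \<open>Y f\<close>. Hence the doubling
  \<open>tD\<close> is composed twice with \<open>Y\<close>.\<close>

lemma union_le:
  assumes "snd Y = ty2"
  shows "T \<turnstile> mem_union_app ty1 N (V 0 N) (Var Y) (V 0 ty1) \<^bold>\<longrightarrow>
    V 0 N \<^bold>\<le> tcomp tD (tcomp tD (Var Y)) \<cdot> V 0 ty1"
proof -
  let ?m = "max (fresh (V 0 N)) (max (fresh (Var Y)) (fresh (V 0 ty1)))"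
  let ?g = "V ?m ty2" and ?f = "V 0 ty1" and ?y = "V 0 N"
  let ?A = "mem_seq ty2 ?g (Var Y)" and ?B = "mem_seq N ?y (?g \<cdot> ?f)"
  let ?c = "Var Y \<cdot> ?f" and ?h = "tcomp tD (Var Y)"
  let ?C = "?y \<^bold>\<le> tcomp tD ?h \<cdot> ?f"
  have ty: "tm_ty (Var Y) = Some ty2" "isN ?c" "isN (?g \<cdot> ?f)" "tm_ty ?h = Some ty2" using assms by simp_all
  have le: "T \<turnstile> ?A \<^bold>\<longrightarrow> ?g \<cdot> ?f \<^bold>\<le> ?c \<^bold>+ ?c" "T \<turnstile> ?B \<^bold>\<longrightarrow> ?y \<^bold>\<le> ?g \<cdot> ?f \<^bold>+ ?g \<cdot> ?f"
    by (rule mem_seq_ty2_le mem_seq_N_le; use ty in simp)+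
  then have w: "wf ?A" "wf ?B" using proves_wf by force+
  let ?G = "[?A \<^bold>\<and> ?B]"
  have h: "pr T ?G (?A \<^bold>\<and> ?B)" and wG: "wfs ?G" using w by (auto intro: pr_hyp)
  have 1: "pr T ?G (?y \<^bold>\<le> (?c \<^bold>+ ?c) \<^bold>+ (?c \<^bold>+ ?c))"
    by (rule LE_trans[OF pr_thm_mp[OF le(2) pr_and2[OF h]] double_mono[OF pr_thm_mp[OF le(1) pr_and1[OF h]]]])
  have 2: "pr T ?G (?h \<cdot> ?f \<^bold>= ?c \<^bold>+ ?c)"
    by (rule EQ_trans[OF tcomp_eq tD_eq]) (use ty wG in auto)
  have "pr T ?G (tcomp tD ?h \<cdot> ?f \<^bold>= tD \<cdot> (?h \<cdot> ?f))" by (rule tcomp_eq) (use ty wG in auto)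
  moreover have "pr T ?G (tD \<cdot> (?h \<cdot> ?f) \<^bold>= tD \<cdot> (?c \<^bold>+ ?c))" by (rule EQ_arg[OF 2]) simp
  moreover have "pr T ?G (tD \<cdot> (?c \<^bold>+ ?c) \<^bold>= (?c \<^bold>+ ?c) \<^bold>+ (?c \<^bold>+ ?c))" by (rule tD_eq) (use ty wG in auto)
  ultimately have "pr T ?G (tcomp tD ?h \<cdot> ?f \<^bold>= (?c \<^bold>+ ?c) \<^bold>+ (?c \<^bold>+ ?c))" using EQ_trans by blast
  from LE_congR[OF EQ_sym[OF this] 1] have "T \<turnstile> ?A \<^bold>\<and> ?B \<^bold>\<longrightarrow> ?C" using pr_Nil pr_impI by blast
  moreover have "(?m, ty2) \<noteq> Y" by (cases Y) auto
  then have "(?m, ty2) \<notin> fv ?C" by simp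
  ultimately show ?thesis unfolding mem_union_app_def Let_def by (rule ex_elim)
qed

section \<open>The relativized equivalence in \<open>B0_minus\<close>\<close>

abbreviation ff :: tm where "ff \<equiv> V 0 ty1"
abbreviation yy :: tm where "yy \<equiv> V 0 N"
abbreviation hasz :: fm where "hasz \<equiv> ff \<cdot> yy \<^bold>= tzero"

definition MUst :: "var \<Rightarrow> fm" where
  "MUst \<mu> = AllSt (0, ty1) (ExSt (0, N) hasz \<^bold>\<longrightarrow> ff \<cdot> (Var \<mu> \<cdot> ff) \<^bold>= tzero)"

definition TJst :: "var \<Rightarrow> fm" where
  "TJst \<phi> = AllSt (0, ty1) (Var \<phi> \<cdot> ff \<^bold>= tzero \<^bold>\<longleftrightarrow> ExSt (0, N) hasz)"

text \<open>No quantifier of the sentence has the shape of a bounded one, so relativization makes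
  every one of them standard.\<close>

lemma relst_MU: "relst (Ex \<mu> (MU \<mu>)) = ExSt \<mu> (MUst \<mu>)"
  by (simp add: MU_def MUst_def bounded_All_def bounded_Ex_def bound_on_def)

lemma relst_TJ: "relst (Ex \<phi> (TJ \<phi>)) = ExSt \<phi> (TJst \<phi>)"
  by (simp add: TJ_def TJst_def bounded_All_def bounded_Ex_def bound_on_def)

text \<open>\<open>\<phi> f\<close> is taken to be \<open>f (\<mu> f)\<close>. If it is 0, a
  standard zero of \<open>f\<close> has to be exhibited, and \<open>\<mu> f\<close> is one because
  \<open>\<mu>\<close> and \<open>f\<close> are standard.\<close>

lemma MUst_TJst:
  assumes "snd \<phi> = ty2" "snd \<mu> = ty2"
  shows "pr T [ExSt \<mu> (MUst \<mu>)] (ExSt \<phi> (TJst \<phi>))"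
proof -
  have neq: "\<mu> \<noteq> (0, ty1)" "\<phi> \<noteq> (0, ty1)" "\<phi> \<noteq> (0, N)" "\<mu> \<noteq> (0, N)" using assms by auto
  let ?S = "ExSt \<mu> (MUst \<mu>)" and ?m = "Var \<mu>"
  let ?t = "tJ ?m"
  let ?E = "ExSt (0, N) hasz"
  let ?G = "[MUst \<mu>, St ty2 ?m, ?S]"
  let ?H = "St ty1 ff # ?G"
  have ty: "tm_ty ?m = Some ty2" "tm_ty ?t = Some ty2" using assms by simp_all
  have w: "wfs ?G" "wf ?S" using assms by (simp_all add: MUst_def)
  have wH: "wfs ?H" using w by simp
  have MU: "pr T ?H (?E \<^bold>\<longrightarrow> ff \<cdot> (?m \<cdot> ff) \<^bold>= tzero)"
    using pr_allstE[of ?H "(0, ty1)" "?E \<^bold>\<longrightarrow> ff \<cdot> (?m \<cdot> ff) \<^bold>= tzero" ff] wH neq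
    by (simp add: pr_hyp MUst_def)
  have eq: "pr T ?H (?t \<cdot> ff \<^bold>= ff \<cdot> (?m \<cdot> ff))" by (rule tJ_eq) (use ty wH in auto)
  have main: "pr T ?H (?t \<cdot> ff \<^bold>= tzero \<^bold>\<longleftrightarrow> ?E)"
  proof (rule pr_iffI)
    let ?J = "(?t \<cdot> ff \<^bold>= tzero) # ?H"
    have wJ: "wfs ?J" using wH ty by simp
    have "pr T ?J (ff \<cdot> (?m \<cdot> ff) \<^bold>= tzero)"
      by (rule EQ_euclid[OF pr_mono[OF eq] pr_hyp]) (use wJ in auto)
    moreover have "pr T ?J (St N (?m \<cdot> ff))"
      by (rule pr_St) (use wJ ty assms(2) in \<open>auto intro!: pr_hyp\<close>)
    ultimately show "pr T ?J ?E" by (intro pr_exstI[of _ _ _ "?m \<cdot> ff"]) auto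
    have wE: "wfs (?E # ?H)" using wH by simp
    have "pr T (?E # ?H) (ff \<cdot> (?m \<cdot> ff) \<^bold>= tzero)" by (rule pr_impE[OF MU])
    then show "pr T (?E # ?H) (?t \<cdot> ff \<^bold>= tzero)"
      by (rule EQ_trans[rotated]) (rule pr_mono[OF eq]; use wE in auto)
  qed
  then have "pr T ?G (AllSt (0, ty1) (?t \<cdot> ff \<^bold>= tzero \<^bold>\<longleftrightarrow> ?E))"
    by (intro pr_allstI) (use neq in \<open>auto simp: MUst_def\<close>)
  moreover have "subst (TJst \<phi>) \<phi> ?t = AllSt (0, ty1) (?t \<cdot> ff \<^bold>= tzero \<^bold>\<longleftrightarrow> ?E)"
    using neq by (auto simp: TJst_def)
  ultimately have "pr T ?G (subst (TJst \<phi>) \<phi> ?t)" by simp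
  moreover have "pr T ?G (St ty2 ?t)"
    by (rule pr_St) (use w ty assms(2) in \<open>auto intro!: pr_hyp\<close>)
  moreover have "free_for ?t \<phi> (TJst \<phi>)" using neq by (auto simp: TJst_def)
  ultimately have "pr T ?G (ExSt \<phi> (TJst \<phi>))"
    using assms(1) by (intro pr_exstI[of _ _ _ ?t]) (simp_all add: TJst_def)
  then have "pr T (MUst \<mu> # St (snd \<mu>) ?m # [?S]) (ExSt \<phi> (TJst \<phi>))"
    unfolding assms(2) .
  then show ?thesis
    by (rule pr_exstE[OF pr_hyp, rotated 2]) (use w in \<open>auto simp: TJst_def\<close>)
qed

text \<open>\<open>HAC_int\<close> requires an internal matrix, whereas having a standard zero is an
  external property. The equation \<open>\<phi> f = 0\<close> expresses it internally, so the matrix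
  becomes \<open>\<phi> f = 0 \<longrightarrow> f x = 0\<close>.\<close>

lemma TJst_MUst:
  assumes "snd \<phi> = ty2" "snd \<mu> = ty2" and HAC: "HAC_int \<subseteq> T"
  shows "pr T [ExSt \<phi> (TJst \<phi>)] (ExSt \<mu> (MUst \<mu>))"
proof -
  define Y where "Y = (Suc (fst \<phi>), ty2)"
  have neq: "\<mu> \<noteq> (0, ty1)" "\<phi> \<noteq> (0, ty1)" "\<phi> \<noteq> (0, N)" "\<mu> \<noteq> (0, N)" "Y \<noteq> \<phi>" "\<phi> \<noteq> Y"
    "Y \<noteq> (0, ty1)" "Y \<noteq> (0, N)" "snd Y = ty2"
    using assms by (cases \<phi>; auto simp: Y_def)+
  let ?S = "ExSt \<phi> (TJst \<phi>)" and ?p = "Var \<phi>" and ?E = "ExSt (0, N) hasz"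
  let ?A = "?p \<cdot> ff \<^bold>= tzero \<^bold>\<longrightarrow> hasz"
  let ?mem = "mem_union_app ty1 N yy (Var Y) ff"
  let ?K = "AllSt (0, ty1) (Ex (0, N) (?mem \<^bold>\<and> ?A))"
  let ?G = "[TJst \<phi>, St ty2 ?p, ?S]"
  let ?H = "St ty1 ff # ?G"
  let ?b = "tcomp tD (tcomp tD (Var Y))"
  let ?t = "tM ?b"
  have ty: "tm_ty ?p = Some ty2" "tm_ty ?b = Some ty2" "tm_ty ?t = Some ty2" using assms neq by simp_all
  have w: "wfs ?G" "wf ?S" "wf ?A" using assms by (simp_all add: TJst_def)
  have wH: "wfs ?H" using w by simp
  have wmem: "wf ?mem" using proves_wf[OF union_le[OF neq(9)]] by simp
  have TJ: "pr T ?H (?p \<cdot> ff \<^bold>= tzero \<^bold>\<longleftrightarrow> ?E)"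
    using pr_allstE[of ?H "(0, ty1)" "?p \<cdot> ff \<^bold>= tzero \<^bold>\<longleftrightarrow> ?E" ff] wH neq
    by (simp add: pr_hyp TJst_def)
  have "pr T ?H (ExSt (0, N) ?A)"
  proof (rule pr_cases[of _ "?p \<cdot> ff \<^bold>= tzero"])
    let ?J = "(?p \<cdot> ff \<^bold>= tzero) # ?H"
    have wJ: "wfs ?J" using wH ty by simp
    have E: "pr T ?J ?E" by (rule pr_iff1[OF pr_mono[OF TJ] pr_hyp]) (use wJ in auto)
    show "pr T ?J (ExSt (0, N) ?A)"
    proof (rule pr_exstE[OF E])
      let ?L = "hasz # St (snd (0 :: nat, N)) (Var (0, N)) # ?J"
      have wL: "wfs ?L" using wJ by simp
      have "pr T ?L ?A" by (rule pr_impI, rule pr_hyp) (use wL ty in auto)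
      moreover have "pr T ?L (St N yy)" by (rule pr_hyp) (use wL in auto)
      ultimately show "pr T ?L (ExSt (0, N) ?A)" 
        using w(3) by (intro pr_exstI[of _ _ _ yy]) (simp_all add: subst_Var_id)
    qed (use neq in \<open>auto simp: TJst_def\<close>)
    \<comment> \<open>Without a standard zero the matrix holds vacuously; \<open>tzero\<close>
      serves as a number that is known to be standard.\<close>
    let ?J' = "Neg (?p \<cdot> ff \<^bold>= tzero) # ?H"
    have wJ': "wfs ?J'" using wH ty by simp
    have "pr T ((?p \<cdot> ff \<^bold>= tzero) # ?J') Bot"
      by (rule pr_mp[of _ _ "?p \<cdot> ff \<^bold>= tzero"]; rule pr_hyp; use wJ' in auto)
    then have "pr T ((?p \<cdot> ff \<^bold>= tzero) # ?J') (ff \<cdot> tzero \<^bold>= tzero)" by (rule pr_botE) simp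
    then have "pr T ?J' (?p \<cdot> ff \<^bold>= tzero \<^bold>\<longrightarrow> ff \<cdot> tzero \<^bold>= tzero)" by (rule pr_impI)
    moreover have "pr T ?J' (St N tzero)" by (rule pr_St) (use wJ' in auto)
    ultimately show "pr T ?J' (ExSt (0, N) ?A)"
      using w(3) neq by (intro pr_exstI[of _ _ _ tzero]) simp_all
  qed
  then have prem: "pr T ?G (AllSt (0, ty1) (ExSt (0, N) ?A))"
    by (intro pr_allstI) (use neq in \<open>auto simp: TJst_def\<close>)
  have "(AllSt (0, ty1) (ExSt (0, N) ?A) \<^bold>\<longrightarrow> ExSt Y ?K) \<in> HAC_int"
    by (rule HAC_int.intros[of ?A _ 0 ty1 _ 0 N Y "Suc (fst \<phi>)"]) (use neq in \<open>auto simp: Y_def\<close>)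
  then have "T \<turnstile> AllSt (0, ty1) (ExSt (0, N) ?A) \<^bold>\<longrightarrow> ExSt Y ?K"
    using HAC w wmem by (intro proves.axiom) auto
  from pr_thm_mp[OF this prem] have HACc: "pr T ?G (ExSt Y ?K)" .
  let ?I = "?K # St (snd Y) (Var Y) # ?G"
  have wI: "wfs ?I" using w wmem neq by simp
  have "pr T ?I (ExSt \<mu> (MUst \<mu>))"
  proof (rule pr_exstI[of _ _ _ ?t])
    show "pr T ?I (St (snd \<mu>) ?t)" unfolding assms(2)
      by (rule pr_St) (use wI ty in \<open>auto intro!: pr_hyp\<close>)
    show "free_for ?t \<mu> (MUst \<mu>)" using neq by (auto simp: MUst_def)
    show "wf (MUst \<mu>)" using assms by (simp add: MUst_def)
    let ?D = "?E # St ty1 ff # ?I"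
    have wD: "wfs ?D" using wI by simp
    have "pr T ?D (ff \<cdot> (?t \<cdot> ff) \<^bold>= tzero)"
    proof -
      have "pr T ?D (?p \<cdot> ff \<^bold>= tzero)"
        by (rule pr_iff2[OF pr_mono[OF TJ] pr_hyp]) (use wD in auto)
      moreover have ex: "pr T ?D (Ex (0, N) (?mem \<^bold>\<and> ?A))"
      proof -
        have "pr T ?D (subst (Ex (0, N) (?mem \<^bold>\<and> ?A)) (0, ty1) (Var (0, ty1)))"
        proof (rule pr_allstE)
          show "pr T ?D ?K" by (rule pr_hyp) (use wD in auto)
          show "pr T ?D (St (snd (0, ty1)) ff)" by (rule pr_hyp) (use wD in auto)
          show "free_for ff (0, ty1) (Ex (0, N) (?mem \<^bold>\<and> ?A))"
            by (rule free_for_self)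
        qed
        then show ?thesis by (simp only: subst_Var_id)
      qed
      let ?C = "ff \<cdot> (?t \<cdot> ff) \<^bold>= tzero" and ?M = "(?mem \<^bold>\<and> ?A) # ?D"
      have wM: "wfs ?M" using wD wmem w(3) by simp
      have h: "pr T ?M (?mem \<^bold>\<and> ?A)" by (rule pr_hyp) (use wM in auto)
      have "pr T ?M (?p \<cdot> ff \<^bold>= tzero)" by (rule pr_mono[OF calculation]) (use wM in auto)
      with pr_and2[OF h] have "pr T ?M hasz" by (rule pr_mp)
      then have "pr T ?M ?C" 
        by (intro tM_found[OF ty(2) _ pr_thm_mp[OF union_le[OF neq(9)] pr_and1[OF h]]]) simp_all
      show ?thesis by (rule pr_exE[OF ex \<open>pr T ?M ?C\<close>]) (use neq in \<open>auto simp: TJst_def\<close>)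
    qed
    then have "pr T ?I (AllSt (0, ty1) (?E \<^bold>\<longrightarrow> ff \<cdot> (?t \<cdot> ff) \<^bold>= tzero))"
      by (intro pr_allstI pr_impI) (use neq in \<open>auto simp: TJst_def\<close>)
    moreover have "subst (MUst \<mu>) \<mu> ?t = AllSt (0, ty1) (?E \<^bold>\<longrightarrow> ff \<cdot> (?t \<cdot> ff) \<^bold>= tzero)"
      using neq by (auto simp: MUst_def)
    ultimately show "pr T ?I (subst (MUst \<mu>) \<mu> ?t)" by simp
  qed
  with HACc have "pr T ?G (ExSt \<mu> (MUst \<mu>))"
    by (rule pr_exstE) (use neq in \<open>auto simp: TJst_def MUst_def\<close>)
  then have "pr T (TJst \<phi> # St (snd \<phi>) ?p # [?S]) (ExSt \<mu> (MUst \<mu>))"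
    unfolding assms(1) .
  then show ?thesis
    by (rule pr_exstE[OF pr_hyp, rotated 2]) (use w in \<open>auto simp: MUst_def\<close>)
qed

section \<open>The internal equivalence and Transfer\<close>

lemma TJ_MU:
  assumes "snd \<phi> = ty2" "snd \<mu> = ty2" and AC: "QF_AC ty1 N \<subseteq> T"
  shows "T \<turnstile> Ex \<phi> (TJ \<phi>) \<^bold>\<longrightarrow> Ex \<mu> (MU \<mu>)"
proof -
  define Y where "Y = (Suc (fst \<phi>), ty2)"
  have neq: "\<mu> \<noteq> (0, ty1)" "\<phi> \<noteq> (0, ty1)" "\<phi> \<noteq> (0, N)" "\<mu> \<noteq> (0, N)" "Y \<noteq> \<phi>" "\<phi> \<noteq> Y"
    "Y \<noteq> (0, ty1)" "Y \<noteq> (0, N)" "snd Y = ty2"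
    using assms by (cases \<phi>; auto simp: Y_def)+
  let ?p = "Var \<phi>" and ?E = "Ex (0, N) hasz"
  \<comment> \<open>Expressing the existence of a zero by \<open>\<phi> f = 0\<close> makes this
    matrix quantifier-free, as choice demands.\<close>
  let ?A = "?p \<cdot> ff \<^bold>= tzero \<^bold>\<longrightarrow> hasz"
  let ?B = "?p \<cdot> ff \<^bold>= tzero \<^bold>\<longrightarrow> ff \<cdot> (Var Y \<cdot> ff) \<^bold>= tzero"
  let ?G = "[TJ \<phi>]"
  have ty: "tm_ty ?p = Some ty2" "tm_ty (Var Y) = Some ty2" using assms neq by simp_all
  have w: "wfs ?G" "wf ?A" using assms by (simp_all add: TJ_def)
  have TJ: "pr T \<Gamma> (?p \<cdot> ff \<^bold>= tzero \<^bold>\<longleftrightarrow> ?E)" if "TJ \<phi> \<in> set \<Gamma>" "wfs \<Gamma>" for \<Gamma>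
    using pr_allE[OF pr_hyp[OF that, unfolded TJ_def], of ff] by (simp add: subst_Var_id)
  have "pr T ?G (Ex (0, N) ?A)"
  proof (rule pr_cases[of _ "?p \<cdot> ff \<^bold>= tzero"])
    let ?J = "(?p \<cdot> ff \<^bold>= tzero) # ?G"
    have wJ: "wfs ?J" using w ty by simp
    have E: "pr T ?J ?E" by (rule pr_iff1[OF TJ pr_hyp]) (use wJ in auto)
    show "pr T ?J (Ex (0, N) ?A)"
    proof (rule pr_exE[OF E])
      let ?L = "hasz # ?J"
      have wL: "wfs ?L" using wJ by simp
      have "pr T ?L ?A" by (rule pr_impI, rule pr_hyp) (use wL ty in auto)
      then show "pr T ?L (Ex (0, N) ?A)"
        using w(2) by (intro pr_exI[of _ _ _ _ yy]) (simp_all add: subst_Var_id)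
    qed (use neq in \<open>auto simp: TJ_def\<close>)
    let ?J' = "Neg (?p \<cdot> ff \<^bold>= tzero) # ?G"
    have wJ': "wfs ?J'" using w ty by simp
    have "pr T ((?p \<cdot> ff \<^bold>= tzero) # ?J') Bot"
      by (rule pr_mp[of _ _ "?p \<cdot> ff \<^bold>= tzero"]; rule pr_hyp; use wJ' in auto)
    then have "pr T ((?p \<cdot> ff \<^bold>= tzero) # ?J') hasz" by (rule pr_botE) simp
    then have "pr T ?J' ?A" by (rule pr_impI)
    then show "pr T ?J' (Ex (0, N) ?A)"
      using w(2) by (intro pr_exI[of _ _ _ _ yy]) (simp_all add: subst_Var_id)
  qed
  then have prem: "pr T ?G (All (0, ty1) (Ex (0, N) ?A))" by (rule pr_allI) (simp add: TJ_def)
  have "(All (0, ty1) (Ex (0, N) ?A) \<^bold>\<longrightarrow> Ex Y (All (0, ty1) (subst ?A (0, N) (Var Y \<cdot> Var (0, ty1))))) \<in> QF_AC ty1 N"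
    by (rule QF_AC.intros[of ?A _ 0 ty1 _ 0 N Y "Suc (fst \<phi>)"]) (use neq in \<open>auto simp: Y_def\<close>)
  moreover have "subst ?A (0, N) (Var Y \<cdot> Var (0, ty1)) = ?B" using neq by simp
  ultimately have "T \<turnstile> All (0, ty1) (Ex (0, N) ?A) \<^bold>\<longrightarrow> Ex Y (All (0, ty1) ?B)"
    using AC ty by (intro proves.axiom) auto
  from pr_thm_mp[OF this prem] have ex: "pr T ?G (Ex Y (All (0, ty1) ?B))" .
  let ?I = "All (0, ty1) ?B # ?G"
  have wI: "wfs ?I" using w ty by simp
  let ?D = "?E # ?I"
  have wD: "wfs ?D" using wI by simp
  have "pr T ?D ?B"
    using pr_allE[OF pr_hyp[of "All (0, ty1) ?B" ?D], of ff] wD by (simp add: subst_Var_id)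
  moreover have "pr T ?D (?p \<cdot> ff \<^bold>= tzero)" by (rule pr_iff2[OF TJ pr_hyp]) (use wD in auto)
  ultimately have "pr T ?D (ff \<cdot> (Var Y \<cdot> ff) \<^bold>= tzero)" by (rule pr_mp)
  then have "pr T ?I (MU Y)" unfolding MU_def by (intro pr_allI pr_impI) (auto simp: TJ_def)
  moreover have "subst (MU \<mu>) \<mu> (Var Y) = MU Y" using neq by (auto simp: MU_def)
  ultimately have "pr T ?I (Ex \<mu> (MU \<mu>))"
    using assms neq by (intro pr_exI[of _ _ _ _ "Var Y"]) (auto simp: MU_def)
  with ex have "pr T ?G (Ex \<mu> (MU \<mu>))" by (rule pr_exE) (use neq in \<open>auto simp: TJ_def MU_def\<close>)
  then have "T \<turnstile> TJ \<phi> \<^bold>\<longrightarrow> Ex \<mu> (MU \<mu>)" by (rule pr_Nil[OF pr_impI])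
  then show ?thesis by (rule ex_elim) (use neq in \<open>auto simp: MU_def\<close>)
qed

lemma MU_TJ:
  assumes "snd \<phi> = ty2" "snd \<mu> = ty2"
  shows "T \<turnstile> Ex \<mu> (MU \<mu>) \<^bold>\<longrightarrow> Ex \<phi> (TJ \<phi>)"
proof -
  have neq: "\<mu> \<noteq> (0, ty1)" "\<phi> \<noteq> (0, ty1)" "\<phi> \<noteq> (0, N)" "\<mu> \<noteq> (0, N)" using assms by auto
  let ?m = "Var \<mu>" and ?E = "Ex (0, N) hasz"
  let ?t = "tJ ?m"
  let ?G = "[MU \<mu>]"
  have ty: "tm_ty ?m = Some ty2" "tm_ty ?t = Some ty2" using assms by simp_all
  have w: "wfs ?G" using assms by (simp_all add: MU_def)
  have MU: "pr T \<Gamma> (?E \<^bold>\<longrightarrow> ff \<cdot> (?m \<cdot> ff) \<^bold>= tzero)" if "MU \<mu> \<in> set \<Gamma>" "wfs \<Gamma>" for \<Gamma>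
    using pr_allE[OF pr_hyp[OF that, unfolded MU_def], of ff] by (simp add: subst_Var_id)
  have eq: "pr T \<Gamma> (?t \<cdot> ff \<^bold>= ff \<cdot> (?m \<cdot> ff))" if "wfs \<Gamma>" for \<Gamma> by (rule tJ_eq) (use ty that in auto)
  have "pr T ?G (?t \<cdot> ff \<^bold>= tzero \<^bold>\<longleftrightarrow> ?E)"
  proof (rule pr_iffI)
    let ?J = "(?t \<cdot> ff \<^bold>= tzero) # ?G"
    have wJ: "wfs ?J" using w ty by simp
    have "pr T ?J (ff \<cdot> (?m \<cdot> ff) \<^bold>= tzero)" by (rule EQ_euclid[OF eq pr_hyp]) (use wJ in auto)
    then show "pr T ?J ?E" using ty by (intro pr_exI[of _ _ _ _ "?m \<cdot> ff"]) auto
    have wE: "wfs (?E # ?G)" using w by simp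
    have "pr T (?E # ?G) (ff \<cdot> (?m \<cdot> ff) \<^bold>= tzero)"
      by (rule pr_mp[OF MU pr_hyp]) (use wE in auto)
    then show "pr T (?E # ?G) (?t \<cdot> ff \<^bold>= tzero)" using EQ_trans[OF eq[OF wE]] by blast
  qed
  then have "pr T ?G (All (0, ty1) (?t \<cdot> ff \<^bold>= tzero \<^bold>\<longleftrightarrow> ?E))" by (rule pr_allI) (simp add: MU_def)
  moreover have "subst (TJ \<phi>) \<phi> ?t = All (0, ty1) (?t \<cdot> ff \<^bold>= tzero \<^bold>\<longleftrightarrow> ?E)"
    using neq by (auto simp: TJ_def)
  ultimately have "pr T ?G (Ex \<phi> (TJ \<phi>))"
    using assms neq ty by (intro pr_exI[of _ _ _ _ ?t]) (auto simp: TJ_def)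
  then have "T \<turnstile> MU \<mu> \<^bold>\<longrightarrow> Ex \<phi> (TJ \<phi>)" by (rule pr_Nil[OF pr_impI])
  then show ?thesis by (rule ex_elim) (use neq in \<open>auto simp: TJ_def\<close>)
qed

lemma exst_imp_ex: "wf A \<Longrightarrow> T \<turnstile> ExSt x A \<^bold>\<longrightarrow> Ex x A"
proof -
  assume w: "wf A"
  have "T \<turnstile> A \<^bold>\<longrightarrow> Ex x A"
    using ex_witness[OF w, of "Var x" x T] by (simp add: subst_Var_id free_for_self)
  then have "T \<turnstile> St (snd x) (Var x) \<^bold>\<and> A \<^bold>\<longrightarrow> Ex x A" using imp_trans[OF and_right] w by simp
  then have "T \<turnstile> Ex x (St (snd x) (Var x) \<^bold>\<and> A) \<^bold>\<longrightarrow> Ex x A" by (rule ex_elim) simp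
  moreover have "T \<turnstile> ExSt x A \<^bold>\<longrightarrow> Ex x (St (snd x) (Var x) \<^bold>\<and> A)"
    by (rule pr_Nil[OF pr_impI[OF pr_exst_ex[OF pr_hyp]]]) (use w in auto)
  ultimately show ?thesis using imp_trans by blast
qed

text \<open>Transfer for the negated formula, read contrapositively. The condition on the free
  variables of \<open>A\<close> makes the instance parameter-free.\<close>

lemma ex_imp_exst:
  assumes "internal A" "wf A" "fv A \<subseteq> {x}" "PF_TP \<subseteq> T"
  shows "T \<turnstile> Ex x A \<^bold>\<longrightarrow> ExSt x A"
proof -
  let ?G = "[Neg (ExSt x A), Ex x A]"
  have w: "wfs ?G" using assms(2) by simp
  let ?H = "A # St (snd x) (Var x) # ?G"
  have wH: "wfs ?H" using w assms(2) by simp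
  have "pr T ?H (ExSt x A)"
    by (rule pr_exstI[of _ _ _ "Var x"])
       (use wH assms(2) in \<open>auto simp: subst_Var_id free_for_self intro!: pr_hyp\<close>)
  moreover have "pr T ?H (Neg (ExSt x A))" by (rule pr_hyp) (use wH in auto)
  ultimately have "pr T ?H Bot" using pr_mp by blast
  then have 1: "pr T ?G (AllSt x (Neg A))" by (intro pr_allstI pr_impI) auto
  have "(AllSt_list [x] (Neg A) \<^bold>\<longrightarrow> All_list [x] (Neg A)) \<in> PF_TP"
    by (rule PF_TP.intros) (use assms in auto)
  then have "T \<turnstile> AllSt x (Neg A) \<^bold>\<longrightarrow> All x (Neg A)"
    using assms(2,4) by (intro proves.axiom) auto
  from pr_thm_mp[OF this 1] have 2: "pr T ?G (All x (Neg A))" .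
  have "pr T (A # ?G) (Neg A)"
    using pr_allE[OF pr_mono[OF 2], of "A # ?G" "Var x"] w assms(2) 
    by (auto simp: subst_Var_id free_for_self)
  moreover have "pr T (A # ?G) A" by (rule pr_hyp) (use w assms(2) in auto)
  ultimately have "pr T (A # ?G) Bot" by (rule pr_mp)
  have "pr T ?G Bot"
    by (rule pr_exE[OF pr_hyp[of "Ex x A" ?G] \<open>pr T (A # ?G) Bot\<close>]) (use w in auto)
  then have "pr T [Ex x A] (ExSt x A)" by (rule pr_ccontr) (simp add: assms)
  then show ?thesis by (rule pr_Nil[OF pr_impI])
qed

end

theorem theorem4p1:
  fixes \<phi> \<mu> :: var
  assumes "snd \<phi> = ty2" and "snd \<mu> = ty2"
  shows "(B0 \<turnstile> ExSt \<phi> (TJ \<phi>) \<^bold>\<longleftrightarrow> ExSt \<mu> (MU \<mu>))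
    \<and> \<not> (B0_minus \<turnstile> ExSt \<phi> (TJ \<phi>) \<^bold>\<longleftrightarrow> ExSt \<mu> (MU \<mu>))
    \<and> (B0_minus \<turnstile> relst (Ex \<mu> (MU \<mu>)) \<^bold>\<longleftrightarrow> relst (Ex \<phi> (TJ \<phi>)))"
proof (intro conjI)
  have st: "EFA \<subseteq> EFA_st" using EFA_st.EFA by blast
  interpret B0: efa_st B0
    by unfold_locales (use st in \<open>auto simp: B0_def B0_minus_def\<close>)
  interpret B0_minus: efa_st B0_minus
    by unfold_locales (use st in \<open>auto simp: B0_minus_def\<close>)
  have TJ: "wf (TJ \<phi>)" "internal (TJ \<phi>)" "fv (TJ \<phi>) \<subseteq> {\<phi>}"
    and MU: "wf (MU \<mu>)" "internal (MU \<mu>)" "fv (MU \<mu>) \<subseteq> {\<mu>}"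
    using assms by (auto simp: TJ_def MU_def)
  have ax: "QF_AC ty1 N \<subseteq> B0" "PF_TP \<subseteq> B0" "HAC_int \<subseteq> B0_minus"
    by (auto simp: B0_def B0_minus_def)
  have 1: "B0 \<turnstile> ExSt \<phi> (TJ \<phi>) \<^bold>\<longrightarrow> ExSt \<mu> (MU \<mu>)"
    by (rule imp_trans[OF imp_trans[OF B0.exst_imp_ex B0.TJ_MU] B0.ex_imp_exst]) (use TJ MU ax assms in auto)
  have 2: "B0 \<turnstile> ExSt \<mu> (MU \<mu>) \<^bold>\<longrightarrow> ExSt \<phi> (TJ \<phi>)"
    by (rule imp_trans[OF imp_trans[OF B0.exst_imp_ex B0.MU_TJ] B0.ex_imp_exst]) (use TJ MU ax assms in auto)
  show "B0 \<turnstile> ExSt \<phi> (TJ \<phi>) \<^bold>\<longleftrightarrow> ExSt \<mu> (MU \<mu>)"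
    by (rule pr_Nil, intro pr_andI pr_thm 1 2) simp_all
  show "\<not> (B0_minus \<turnstile> ExSt \<phi> (TJ \<phi>) \<^bold>\<longleftrightarrow> ExSt \<mu> (MU \<mu>))"
    using not_B0_minus[OF assms] .
  show "B0_minus \<turnstile> relst (Ex \<mu> (MU \<mu>)) \<^bold>\<longleftrightarrow> relst (Ex \<phi> (TJ \<phi>))"
    unfolding B0_minus.relst_MU B0_minus.relst_TJ
    by (rule pr_Nil, rule pr_iffI)
       (rule pr_mono[OF B0_minus.MUst_TJst[OF assms]] pr_mono[OF B0_minus.TJst_MUst[OF assms ax(3)]];
        use assms in \<open>simp add: B0_minus.MUst_def B0_minus.TJst_def\<close>)+
qed

end
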